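(* Let $B$ be a category, let $\mathbb C_B$ be the restriction of the comma 2-monad $\mathbb C$ to $\mathbf{CAT}/B$, and let $\mathbf{ClCoFib}(B)$ be the 2-category of cloven cofibrations over $B$, cocartesian-arrow-preserving functors over $B$, and natural transformations over $1_B$. There is an isomorphism of 2-categories over $\mathbf{CAT}/B$ $$\mathbf{ClCoFib}(B)\xrightarrow{\ \cong\ }\mathbf{PsAlg}(\mathbb C_B).$$ It restricts to the isomorphism between normally cloven cofibrations and normal pseudoalgebras (over $B$). Under this isomorphism, strict pseudoalgebra morphisms are the functors preserving the chosen lifts strictly.
   Context: $\mathbf{CAT}$ is the strict 2-category of locally small categories, functors and natural transformations. $\mathbf{CAT}/B$ is the strict slice 2-category: objects are functors $P\colon E\to B$, 1-cells are functors $T$ strictly over $B$ ($QT=P$), 2-cells are natural transformations $\beta$ with $Q\beta$ the identity ("over $1_B$"). **Cloven cofibrations.** For $P\colon E\to B$, an arrow $e\colon x\to y$ of $E$ is $P$-cocartesian if for all $g\colon x\to z$ and $v\colon Py\to Pz$ with $Pg=v\,Pe$ there is a unique $h\colon y\to z$ with $he=g$, $Ph=v$. A cleavage chooses, for each $x\in E$ and $u\colon Px\to b$, a $P$-cocartesian arrow (chosen lift) $\delta^x_u\colon x\to u_!x$ with $P\delta^x_u=u$; no normality is required. A cloven cofibration is a functor with a cleavage. The cleavage is normal if $\delta^x_{1_{Px}}=1_x$ for all $x$. A functor $T$ over $B$ preserves the chosen lifts strictly if $T\delta^x_u=\delta^{Tx}_u$ for all $x,u$. **Comma 2-monad over $B$.**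 $P\downarrow B$ has objects $(x,u)$ with $x\in E$, $u\colon Px\to b$; an arrow $(f,v)\colon(x,u)\to(y,w)$ consists of $f\colon x\to y$, $v\colon b\to c$ with $vu=w\,Pf$. $\mathbb C_B$ on $\mathbf{CAT}/B$: $\mathbb C_BP=\mathrm{Cod}_P\colon P\downarrow B\to B$, $(x,u)\mapsto b$, $(f,v)\mapsto v$; a functor $T$ over $B$ goes to $\overline T(x,u)=(Tx,u)$, $\overline T(f,v)=(Tf,v)$; a 2-cell $\beta$ goes to $\overline\beta_{(x,u)}=(\beta_x,1_b)$; unit $H^Px=(x,1_{Px})$, $H^Pf=(f,Pf)$; multiplication $M^P((x,u),v)=(x,vu)$, $M^P((f,r),s)=(f,s)$. **Pseudoalgebras.** For a strict 2-monad $\mathbb T=(\mathbb T,\eta,\mu)$ on $\mathcal K$, a pseudoalgebra is $a\colon\mathbb TX\to X$ with invertible 2-cells $\iota\colon1_X\Rightarrow a\eta_X$, $\chi\colon a\,\mathbb Ta\Rightarrow a\mu_X$ such that (vertical composites of whiskered cells) $(\chi\,\mathbb T\eta_X)(a\,\mathbb T\iota)=1_a$, $(\chi\,\eta_{\mathbb TX})(\iota a)=1_a$, $(\chi\,\mathbb T\mu_X)(a\,\mathbb T\chi)=(\chi\,\mu_{\mathbb TX})(\chi\,\mathbb T^2a)$; it is normal if $\iota$ is an identity. A pseudomorphism $(X,a,\iota^a,\chi^a)\to(Y,b,\iota^b,\chi^b)$ is a 1-cell $f$ with an invertible $\overline f\colon b\,\mathbb Tf\Rightarrow fa$ such that $(\overline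 f\,\eta_X)(\iota^bf)=f\iota^a$ and $(\overline f\,\mu_X)(\chi^b\,\mathbb T^2f)=(f\chi^a)(\overline f\,\mathbb Ta)(b\,\mathbb T\overline f)$; it is a strict morphism if $\overline f$ is an identity. An algebra transformation $(f,\overline f)\Rightarrow(g,\overline g)$ is a 2-cell $\alpha\colon f\Rightarrow g$ with $(\alpha a)\overline f=\overline g(b\,\mathbb T\alpha)$. These form $\mathbf{PsAlg}(\mathbb T)$. The isomorphism sends a cloven cofibration $P$ to the action $L^P\colon P\downarrow B\to E$, the unique functor with $L^P(x,u)=u_!x$, $PL^P=\mathrm{Cod}_P$, $L^P(f,v)\delta^x_u=\delta^y_wf$, with unit $\iota_x=\delta^x_{1_{Px}}$ and multiplication cell given by the unique isomorphisms $\chi^x_{v,u}\colon v_!u_!x\to(vu)_!x$ over an identity with $\chi^x_{v,u}\delta^{u_!x}_v\delta^x_u=\delta^x_{vu}$. "Over $\mathbf{CAT}/B$" means commuting strictly with the forgetful 2-functors. *)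

theory Defs
  imports "HOL-Library.Equipollence" "HOL-Library.FuncSet" "HOL-Library.Nat_Bijection"
begin

section \<open>Universes\<close>

text \<open>
  A type of this class plays the part of the class of all sets: its subsets are the classes, and a
  class is small when it is strictly smaller than the whole universe.  The pairing makes it possible
  to form the comma category inside the universe; every infinite type admits such a pairing.
\<close>

class universe =
  fixes upair :: "'a \<Rightarrow> 'a \<Rightarrow> 'a"
    and ufst :: "'a \<Rightarrow> 'a"
    and usnd :: "'a \<Rightarrow> 'a"
  assumes ufst_upair [simp]: "ufst (upair a b) = a"
    and usnd_upair [simp]: "usnd (upair a b) = b"
    and infinite_universe: "infinite (UNIV :: 'a set)"

instantiation nat :: universe
begin
definition "upair a b = prod_encode (a, b)"
definition "ufst n = fst (prod_decode n)"
definition "usnd n = snd (prod_decode n)"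
instance by standard (simp_all add: upair_nat_def ufst_nat_def usnd_nat_def)
end

definition small :: "'u set \<Rightarrow> bool" where
  "small A \<longleftrightarrow> A \<prec> (UNIV :: 'u set)"


section \<open>Categories, functors, natural transformations\<close>

text \<open>
  All structure maps take the value \<^const>\<open>undefined\<close> outside their domain, so that equality in
  the logic is equality of categories, of functors and of natural transformations.
\<close>

record 'u cat =
  Ob :: "'u set"
  Ar :: "'u set"
  Dom :: "'u \<Rightarrow> 'u"
  Cod :: "'u \<Rightarrow> 'u"
  Idn :: "'u \<Rightarrow> 'u"
  Cmp :: "'u \<Rightarrow> 'u \<Rightarrow> 'u"

definition hom :: "'u cat \<Rightarrow> 'u \<Rightarrow> 'u \<Rightarrow> 'u set" where
  "hom C x y = {f \<in> Ar C. Dom C f = x \<and> Cod C f = y}"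

definition composable :: "'u cat \<Rightarrow> 'u \<Rightarrow> 'u \<Rightarrow> bool" where
  "composable C g f \<longleftrightarrow> f \<in> Ar C \<and> g \<in> Ar C \<and> Dom C g = Cod C f"

locale category =
  fixes C :: "'u cat"
  assumes Dom_in: "Dom C \<in> Ar C \<rightarrow>\<^sub>E Ob C"
    and Cod_in: "Cod C \<in> Ar C \<rightarrow>\<^sub>E Ob C"
    and Idn_ext: "Idn C \<in> extensional (Ob C)"
    and Idn_hom: "x \<in> Ob C \<Longrightarrow> Idn C x \<in> hom C x x"
    and Cmp_ext: "\<not> composable C g f \<Longrightarrow> Cmp C g f = undefined"
    and Cmp_hom: "composable C g f \<Longrightarrow> Cmp C g f \<in> hom C (Dom C f) (Cod C g)"
    and Cmp_Idn_left: "f \<in> Ar C \<Longrightarrow> Cmp C (Idn C (Cod C f)) f = f"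
    and Cmp_Idn_right: "f \<in> Ar C \<Longrightarrow> Cmp C f (Idn C (Dom C f)) = f"
    and Cmp_assoc: "composable C g f \<Longrightarrow> composable C h g \<Longrightarrow>
      Cmp C h (Cmp C g f) = Cmp C (Cmp C h g) f"

locale locally_small_category = category +
  assumes small_hom: "x \<in> Ob C \<Longrightarrow> y \<in> Ob C \<Longrightarrow> small (hom C x y)"

record 'u func =
  FDom :: "'u cat"
  FCod :: "'u cat"
  FOb :: "'u \<Rightarrow> 'u"
  FAr :: "'u \<Rightarrow> 'u"

locale is_functor =
  fixes F :: "'u func"
  assumes FDom_category: "category (FDom F)"
    and FCod_category: "category (FCod F)"
    and FOb_in: "FOb F \<in> Ob (FDom F) \<rightarrow>\<^sub>E Ob (FCod F)"
    and FAr_ext: "FAr F \<in> extensional (Ar (FDom F))"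
    and FAr_hom: "f \<in> hom (FDom F) x y \<Longrightarrow> FAr F f \<in> hom (FCod F) (FOb F x) (FOb F y)"
    and FAr_Idn: "x \<in> Ob (FDom F) \<Longrightarrow> FAr F (Idn (FDom F) x) = Idn (FCod F) (FOb F x)"
    and FAr_Cmp: "composable (FDom F) g f \<Longrightarrow>
      FAr F (Cmp (FDom F) g f) = Cmp (FCod F) (FAr F g) (FAr F f)"

definition id_func :: "'u cat \<Rightarrow> 'u func" where
  "id_func C = \<lparr>FDom = C, FCod = C, FOb = (\<lambda>x \<in> Ob C. x), FAr = (\<lambda>f \<in> Ar C. f)\<rparr>"

definition comp_func :: "'u func \<Rightarrow> 'u func \<Rightarrow> 'u func" where
  "comp_func G F = \<lparr>FDom = FDom F, FCod = FCod G,
     FOb = (\<lambda>x \<in> Ob (FDom F). FOb G (FOb F x)),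
     FAr = (\<lambda>f \<in> Ar (FDom F). FAr G (FAr F f))\<rparr>"

record 'u nattr =
  NDom :: "'u func"
  NCod :: "'u func"
  NAt :: "'u \<Rightarrow> 'u"

locale natural_transformation =
  fixes \<alpha> :: "'u nattr"
  assumes NDom_functor: "is_functor (NDom \<alpha>)"
    and NCod_functor: "is_functor (NCod \<alpha>)"
    and same_FDom: "FDom (NCod \<alpha>) = FDom (NDom \<alpha>)"
    and same_FCod: "FCod (NCod \<alpha>) = FCod (NDom \<alpha>)"
    and NAt_ext: "NAt \<alpha> \<in> extensional (Ob (FDom (NDom \<alpha>)))"
    and NAt_hom: "x \<in> Ob (FDom (NDom \<alpha>)) \<Longrightarrow>
      NAt \<alpha> x \<in> hom (FCod (NDom \<alpha>)) (FOb (NDom \<alpha>) x) (FOb (NCod \<alpha>) x)"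
    and naturality: "f \<in> hom (FDom (NDom \<alpha>)) x y \<Longrightarrow>
      Cmp (FCod (NDom \<alpha>)) (NAt \<alpha> y) (FAr (NDom \<alpha>) f)
        = Cmp (FCod (NDom \<alpha>)) (FAr (NCod \<alpha>) f) (NAt \<alpha> x)"

definition id_nat :: "'u func \<Rightarrow> 'u nattr" where
  "id_nat F = \<lparr>NDom = F, NCod = F, NAt = (\<lambda>x \<in> Ob (FDom F). Idn (FCod F) (FOb F x))\<rparr>"

definition vcomp_nat :: "'u nattr \<Rightarrow> 'u nattr \<Rightarrow> 'u nattr" where
  "vcomp_nat \<beta> \<alpha> = \<lparr>NDom = NDom \<alpha>, NCod = NCod \<beta>,
     NAt = (\<lambda>x \<in> Ob (FDom (NDom \<alpha>)). Cmp (FCod (NDom \<alpha>)) (NAt \<beta> x) (NAt \<alpha> x))\<rparr>"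

definition hcomp_nat :: "'u nattr \<Rightarrow> 'u nattr \<Rightarrow> 'u nattr" where
  "hcomp_nat \<beta> \<alpha> =
    \<lparr>NDom = comp_func (NDom \<beta>) (NDom \<alpha>), NCod = comp_func (NCod \<beta>) (NCod \<alpha>),
     NAt = (\<lambda>x \<in> Ob (FDom (NDom \<alpha>)).
       Cmp (FCod (NDom \<beta>)) (NAt \<beta> (FOb (NCod \<alpha>) x)) (FAr (NDom \<beta>) (NAt \<alpha> x)))\<rparr>"


section \<open>Strict 2-categories and 2-functors\<close>

text \<open>
  \<open>VComp K \<beta> \<alpha>\<close> is the vertical and \<open>HComp K \<beta> \<alpha>\<close> the horizontal composite
  of 2-cells, both in applicative order.
\<close>

record ('o, 'm, 't) twocat =
  Obj :: "'o set"
  Mor :: "'m set"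
  Cell :: "'t set"
  Src :: "'m \<Rightarrow> 'o"
  Trg :: "'m \<Rightarrow> 'o"
  Id1 :: "'o \<Rightarrow> 'm"
  Comp1 :: "'m \<Rightarrow> 'm \<Rightarrow> 'm"
  Src2 :: "'t \<Rightarrow> 'm"
  Trg2 :: "'t \<Rightarrow> 'm"
  Id2 :: "'m \<Rightarrow> 't"
  VComp :: "'t \<Rightarrow> 't \<Rightarrow> 't"
  HComp :: "'t \<Rightarrow> 't \<Rightarrow> 't"

definition mor :: "('o, 'm, 't) twocat \<Rightarrow> 'o \<Rightarrow> 'o \<Rightarrow> 'm set" where
  "mor K X Y = {f \<in> Mor K. Src K f = X \<and> Trg K f = Y}"

definition cell :: "('o, 'm, 't) twocat \<Rightarrow> 'm \<Rightarrow> 'm \<Rightarrow> 't set" where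
  "cell K f g = {\<alpha> \<in> Cell K. Src2 K \<alpha> = f \<and> Trg2 K \<alpha> = g}"

text \<open>The 0-cells between which a 2-cell lies.\<close>

definition Src0 :: "('o, 'm, 't) twocat \<Rightarrow> 't \<Rightarrow> 'o" where
  "Src0 K \<alpha> = Src K (Src2 K \<alpha>)"

definition Trg0 :: "('o, 'm, 't) twocat \<Rightarrow> 't \<Rightarrow> 'o" where
  "Trg0 K \<alpha> = Trg K (Src2 K \<alpha>)"

locale two_category =
  fixes K :: "('o, 'm, 't) twocat"
  assumes Src_Obj: "f \<in> Mor K \<Longrightarrow> Src K f \<in> Obj K"
    and Trg_Obj: "f \<in> Mor K \<Longrightarrow> Trg K f \<in> Obj K"
    and Id1_mor: "X \<in> Obj K \<Longrightarrow> Id1 K X \<in> mor K X X"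
    and Comp1_mor: "f \<in> mor K X Y \<Longrightarrow> g \<in> mor K Y Z \<Longrightarrow> Comp1 K g f \<in> mor K X Z"
    and Comp1_Id1_left: "f \<in> mor K X Y \<Longrightarrow> Comp1 K (Id1 K Y) f = f"
    and Comp1_Id1_right: "f \<in> mor K X Y \<Longrightarrow> Comp1 K f (Id1 K X) = f"
    and Comp1_assoc: "f \<in> mor K W X \<Longrightarrow> g \<in> mor K X Y \<Longrightarrow> h \<in> mor K Y Z \<Longrightarrow>
      Comp1 K h (Comp1 K g f) = Comp1 K (Comp1 K h g) f"
    and Src2_Mor: "\<alpha> \<in> Cell K \<Longrightarrow> Src2 K \<alpha> \<in> Mor K"
    and Trg2_mor: "\<alpha> \<in> Cell K \<Longrightarrow> Trg2 K \<alpha> \<in> mor K (Src0 K \<alpha>) (Trg0 K \<alpha>)"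
    and Id2_cell: "f \<in> Mor K \<Longrightarrow> Id2 K f \<in> cell K f f"
    and VComp_cell: "\<alpha> \<in> cell K f g \<Longrightarrow> \<beta> \<in> cell K g h \<Longrightarrow> VComp K \<beta> \<alpha> \<in> cell K f h"
    and VComp_Id2_left: "\<alpha> \<in> cell K f g \<Longrightarrow> VComp K (Id2 K g) \<alpha> = \<alpha>"
    and VComp_Id2_right: "\<alpha> \<in> cell K f g \<Longrightarrow> VComp K \<alpha> (Id2 K f) = \<alpha>"
    and VComp_assoc: "\<alpha> \<in> cell K f g \<Longrightarrow> \<beta> \<in> cell K g h \<Longrightarrow> \<gamma> \<in> cell K h k \<Longrightarrow>
      VComp K \<gamma> (VComp K \<beta> \<alpha>) = VComp K (VComp K \<gamma> \<beta>) \<alpha>"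
    and HComp_cell: "\<alpha> \<in> cell K f f' \<Longrightarrow> \<beta> \<in> cell K g g' \<Longrightarrow> Trg K f = Src K g \<Longrightarrow>
      HComp K \<beta> \<alpha> \<in> cell K (Comp1 K g f) (Comp1 K g' f')"
    and HComp_Id_left: "\<alpha> \<in> Cell K \<Longrightarrow> HComp K (Id2 K (Id1 K (Trg0 K \<alpha>))) \<alpha> = \<alpha>"
    and HComp_Id_right: "\<alpha> \<in> Cell K \<Longrightarrow> HComp K \<alpha> (Id2 K (Id1 K (Src0 K \<alpha>))) = \<alpha>"
    and HComp_assoc: "\<alpha> \<in> Cell K \<Longrightarrow> \<beta> \<in> Cell K \<Longrightarrow> \<gamma> \<in> Cell K \<Longrightarrow>
      Trg0 K \<alpha> = Src0 K \<beta> \<Longrightarrow> Trg0 K \<beta> = Src0 K \<gamma> \<Longrightarrow>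
      HComp K \<gamma> (HComp K \<beta> \<alpha>) = HComp K (HComp K \<gamma> \<beta>) \<alpha>"
    and HComp_Id2: "f \<in> mor K X Y \<Longrightarrow> g \<in> mor K Y Z \<Longrightarrow>
      HComp K (Id2 K g) (Id2 K f) = Id2 K (Comp1 K g f)"
    and interchange: "\<alpha> \<in> cell K f f' \<Longrightarrow> \<alpha>' \<in> cell K f' f'' \<Longrightarrow>
      \<beta> \<in> cell K g g' \<Longrightarrow> \<beta>' \<in> cell K g' g'' \<Longrightarrow> Trg K f = Src K g \<Longrightarrow>
      HComp K (VComp K \<beta>' \<beta>) (VComp K \<alpha>' \<alpha>)
        = VComp K (HComp K \<beta>' \<alpha>') (HComp K \<beta> \<alpha>)"

definition whisker_left :: "('o, 'm, 't) twocat \<Rightarrow> 'm \<Rightarrow> 't \<Rightarrow> 't" where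
  "whisker_left K g \<alpha> = HComp K (Id2 K g) \<alpha>"

definition whisker_right :: "('o, 'm, 't) twocat \<Rightarrow> 't \<Rightarrow> 'm \<Rightarrow> 't" where
  "whisker_right K \<beta> f = HComp K \<beta> (Id2 K f)"

definition invertible_cell :: "('o, 'm, 't) twocat \<Rightarrow> 't \<Rightarrow> bool" where
  "invertible_cell K \<alpha> \<longleftrightarrow> \<alpha> \<in> Cell K \<and>
    (\<exists>\<beta> \<in> cell K (Trg2 K \<alpha>) (Src2 K \<alpha>).
      VComp K \<beta> \<alpha> = Id2 K (Src2 K \<alpha>) \<and> VComp K \<alpha> \<beta> = Id2 K (Trg2 K \<alpha>))"

record ('o, 'm, 't, 'p, 'n, 's) twofun =
  F0 :: "'o \<Rightarrow> 'p"
  F1 :: "'m \<Rightarrow> 'n"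
  F2 :: "'t \<Rightarrow> 's"

text \<open>
  Only the values of a 2-functor on the cells of its source matter; equality of 2-functors is
  always expressed on those cells.
\<close>

locale two_functor =
  fixes K :: "('o, 'm, 't) twocat"
    and L :: "('p, 'n, 's) twocat"
    and F :: "('o, 'm, 't, 'p, 'n, 's) twofun"
  assumes source: "two_category K"
    and target: "two_category L"
    and F0_Obj: "X \<in> Obj K \<Longrightarrow> F0 F X \<in> Obj L"
    and F1_mor: "f \<in> mor K X Y \<Longrightarrow> F1 F f \<in> mor L (F0 F X) (F0 F Y)"
    and F2_cell: "\<alpha> \<in> cell K f g \<Longrightarrow> F2 F \<alpha> \<in> cell L (F1 F f) (F1 F g)"
    and F1_Id1: "X \<in> Obj K \<Longrightarrow> F1 F (Id1 K X) = Id1 L (F0 F X)"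
    and F1_Comp1: "f \<in> mor K X Y \<Longrightarrow> g \<in> mor K Y Z \<Longrightarrow>
      F1 F (Comp1 K g f) = Comp1 L (F1 F g) (F1 F f)"
    and F2_Id2: "f \<in> Mor K \<Longrightarrow> F2 F (Id2 K f) = Id2 L (F1 F f)"
    and F2_VComp: "\<alpha> \<in> cell K f g \<Longrightarrow> \<beta> \<in> cell K g h \<Longrightarrow>
      F2 F (VComp K \<beta> \<alpha>) = VComp L (F2 F \<beta>) (F2 F \<alpha>)"
    and F2_HComp: "\<alpha> \<in> Cell K \<Longrightarrow> \<beta> \<in> Cell K \<Longrightarrow> Trg0 K \<alpha> = Src0 K \<beta> \<Longrightarrow>
      F2 F (HComp K \<beta> \<alpha>) = HComp L (F2 F \<beta>) (F2 F \<alpha>)"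

definition inverse_on :: "('o, 'm, 't) twocat \<Rightarrow> ('o, 'm, 't, 'p, 'n, 's) twofun
    \<Rightarrow> ('p, 'n, 's, 'o, 'm, 't) twofun \<Rightarrow> bool" where
  "inverse_on K F G \<longleftrightarrow>
    (\<forall>X \<in> Obj K. F0 G (F0 F X) = X) \<and>
    (\<forall>f \<in> Mor K. F1 G (F1 F f) = f) \<and>
    (\<forall>\<alpha> \<in> Cell K. F2 G (F2 F \<alpha>) = \<alpha>)"

definition two_isomorphism :: "('o, 'm, 't) twocat \<Rightarrow> ('p, 'n, 's) twocat
    \<Rightarrow> ('o, 'm, 't, 'p, 'n, 's) twofun \<Rightarrow> bool" where
  "two_isomorphism K L F \<longleftrightarrow> two_functor K L F \<and>
    (\<exists>G. two_functor L K G \<and> inverse_on K F G \<and> inverse_on L G F)"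

text \<open>An isomorphism from \<open>U : K \<rightarrow> S\<close> to \<open>V : L \<rightarrow> S\<close> over \<open>S\<close>.\<close>

definition two_isomorphism_over :: "('x, 'y, 'z) twocat
    \<Rightarrow> ('o, 'm, 't) twocat \<Rightarrow> ('o, 'm, 't, 'x, 'y, 'z) twofun
    \<Rightarrow> ('p, 'n, 's) twocat \<Rightarrow> ('p, 'n, 's, 'x, 'y, 'z) twofun
    \<Rightarrow> ('o, 'm, 't, 'p, 'n, 's) twofun \<Rightarrow> bool" where
  "two_isomorphism_over S K U L V F \<longleftrightarrow>
    two_functor K S U \<and> two_functor L S V \<and> two_isomorphism K L F \<and>
    (\<forall>X \<in> Obj K. F0 V (F0 F X) = F0 U X) \<and>
    (\<forall>f \<in> Mor K. F1 V (F1 F f) = F1 U f) \<and>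
    (\<forall>\<alpha> \<in> Cell K. F2 V (F2 F \<alpha>) = F2 U \<alpha>)"

definition full_sub :: "('o, 'm, 't) twocat \<Rightarrow> ('o \<Rightarrow> bool) \<Rightarrow> ('o, 'm, 't) twocat" where
  "full_sub K R = K\<lparr>
     Obj := {X \<in> Obj K. R X},
     Mor := {f \<in> Mor K. R (Src K f) \<and> R (Trg K f)},
     Cell := {\<alpha> \<in> Cell K. R (Src0 K \<alpha>) \<and> R (Trg0 K \<alpha>)}\<rparr>"


section \<open>The 2-categories \<open>CAT\<close> and \<open>CAT/B\<close>\<close>

definition CAT :: "('u cat, 'u func, 'u nattr) twocat" where
  "CAT = \<lparr>
     Obj = {C. locally_small_category C},
     Mor = {F. is_functor F \<and> locally_small_category (FDom F) \<and> locally_small_category (FCod F)},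
     Cell = {\<alpha>. natural_transformation \<alpha> \<and> locally_small_category (FDom (NDom \<alpha>))
       \<and> locally_small_category (FCod (NDom \<alpha>))},
     Src = FDom, Trg = FCod, Id1 = id_func, Comp1 = comp_func,
     Src2 = NDom, Trg2 = NCod, Id2 = id_nat, VComp = vcomp_nat, HComp = hcomp_nat\<rparr>"

text \<open>
  A cell together with its source and target objects: a functor does not determine the functors
  to \<open>B\<close> over which it lies.
\<close>

record ('x, 'y) between =
  bsrc :: 'x
  body :: 'y
  btrg :: 'x

definition slice :: "('o, 'm, 't) twocat \<Rightarrow> 'o
    \<Rightarrow> ('m, ('m, 'm) between, ('m, 't) between) twocat" where
  "slice K b = \<lparr>
     Obj = {p \<in> Mor K. Trg K p = b},
     Mor = {t. bsrc t \<in> Mor K \<and> Trg K (bsrc t) = b \<and> btrg t \<in> Mor K \<and> Trg K (btrg t) = b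
       \<and> body t \<in> mor K (Src K (bsrc t)) (Src K (btrg t))
       \<and> Comp1 K (btrg t) (body t) = bsrc t},
     Cell = {\<beta>. bsrc \<beta> \<in> Mor K \<and> Trg K (bsrc \<beta>) = b \<and> btrg \<beta> \<in> Mor K \<and> Trg K (btrg \<beta>) = b
       \<and> body \<beta> \<in> Cell K
       \<and> Src0 K (body \<beta>) = Src K (bsrc \<beta>) \<and> Trg0 K (body \<beta>) = Src K (btrg \<beta>)
       \<and> Comp1 K (btrg \<beta>) (Src2 K (body \<beta>)) = bsrc \<beta>
       \<and> Comp1 K (btrg \<beta>) (Trg2 K (body \<beta>)) = bsrc \<beta>
       \<and> whisker_left K (btrg \<beta>) (body \<beta>) = Id2 K (bsrc \<beta>)},
     Src = bsrc,
     Trg = btrg,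
     Id1 = (\<lambda>p. \<lparr>bsrc = p, body = Id1 K (Src K p), btrg = p\<rparr>),
     Comp1 = (\<lambda>t s. \<lparr>bsrc = bsrc s, body = Comp1 K (body t) (body s), btrg = btrg t\<rparr>),
     Src2 = (\<lambda>\<beta>. \<lparr>bsrc = bsrc \<beta>, body = Src2 K (body \<beta>), btrg = btrg \<beta>\<rparr>),
     Trg2 = (\<lambda>\<beta>. \<lparr>bsrc = bsrc \<beta>, body = Trg2 K (body \<beta>), btrg = btrg \<beta>\<rparr>),
     Id2 = (\<lambda>t. \<lparr>bsrc = bsrc t, body = Id2 K (body t), btrg = btrg t\<rparr>),
     VComp = (\<lambda>\<beta> \<alpha>. \<lparr>bsrc = bsrc \<alpha>, body = VComp K (body \<beta>) (body \<alpha>), btrg = btrg \<alpha>\<rparr>),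
     HComp = (\<lambda>\<beta> \<alpha>. \<lparr>bsrc = bsrc \<alpha>, body = HComp K (body \<beta>) (body \<alpha>), btrg = btrg \<beta>\<rparr>)\<rparr>"


section \<open>Strict 2-monads and their pseudoalgebras\<close>

record ('o, 'm, 't) twomonad =
  Endo :: "('o, 'm, 't, 'o, 'm, 't) twofun"
  Unit :: "'o \<Rightarrow> 'm"
  Mult :: "'o \<Rightarrow> 'm"

abbreviation T0 :: "('o, 'm, 't) twomonad \<Rightarrow> 'o \<Rightarrow> 'o" where "T0 T \<equiv> F0 (Endo T)"
abbreviation T1 :: "('o, 'm, 't) twomonad \<Rightarrow> 'm \<Rightarrow> 'm" where "T1 T \<equiv> F1 (Endo T)"
abbreviation T2 :: "('o, 'm, 't) twomonad \<Rightarrow> 't \<Rightarrow> 't" where "T2 T \<equiv> F2 (Endo T)"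

locale strict_2monad =
  fixes K :: "('o, 'm, 't) twocat" and T :: "('o, 'm, 't) twomonad"
  assumes Endo_2functor: "two_functor K K (Endo T)"
    and Unit_mor: "X \<in> Obj K \<Longrightarrow> Unit T X \<in> mor K X (T0 T X)"
    and Mult_mor: "X \<in> Obj K \<Longrightarrow> Mult T X \<in> mor K (T0 T (T0 T X)) (T0 T X)"
    and Unit_natural: "f \<in> mor K X Y \<Longrightarrow>
      Comp1 K (Unit T Y) f = Comp1 K (T1 T f) (Unit T X)"
    and Mult_natural: "f \<in> mor K X Y \<Longrightarrow>
      Comp1 K (Mult T Y) (T1 T (T1 T f)) = Comp1 K (T1 T f) (Mult T X)"
    and Unit_2natural: "\<alpha> \<in> Cell K \<Longrightarrow>
      whisker_left K (Unit T (Trg0 K \<alpha>)) \<alpha>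
        = whisker_right K (T2 T \<alpha>) (Unit T (Src0 K \<alpha>))"
    and Mult_2natural: "\<alpha> \<in> Cell K \<Longrightarrow>
      whisker_left K (Mult T (Trg0 K \<alpha>)) (T2 T (T2 T \<alpha>))
        = whisker_right K (T2 T \<alpha>) (Mult T (Src0 K \<alpha>))"
    and Mult_Unit: "X \<in> Obj K \<Longrightarrow> Comp1 K (Mult T X) (Unit T (T0 T X)) = Id1 K (T0 T X)"
    and Mult_T_Unit: "X \<in> Obj K \<Longrightarrow> Comp1 K (Mult T X) (T1 T (Unit T X)) = Id1 K (T0 T X)"
    and Mult_Mult: "X \<in> Obj K \<Longrightarrow>
      Comp1 K (Mult T X) (Mult T (T0 T X)) = Comp1 K (Mult T X) (T1 T (Mult T X))"

record ('o, 'm, 't) psalg =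
  Carrier :: 'o
  Act :: 'm
  UnitC :: 't
  MultC :: 't

locale pseudoalgebra =
  fixes K :: "('o, 'm, 't) twocat" and T :: "('o, 'm, 't) twomonad"
    and A :: "('o, 'm, 't) psalg"
  fixes X a \<iota> \<chi>
  defines "X \<equiv> Carrier A" and "a \<equiv> Act A" and "\<iota> \<equiv> UnitC A" and "\<chi> \<equiv> MultC A"
  assumes Carrier_Obj: "X \<in> Obj K"
    and Act_mor: "a \<in> mor K (T0 T X) X"
    and UnitC_cell: "\<iota> \<in> cell K (Id1 K X) (Comp1 K a (Unit T X))"
    and UnitC_invertible: "invertible_cell K \<iota>"
    and MultC_cell: "\<chi> \<in> cell K (Comp1 K a (T1 T a)) (Comp1 K a (Mult T X))"
    and MultC_invertible: "invertible_cell K \<chi>"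
    and unit_right: "VComp K (whisker_right K \<chi> (T1 T (Unit T X))) (whisker_left K a (T2 T \<iota>))
      = Id2 K a"
    and unit_left: "VComp K (whisker_right K \<chi> (Unit T (T0 T X))) (whisker_right K \<iota> a)
      = Id2 K a"
    and associativity:
      "VComp K (whisker_right K \<chi> (T1 T (Mult T X))) (whisker_left K a (T2 T \<chi>))
      = VComp K (whisker_right K \<chi> (Mult T (T0 T X))) (whisker_right K \<chi> (T1 T (T1 T a)))"

definition normal_psalg :: "('o, 'm, 't) twocat \<Rightarrow> ('o, 'm, 't) psalg \<Rightarrow> bool" where
  "normal_psalg K A \<longleftrightarrow> UnitC A = Id2 K (Id1 K (Carrier A))"

record ('o, 'm, 't) psmor =
  MSrc :: "('o, 'm, 't) psalg"
  Und :: 'm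
  Str :: 't
  MTrg :: "('o, 'm, 't) psalg"

locale pseudomorphism =
  fixes K :: "('o, 'm, 't) twocat" and T :: "('o, 'm, 't) twomonad"
    and m :: "('o, 'm, 't) psmor"
  fixes X a \<iota>a \<chi>a Y b \<iota>b \<chi>b f fbar
  defines "X \<equiv> Carrier (MSrc m)" and "a \<equiv> Act (MSrc m)"
    and "\<iota>a \<equiv> UnitC (MSrc m)" and "\<chi>a \<equiv> MultC (MSrc m)"
    and "Y \<equiv> Carrier (MTrg m)" and "b \<equiv> Act (MTrg m)"
    and "\<iota>b \<equiv> UnitC (MTrg m)" and "\<chi>b \<equiv> MultC (MTrg m)"
    and "f \<equiv> Und m" and "fbar \<equiv> Str m"
  assumes MSrc_psalg: "pseudoalgebra K T (MSrc m)"
    and MTrg_psalg: "pseudoalgebra K T (MTrg m)"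
    and Und_mor: "f \<in> mor K X Y"
    and Str_cell: "fbar \<in> cell K (Comp1 K b (T1 T f)) (Comp1 K f a)"
    and Str_invertible: "invertible_cell K fbar"
    and Str_unit: "VComp K (whisker_right K fbar (Unit T X)) (whisker_right K \<iota>b f)
      = whisker_left K f \<iota>a"
    and Str_mult:
      "VComp K (whisker_right K fbar (Mult T X)) (whisker_right K \<chi>b (T1 T (T1 T f)))
      = VComp K (whisker_left K f \<chi>a)
          (VComp K (whisker_right K fbar (T1 T a)) (whisker_left K b (T2 T fbar)))"

definition strict_psmor :: "('o, 'm, 't) twocat \<Rightarrow> ('o, 'm, 't) psmor \<Rightarrow> bool" where
  "strict_psmor K m \<longleftrightarrow> Str m = Id2 K (Comp1 K (Und m) (Act (MSrc m)))"

record ('o, 'm, 't) pscell =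
  CSrc :: "('o, 'm, 't) psmor"
  CUnd :: 't
  CTrg :: "('o, 'm, 't) psmor"

locale algebra_transformation =
  fixes K :: "('o, 'm, 't) twocat" and T :: "('o, 'm, 't) twomonad"
    and c :: "('o, 'm, 't) pscell"
  assumes CSrc_psmor: "pseudomorphism K T (CSrc c)"
    and CTrg_psmor: "pseudomorphism K T (CTrg c)"
    and same_MSrc: "MSrc (CTrg c) = MSrc (CSrc c)"
    and same_MTrg: "MTrg (CTrg c) = MTrg (CSrc c)"
    and CUnd_cell: "CUnd c \<in> cell K (Und (CSrc c)) (Und (CTrg c))"
    and CUnd_compatible:
      "VComp K (whisker_right K (CUnd c) (Act (MSrc (CSrc c)))) (Str (CSrc c))
      = VComp K (Str (CTrg c)) (whisker_left K (Act (MTrg (CSrc c))) (T2 T (CUnd c)))"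

definition id_psmor :: "('o, 'm, 't) twocat \<Rightarrow> ('o, 'm, 't) psalg \<Rightarrow> ('o, 'm, 't) psmor" where
  "id_psmor K A = \<lparr>MSrc = A, Und = Id1 K (Carrier A), Str = Id2 K (Act A), MTrg = A\<rparr>"

definition comp_psmor :: "('o, 'm, 't) twocat \<Rightarrow> ('o, 'm, 't) twomonad
    \<Rightarrow> ('o, 'm, 't) psmor \<Rightarrow> ('o, 'm, 't) psmor \<Rightarrow> ('o, 'm, 't) psmor" where
  "comp_psmor K T n m = \<lparr>MSrc = MSrc m, Und = Comp1 K (Und n) (Und m),
     Str = VComp K (whisker_left K (Und n) (Str m)) (whisker_right K (Str n) (T1 T (Und m))),
     MTrg = MTrg n\<rparr>"

definition PsAlg :: "('o, 'm, 't) twocat \<Rightarrow> ('o, 'm, 't) twomonad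
    \<Rightarrow> (('o, 'm, 't) psalg, ('o, 'm, 't) psmor, ('o, 'm, 't) pscell) twocat" where
  "PsAlg K T = \<lparr>
     Obj = {A. pseudoalgebra K T A},
     Mor = {m. pseudomorphism K T m},
     Cell = {c. algebra_transformation K T c},
     Src = MSrc, Trg = MTrg, Id1 = id_psmor K, Comp1 = comp_psmor K T,
     Src2 = CSrc, Trg2 = CTrg,
     Id2 = (\<lambda>m. \<lparr>CSrc = m, CUnd = Id2 K (Und m), CTrg = m\<rparr>),
     VComp = (\<lambda>d c. \<lparr>CSrc = CSrc c, CUnd = VComp K (CUnd d) (CUnd c), CTrg = CTrg d\<rparr>),
     HComp = (\<lambda>d c. \<lparr>CSrc = comp_psmor K T (CSrc d) (CSrc c),
       CUnd = HComp K (CUnd d) (CUnd c),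
       CTrg = comp_psmor K T (CTrg d) (CTrg c)\<rparr>)\<rparr>"

definition PsAlg_forget :: "(('o, 'm, 't) psalg, ('o, 'm, 't) psmor, ('o, 'm, 't) pscell, 'o, 'm, 't)
    twofun" where
  "PsAlg_forget = \<lparr>F0 = Carrier, F1 = Und, F2 = CUnd\<rparr>"


section \<open>The comma 2-monad over \<open>B\<close>\<close>

text \<open>
  The object \<open>(x, u)\<close> of \<open>P \<down> B\<close> is encoded as \<open>upair x u\<close>, and the arrow
  \<open>(f, v) : X \<rightarrow> Y\<close> as \<open>comma_ar X Y f v\<close>, since \<open>f\<close> and \<open>v\<close> alone do not determine
  \<open>X\<close> and \<open>Y\<close>.
\<close>

definition comma_ar :: "'u::universe \<Rightarrow> 'u \<Rightarrow> 'u \<Rightarrow> 'u \<Rightarrow> 'u" where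
  "comma_ar X Y f v = upair (upair X Y) (upair f v)"

definition cm_src :: "'u::universe \<Rightarrow> 'u" where "cm_src a = ufst (ufst a)"
definition cm_trg :: "'u::universe \<Rightarrow> 'u" where "cm_trg a = usnd (ufst a)"
definition cm_fst :: "'u::universe \<Rightarrow> 'u" where "cm_fst a = ufst (usnd a)"
definition cm_snd :: "'u::universe \<Rightarrow> 'u" where "cm_snd a = usnd (usnd a)"

definition comma_Ob :: "'u::universe func \<Rightarrow> 'u set" where
  "comma_Ob P = {upair x u | x u. x \<in> Ob (FDom P) \<and> u \<in> Ar (FCod P)
     \<and> Dom (FCod P) u = FOb P x}"

definition comma_Ar :: "'u::universe func \<Rightarrow> 'u set" where
  "comma_Ar P = {comma_ar (upair x u) (upair y w) f v | x u y w f v.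
     upair x u \<in> comma_Ob P \<and> upair y w \<in> comma_Ob P
     \<and> f \<in> hom (FDom P) x y \<and> v \<in> hom (FCod P) (Cod (FCod P) u) (Cod (FCod P) w)
     \<and> Cmp (FCod P) v u = Cmp (FCod P) w (FAr P f)}"

definition comma_cat :: "'u::universe func \<Rightarrow> 'u cat" where
  "comma_cat P = \<lparr>
     Ob = comma_Ob P,
     Ar = comma_Ar P,
     Dom = (\<lambda>a \<in> comma_Ar P. cm_src a),
     Cod = (\<lambda>a \<in> comma_Ar P. cm_trg a),
     Idn = (\<lambda>X \<in> comma_Ob P. comma_ar X X
       (Idn (FDom P) (ufst X)) (Idn (FCod P) (Cod (FCod P) (usnd X)))),
     Cmp = (\<lambda>b a. if a \<in> comma_Ar P \<and> b \<in> comma_Ar P \<and> cm_src b = cm_trg a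
       then comma_ar (cm_src a) (cm_trg b)
         (Cmp (FDom P) (cm_fst b) (cm_fst a)) (Cmp (FCod P) (cm_snd b) (cm_snd a))
       else undefined)\<rparr>"

definition comma_proj :: "'u::universe func \<Rightarrow> 'u func" where
  "comma_proj P = \<lparr>FDom = comma_cat P, FCod = FCod P,
     FOb = (\<lambda>X \<in> comma_Ob P. Cod (FCod P) (usnd X)),
     FAr = (\<lambda>a \<in> comma_Ar P. cm_snd a)\<rparr>"

definition comma_func :: "'u::universe func \<Rightarrow> 'u func \<Rightarrow> 'u func \<Rightarrow> 'u func" where
  "comma_func P T Q = \<lparr>FDom = comma_cat P, FCod = comma_cat Q,
     FOb = (\<lambda>X \<in> comma_Ob P. upair (FOb T (ufst X)) (usnd X)),
     FAr = (\<lambda>a \<in> comma_Ar P. comma_ar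
       (upair (FOb T (ufst (cm_src a))) (usnd (cm_src a)))
       (upair (FOb T (ufst (cm_trg a))) (usnd (cm_trg a)))
       (FAr T (cm_fst a)) (cm_snd a))\<rparr>"

definition comma_nat :: "'u::universe func \<Rightarrow> 'u nattr \<Rightarrow> 'u func \<Rightarrow> 'u nattr" where
  "comma_nat P \<beta> Q = \<lparr>NDom = comma_func P (NDom \<beta>) Q, NCod = comma_func P (NCod \<beta>) Q,
     NAt = (\<lambda>X \<in> comma_Ob P. comma_ar
       (upair (FOb (NDom \<beta>) (ufst X)) (usnd X))
       (upair (FOb (NCod \<beta>) (ufst X)) (usnd X))
       (NAt \<beta> (ufst X)) (Idn (FCod P) (Cod (FCod P) (usnd X))))\<rparr>"

definition comma_unit_ob :: "'u::universe func \<Rightarrow> 'u \<Rightarrow> 'u" where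
  "comma_unit_ob P x = upair x (Idn (FCod P) (FOb P x))"

definition comma_unit :: "'u::universe func \<Rightarrow> 'u func" where
  "comma_unit P = \<lparr>FDom = FDom P, FCod = comma_cat P,
     FOb = (\<lambda>x \<in> Ob (FDom P). comma_unit_ob P x),
     FAr = (\<lambda>f \<in> Ar (FDom P). comma_ar
       (comma_unit_ob P (Dom (FDom P) f)) (comma_unit_ob P (Cod (FDom P) f)) f (FAr P f))\<rparr>"

definition comma_mult_ob :: "'u::universe func \<Rightarrow> 'u \<Rightarrow> 'u" where
  "comma_mult_ob P Z = upair (ufst (ufst Z)) (Cmp (FCod P) (usnd Z) (usnd (ufst Z)))"

definition comma_mult :: "'u::universe func \<Rightarrow> 'u func" where
  "comma_mult P = \<lparr>FDom = comma_cat (comma_proj P), FCod = comma_cat P,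
     FOb = (\<lambda>Z \<in> comma_Ob (comma_proj P). comma_mult_ob P Z),
     FAr = (\<lambda>a \<in> comma_Ar (comma_proj P). comma_ar
       (comma_mult_ob P (cm_src a)) (comma_mult_ob P (cm_trg a))
       (cm_fst (cm_fst a)) (cm_snd a))\<rparr>"

text \<open>
  The base category is read off from the codomain of a functor, so that the same terms describe
  the 2-monad on \<^term>\<open>slice CAT B\<close> for every \<open>B\<close>.
\<close>

definition comma_2monad :: "('u::universe func, ('u func, 'u func) between,
    ('u func, 'u nattr) between) twomonad" where
  "comma_2monad = \<lparr>
     Endo = \<lparr>
       F0 = comma_proj,
       F1 = (\<lambda>t. \<lparr>bsrc = comma_proj (bsrc t), body = comma_func (bsrc t) (body t) (btrg t),
         btrg = comma_proj (btrg t)\<rparr>),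
       F2 = (\<lambda>\<beta>. \<lparr>bsrc = comma_proj (bsrc \<beta>), body = comma_nat (bsrc \<beta>) (body \<beta>) (btrg \<beta>),
         btrg = comma_proj (btrg \<beta>)\<rparr>)\<rparr>,
     Unit = (\<lambda>P. \<lparr>bsrc = P, body = comma_unit P, btrg = comma_proj P\<rparr>),
     Mult = (\<lambda>P. \<lparr>bsrc = comma_proj (comma_proj P), body = comma_mult P,
       btrg = comma_proj P\<rparr>)\<rparr>"


section \<open>Cloven cofibrations\<close>

definition cocartesian :: "'u func \<Rightarrow> 'u \<Rightarrow> bool" where
  "cocartesian P e \<longleftrightarrow> e \<in> Ar (FDom P) \<and>
    (\<forall>g v. g \<in> Ar (FDom P) \<and> Dom (FDom P) g = Dom (FDom P) e \<and>
       v \<in> hom (FCod P) (FOb P (Cod (FDom P) e)) (FOb P (Cod (FDom P) g)) \<and>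
       FAr P g = Cmp (FCod P) v (FAr P e) \<longrightarrow>
       (\<exists>!h. h \<in> hom (FDom P) (Cod (FDom P) e) (Cod (FDom P) g) \<and>
          Cmp (FDom P) h e = g \<and> FAr P h = v))"

definition liftable :: "'u func \<Rightarrow> 'u \<Rightarrow> 'u \<Rightarrow> bool" where
  "liftable P x u \<longleftrightarrow> x \<in> Ob (FDom P) \<and> u \<in> Ar (FCod P) \<and> Dom (FCod P) u = FOb P x"

definition cleavage :: "'u func \<Rightarrow> ('u \<Rightarrow> 'u \<Rightarrow> 'u) \<Rightarrow> bool" where
  "cleavage P \<delta> \<longleftrightarrow>
    (\<forall>x u. liftable P x u \<longrightarrow>
      cocartesian P (\<delta> x u) \<and> Dom (FDom P) (\<delta> x u) = x \<and> FAr P (\<delta> x u) = u) \<and>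
    (\<forall>x u. \<not> liftable P x u \<longrightarrow> \<delta> x u = undefined)"

record 'u clcofib =
  Proj :: "'u func"
  Lift :: "'u \<Rightarrow> 'u \<Rightarrow> 'u"

definition cloven_cofibration :: "'u cat \<Rightarrow> 'u clcofib \<Rightarrow> bool" where
  "cloven_cofibration B C \<longleftrightarrow> Proj C \<in> Obj (slice CAT B) \<and> cleavage (Proj C) (Lift C)"

definition normally_cloven :: "'u clcofib \<Rightarrow> bool" where
  "normally_cloven C \<longleftrightarrow> (\<forall>x \<in> Ob (FDom (Proj C)).
    Lift C x (Idn (FCod (Proj C)) (FOb (Proj C) x)) = Idn (FDom (Proj C)) x)"

definition preserves_cocartesian :: "'u func \<Rightarrow> 'u func \<Rightarrow> 'u func \<Rightarrow> bool" where
  "preserves_cocartesian P T Q \<longleftrightarrow> (\<forall>e. cocartesian P e \<longrightarrow> cocartesian Q (FAr T e))"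

definition preserves_lifts :: "'u clcofib \<Rightarrow> 'u func \<Rightarrow> 'u clcofib \<Rightarrow> bool" where
  "preserves_lifts C T D \<longleftrightarrow> (\<forall>x u. liftable (Proj C) x u \<longrightarrow>
    FAr T (Lift C x u) = Lift D (FOb T x) u)"

definition over :: "('u clcofib, 'y) between \<Rightarrow> ('u func, 'y) between" where
  "over t = \<lparr>bsrc = Proj (bsrc t), body = body t, btrg = Proj (btrg t)\<rparr>"

definition functor_over :: "'u cat \<Rightarrow> ('u clcofib, 'u func) between \<Rightarrow> bool" where
  "functor_over B t \<longleftrightarrow> cloven_cofibration B (bsrc t) \<and> cloven_cofibration B (btrg t) \<and>
    over t \<in> Mor (slice CAT B)"

definition ClCoFib :: "'u cat
    \<Rightarrow> ('u clcofib, ('u clcofib, 'u func) between, ('u clcofib, 'u nattr) between) twocat" where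
  "ClCoFib B = \<lparr>
     Obj = {C. cloven_cofibration B C},
     Mor = {t. functor_over B t
       \<and> preserves_cocartesian (Proj (bsrc t)) (body t) (Proj (btrg t))},
     Cell = {\<beta>. cloven_cofibration B (bsrc \<beta>) \<and> cloven_cofibration B (btrg \<beta>)
       \<and> over \<beta> \<in> Cell (slice CAT B)
       \<and> preserves_cocartesian (Proj (bsrc \<beta>)) (NDom (body \<beta>)) (Proj (btrg \<beta>))
       \<and> preserves_cocartesian (Proj (bsrc \<beta>)) (NCod (body \<beta>)) (Proj (btrg \<beta>))},
     Src = bsrc,
     Trg = btrg,
     Id1 = (\<lambda>C. \<lparr>bsrc = C, body = id_func (FDom (Proj C)), btrg = C\<rparr>),
     Comp1 = (\<lambda>t s. \<lparr>bsrc = bsrc s, body = comp_func (body t) (body s), btrg = btrg t\<rparr>),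
     Src2 = (\<lambda>\<beta>. \<lparr>bsrc = bsrc \<beta>, body = NDom (body \<beta>), btrg = btrg \<beta>\<rparr>),
     Trg2 = (\<lambda>\<beta>. \<lparr>bsrc = bsrc \<beta>, body = NCod (body \<beta>), btrg = btrg \<beta>\<rparr>),
     Id2 = (\<lambda>t. \<lparr>bsrc = bsrc t, body = id_nat (body t), btrg = btrg t\<rparr>),
     VComp = (\<lambda>\<beta> \<alpha>. \<lparr>bsrc = bsrc \<alpha>, body = vcomp_nat (body \<beta>) (body \<alpha>), btrg = btrg \<alpha>\<rparr>),
     HComp = (\<lambda>\<beta> \<alpha>. \<lparr>bsrc = bsrc \<alpha>, body = hcomp_nat (body \<beta>) (body \<alpha>), btrg = btrg \<beta>\<rparr>)\<rparr>"

definition ClCoFib_forget :: "('u clcofib, ('u clcofib, 'u func) between, ('u clcofib, 'u nattr) between,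
    'u func, ('u func, 'u func) between, ('u func, 'u nattr) between) twofun" where
  "ClCoFib_forget = \<lparr>F0 = Proj, F1 = over, F2 = over\<rparr>"

text \<open>
  The equations that determine the pseudoalgebra of a cloven cofibration.  That the action and the
  two structure cells lie over \<open>B\<close>, in particular that the multiplication cell has components over
  identities, is part of their being cells of \<^term>\<open>slice CAT B\<close>.
\<close>

definition induced_by_lifts :: "'u::universe clcofib
    \<Rightarrow> ('u func, ('u func, 'u func) between, ('u func, 'u nattr) between) psalg \<Rightarrow> bool" where
  "induced_by_lifts C A \<longleftrightarrow>
    (let P = Proj C; \<delta> = Lift C; E = FDom P; B = FCod P;
         L = body (Act A); \<iota> = NAt (body (UnitC A)); \<chi> = NAt (body (MultC A))
     in Carrier A = P \<and>
       (\<forall>x u. upair x u \<in> comma_Ob P \<longrightarrow> FOb L (upair x u) = Cod E (\<delta> x u)) \<and>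
       (\<forall>x u y w f v. comma_ar (upair x u) (upair y w) f v \<in> comma_Ar P \<longrightarrow>
         Cmp E (FAr L (comma_ar (upair x u) (upair y w) f v)) (\<delta> x u) = Cmp E (\<delta> y w) f) \<and>
       (\<forall>x \<in> Ob E. \<iota> x = \<delta> x (Idn B (FOb P x))) \<and>
       (\<forall>x u v. upair (upair x u) v \<in> comma_Ob (comma_proj P) \<longrightarrow>
         Cmp E (\<chi> (upair (upair x u) v)) (Cmp E (\<delta> (Cod E (\<delta> x u)) v) (\<delta> x u))
           = \<delta> x (Cmp B v u)))"

end

theory Submission
  imports Defs
begin

text \<open>
  A 2-cell out of the action of a cloven cofibration is determined by its composites with the chosen
  lifts, so the pseudoalgebra axioms can all be checked after precomposing with lifts, where they
  become identities between composites of lifts.  For the same reason every functor \<open>T\<close> over the base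
  carries exactly one candidate structure cell \<open>\<sigma>\<close>, given by \<open>\<sigma> \<cdot> \<delta> = T \<delta>\<close>; it is invertible exactly
  when \<open>T\<close> preserves cocartesian arrows, and every 2-cell over the base is compatible with it.

  Conversely, a pseudoalgebra \<open>a\<close> lifts \<open>u\<close> at \<open>x\<close> to \<open>\<delta> = a (1, u) \<cdot> \<iota>\<^sub>x\<close>.  The two unit axioms force
  \<open>\<iota>\<close> at \<open>a (x, u)\<close> to be \<open>a (\<delta>, 1)\<close>, so by naturality of \<open>\<iota>\<close> an arrow \<open>h\<close> out of \<open>a (x, u)\<close> is
  recovered from \<open>h \<cdot> \<delta>\<close> and its image in the base: \<open>\<delta>\<close> is cocartesian.

  The 2-category axioms of slices and of cloven cofibrations are reflected along faithful forgetful
  assignments, and those of pseudoalgebras are transported along the bijection.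
\<close>

section \<open>Faithful structures over a 2-category\<close>

text \<open>The isomorphism is strict, so both round trips must be equalities, and each is reduced
  to uniqueness. The equations tying \<open>L\<close>, \<iota> and \<chi> to given lifts determine a
  pseudoalgebra completely; hence a pseudoalgebra is recovered as soon as it is shown to be induced
  by its own lifts, and a cleavage is recovered by reading the equation for \<open>L\<close> at
  \<open>(1, u)\<close>. Cancelling a lift is legitimate only for arrows with the same image in the
  base. This is where it matters that structure cells live in the slice: their components lie over
  identities. For an equation involving two or three base arrows the test arrow is a composite of
  two or three lifts, which is again cocartesian. In the other direction the unit cell is only
  invertible, so the action of \<open>(1, u)\<close> starts at \<open>L (x, 1)\<close> instead of
  \<open>x\<close>; \<iota> bridges this gap, and its inverse supplies the fillers. Components of
  slice cells decide equality only between parallel cells. The necessary typings are consequences of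
  the 2-monad laws alone, so they are established for an arbitrary strict 2-monad.\<close>

lemma mor_iff: "f \<in> mor K X Y \<longleftrightarrow> f \<in> Mor K \<and> Src K f = X \<and> Trg K f = Y"
  by (simp add: mor_def)

lemma cell_iff: "\<alpha> \<in> cell K f g \<longleftrightarrow> \<alpha> \<in> Cell K \<and> Src2 K \<alpha> = f \<and> Trg2 K \<alpha> = g"
  by (simp add: cell_def)

section \<open>Ends of 2-cells and of whiskerings\<close>

context two_category
begin

lemma mor_Obj: "f \<in> mor K X Y \<Longrightarrow> X \<in> Obj K" "f \<in> mor K X Y \<Longrightarrow> Y \<in> Obj K"
  using Src_Obj Trg_Obj by (auto simp: mor_iff)

lemma cell_mor:
  assumes "\<alpha> \<in> cell K f g"
  shows "f \<in> mor K (Src K f) (Trg K f)" "g \<in> mor K (Src K f) (Trg K f)"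
  using assms Src2_Mor[of \<alpha>] Trg2_mor[of \<alpha>] by (auto simp: cell_iff mor_iff Src0_def Trg0_def)

lemma whisker_left_cell:
  assumes "\<alpha> \<in> cell K f f'" "f \<in> mor K X Y" "g \<in> mor K Y Z"
  shows "whisker_left K g \<alpha> \<in> cell K (Comp1 K g f) (Comp1 K g f')"
  unfolding whisker_left_def
  by (rule HComp_cell) (use assms Id2_cell in \<open>auto simp: mor_iff\<close>)

lemma whisker_right_cell:
  assumes "\<beta> \<in> cell K g g'" "g \<in> mor K Y Z" "f \<in> mor K X Y"
  shows "whisker_right K \<beta> f \<in> cell K (Comp1 K g f) (Comp1 K g' f)"
  unfolding whisker_right_def
  by (rule HComp_cell) (use assms Id2_cell in \<open>auto simp: mor_iff\<close>)

end

text \<open>Every 2-category law equates parallel cells. Once the operations of \<open>K\<close> are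
  typed and preserved, \<open>U\<close> carries such an equation to the corresponding law of
  \<open>S\<close>, and faithfulness brings it back. Faithfulness is asked on parallel cells only,
  so that the domain assignment of a slice qualifies although it forgets the functors to the
  base.\<close>

locale faithful_structure =
  S: two_category S
  for S :: "('p, 'n, 's) twocat" and K :: "('o, 'm, 't) twocat"
    and U :: "('o, 'm, 't, 'p, 'n, 's) twofun" +
  assumes Src_Obj: "f \<in> Mor K \<Longrightarrow> Src K f \<in> Obj K"
    and Trg_Obj: "f \<in> Mor K \<Longrightarrow> Trg K f \<in> Obj K"
    and Id1_mor: "X \<in> Obj K \<Longrightarrow> Id1 K X \<in> mor K X X"
    and Comp1_mor: "f \<in> mor K X Y \<Longrightarrow> g \<in> mor K Y Z \<Longrightarrow> Comp1 K g f \<in> mor K X Z"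
    and Src2_Mor: "\<alpha> \<in> Cell K \<Longrightarrow> Src2 K \<alpha> \<in> Mor K"
    and Trg2_mor: "\<alpha> \<in> Cell K \<Longrightarrow> Trg2 K \<alpha> \<in> mor K (Src0 K \<alpha>) (Trg0 K \<alpha>)"
    and Id2_cell: "f \<in> Mor K \<Longrightarrow> Id2 K f \<in> cell K f f"
    and VComp_cell: "\<alpha> \<in> cell K f g \<Longrightarrow> \<beta> \<in> cell K g h \<Longrightarrow> VComp K \<beta> \<alpha> \<in> cell K f h"
    and HComp_cell: "\<alpha> \<in> cell K f f' \<Longrightarrow> \<beta> \<in> cell K g g' \<Longrightarrow> Trg K f = Src K g \<Longrightarrow>
      HComp K \<beta> \<alpha> \<in> cell K (Comp1 K g f) (Comp1 K g' f')"
    and F0_Obj: "X \<in> Obj K \<Longrightarrow> F0 U X \<in> Obj S"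
    and F1_mor: "f \<in> mor K X Y \<Longrightarrow> F1 U f \<in> mor S (F0 U X) (F0 U Y)"
    and F2_cell: "\<alpha> \<in> cell K f g \<Longrightarrow> F2 U \<alpha> \<in> cell S (F1 U f) (F1 U g)"
    and F1_Id1: "X \<in> Obj K \<Longrightarrow> F1 U (Id1 K X) = Id1 S (F0 U X)"
    and F1_Comp1: "f \<in> mor K X Y \<Longrightarrow> g \<in> mor K Y Z \<Longrightarrow>
      F1 U (Comp1 K g f) = Comp1 S (F1 U g) (F1 U f)"
    and F2_Id2: "f \<in> Mor K \<Longrightarrow> F2 U (Id2 K f) = Id2 S (F1 U f)"
    and F2_VComp: "\<alpha> \<in> cell K f g \<Longrightarrow> \<beta> \<in> cell K g h \<Longrightarrow>
      F2 U (VComp K \<beta> \<alpha>) = VComp S (F2 U \<beta>) (F2 U \<alpha>)"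
    and F2_HComp: "\<alpha> \<in> Cell K \<Longrightarrow> \<beta> \<in> Cell K \<Longrightarrow> Trg0 K \<alpha> = Src0 K \<beta> \<Longrightarrow>
      F2 U (HComp K \<beta> \<alpha>) = HComp S (F2 U \<beta>) (F2 U \<alpha>)"
    and F1_faithful: "f \<in> mor K X Y \<Longrightarrow> g \<in> mor K X Y \<Longrightarrow> F1 U f = F1 U g \<Longrightarrow> f = g"
    and F2_faithful: "\<alpha> \<in> cell K f g \<Longrightarrow> \<beta> \<in> cell K f g \<Longrightarrow> F2 U \<alpha> = F2 U \<beta> \<Longrightarrow> \<alpha> = \<beta>"
begin

lemma F2_HComp': "\<alpha> \<in> cell K f f' \<Longrightarrow> \<beta> \<in> cell K g g' \<Longrightarrow> Trg K f = Src K g \<Longrightarrow>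
      F2 U (HComp K \<beta> \<alpha>) = HComp S (F2 U \<beta>) (F2 U \<alpha>)"
  by (rule F2_HComp) (auto simp: cell_iff Src0_def Trg0_def)

lemma cellD:
  assumes "\<alpha> \<in> cell K f g"
  shows "f \<in> mor K (Src K f) (Trg K f)" "g \<in> mor K (Src K f) (Trg K f)"
    "Src0 K \<alpha> = Src K f" "Trg0 K \<alpha> = Trg K f"
    "Src K g = Src K f" "Trg K g = Trg K f"
  using assms Src2_Mor[of \<alpha>] Trg2_mor[of \<alpha>] by (auto simp: cell_iff mor_iff Src0_def Trg0_def)

lemma F2_Src0: "\<alpha> \<in> Cell K \<Longrightarrow> Src0 S (F2 U \<alpha>) = F0 U (Src0 K \<alpha>)"
  and F2_Trg0: "\<alpha> \<in> Cell K \<Longrightarrow> Trg0 S (F2 U \<alpha>) = F0 U (Trg0 K \<alpha>)"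
  using F2_cell[of \<alpha> "Src2 K \<alpha>" "Trg2 K \<alpha>"] F1_mor[of "Src2 K \<alpha>"] Src2_Mor[of \<alpha>]
  by (auto simp: cell_iff mor_iff Src0_def Trg0_def)

lemma Comp1_id_left: "f \<in> mor K X Y \<Longrightarrow> Comp1 K (Id1 K Y) f = f"
  by (rule F1_faithful[of _ X Y])
    (use Id1_mor[of Y] Trg_Obj[of f] Comp1_mor[of f X Y "Id1 K Y" Y] F1_mor[of f X Y] in
      \<open>auto simp: mor_iff F1_Comp1[of f X Y _ Y] F1_Id1 S.Comp1_Id1_left\<close>)

lemma Comp1_id_right: "f \<in> mor K X Y \<Longrightarrow> Comp1 K f (Id1 K X) = f"
  by (rule F1_faithful[of _ X Y])
    (use Id1_mor[of X] Src_Obj[of f] Comp1_mor[of "Id1 K X" X X f Y] F1_mor[of f X Y] in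
      \<open>auto simp: mor_iff F1_Comp1[of _ X X _ Y] F1_Id1 S.Comp1_Id1_right\<close>)

lemma Comp1_assoc:
  assumes f: "f \<in> mor K W X" and g: "g \<in> mor K X Y" and h: "h \<in> mor K Y Z"
  shows "Comp1 K h (Comp1 K g f) = Comp1 K (Comp1 K h g) f"
proof (rule F1_faithful[of _ W Z])
  note gf = Comp1_mor[OF f g] and hg = Comp1_mor[OF g h]
  show "Comp1 K h (Comp1 K g f) \<in> mor K W Z" by (rule Comp1_mor[OF gf h])
  show "Comp1 K (Comp1 K h g) f \<in> mor K W Z" by (rule Comp1_mor[OF f hg])
  show "F1 U (Comp1 K h (Comp1 K g f)) = F1 U (Comp1 K (Comp1 K h g) f)"
    by (simp add: F1_Comp1[OF f g] F1_Comp1[OF g h] F1_Comp1[OF gf h] F1_Comp1[OF f hg]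
        S.Comp1_assoc[OF F1_mor[OF f] F1_mor[OF g] F1_mor[OF h]])
qed

lemma HComp_id_left:
  assumes "\<alpha> \<in> Cell K"
  shows "HComp K (Id2 K (Id1 K (Trg0 K \<alpha>))) \<alpha> = \<alpha>"
proof -
  let ?f = "Src2 K \<alpha>" and ?g = "Trg2 K \<alpha>"
  let ?Y = "Trg0 K \<alpha>"
  have a: "\<alpha> \<in> cell K ?f ?g" using assms by (simp add: cell_iff)
  note d = cellD[OF a]
  have Y: "?Y \<in> Obj K" using d(1,4) Trg_Obj by (auto simp: mor_iff)
  have i: "Id2 K (Id1 K ?Y) \<in> cell K (Id1 K ?Y) (Id1 K ?Y)"
    using Id1_mor[OF Y] Id2_cell by (simp add: mor_iff)
  have c: "Trg K ?f = Src K (Id1 K ?Y)" using Id1_mor[OF Y] d by (simp add: mor_iff)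
  show ?thesis
  proof (rule F2_faithful[OF _ a])
    show "HComp K (Id2 K (Id1 K ?Y)) \<alpha> \<in> cell K ?f ?g"
      using HComp_cell[OF a i c] Comp1_id_left d by metis
    show "F2 U (HComp K (Id2 K (Id1 K ?Y)) \<alpha>) = F2 U \<alpha>"
      using F2_HComp'[OF a i c] F2_Id2 F1_Id1 Y Id1_mor[OF Y] S.HComp_Id_left[of "F2 U \<alpha>"]
        F2_cell[OF a] F2_Trg0[OF assms]
      by (simp add: mor_iff cell_iff)
  qed
qed

lemma HComp_id_right:
  assumes "\<alpha> \<in> Cell K"
  shows "HComp K \<alpha> (Id2 K (Id1 K (Src0 K \<alpha>))) = \<alpha>"
proof -
  let ?f = "Src2 K \<alpha>" and ?g = "Trg2 K \<alpha>"
  let ?X = "Src0 K \<alpha>"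
  have a: "\<alpha> \<in> cell K ?f ?g" using assms by (simp add: cell_iff)
  note d = cellD[OF a]
  have X: "?X \<in> Obj K" using d(1,3) Src_Obj by (auto simp: mor_iff)
  have i: "Id2 K (Id1 K ?X) \<in> cell K (Id1 K ?X) (Id1 K ?X)"
    using Id1_mor[OF X] Id2_cell by (simp add: mor_iff)
  have c: "Trg K (Id1 K ?X) = Src K ?f" using Id1_mor[OF X] d by (simp add: mor_iff)
  show ?thesis
  proof (rule F2_faithful[OF _ a])
    show "HComp K \<alpha> (Id2 K (Id1 K ?X)) \<in> cell K ?f ?g"
      using HComp_cell[OF i a c] Comp1_id_right d by metis
    show "F2 U (HComp K \<alpha> (Id2 K (Id1 K ?X))) = F2 U \<alpha>"
      using F2_HComp'[OF i a c] F2_Id2 F1_Id1 X Id1_mor[OF X] S.HComp_Id_right[of "F2 U \<alpha>"]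
        F2_cell[OF a] F2_Src0[OF assms]
      by (simp add: mor_iff cell_iff)
  qed
qed

lemma VComp_id_left: "\<alpha> \<in> cell K f g \<Longrightarrow> VComp K (Id2 K g) \<alpha> = \<alpha>"
  by (rule F2_faithful[of _ f g])
    (use Id2_cell[of g] cellD[of \<alpha> f g] VComp_cell[of \<alpha> f g "Id2 K g" g] F2_cell[of \<alpha> f g] in
      \<open>auto simp: mor_iff F2_VComp[of \<alpha> f g _ g] F2_Id2 S.VComp_Id2_left\<close>)

lemma VComp_id_right: "\<alpha> \<in> cell K f g \<Longrightarrow> VComp K \<alpha> (Id2 K f) = \<alpha>"
  by (rule F2_faithful[of _ f g])
    (use Id2_cell[of f] cellD[of \<alpha> f g] VComp_cell[of "Id2 K f" f f \<alpha> g] F2_cell[of \<alpha> f g] in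
      \<open>auto simp: mor_iff F2_VComp[of _ f f _ g] F2_Id2 S.VComp_Id2_right\<close>)

lemma VComp_assoc:
  assumes f: "\<alpha> \<in> cell K f g" and g: "\<beta> \<in> cell K g h" and h: "\<gamma> \<in> cell K h k"
  shows "VComp K \<gamma> (VComp K \<beta> \<alpha>) = VComp K (VComp K \<gamma> \<beta>) \<alpha>"
proof (rule F2_faithful[of _ f k])
  note gf = VComp_cell[OF f g] and hg = VComp_cell[OF g h]
  show "VComp K \<gamma> (VComp K \<beta> \<alpha>) \<in> cell K f k" by (rule VComp_cell[OF gf h])
  show "VComp K (VComp K \<gamma> \<beta>) \<alpha> \<in> cell K f k" by (rule VComp_cell[OF f hg])
  show "F2 U (VComp K \<gamma> (VComp K \<beta> \<alpha>)) = F2 U (VComp K (VComp K \<gamma> \<beta>) \<alpha>)"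
    by (simp add: F2_VComp[OF f g] F2_VComp[OF g h] F2_VComp[OF gf h] F2_VComp[OF f hg]
        S.VComp_assoc[OF F2_cell[OF f] F2_cell[OF g] F2_cell[OF h]])
qed

lemma HComp_assoc:
  assumes "\<alpha> \<in> Cell K" "\<beta> \<in> Cell K" "\<gamma> \<in> Cell K"
    and "Trg0 K \<alpha> = Src0 K \<beta>" "Trg0 K \<beta> = Src0 K \<gamma>"
  shows "HComp K \<gamma> (HComp K \<beta> \<alpha>) = HComp K (HComp K \<gamma> \<beta>) \<alpha>"
proof -
  let ?f = "Src2 K \<alpha>" and ?f' = "Trg2 K \<alpha>"
  let ?g = "Src2 K \<beta>" and ?g' = "Trg2 K \<beta>"
  let ?h = "Src2 K \<gamma>" and ?h' = "Trg2 K \<gamma>"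
  have a: "\<alpha> \<in> cell K ?f ?f'" and b: "\<beta> \<in> cell K ?g ?g'" and c: "\<gamma> \<in> cell K ?h ?h'"
    using assms by (auto simp: cell_iff)
  note ad = cellD[OF a] and bd = cellD[OF b] and cd = cellD[OF c]
  have eq: "Trg K ?f = Src K ?g" "Trg K ?g = Src K ?h"
    using assms(4,5) by (auto simp: Src0_def Trg0_def)
  note ba = HComp_cell[OF a b eq(1)] and cb = HComp_cell[OF b c eq(2)]
  have m: "?f \<in> mor K (Src K ?f) (Src K ?g)" "?g \<in> mor K (Src K ?g) (Src K ?h)"
    "?h \<in> mor K (Src K ?h) (Trg K ?h)"
    "?f' \<in> mor K (Src K ?f) (Src K ?g)" "?g' \<in> mor K (Src K ?g) (Src K ?h)"
    "?h' \<in> mor K (Src K ?h) (Trg K ?h)"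
    using ad bd cd eq by auto
  have t1: "Trg K (Comp1 K ?g ?f) = Src K ?h" using Comp1_mor[OF m(1,2)] by (simp add: mor_iff)
  have t2: "Trg K ?f = Src K (Comp1 K ?h ?g)" using Comp1_mor[OF m(2,3)] eq by (simp add: mor_iff)
  show ?thesis
  proof (rule F2_faithful[OF HComp_cell[OF ba c t1]])
    \<comment> \<open>The two bracketings are parallel only after associativity of
      \<open>Comp1\<close> has identified their ends.\<close>
    show "HComp K (HComp K \<gamma> \<beta>) \<alpha> \<in> cell K (Comp1 K ?h (Comp1 K ?g ?f)) (Comp1 K ?h' (Comp1 K ?g' ?f'))"
      using HComp_cell[OF a cb t2] Comp1_assoc[OF m(1,2,3)] Comp1_assoc[OF m(4,5,6)] by simp
    show "F2 U (HComp K \<gamma> (HComp K \<beta> \<alpha>)) = F2 U (HComp K (HComp K \<gamma> \<beta>) \<alpha>)"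
      unfolding F2_HComp'[OF ba c t1] F2_HComp'[OF a b eq(1)] F2_HComp'[OF a cb t2]
        F2_HComp'[OF b c eq(2)]
      by (rule S.HComp_assoc)
        (use F2_cell[OF a] F2_cell[OF b] F2_cell[OF c] assms in
          \<open>auto simp: cell_iff F2_Src0 F2_Trg0\<close>)
  qed
qed

lemma HComp_Id2:
  assumes f: "f \<in> mor K X Y" and g: "g \<in> mor K Y Z"
  shows "HComp K (Id2 K g) (Id2 K f) = Id2 K (Comp1 K g f)"
proof -
  have i: "Id2 K f \<in> cell K f f" "Id2 K g \<in> cell K g g"
    "Id2 K (Comp1 K g f) \<in> cell K (Comp1 K g f) (Comp1 K g f)"
    using Id2_cell f g Comp1_mor[OF f g] by (auto simp: mor_iff)
  have c: "Trg K f = Src K g" using f g by (simp add: mor_iff)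
  show ?thesis
    by (rule F2_faithful[OF HComp_cell[OF i(1,2) c] i(3)])
      (use f g Comp1_mor[OF f g] S.HComp_Id2[OF F1_mor[OF f] F1_mor[OF g]] in
        \<open>simp add: F2_HComp'[OF i(1,2) c] F2_Id2 mor_iff F1_Comp1[OF f g]\<close>)
qed

lemma interchange:
  assumes a: "\<alpha> \<in> cell K f f'" and a': "\<alpha>' \<in> cell K f' f''"
    and b: "\<beta> \<in> cell K g g'" and b': "\<beta>' \<in> cell K g' g''" and c: "Trg K f = Src K g"
  shows "HComp K (VComp K \<beta>' \<beta>) (VComp K \<alpha>' \<alpha>)
        = VComp K (HComp K \<beta>' \<alpha>') (HComp K \<beta> \<alpha>)"
proof -
  have c': "Trg K f' = Src K g'" using cellD[OF a] cellD[OF b] c by simp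
  note va = VComp_cell[OF a a'] and vb = VComp_cell[OF b b']
  note h = HComp_cell[OF a b c] and h' = HComp_cell[OF a' b' c']
  have cs: "Trg S (F1 U f) = Src S (F1 U g)"
    using F1_mor[OF cellD(1)[OF a]] F1_mor[OF cellD(1)[OF b]] c by (simp add: mor_iff)
  show ?thesis
    by (rule F2_faithful[OF HComp_cell[OF va vb c] VComp_cell[OF h h']])
      (simp add: F2_HComp'[OF va vb c] F2_VComp[OF a a'] F2_VComp[OF b b'] F2_VComp[OF h h']
        F2_HComp'[OF a b c] F2_HComp'[OF a' b' c']
        S.interchange[OF F2_cell[OF a] F2_cell[OF a'] F2_cell[OF b] F2_cell[OF b'] cs])
qed

lemma two_category: "two_category K"
  by unfold_locales
    (fact Src_Obj Trg_Obj Id1_mor Comp1_mor Comp1_id_left Comp1_id_right Comp1_assoc Src2_Mor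
      Trg2_mor Id2_cell VComp_cell VComp_id_left VComp_id_right VComp_assoc HComp_cell
      HComp_id_left HComp_id_right HComp_assoc HComp_Id2 interchange)+

lemma two_functor: "two_functor K S U"
  by (rule two_functor.intro)
    (fact two_category S.two_category_axioms F0_Obj F1_mor F2_cell F1_Id1 F1_Comp1 F2_Id2 F2_VComp
      F2_HComp)+

end

text \<open>\<open>L\<close> enters as bare data, matched cell by cell with the 2-category
  \<open>K\<close>. For pseudoalgebras this replaces the pasting arguments showing that
  pseudomorphisms and their transformations compose: such closure facts are read off from
  \<open>K\<close> through \<open>F\<close>.\<close>

locale transported_structure =
  K: two_category K
  for K :: "('o, 'm, 't) twocat" and L :: "('p, 'n, 's) twocat"
    and F :: "('o, 'm, 't, 'p, 'n, 's) twofun" and G :: "('p, 'n, 's, 'o, 'm, 't) twofun" +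
  assumes F_Obj: "X \<in> Obj K \<Longrightarrow> F0 F X \<in> Obj L"
    and F_Mor: "f \<in> Mor K \<Longrightarrow> F1 F f \<in> Mor L"
    and F_Cell: "\<alpha> \<in> Cell K \<Longrightarrow> F2 F \<alpha> \<in> Cell L"
    and G_Obj: "X' \<in> Obj L \<Longrightarrow> F0 G X' \<in> Obj K"
    and G_Mor: "f' \<in> Mor L \<Longrightarrow> F1 G f' \<in> Mor K"
    and G_Cell: "\<alpha>' \<in> Cell L \<Longrightarrow> F2 G \<alpha>' \<in> Cell K"
    and G_F: "inverse_on K F G"
    and F_G: "inverse_on L G F"
    and F_Src: "f \<in> Mor K \<Longrightarrow> Src L (F1 F f) = F0 F (Src K f)"
    and F_Trg: "f \<in> Mor K \<Longrightarrow> Trg L (F1 F f) = F0 F (Trg K f)"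
    and F_Src2: "\<alpha> \<in> Cell K \<Longrightarrow> Src2 L (F2 F \<alpha>) = F1 F (Src2 K \<alpha>)"
    and F_Trg2: "\<alpha> \<in> Cell K \<Longrightarrow> Trg2 L (F2 F \<alpha>) = F1 F (Trg2 K \<alpha>)"
    and F_Id1: "X \<in> Obj K \<Longrightarrow> F1 F (Id1 K X) = Id1 L (F0 F X)"
    and F_Comp1: "f \<in> mor K X Y \<Longrightarrow> g \<in> mor K Y Z \<Longrightarrow>
      F1 F (Comp1 K g f) = Comp1 L (F1 F g) (F1 F f)"
    and F_Id2: "f \<in> Mor K \<Longrightarrow> F2 F (Id2 K f) = Id2 L (F1 F f)"
    and F_VComp: "\<alpha> \<in> cell K f g \<Longrightarrow> \<beta> \<in> cell K g h \<Longrightarrow>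
      F2 F (VComp K \<beta> \<alpha>) = VComp L (F2 F \<beta>) (F2 F \<alpha>)"
    and F_HComp: "\<alpha> \<in> Cell K \<Longrightarrow> \<beta> \<in> Cell K \<Longrightarrow> Trg0 K \<alpha> = Src0 K \<beta> \<Longrightarrow>
      F2 F (HComp K \<beta> \<alpha>) = HComp L (F2 F \<beta>) (F2 F \<alpha>)"
begin

lemma GF0: "X \<in> Obj K \<Longrightarrow> F0 G (F0 F X) = X" and GF1: "f \<in> Mor K \<Longrightarrow> F1 G (F1 F f) = f"
  and GF2: "\<alpha> \<in> Cell K \<Longrightarrow> F2 G (F2 F \<alpha>) = \<alpha>"
  using G_F by (auto simp: inverse_on_def)

lemma FG0: "X \<in> Obj L \<Longrightarrow> F0 F (F0 G X) = X" and FG1: "f \<in> Mor L \<Longrightarrow> F1 F (F1 G f) = f"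
  and FG2: "\<alpha> \<in> Cell L \<Longrightarrow> F2 F (F2 G \<alpha>) = \<alpha>"
  using F_G by (auto simp: inverse_on_def)

lemma G_Src: "f \<in> Mor L \<Longrightarrow> F0 G (Src L f) = Src K (F1 G f)"
  and G_Trg: "f \<in> Mor L \<Longrightarrow> F0 G (Trg L f) = Trg K (F1 G f)"
  using F_Src[OF G_Mor] F_Trg[OF G_Mor] GF0 K.Src_Obj K.Trg_Obj G_Mor FG1 by metis+

lemma G_Src2: "\<alpha> \<in> Cell L \<Longrightarrow> F1 G (Src2 L \<alpha>) = Src2 K (F2 G \<alpha>)"
  and G_Trg2: "\<alpha> \<in> Cell L \<Longrightarrow> F1 G (Trg2 L \<alpha>) = Trg2 K (F2 G \<alpha>)"
  using F_Src2[OF G_Cell] F_Trg2[OF G_Cell] GF1 K.Src2_Mor K.Trg2_mor G_Cell FG2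
  by (metis mor_iff)+

lemma F_mor: "f \<in> mor K X Y \<Longrightarrow> F1 F f \<in> mor L (F0 F X) (F0 F Y)"
  by (auto simp: mor_iff F_Mor F_Src F_Trg)

lemma F_cell: "\<alpha> \<in> cell K f g \<Longrightarrow> F2 F \<alpha> \<in> cell L (F1 F f) (F1 F g)"
  by (auto simp: cell_iff F_Cell F_Src2 F_Trg2)

lemma G_mor: "f \<in> mor L X Y \<Longrightarrow> F1 G f \<in> mor K (F0 G X) (F0 G Y)"
  by (auto simp: mor_iff G_Mor G_Src G_Trg)

lemma G_cell: "\<alpha> \<in> cell L f g \<Longrightarrow> F2 G \<alpha> \<in> cell K (F1 G f) (F1 G g)"
  by (auto simp: cell_iff G_Cell G_Src2 G_Trg2)

lemma L_Src: "f \<in> Mor L \<Longrightarrow> Src L f \<in> Obj L" and L_Trg: "f \<in> Mor L \<Longrightarrow> Trg L f \<in> Obj L"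
  using F_Src[OF G_Mor] F_Trg[OF G_Mor] F_Obj K.Src_Obj K.Trg_Obj G_Mor FG1 by metis+

lemma L_Src2: "\<alpha> \<in> Cell L \<Longrightarrow> Src2 L \<alpha> \<in> Mor L" and L_Trg2: "\<alpha> \<in> Cell L \<Longrightarrow> Trg2 L \<alpha> \<in> Mor L"
  using F_Src2[OF G_Cell] F_Trg2[OF G_Cell] F_Mor K.Src2_Mor K.Trg2_mor G_Cell FG2
  by (metis mor_iff)+

lemma L_cell: assumes "\<alpha> \<in> cell L f g" shows "f \<in> Mor L" "g \<in> Mor L"
  using assms L_Src2 L_Trg2 by (auto simp: cell_iff)

lemma L_mor: assumes "f \<in> mor L X Y" shows "f \<in> Mor L" "X \<in> Obj L" "Y \<in> Obj L"
  using assms L_Src L_Trg by (auto simp: mor_iff)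

lemma G_Src0: "\<alpha> \<in> Cell L \<Longrightarrow> Src0 K (F2 G \<alpha>) = F0 G (Src0 L \<alpha>)"
  and G_Trg0: "\<alpha> \<in> Cell L \<Longrightarrow> Trg0 K (F2 G \<alpha>) = F0 G (Trg0 L \<alpha>)"
  by (simp_all add: Src0_def Trg0_def G_Src G_Trg L_Src2 flip: G_Src2)

lemma L_Id1: "X \<in> Obj L \<Longrightarrow> Id1 L X = F1 F (Id1 K (F0 G X))"
  by (simp add: F_Id1 G_Obj FG0)

lemma L_Comp1: "f \<in> mor L X Y \<Longrightarrow> g \<in> mor L Y Z \<Longrightarrow>
    Comp1 L g f = F1 F (Comp1 K (F1 G g) (F1 G f))"
  using F_Comp1[OF G_mor G_mor, of f X Y g Z] L_mor[of f X Y] L_mor[of g Y Z]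
  by (simp add: FG1)

lemma L_Id2: "f \<in> Mor L \<Longrightarrow> Id2 L f = F2 F (Id2 K (F1 G f))"
  by (simp add: F_Id2 G_Mor FG1)

lemma L_VComp: "\<alpha> \<in> cell L f g \<Longrightarrow> \<beta> \<in> cell L g h \<Longrightarrow>
    VComp L \<beta> \<alpha> = F2 F (VComp K (F2 G \<beta>) (F2 G \<alpha>))"
  using F_VComp[OF G_cell G_cell, of \<alpha> f g \<beta> h] by (simp add: FG2 cell_iff)

lemma L_HComp: "\<alpha> \<in> Cell L \<Longrightarrow> \<beta> \<in> Cell L \<Longrightarrow> Trg0 L \<alpha> = Src0 L \<beta> \<Longrightarrow>
    HComp L \<beta> \<alpha> = F2 F (HComp K (F2 G \<beta>) (F2 G \<alpha>))"
  using F_HComp[OF G_Cell G_Cell, of \<alpha> \<beta>] by (simp add: FG2 G_Src0 G_Trg0)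

lemma L_HComp': "\<alpha> \<in> cell L f f' \<Longrightarrow> \<beta> \<in> cell L g g' \<Longrightarrow> Trg L f = Src L g \<Longrightarrow>
    HComp L \<beta> \<alpha> = F2 F (HComp K (F2 G \<beta>) (F2 G \<alpha>))"
  by (rule L_HComp) (auto simp: cell_iff Src0_def Trg0_def)

lemma Comp1_in_L:
  assumes f: "f \<in> mor L X Y" and g: "g \<in> mor L Y Z"
  shows "Comp1 L g f \<in> mor L X Z"
  using F_mor[OF K.Comp1_mor[OF G_mor[OF f] G_mor[OF g]]] L_Comp1[OF f g] L_mor[OF f] L_mor[OF g]
  by (simp add: FG0)

lemma VComp_in_L:
  assumes f: "\<alpha> \<in> cell L f g" and g: "\<beta> \<in> cell L g h"
  shows "VComp L \<beta> \<alpha> \<in> cell L f h"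
  using F_cell[OF K.VComp_cell[OF G_cell[OF f] G_cell[OF g]]] L_VComp[OF f g] L_cell[OF f] L_cell[OF g]
  by (simp add: FG1)

lemma HComp_in_L:
  assumes a: "\<alpha> \<in> cell L f f'" and b: "\<beta> \<in> cell L g g'" and c: "Trg L f = Src L g"
  shows "HComp L \<beta> \<alpha> \<in> cell L (Comp1 L g f) (Comp1 L g' f')"
proof -
  have cK: "Trg K (F1 G f) = Src K (F1 G g)"
    using c L_cell[OF a] L_cell[OF b] by (simp flip: G_Src G_Trg)
  note ga = G_cell[OF a] and gb = G_cell[OF b]
  note ma = K.cell_mor[OF ga] and mb = K.cell_mor[OF gb]
  have "HComp L \<beta> \<alpha> \<in> cell L (F1 F (Comp1 K (F1 G g) (F1 G f))) (F1 F (Comp1 K (F1 G g') (F1 G f')))"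
    unfolding L_HComp'[OF a b c] by (rule F_cell[OF K.HComp_cell[OF ga gb cK]])
  then show ?thesis
    using F_Comp1[OF ma(1), of "F1 G g"] F_Comp1[OF ma(2), of "F1 G g'"] mb cK L_cell[OF a] L_cell[OF b]
    by (simp add: FG1)
qed

text \<open>Having a left inverse on cells, \<open>G\<close> is faithful. Typing of the operations
  of \<open>L\<close> comes from writing them as images under \<open>F\<close>; preservation by
  \<open>G\<close> comes from cancelling \<open>F\<close> in the same expressions.\<close>

lemma faithful: "faithful_structure K L G"
proof unfold_locales
  show "Trg2 L \<alpha> \<in> mor L (Src0 L \<alpha>) (Trg0 L \<alpha>)" if a: "\<alpha> \<in> Cell L" for \<alpha>
  proof -
    have "F1 F (Trg2 K (F2 G \<alpha>)) \<in> mor L (F0 F (Src0 K (F2 G \<alpha>))) (F0 F (Trg0 K (F2 G \<alpha>)))"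
      by (rule F_mor[OF K.Trg2_mor[OF G_Cell[OF a]]])
    moreover have "Src0 L \<alpha> \<in> Obj L" "Trg0 L \<alpha> \<in> Obj L"
      using L_Src[OF L_Src2[OF a]] L_Trg[OF L_Src2[OF a]] by (simp_all add: Src0_def Trg0_def)
    ultimately show ?thesis
      by (simp add: a FG1 G_Src0 G_Trg0 L_Trg2 FG0 flip: G_Trg2)
  qed
  show "Id1 L X \<in> mor L X X" if "X \<in> Obj L" for X
    using F_mor[OF K.Id1_mor[OF G_Obj[OF that]]] L_Id1[OF that] that by (simp add: FG0)
  show "Id2 L f \<in> cell L f f" if "f \<in> Mor L" for f
    using F_cell[OF K.Id2_cell[OF G_Mor[OF that]]] L_Id2[OF that] that by (simp add: FG1)
  show "F1 G (Id1 L X) = Id1 K (F0 G X)" if "X \<in> Obj L" for X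
    using K.Id1_mor[OF G_Obj[OF that]] by (simp add: L_Id1 that GF1 mor_iff)
  show "F2 G (Id2 L f) = Id2 K (F1 G f)" if "f \<in> Mor L" for f
    using K.Id2_cell[OF G_Mor[OF that]] by (simp add: L_Id2 that GF2 cell_iff)
  show "F1 G (Comp1 L g f) = Comp1 K (F1 G g) (F1 G f)" if "f \<in> mor L X Y" "g \<in> mor L Y Z" for f g X Y Z
    using K.Comp1_mor[OF G_mor[OF that(1)] G_mor[OF that(2)]]
    by (simp add: L_Comp1[OF that] GF1 mor_iff)
  show "F2 G (VComp L \<beta> \<alpha>) = VComp K (F2 G \<beta>) (F2 G \<alpha>)"
    if "\<alpha> \<in> cell L f g" "\<beta> \<in> cell L g h" for \<alpha> \<beta> f g h
    using K.VComp_cell[OF G_cell[OF that(1)] G_cell[OF that(2)]]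
    by (simp add: L_VComp[OF that] GF2 cell_iff)
  show "F2 G (HComp L \<beta> \<alpha>) = HComp K (F2 G \<beta>) (F2 G \<alpha>)"
    if "\<alpha> \<in> Cell L" "\<beta> \<in> Cell L" "Trg0 L \<alpha> = Src0 L \<beta>" for \<alpha> \<beta>
  proof -
    have "HComp K (F2 G \<beta>) (F2 G \<alpha>) \<in> Cell K"
      using K.HComp_cell[of "F2 G \<alpha>" _ _ "F2 G \<beta>"] G_Cell that G_Src0[of \<beta>] G_Trg0[of \<alpha>]
      by (auto simp: cell_iff Src0_def Trg0_def)
    then show ?thesis by (simp add: L_HComp[OF that] GF2)
  qed
  show "f = g" if "f \<in> mor L X Y" "g \<in> mor L X Y" "F1 G f = F1 G g" for f g X Y
    using that FG1 by (metis mor_iff)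
  show "\<alpha> = \<beta>" if "\<alpha> \<in> cell L f g" "\<beta> \<in> cell L f g" "F2 G \<alpha> = F2 G \<beta>" for \<alpha> \<beta> f g
    using that FG2 by (metis cell_iff)
qed (fact L_Src L_Trg Comp1_in_L L_Src2 VComp_in_L HComp_in_L G_Obj G_mor G_cell)+

interpretation L: faithful_structure K L G by (rule faithful)

lemma F_two_functor: "two_functor K L F"
  by (rule two_functor.intro)
    (fact L.two_category K.two_category_axioms F_Obj F_mor F_cell F_Id1 F_Comp1 F_Id2 F_VComp
      F_HComp)+

lemma isomorphism: "two_isomorphism K L F"
  unfolding two_isomorphism_def using F_two_functor L.two_functor G_F F_G by blast

text \<open>On the cells of \<open>L\<close>, the assignment \<open>V\<close> coincides with
  \<open>U\<close> after \<open>G\<close>. Its 2-functoriality is therefore inherited from two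
  2-functors, without any inspection of \<open>L\<close>.\<close>

lemma isomorphism_over:
  assumes "two_functor K S U"
    and V0: "\<And>X. X \<in> Obj K \<Longrightarrow> F0 V (F0 F X) = F0 U X"
    and V1: "\<And>f. f \<in> Mor K \<Longrightarrow> F1 V (F1 F f) = F1 U f"
    and V2: "\<And>\<alpha>. \<alpha> \<in> Cell K \<Longrightarrow> F2 V (F2 F \<alpha>) = F2 U \<alpha>"
  shows "two_isomorphism_over S K U L V F"
proof -
  interpret U: two_functor K S U by fact
  interpret GF: two_functor L K G by (rule L.two_functor)
  have v0: "F0 V X = F0 U (F0 G X)" if "X \<in> Obj L" for X
    using V0[OF G_Obj[OF that]] FG0[OF that] by simp
  have v1: "F1 V f = F1 U (F1 G f)" if "f \<in> Mor L" for f
    using V1[OF G_Mor[OF that]] FG1[OF that] by simp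
  have v2: "F2 V \<alpha> = F2 U (F2 G \<alpha>)" if "\<alpha> \<in> Cell L" for \<alpha>
    using V2[OF G_Cell[OF that]] FG2[OF that] by simp
  interpret Lc: two_category L by (rule L.two_category)
  have "two_functor L S V"
  proof (rule two_functor.intro)
    show "F1 V f \<in> mor S (F0 V X) (F0 V Y)" if "f \<in> mor L X Y" for f X Y
      using U.F1_mor[OF G_mor[OF that]] L_mor[OF that] by (simp add: v0 v1)
    show "F2 V \<alpha> \<in> cell S (F1 V f) (F1 V g)" if "\<alpha> \<in> cell L f g" for \<alpha> f g
      using U.F2_cell[OF G_cell[OF that]] L_cell[OF that] that by (simp add: v1 v2 cell_iff)
    show "F1 V (Id1 L X) = Id1 S (F0 V X)" if "X \<in> Obj L" for X
      using Lc.Id1_mor[OF that] that by (simp add: v0 v1 mor_iff GF.F1_Id1 U.F1_Id1 G_Obj)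
    show "F1 V (Comp1 L g f) = Comp1 S (F1 V g) (F1 V f)" if "f \<in> mor L X Y" "g \<in> mor L Y Z" for f g X Y Z
      using Lc.Comp1_mor[OF that] L_mor[OF that(1)] L_mor[OF that(2)]
        U.F1_Comp1[OF G_mor[OF that(1)] G_mor[OF that(2)]]
      by (simp add: v1 mor_iff GF.F1_Comp1[OF that])
    show "F2 V (Id2 L f) = Id2 S (F1 V f)" if "f \<in> Mor L" for f
      using Lc.Id2_cell[OF that] that by (simp add: v1 v2 cell_iff GF.F2_Id2 U.F2_Id2 G_Mor)
    show "F2 V (VComp L \<beta> \<alpha>) = VComp S (F2 V \<beta>) (F2 V \<alpha>)"
      if "\<alpha> \<in> cell L f g" "\<beta> \<in> cell L g h" for \<alpha> \<beta> f g h
      using Lc.VComp_cell[OF that] that U.F2_VComp[OF G_cell[OF that(1)] G_cell[OF that(2)]]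
      by (simp add: v2 cell_iff GF.F2_VComp[OF that])
    show "F2 V (HComp L \<beta> \<alpha>) = HComp S (F2 V \<beta>) (F2 V \<alpha>)"
      if "\<alpha> \<in> Cell L" "\<beta> \<in> Cell L" "Trg0 L \<alpha> = Src0 L \<beta>" for \<alpha> \<beta>
      using Lc.HComp_cell[of \<alpha> _ _ \<beta>] that U.F2_HComp[OF G_Cell[OF that(1)] G_Cell[OF that(2)]]
        G_Src0[OF that(2)] G_Trg0[OF that(1)]
      by (simp add: v2 cell_iff GF.F2_HComp[OF that] Src0_def Trg0_def)
  qed (use U.F0_Obj G_Obj v0 U.target L.two_category in auto)
  then show ?thesis
    unfolding two_isomorphism_over_def using assms isomorphism by blast
qed

end


subsection \<open>Full sub-2-categories\<close>

lemma full_sub_simps [simp]: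
  "Obj (full_sub K R) = {X \<in> Obj K. R X}"
  "Mor (full_sub K R) = {f \<in> Mor K. R (Src K f) \<and> R (Trg K f)}"
  "Cell (full_sub K R) = {\<alpha> \<in> Cell K. R (Src0 K \<alpha>) \<and> R (Trg0 K \<alpha>)}"
  "Src (full_sub K R) = Src K" "Trg (full_sub K R) = Trg K"
  "Id1 (full_sub K R) = Id1 K" "Comp1 (full_sub K R) = Comp1 K"
  "Src2 (full_sub K R) = Src2 K" "Trg2 (full_sub K R) = Trg2 K" "Id2 (full_sub K R) = Id2 K"
  "VComp (full_sub K R) = VComp K" "HComp (full_sub K R) = HComp K"
  "Src0 (full_sub K R) = Src0 K" "Trg0 (full_sub K R) = Trg0 K"
  by (simp_all add: full_sub_def Src0_def Trg0_def fun_eq_iff)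

lemma full_sub_mor_iff:
  "f \<in> mor (full_sub K R) X Y \<longleftrightarrow> f \<in> mor K X Y \<and> R X \<and> R Y"
  by (auto simp: mor_iff)

lemma full_sub_cell_iff:
  "\<alpha> \<in> cell (full_sub K R) f g \<longleftrightarrow> \<alpha> \<in> cell K f g \<and> R (Src K f) \<and> R (Trg K f)"
  by (auto simp: cell_iff Src0_def Trg0_def)

text \<open>Fullness turns closure under every operation into a condition on end objects, and the
  inclusion is trivially faithful.\<close>

lemma (in two_category) full_sub_faithful:
  "faithful_structure K (full_sub K R) \<lparr>F0 = \<lambda>x. x, F1 = \<lambda>x. x, F2 = \<lambda>x. x\<rparr>"
proof unfold_locales
  show "HComp (full_sub K R) \<beta> \<alpha>
      \<in> cell (full_sub K R) (Comp1 (full_sub K R) g f) (Comp1 (full_sub K R) g' f')"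
    if "\<alpha> \<in> cell (full_sub K R) f f'" "\<beta> \<in> cell (full_sub K R) g g'"
      "Trg (full_sub K R) f = Src (full_sub K R) g" for \<alpha> \<beta> f f' g g'
    using that HComp_cell[of \<alpha> f f' \<beta> g g'] Comp1_mor[of f _ _ g] cell_mor[of \<alpha> f f']
      cell_mor[of \<beta> g g']
    by (auto simp: full_sub_cell_iff mor_iff)
qed (use Src_Obj Trg_Obj Id1_mor Comp1_mor Src2_Mor Trg2_mor Id2_cell VComp_cell in
    \<open>auto simp: full_sub_mor_iff full_sub_cell_iff mor_iff cell_iff Src0_def Trg0_def\<close>)

lemma two_functor_full_sub:
  assumes "two_functor K L F" and R: "\<And>X. X \<in> Obj K \<Longrightarrow> R X \<Longrightarrow> R' (F0 F X)"
  shows "two_functor (full_sub K R) (full_sub L R') F"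
proof -
  interpret two_functor K L F by fact
  interpret K: two_category K by (rule source)
  interpret L: two_category L by (rule target)
  show ?thesis
  proof (rule two_functor.intro)
    show "two_category (full_sub K R)" "two_category (full_sub L R')"
      using K.full_sub_faithful L.full_sub_faithful faithful_structure.two_category by blast+
    show "F1 F f \<in> mor (full_sub L R') (F0 F X) (F0 F Y)" if "f \<in> mor (full_sub K R) X Y" for f X Y
      using that F1_mor R K.mor_Obj[of f X Y] by (auto simp: full_sub_mor_iff)
    show "F2 F \<alpha> \<in> cell (full_sub L R') (F1 F f) (F1 F g)" if "\<alpha> \<in> cell (full_sub K R) f g" for \<alpha> f g
      using that F2_cell[of \<alpha> f g] R K.cell_mor[of \<alpha> f g] K.mor_Obj[of f] F1_mor[of f]
      by (auto simp: full_sub_cell_iff mor_iff)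
  qed (use R F0_Obj F1_Id1 F2_Id2 F1_Comp1 F2_VComp F2_HComp in
      \<open>auto simp: full_sub_mor_iff full_sub_cell_iff\<close>)
qed

lemma two_functor_on_full_sub:
  assumes "two_functor K L F"
  shows "two_functor (full_sub K R) L F"
proof -
  interpret two_functor K L F by fact
  interpret K: two_category K by (rule source)
  show ?thesis
  proof (rule two_functor.intro)
    show "two_category (full_sub K R)"
      using K.full_sub_faithful faithful_structure.two_category by blast
  qed (use target F0_Obj F1_Id1 F2_Id2 F1_Comp1 F2_VComp F2_HComp F1_mor F2_cell in
      \<open>auto simp: full_sub_mor_iff full_sub_cell_iff\<close>)
qed

text \<open>Every object of \<open>L\<close> is \<open>F0 F\<close> of its image under the inverse,
  so the equivalence of \<open>R\<close> and \<open>R'\<close> also restricts the inverse; morphisms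
  and cells follow by fullness.\<close>

lemma isomorphism_over_full_sub:
  assumes iso: "two_isomorphism_over S K U L V F"
    and R: "\<And>X. X \<in> Obj K \<Longrightarrow> R' (F0 F X) \<longleftrightarrow> R X"
  shows "two_isomorphism_over S (full_sub K R) U (full_sub L R') V F"
proof -
  obtain G where F: "two_functor K L F" and G: "two_functor L K G"
    and GF: "inverse_on K F G" and FG: "inverse_on L G F"
    using iso by (auto simp: two_isomorphism_over_def two_isomorphism_def)
  have "R (F0 G X)" if "X \<in> Obj L" "R' X" for X
    using that R[of "F0 G X"] FG two_functor.F0_Obj[OF G] by (auto simp: inverse_on_def)
  then show ?thesis
    using iso two_functor_full_sub[OF F, of R R'] two_functor_full_sub[OF G, of R' R] R GF FG
      two_functor_on_full_sub[of K S U R] two_functor_on_full_sub[of L S V R']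
    by (auto simp: two_isomorphism_over_def two_isomorphism_def inverse_on_def)
qed

section \<open>Calculating with categories, functors and natural transformations\<close>

lemma hom_iff: "f \<in> hom C x y \<longleftrightarrow> f \<in> Ar C \<and> Dom C f = x \<and> Cod C f = y"
  by (simp add: hom_def)

section \<open>Typed rewriting for categories and functors\<close>

context
  fixes C :: "'u cat"
  assumes C: "category C"
begin

interpretation category C by (rule C)

lemma Dom_Ob [simp]: "f \<in> Ar C \<Longrightarrow> Dom C f \<in> Ob C"
  using Dom_in by auto

lemma Cod_Ob [simp]: "f \<in> Ar C \<Longrightarrow> Cod C f \<in> Ob C"
  using Cod_in by auto

lemma Idn_Ar [simp]: "x \<in> Ob C \<Longrightarrow> Idn C x \<in> Ar C"
  and Dom_Idn [simp]: "x \<in> Ob C \<Longrightarrow> Dom C (Idn C x) = x"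
  and Cod_Idn [simp]: "x \<in> Ob C \<Longrightarrow> Cod C (Idn C x) = x"
  using Idn_hom by (auto simp: hom_iff)

lemma Cmp_Ar [simp]: "f \<in> Ar C \<Longrightarrow> g \<in> Ar C \<Longrightarrow> Dom C g = Cod C f \<Longrightarrow> Cmp C g f \<in> Ar C"
  and Dom_Cmp [simp]: "f \<in> Ar C \<Longrightarrow> g \<in> Ar C \<Longrightarrow> Dom C g = Cod C f \<Longrightarrow> Dom C (Cmp C g f) = Dom C f"
  and Cod_Cmp [simp]: "f \<in> Ar C \<Longrightarrow> g \<in> Ar C \<Longrightarrow> Dom C g = Cod C f \<Longrightarrow> Cod C (Cmp C g f) = Cod C g"
  using Cmp_hom by (auto simp: hom_iff composable_def)

lemma Cmp_Idn_l [simp]: "f \<in> Ar C \<Longrightarrow> Cod C f = x \<Longrightarrow> Cmp C (Idn C x) f = f"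
  and Cmp_Idn_r [simp]: "f \<in> Ar C \<Longrightarrow> Dom C f = x \<Longrightarrow> Cmp C f (Idn C x) = f"
  using Cmp_Idn_left Cmp_Idn_right by auto

text \<open>Right association is the normal form of the arrow chases below; used backwards, the rule
  isolates a factor to which an equation applies.\<close>

lemma Cmp_assoc_r: "f \<in> Ar C \<Longrightarrow> g \<in> Ar C \<Longrightarrow> h \<in> Ar C \<Longrightarrow> Dom C g = Cod C f \<Longrightarrow> Dom C h = Cod C g \<Longrightarrow>
    Cmp C (Cmp C h g) f = Cmp C h (Cmp C g f)"
  using Cmp_assoc[of g f h] by (simp add: composable_def)

end

lemma locally_small_category_category [simp]: "locally_small_category C \<Longrightarrow> category C"
  by (rule locally_small_category.axioms(1))

context
  fixes F :: "'u func"
  assumes F: "is_functor F"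
begin

interpretation is_functor F by (rule F)

lemma functor_category [simp]: "category (FDom F)" "category (FCod F)"
  by (rule FDom_category FCod_category)+

text \<open>The codomain is a variable \<open>D\<close> with an equation as premise. The rule thus
  still matches when the simplifier has rewritten \<open>FCod F\<close> to the name of a concrete
  category; the rules that follow have the same form.\<close>

lemma FOb_Ob [simp]: "FCod F = D \<Longrightarrow> x \<in> Ob (FDom F) \<Longrightarrow> FOb F x \<in> Ob D"
  using FOb_in by auto

lemma FAr_Ar [simp]: "FCod F = D \<Longrightarrow> f \<in> Ar (FDom F) \<Longrightarrow> FAr F f \<in> Ar D"
  and Dom_FAr [simp]: "FCod F = D \<Longrightarrow> f \<in> Ar (FDom F) \<Longrightarrow> Dom D (FAr F f) = FOb F (Dom (FDom F) f)"
  and Cod_FAr [simp]: "FCod F = D \<Longrightarrow> f \<in> Ar (FDom F) \<Longrightarrow> Cod D (FAr F f) = FOb F (Cod (FDom F) f)"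
  using FAr_hom[of f] by (auto simp: hom_iff)

lemma FAr_Idn_eq [simp]: "FDom F = C \<Longrightarrow> x \<in> Ob C \<Longrightarrow> FAr F (Idn C x) = Idn (FCod F) (FOb F x)"
  using FAr_Idn by auto

lemma FAr_Cmp_eq [simp]: "FDom F = C \<Longrightarrow> f \<in> Ar C \<Longrightarrow> g \<in> Ar C \<Longrightarrow> Dom C g = Cod C f \<Longrightarrow>
    FAr F (Cmp C g f) = Cmp (FCod F) (FAr F g) (FAr F f)"
  using FAr_Cmp by (auto simp: composable_def)

end

lemma is_functorI:
  assumes "category (FDom F)" "category (FCod F)"
    and "FOb F \<in> extensional (Ob (FDom F))" "FAr F \<in> extensional (Ar (FDom F))"
    and "\<And>x. x \<in> Ob (FDom F) \<Longrightarrow> FOb F x \<in> Ob (FCod F)"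
    and "\<And>f. f \<in> Ar (FDom F) \<Longrightarrow> FAr F f \<in> Ar (FCod F)
      \<and> Dom (FCod F) (FAr F f) = FOb F (Dom (FDom F) f)
      \<and> Cod (FCod F) (FAr F f) = FOb F (Cod (FDom F) f)"
    and "\<And>x. x \<in> Ob (FDom F) \<Longrightarrow> FAr F (Idn (FDom F) x) = Idn (FCod F) (FOb F x)"
    and "\<And>g f. f \<in> Ar (FDom F) \<Longrightarrow> g \<in> Ar (FDom F) \<Longrightarrow> Dom (FDom F) g = Cod (FDom F) f \<Longrightarrow>
      FAr F (Cmp (FDom F) g f) = Cmp (FCod F) (FAr F g) (FAr F f)"
  shows "is_functor F"
  by (rule is_functor.intro) (use assms in \<open>auto simp: hom_iff composable_def PiE_def\<close>)

text \<open>Extensionality fixes all values off the domain, so agreement on objects and arrows of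
  the domain is equality in the logic.\<close>

lemma func_eqI:
  assumes F: "is_functor F" and G: "is_functor G" and D: "FDom F = FDom G" and C: "FCod F = FCod G"
    and Ob: "\<And>x. x \<in> Ob (FDom G) \<Longrightarrow> FOb F x = FOb G x"
    and Ar: "\<And>f. f \<in> Ar (FDom G) \<Longrightarrow> FAr F f = FAr G f"
  shows "F = (G :: 'u func)"
proof -
  have "FOb F = FOb G"
    by (rule extensionalityI[of _ "Ob (FDom G)"])
      (use is_functor.FOb_in[OF F] is_functor.FOb_in[OF G] D Ob in \<open>auto simp: PiE_def\<close>)
  moreover have "FAr F = FAr G"
    by (rule extensionalityI[of _ "Ar (FDom G)"])
      (use is_functor.FAr_ext[OF F] is_functor.FAr_ext[OF G] D Ar in auto)
  ultimately show ?thesis using D C by simp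
qed

lemma id_func_simps [simp]:
  "FDom (id_func C) = C" "FCod (id_func C) = C"
  "x \<in> Ob C \<Longrightarrow> FOb (id_func C) x = x" "f \<in> Ar C \<Longrightarrow> FAr (id_func C) f = f"
  by (simp_all add: id_func_def)

lemma is_functor_id [simp]: "category C \<Longrightarrow> is_functor (id_func C)"
  by (rule is_functorI) (auto simp: id_func_def)

lemma comp_func_simps [simp]:
  "FDom (comp_func G F) = FDom F" "FCod (comp_func G F) = FCod G"
  "x \<in> Ob (FDom F) \<Longrightarrow> FOb (comp_func G F) x = FOb G (FOb F x)"
  "f \<in> Ar (FDom F) \<Longrightarrow> FAr (comp_func G F) f = FAr G (FAr F f)"
  by (simp_all add: comp_func_def)

lemma is_functor_comp [simp]:
  "is_functor F \<Longrightarrow> is_functor G \<Longrightarrow> FDom G = FCod F \<Longrightarrow> is_functor (comp_func G F)"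
  by (rule is_functorI) (simp_all add: comp_func_def)

lemma comp_func_id_left: "is_functor F \<Longrightarrow> FCod F = D \<Longrightarrow> comp_func (id_func D) F = F"
  and comp_func_id_right: "is_functor F \<Longrightarrow> FDom F = C \<Longrightarrow> comp_func F (id_func C) = F"
  by (rule func_eqI; fastforce)+

lemma comp_func_assoc:
  "is_functor F \<Longrightarrow> is_functor G \<Longrightarrow> is_functor H \<Longrightarrow> FDom G = FCod F \<Longrightarrow> FDom H = FCod G \<Longrightarrow>
    comp_func H (comp_func G F) = comp_func (comp_func H G) F"
  by (rule func_eqI) simp_all

section \<open>Natural transformations and their composites\<close>

context
  fixes \<alpha> :: "'u nattr"
  assumes \<alpha>: "natural_transformation \<alpha>"
begin

interpretation natural_transformation \<alpha> by (rule \<alpha>)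

lemma nat_functor [simp]: "is_functor (NDom \<alpha>)" "is_functor (NCod \<alpha>)"
  by (rule NDom_functor NCod_functor)+

lemma nat_same [simp]: "FDom (NCod \<alpha>) = FDom (NDom \<alpha>)" "FCod (NCod \<alpha>) = FCod (NDom \<alpha>)"
  by (rule same_FDom same_FCod)+

lemma NAt_Ar [simp]: "FCod (NDom \<alpha>) = D \<Longrightarrow> x \<in> Ob (FDom (NDom \<alpha>)) \<Longrightarrow> NAt \<alpha> x \<in> Ar D"
  and Dom_NAt [simp]: "FCod (NDom \<alpha>) = D \<Longrightarrow> x \<in> Ob (FDom (NDom \<alpha>)) \<Longrightarrow>
    Dom D (NAt \<alpha> x) = FOb (NDom \<alpha>) x"
  and Cod_NAt [simp]: "FCod (NDom \<alpha>) = D \<Longrightarrow> x \<in> Ob (FDom (NDom \<alpha>)) \<Longrightarrow>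
    Cod D (NAt \<alpha> x) = FOb (NCod \<alpha>) x"
  using NAt_hom[of x] by (auto simp: hom_iff)

lemma NAt_natural: "FCod (NDom \<alpha>) = D \<Longrightarrow> FDom (NDom \<alpha>) = C \<Longrightarrow> f \<in> Ar C \<Longrightarrow>
    Cmp D (NAt \<alpha> (Cod C f)) (FAr (NDom \<alpha>) f) = Cmp D (FAr (NCod \<alpha>) f) (NAt \<alpha> (Dom C f))"
  using naturality[of f] by (auto simp: hom_iff)

end

lemma natural_transformationI:
  assumes "is_functor (NDom \<alpha>)" "is_functor (NCod \<alpha>)"
    and "FDom (NCod \<alpha>) = FDom (NDom \<alpha>)" "FCod (NCod \<alpha>) = FCod (NDom \<alpha>)"
    and "NAt \<alpha> \<in> extensional (Ob (FDom (NDom \<alpha>)))"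
    and "\<And>x. x \<in> Ob (FDom (NDom \<alpha>)) \<Longrightarrow> NAt \<alpha> x \<in> Ar (FCod (NDom \<alpha>))
      \<and> Dom (FCod (NDom \<alpha>)) (NAt \<alpha> x) = FOb (NDom \<alpha>) x
      \<and> Cod (FCod (NDom \<alpha>)) (NAt \<alpha> x) = FOb (NCod \<alpha>) x"
    and "\<And>f. f \<in> Ar (FDom (NDom \<alpha>)) \<Longrightarrow>
      Cmp (FCod (NDom \<alpha>)) (NAt \<alpha> (Cod (FDom (NDom \<alpha>)) f)) (FAr (NDom \<alpha>) f)
        = Cmp (FCod (NDom \<alpha>)) (FAr (NCod \<alpha>) f) (NAt \<alpha> (Dom (FDom (NDom \<alpha>)) f))"
  shows "natural_transformation \<alpha>"
  by (rule natural_transformation.intro) (use assms in \<open>auto simp: hom_iff\<close>)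

lemma nat_eqI:
  assumes \<alpha>: "natural_transformation \<alpha>" and \<beta>: "natural_transformation \<beta>"
    and D: "NDom \<alpha> = NDom \<beta>" and C: "NCod \<alpha> = NCod \<beta>"
    and eq: "\<And>x. x \<in> Ob (FDom (NDom \<beta>)) \<Longrightarrow> NAt \<alpha> x = NAt \<beta> x"
  shows "\<alpha> = (\<beta> :: 'u nattr)"
proof -
  have "NAt \<alpha> = NAt \<beta>"
    using natural_transformation.NAt_ext[OF \<alpha>] natural_transformation.NAt_ext[OF \<beta>] D eq
    by (auto intro!: extensionalityI[of _ "Ob (FDom (NDom \<beta>))"])
  then show ?thesis using D C by simp
qed

lemma id_nat_simps [simp]:
  "NDom (id_nat F) = F" "NCod (id_nat F) = F"
  "x \<in> Ob (FDom F) \<Longrightarrow> NAt (id_nat F) x = Idn (FCod F) (FOb F x)"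
  by (simp_all add: id_nat_def)

lemma natural_transformation_id [simp]: "is_functor F \<Longrightarrow> natural_transformation (id_nat F)"
  by (rule natural_transformationI) (simp_all add: id_nat_def)

lemma vcomp_nat_simps [simp]:
  "NDom (vcomp_nat \<beta> \<alpha>) = NDom \<alpha>" "NCod (vcomp_nat \<beta> \<alpha>) = NCod \<beta>"
  "x \<in> Ob (FDom (NDom \<alpha>)) \<Longrightarrow>
    NAt (vcomp_nat \<beta> \<alpha>) x = Cmp (FCod (NDom \<alpha>)) (NAt \<beta> x) (NAt \<alpha> x)"
  by (simp_all add: vcomp_nat_def)

lemma natural_transformation_vcomp [simp]:
  assumes \<alpha>: "natural_transformation \<alpha>" and \<beta>: "natural_transformation \<beta>" and c: "NDom \<beta> = NCod \<alpha>"
  shows "natural_transformation (vcomp_nat \<beta> \<alpha>)"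
proof (rule natural_transformationI, goal_cases)
  case (7 f)
  let ?D = "FCod (NDom \<alpha>)" and ?C = "FDom (NDom \<alpha>)"
  have f: "f \<in> Ar ?C" using 7 by simp
  have 1: "Cmp ?D (NAt \<alpha> (Cod ?C f)) (FAr (NDom \<alpha>) f) = Cmp ?D (FAr (NDom \<beta>) f) (NAt \<alpha> (Dom ?C f))"
    using NAt_natural[OF \<alpha> refl refl f] c by simp
  have 2: "Cmp ?D (NAt \<beta> (Cod ?C f)) (FAr (NDom \<beta>) f) = Cmp ?D (FAr (NCod \<beta>) f) (NAt \<beta> (Dom ?C f))"
    using NAt_natural[OF \<beta>, of ?D ?C f] f c \<alpha> by simp
  have ty: "FDom (NDom \<beta>) = ?C" "FCod (NDom \<beta>) = ?D" "FOb (NDom \<beta>) = FOb (NCod \<alpha>)"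
    using c \<alpha> by simp_all
  have "Cmp ?D (Cmp ?D (NAt \<beta> (Cod ?C f)) (NAt \<alpha> (Cod ?C f))) (FAr (NDom \<alpha>) f)
      = Cmp ?D (Cmp ?D (NAt \<beta> (Cod ?C f)) (FAr (NDom \<beta>) f)) (NAt \<alpha> (Dom ?C f))"
    using \<alpha> \<beta> f by (simp add: Cmp_assoc_r ty 1)
  also have "\<dots> = Cmp ?D (FAr (NCod \<beta>) f) (Cmp ?D (NAt \<beta> (Dom ?C f)) (NAt \<alpha> (Dom ?C f)))"
    unfolding 2 using \<alpha> \<beta> f by (simp add: Cmp_assoc_r ty)
  finally show ?case using \<alpha> f by simp
qed (use assms in \<open>auto simp: vcomp_nat_def\<close>)

lemma hcomp_nat_simps [simp]:
  "NDom (hcomp_nat \<beta> \<alpha>) = comp_func (NDom \<beta>) (NDom \<alpha>)"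
  "NCod (hcomp_nat \<beta> \<alpha>) = comp_func (NCod \<beta>) (NCod \<alpha>)"
  "x \<in> Ob (FDom (NDom \<alpha>)) \<Longrightarrow> NAt (hcomp_nat \<beta> \<alpha>) x =
    Cmp (FCod (NDom \<beta>)) (NAt \<beta> (FOb (NCod \<alpha>) x)) (FAr (NDom \<beta>) (NAt \<alpha> x))"
  by (simp_all add: hcomp_nat_def)

lemma natural_transformation_hcomp [simp]:
  assumes \<alpha>: "natural_transformation \<alpha>" and \<beta>: "natural_transformation \<beta>"
    and c: "FDom (NDom \<beta>) = FCod (NDom \<alpha>)"
  shows "natural_transformation (hcomp_nat \<beta> \<alpha>)"
proof (rule natural_transformationI, goal_cases)
  case (7 f)
  let ?E = "FCod (NDom \<beta>)" and ?D = "FCod (NDom \<alpha>)" and ?C = "FDom (NDom \<alpha>)"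
  let ?x = "Dom ?C f" and ?y = "Cod ?C f"
  let ?G = "FAr (NDom \<beta>)" and ?G' = "FAr (NCod \<beta>)" and ?F = "FAr (NDom \<alpha>)" and ?F' = "FAr (NCod \<alpha>)"
  have f: "f \<in> Ar ?C" using 7 by simp
  have 1: "Cmp ?D (NAt \<alpha> ?y) (?F f) = Cmp ?D (?F' f) (NAt \<alpha> ?x)"
    using NAt_natural[OF \<alpha> refl refl f] .
  have 2: "Cmp ?E (NAt \<beta> (FOb (NCod \<alpha>) ?y)) (?G (?F' f)) = Cmp ?E (?G' (?F' f)) (NAt \<beta> (FOb (NCod \<alpha>) ?x))"
    using NAt_natural[OF \<beta> refl c, of "?F' f"] f \<alpha> by simp
  \<comment> \<open>The square of \<alpha> is used inside the functor \<open>NDom \<beta>\<close>;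
    the square of \<beta> is then used at the arrow \<open>?F' f\<close>.\<close>
  have "Cmp ?E (Cmp ?E (NAt \<beta> (FOb (NCod \<alpha>) ?y)) (?G (NAt \<alpha> ?y))) (?G (?F f))
      = Cmp ?E (NAt \<beta> (FOb (NCod \<alpha>) ?y)) (?G (Cmp ?D (NAt \<alpha> ?y) (?F f)))"
    using \<alpha> \<beta> f c by (simp add: Cmp_assoc_r)
  also have "\<dots> = Cmp ?E (Cmp ?E (NAt \<beta> (FOb (NCod \<alpha>) ?y)) (?G (?F' f))) (?G (NAt \<alpha> ?x))"
    unfolding 1 using \<alpha> \<beta> f c by (simp add: Cmp_assoc_r)
  also have "\<dots> = Cmp ?E (?G' (?F' f)) (Cmp ?E (NAt \<beta> (FOb (NCod \<alpha>) ?x)) (?G (NAt \<alpha> ?x)))"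
    unfolding 2 using \<alpha> \<beta> f c by (simp add: Cmp_assoc_r)
  finally show ?case using \<alpha> f by simp
qed (use assms in \<open>auto simp: hcomp_nat_def\<close>)

lemma hcomp_id_right [simp]:
  assumes "natural_transformation \<beta>" "is_functor F" "FDom (NDom \<beta>) = FCod F" "x \<in> Ob (FDom F)"
  shows "NAt (hcomp_nat \<beta> (id_nat F)) x = NAt \<beta> (FOb F x)"
  using assms by simp

lemma hcomp_id_left [simp]:
  assumes "natural_transformation \<alpha>" "is_functor G" "FDom G = FCod (NDom \<alpha>)" "x \<in> Ob (FDom (NDom \<alpha>))"
  shows "NAt (hcomp_nat (id_nat G) \<alpha>) x = FAr G (NAt \<alpha> x)"
  using assms by simp

text \<open>Identity components turn the naturality square into equality of the two functors on
  arrows. The equality of \<open>NDom\<close> and \<open>NCod\<close>, which an identity 2-cell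
  includes, thus comes from data on objects; strictness and normality are both recognized in this
  way.\<close>

lemma nat_componentwise_id:
  assumes \<alpha>: "natural_transformation \<alpha>"
    and id: "\<And>x. x \<in> Ob (FDom (NDom \<alpha>)) \<Longrightarrow>
      FOb (NDom \<alpha>) x = FOb (NCod \<alpha>) x \<and> NAt \<alpha> x = Idn (FCod (NDom \<alpha>)) (FOb (NCod \<alpha>) x)"
  shows "\<alpha> = id_nat (NCod \<alpha>)"
proof (rule nat_eqI)
  show "NDom \<alpha> = NDom (id_nat (NCod \<alpha>))"
  proof (simp, rule func_eqI)
    fix f assume f: "f \<in> Ar (FDom (NCod \<alpha>))"
    let ?C = "FDom (NDom \<alpha>)"
    from f have f': "f \<in> Ar ?C" using \<alpha> by simp
    then have d: "Dom ?C f \<in> Ob ?C" "Cod ?C f \<in> Ob ?C" using \<alpha> by simp_all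
    show "FAr (NDom \<alpha>) f = FAr (NCod \<alpha>) f"
      using NAt_natural[OF \<alpha> refl refl f'] id[OF d(1)] id[OF d(2)] f' \<alpha> by simp
  qed (use \<alpha> id in auto)
qed (use \<alpha> id in auto)


subsection \<open>The 2-category of categories\<close>

lemma CAT_simps [simp]:
  "C \<in> Obj CAT \<longleftrightarrow> locally_small_category C"
  "F \<in> Mor CAT \<longleftrightarrow> is_functor F \<and> locally_small_category (FDom F) \<and> locally_small_category (FCod F)"
  "\<alpha> \<in> Cell CAT \<longleftrightarrow> natural_transformation \<alpha> \<and> locally_small_category (FDom (NDom \<alpha>))
       \<and> locally_small_category (FCod (NDom \<alpha>))"
  "Src CAT = FDom" "Trg CAT = FCod" "Id1 CAT = id_func" "Comp1 CAT = comp_func"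
  "Src2 CAT = NDom" "Trg2 CAT = NCod" "Id2 CAT = id_nat" "VComp CAT = vcomp_nat" "HComp CAT = hcomp_nat"
  by (simp_all add: CAT_def)

lemma two_category_CAT: "two_category CAT"
proof (unfold_locales, goal_cases)
  case (18 \<alpha> \<beta> \<gamma>)
  then show ?case
    by (intro nat_eqI) (auto simp: Src0_def Trg0_def comp_func_assoc Cmp_assoc_r)
next
  case (20 \<alpha> f f' \<alpha>' f'' \<beta> g g' \<beta>' g'')
  let ?C = "FDom f" and ?D = "FDom g" and ?E = "FCod g"
  have nt: "natural_transformation \<alpha>" "natural_transformation \<alpha>'" "natural_transformation \<beta>"
    "natural_transformation \<beta>'"
    and ty: "NDom \<alpha> = f" "NCod \<alpha> = f'" "NDom \<alpha>' = f'" "NCod \<alpha>' = f''" "NDom \<beta> = g" "NCod \<beta> = g'"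
      "NDom \<beta>' = g'" "NCod \<beta>' = g''" "FCod f = ?D"
    using 20 by (auto simp: cell_iff)
  note same = nat_same[OF nt(1)] nat_same[OF nt(2)] nat_same[OF nt(3)] nat_same[OF nt(4)]
  note fn = nat_functor[OF nt(1)] nat_functor[OF nt(2)] nat_functor[OF nt(3)] nat_functor[OF nt(4)]
  note tys [simp] = same[unfolded ty] fn[unfolded ty] ty
  show ?case
  proof (rule nat_eqI)
    fix x
    assume "x \<in> Ob (FDom (NDom (VComp CAT (HComp CAT \<beta>' \<alpha>') (HComp CAT \<beta> \<alpha>))))"
    then have x: "x \<in> Ob ?C" by simp
    \<comment> \<open>Interchange swaps the two middle factors, which is naturality of \<beta> at
      the component of \<alpha>'.\<close>
    have 1: "Cmp ?E (NAt \<beta> (FOb f'' x)) (FAr g (NAt \<alpha>' x)) = Cmp ?E (FAr g' (NAt \<alpha>' x)) (NAt \<beta> (FOb f' x))"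
      using NAt_natural[OF nt(3), of ?E ?D "NAt \<alpha>' x"] x nt by simp
    have "Cmp ?E (Cmp ?E (NAt \<beta>' (FOb f'' x)) (NAt \<beta> (FOb f'' x))) (Cmp ?E (FAr g (NAt \<alpha>' x)) (FAr g (NAt \<alpha> x)))
      = Cmp ?E (NAt \<beta>' (FOb f'' x)) (Cmp ?E (Cmp ?E (NAt \<beta> (FOb f'' x)) (FAr g (NAt \<alpha>' x))) (FAr g (NAt \<alpha> x)))"
      using x nt by (simp add: Cmp_assoc_r)
    also have "\<dots> = Cmp ?E (Cmp ?E (NAt \<beta>' (FOb f'' x)) (FAr g' (NAt \<alpha>' x))) (Cmp ?E (NAt \<beta> (FOb f' x)) (FAr g (NAt \<alpha> x)))"
      unfolding 1 using x nt by (simp add: Cmp_assoc_r)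
    finally show "NAt (HComp CAT (VComp CAT \<beta>' \<beta>) (VComp CAT \<alpha>' \<alpha>)) x
      = NAt (VComp CAT (HComp CAT \<beta>' \<alpha>') (HComp CAT \<beta> \<alpha>)) x"
      using x nt by simp
  qed (use nt in simp_all)
qed (auto simp: mor_iff cell_iff Src0_def Trg0_def comp_func_id_left comp_func_id_right
    comp_func_assoc Cmp_assoc_r intro!: nat_eqI)

section \<open>Slices\<close>

lemma slice_simps [simp]:
  "Obj (slice K b) = {p \<in> Mor K. Trg K p = b}"
  "Src (slice K b) = bsrc" "Trg (slice K b) = btrg"
  "Id1 (slice K b) p = \<lparr>bsrc = p, body = Id1 K (Src K p), btrg = p\<rparr>"
  "Comp1 (slice K b) t s = \<lparr>bsrc = bsrc s, body = Comp1 K (body t) (body s), btrg = btrg t\<rparr>"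
  "Src2 (slice K b) \<beta> = \<lparr>bsrc = bsrc \<beta>, body = Src2 K (body \<beta>), btrg = btrg \<beta>\<rparr>"
  "Trg2 (slice K b) \<beta> = \<lparr>bsrc = bsrc \<beta>, body = Trg2 K (body \<beta>), btrg = btrg \<beta>\<rparr>"
  "Id2 (slice K b) t = \<lparr>bsrc = bsrc t, body = Id2 K (body t), btrg = btrg t\<rparr>"
  "VComp (slice K b) \<beta> \<alpha> = \<lparr>bsrc = bsrc \<alpha>, body = VComp K (body \<beta>) (body \<alpha>), btrg = btrg \<alpha>\<rparr>"
  "HComp (slice K b) \<beta> \<alpha> = \<lparr>bsrc = bsrc \<alpha>, body = HComp K (body \<beta>) (body \<alpha>), btrg = btrg \<beta>\<rparr>"
  "Src0 (slice K b) \<alpha> = bsrc \<alpha>" "Trg0 (slice K b) \<alpha> = btrg \<alpha>"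
  by (simp_all add: slice_def Src0_def Trg0_def)

lemma slice_Mor:
  "t \<in> Mor (slice K b) \<longleftrightarrow> bsrc t \<in> Mor K \<and> Trg K (bsrc t) = b \<and> btrg t \<in> Mor K \<and> Trg K (btrg t) = b
       \<and> body t \<in> mor K (Src K (bsrc t)) (Src K (btrg t)) \<and> Comp1 K (btrg t) (body t) = bsrc t"
  by (simp add: slice_def)

lemma slice_Cell:
  "\<beta> \<in> Cell (slice K b) \<longleftrightarrow> bsrc \<beta> \<in> Mor K \<and> Trg K (bsrc \<beta>) = b \<and> btrg \<beta> \<in> Mor K
       \<and> Trg K (btrg \<beta>) = b \<and> body \<beta> \<in> Cell K
       \<and> Src0 K (body \<beta>) = Src K (bsrc \<beta>) \<and> Trg0 K (body \<beta>) = Src K (btrg \<beta>)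
       \<and> Comp1 K (btrg \<beta>) (Src2 K (body \<beta>)) = bsrc \<beta>
       \<and> Comp1 K (btrg \<beta>) (Trg2 K (body \<beta>)) = bsrc \<beta>
       \<and> HComp K (Id2 K (btrg \<beta>)) (body \<beta>) = Id2 K (bsrc \<beta>)"
  by (simp add: slice_def whisker_left_def)

text \<open>Cells of the slice carry their end objects, so between fixed ends the body determines
  the cell. What has to be proved is that the conditions of lying over \<open>b\<close> survive the
  operations.\<close>

lemma (in two_category) slice_faithful:
  "faithful_structure K (slice K b) \<lparr>F0 = Src K, F1 = body, F2 = body\<rparr>"
proof (unfold_locales, goal_cases)
  case (3 X)
  then show ?case
    using Id1_mor[OF Src_Obj, of X] by (auto simp: mor_iff slice_Mor Comp1_Id1_right)
next
  case (4 f X Y g Z)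
  then show ?case
    using Comp1_mor[of "body f" _ _ "body g"] Comp1_assoc[of "body f" _ _ "body g" _ "btrg g" b]
    by (auto simp: mor_iff slice_Mor)
next
  case (6 \<alpha>)
  then show ?case
    using Trg2_mor[of "body \<alpha>"] by (auto simp: mor_iff slice_Cell slice_Mor)
next
  case (7 f)
  then show ?case
    using Id2_cell[of "body f"] HComp_Id2[of "body f" _ _ "btrg f" b]
    by (auto simp: mor_iff cell_iff slice_Cell slice_Mor Src0_def Trg0_def)
next
  case (8 \<alpha> f g \<beta> h)
  let ?a = "body \<alpha>" and ?b = "body \<beta>" and ?q = "btrg \<beta>"
  have a: "?a \<in> cell K (Src2 K ?a) (Trg2 K ?a)" and b: "?b \<in> cell K (Trg2 K ?a) (Trg2 K ?b)"
    and q: "Id2 K ?q \<in> cell K ?q ?q" and c: "Trg K (Src2 K ?a) = Src K ?q"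
    using 8 Id2_cell[of ?q] by (auto simp: cell_iff slice_Cell slice_Mor Src0_def Trg0_def)
  \<comment> \<open>Doubling the identity on \<open>?q\<close> lets interchange split the whiskering
    into two cells that are identities over the base.\<close>
  have "HComp K (Id2 K ?q) (VComp K ?b ?a) = HComp K (VComp K (Id2 K ?q) (Id2 K ?q)) (VComp K ?b ?a)"
    using VComp_Id2_left[OF q] by simp
  also have "\<dots> = VComp K (HComp K (Id2 K ?q) ?b) (HComp K (Id2 K ?q) ?a)"
    by (rule interchange[OF a b q q c])
  also have "\<dots> = Id2 K (bsrc \<alpha>)"
    using 8 Id2_cell[of "bsrc \<alpha>"] VComp_Id2_left[of "Id2 K (bsrc \<alpha>)"] by (auto simp: cell_iff slice_Cell)
  finally show ?case
    using 8 VComp_cell[OF a b] by (auto simp: cell_iff slice_Cell Src0_def Trg0_def)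
next
  case (9 \<alpha> f f' \<beta> g g')
  let ?a = "body \<alpha>" and ?b = "body \<beta>" and ?r = "btrg \<beta>" and ?q = "btrg \<alpha>"
  have ab: "\<alpha> \<in> Cell (slice K b)" "\<beta> \<in> Cell (slice K b)" and q: "?q = bsrc \<beta>"
    and tys: "f = Src2 (slice K b) \<alpha>" "f' = Trg2 (slice K b) \<alpha>" "g = Src2 (slice K b) \<beta>"
      "g' = Trg2 (slice K b) \<beta>"
    using 9 by (auto simp: cell_iff)
  have a: "?a \<in> cell K (Src2 K ?a) (Trg2 K ?a)" and b: "?b \<in> cell K (Src2 K ?b) (Trg2 K ?b)"
    and c: "Trg K (Src2 K ?a) = Src K (Src2 K ?b)" and d: "Trg K (Src2 K ?b) = Src K ?r"
    using ab q by (auto simp: cell_iff slice_Cell Src0_def Trg0_def)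
  note ma = cell_mor[OF a] and mb = cell_mor[OF b]
  have r: "?r \<in> mor K (Trg K (Src2 K ?b)) b" using ab d by (simp add: slice_Cell mor_iff)
  \<comment> \<open>Associativity whiskers \<open>?b\<close> first, giving the identity on
    \<open>bsrc \<beta>\<close>; as this is \<open>?q\<close>, what remains is the whiskering of
    \<open>?a\<close>.\<close>
  have "HComp K (Id2 K ?r) (HComp K ?b ?a) = HComp K (HComp K (Id2 K ?r) ?b) ?a"
    using ab q c d Id2_cell[of ?r]
    by (intro HComp_assoc) (auto simp: cell_iff slice_Cell Src0_def Trg0_def)
  also have "\<dots> = Id2 K (bsrc \<alpha>)"
    using ab q by (simp add: slice_Cell)
  finally have e: "HComp K (Id2 K ?r) (HComp K ?b ?a) = Id2 K (bsrc \<alpha>)" .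
  have "Comp1 K ?r (Comp1 K (Src2 K ?b) (Src2 K ?a)) = bsrc \<alpha>"
    "Comp1 K ?r (Comp1 K (Trg2 K ?b) (Trg2 K ?a)) = bsrc \<alpha>"
    using ma mb r c d ab q
    by (simp_all add: mor_iff slice_Cell
        Comp1_assoc[of "Src2 K ?a" _ _ "Src2 K ?b" _ ?r] Comp1_assoc[of "Trg2 K ?a" _ _ "Trg2 K ?b" _ ?r])
  then show ?case
    using HComp_cell[OF a b c] e ab Comp1_mor[of "Src2 K ?a" _ _ "Src2 K ?b"] ma mb c d
    unfolding tys by (auto simp: cell_iff slice_Cell Src0_def Trg0_def mor_iff)
qed (auto simp: slice_Mor slice_Cell mor_iff cell_iff Id1_mor Comp1_Id1_right Src0_def Trg0_def
  intro: Src_Obj Trg_Obj Src2_Mor)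

lemmas two_category_slice_CAT = faithful_structure.two_category[OF two_category.slice_faithful[OF two_category_CAT]]

interpretation slice: two_category "slice CAT B"
  by (rule two_category_slice_CAT)

section \<open>Functors and transformations over the base\<close>

definition fun_over :: "'u func \<Rightarrow> 'u func \<Rightarrow> 'u func \<Rightarrow> bool" where
  "fun_over P T Q \<longleftrightarrow> is_functor T \<and> FDom T = FDom P \<and> FCod T = FDom Q \<and> comp_func Q T = P"

definition nat_over :: "'u func \<Rightarrow> 'u nattr \<Rightarrow> 'u func \<Rightarrow> bool" where
  "nat_over P \<alpha> Q \<longleftrightarrow> natural_transformation \<alpha> \<and> fun_over P (NDom \<alpha>) Q \<and> fun_over P (NCod \<alpha>) Q \<and>
    (\<forall>x \<in> Ob (FDom P). FAr Q (NAt \<alpha> x) = Idn (FCod P) (FOb P x))"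

lemma fun_overD:
  assumes "fun_over P T Q"
  shows "is_functor T" "FDom T = FDom P" "FCod T = FDom Q" "comp_func Q T = P" "FCod Q = FCod P"
    and "\<And>x. x \<in> Ob (FDom P) \<Longrightarrow> FOb Q (FOb T x) = FOb P x"
    and "\<And>f. f \<in> Ar (FDom P) \<Longrightarrow> FAr Q (FAr T f) = FAr P f"
  using assms comp_func_simps[where G = Q and F = T] unfolding fun_over_def by auto

lemma fun_overI:
  assumes "is_functor T" "is_functor P" "is_functor Q" "FDom T = FDom P" "FCod T = FDom Q"
    and "FCod Q = FCod P"
    and "\<And>x. x \<in> Ob (FDom P) \<Longrightarrow> FOb Q (FOb T x) = FOb P x"
    and "\<And>f. f \<in> Ar (FDom P) \<Longrightarrow> FAr Q (FAr T f) = FAr P f"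
  shows "fun_over P T Q"
  unfolding fun_over_def using assms by (auto intro!: func_eqI)

lemma nat_overD:
  assumes "nat_over P \<alpha> Q"
  shows "natural_transformation \<alpha>" "fun_over P (NDom \<alpha>) Q" "fun_over P (NCod \<alpha>) Q"
    and "FDom (NDom \<alpha>) = FDom P" "FCod (NDom \<alpha>) = FDom Q"
    and "\<And>x. x \<in> Ob (FDom P) \<Longrightarrow> FAr Q (NAt \<alpha> x) = Idn (FCod P) (FOb P x)"
  using assms fun_overD[of P "NDom \<alpha>" Q] unfolding nat_over_def by auto

lemma slice_CAT_Mor: "t \<in> Mor (slice CAT B) \<longleftrightarrow>
    bsrc t \<in> Obj (slice CAT B) \<and> btrg t \<in> Obj (slice CAT B) \<and> fun_over (bsrc t) (body t) (btrg t)"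
  by (auto simp: slice_Mor mor_iff fun_over_def)

text \<open>Both sides of the whiskering equation are extensional transformations on the same
  domain, so the equation amounts to one condition per component.\<close>

lemma slice_CAT_Cell: "\<beta> \<in> Cell (slice CAT B) \<longleftrightarrow>
    bsrc \<beta> \<in> Obj (slice CAT B) \<and> btrg \<beta> \<in> Obj (slice CAT B) \<and> nat_over (bsrc \<beta>) (body \<beta>) (btrg \<beta>)"
proof -
  have 1: "hcomp_nat (id_nat Q) \<alpha> = id_nat P \<longleftrightarrow>
      (\<forall>x \<in> Ob (FDom P). FAr Q (NAt \<alpha> x) = Idn (FCod P) (FOb P x))"
    if "natural_transformation \<alpha>" "is_functor P" "is_functor Q"
      and "fun_over P (NDom \<alpha>) Q" "fun_over P (NCod \<alpha>) Q" for P Q \<alpha>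
  proof -
    note f = fun_overD[OF that(4)] fun_overD[OF that(5)]
    have c: "NAt (hcomp_nat (id_nat Q) \<alpha>) x = FAr Q (NAt \<alpha> x)" if "x \<in> Ob (FDom P)" for x
      by (rule hcomp_id_left) (use that \<open>natural_transformation \<alpha>\<close> \<open>is_functor Q\<close> f in auto)
    show ?thesis
    proof
      assume "hcomp_nat (id_nat Q) \<alpha> = id_nat P"
      then show "\<forall>x \<in> Ob (FDom P). FAr Q (NAt \<alpha> x) = Idn (FCod P) (FOb P x)"
        using c by (metis id_nat_simps(3))
    next
      assume "\<forall>x \<in> Ob (FDom P). FAr Q (NAt \<alpha> x) = Idn (FCod P) (FOb P x)"
      then show "hcomp_nat (id_nat Q) \<alpha> = id_nat P"
        using that f c by (intro nat_eqI) simp_all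
    qed
  qed
  show ?thesis
    using 1[of "body \<beta>" "bsrc \<beta>" "btrg \<beta>"]
    by (auto simp: slice_Cell mor_iff nat_over_def fun_over_def Src0_def Trg0_def)
qed

lemma slice_CAT_mor: "t \<in> mor (slice CAT B) P Q \<longleftrightarrow> P \<in> Obj (slice CAT B) \<and> Q \<in> Obj (slice CAT B) \<and>
    bsrc t = P \<and> btrg t = Q \<and> fun_over P (body t) Q"
  unfolding mor_iff slice_CAT_Mor by auto

lemma slice_CAT_cell: "\<beta> \<in> cell (slice CAT B) s t \<longleftrightarrow>
    bsrc \<beta> \<in> Obj (slice CAT B) \<and> btrg \<beta> \<in> Obj (slice CAT B) \<and> nat_over (bsrc \<beta>) (body \<beta>) (btrg \<beta>) \<and>
    s = \<lparr>bsrc = bsrc \<beta>, body = NDom (body \<beta>), btrg = btrg \<beta>\<rparr> \<and>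
    t = \<lparr>bsrc = bsrc \<beta>, body = NCod (body \<beta>), btrg = btrg \<beta>\<rparr>"
  unfolding cell_iff slice_CAT_Cell by auto

lemma slice_cell_eqI:
  assumes "\<alpha> \<in> cell (slice CAT B) s t" "\<beta> \<in> cell (slice CAT B) s t"
    and "\<And>x. x \<in> Ob (FDom (bsrc s)) \<Longrightarrow> NAt (body \<alpha>) x = NAt (body \<beta>) x"
  shows "\<alpha> = \<beta>"
proof -
  have "body \<alpha> = body \<beta>"
    using assms unfolding slice_CAT_cell
    by (intro nat_eqI) (auto dest: nat_overD)
  then show ?thesis using assms(1,2) unfolding slice_CAT_cell by (cases \<alpha>; cases \<beta>) auto
qed


section \<open>Componentwise invertibility of 2-cells over the base\<close>

definition inverse_arrows :: "'u cat \<Rightarrow> 'u \<Rightarrow> 'u \<Rightarrow> bool" where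
  "inverse_arrows C f g \<longleftrightarrow> f \<in> Ar C \<and> g \<in> Ar C \<and> Dom C g = Cod C f \<and> Cod C g = Dom C f \<and>
    Cmp C g f = Idn C (Dom C f) \<and> Cmp C f g = Idn C (Cod C f)"

lemma inverse_arrowsD:
  assumes "inverse_arrows C f g"
  shows "f \<in> Ar C" "g \<in> Ar C" "Dom C g = Cod C f" "Cod C g = Dom C f"
    "Cmp C g f = Idn C (Dom C f)" "Cmp C f g = Idn C (Cod C f)"
  using assms by (auto simp: inverse_arrows_def)

lemma inverse_arrows_sym: "inverse_arrows C f g \<Longrightarrow> inverse_arrows C g f"
  by (auto simp: inverse_arrows_def)

lemma inverse_arrows_cancel_l:
  assumes "category C" "inverse_arrows C f g" "h \<in> Ar C" "Cod C h = Dom C f"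
  shows "Cmp C g (Cmp C f h) = h"
  using assms inverse_arrowsD[OF assms(2)] by (simp flip: Cmp_assoc_r)

lemma inverse_arrows_cancel_r:
  assumes "category C" "inverse_arrows C f g" "h \<in> Ar C" "Dom C h = Cod C f"
  shows "Cmp C (Cmp C h f) g = h"
  using assms inverse_arrowsD[OF assms(2)] by (simp add: Cmp_assoc_r)

lemma inverse_arrows_FAr:
  assumes "is_functor F" "inverse_arrows (FDom F) f g"
  shows "inverse_arrows (FCod F) (FAr F f) (FAr F g)"
  using assms inverse_arrowsD[OF assms(2)]
  by (simp add: inverse_arrows_def flip: FAr_Cmp_eq)

lemma inverse_arrows_Idn: "category C \<Longrightarrow> inverse_arrows C f g \<Longrightarrow> f = Idn C x \<Longrightarrow> x \<in> Ob C \<Longrightarrow> g = Idn C x"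
  by (auto simp: inverse_arrows_def)

text \<open>The inverse 2-cell belongs to the slice as well, which puts the inverse arrow over an
  identity.\<close>

lemma invertible_cell_sliceD:
  assumes "invertible_cell (slice CAT B) \<alpha>" and x: "x \<in> Ob (FDom (bsrc \<alpha>))"
  obtains g where "inverse_arrows (FDom (btrg \<alpha>)) (NAt (body \<alpha>) x) g"
    "FAr (btrg \<alpha>) g = Idn B (FOb (bsrc \<alpha>) x)"
proof -
  obtain \<beta> where a: "\<alpha> \<in> Cell (slice CAT B)"
    and b: "\<beta> \<in> cell (slice CAT B) (Trg2 (slice CAT B) \<alpha>) (Src2 (slice CAT B) \<alpha>)"
    and 1: "VComp (slice CAT B) \<beta> \<alpha> = Id2 (slice CAT B) (Src2 (slice CAT B) \<alpha>)"
    and 2: "VComp (slice CAT B) \<alpha> \<beta> = Id2 (slice CAT B) (Trg2 (slice CAT B) \<alpha>)"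
    using assms(1) unfolding invertible_cell_def by blast
  have ao: "bsrc \<alpha> \<in> Obj (slice CAT B)" "btrg \<alpha> \<in> Obj (slice CAT B)"
    and an: "nat_over (bsrc \<alpha>) (body \<alpha>) (btrg \<alpha>)"
    using a unfolding slice_CAT_Cell by auto
  have bn: "nat_over (bsrc \<alpha>) (body \<beta>) (btrg \<alpha>)" and bs: "NDom (body \<beta>) = NCod (body \<alpha>)"
    "NCod (body \<beta>) = NDom (body \<alpha>)"
    using b unfolding slice_CAT_cell by auto
  note A = nat_overD[OF an] and Bn = nat_overD[OF bn]
  have e: "vcomp_nat (body \<beta>) (body \<alpha>) = id_nat (NDom (body \<alpha>))"
    "vcomp_nat (body \<alpha>) (body \<beta>) = id_nat (NCod (body \<alpha>))"
    using 1 2 by auto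
  have "inverse_arrows (FDom (btrg \<alpha>)) (NAt (body \<alpha>) x) (NAt (body \<beta>) x)"
    using A Bn bs x arg_cong[OF e(1), of "\<lambda>n. NAt n x"] arg_cong[OF e(2), of "\<lambda>n. NAt n x"]
    by (simp add: inverse_arrows_def)
  moreover have "FAr (btrg \<alpha>) (NAt (body \<beta>) x) = Idn B (FOb (bsrc \<alpha>) x)"
    using Bn(6)[OF x] ao by simp
  ultimately show thesis by (rule that)
qed

text \<open>Pointwise inverses of a natural family are natural, and they stay over the base because
  the inverse of an identity is an identity.\<close>

lemma invertible_cell_sliceI:
  assumes a: "\<alpha> \<in> Cell (slice CAT B)"
    and inv: "\<And>x. x \<in> Ob (FDom (bsrc \<alpha>)) \<Longrightarrow> \<exists>g. inverse_arrows (FDom (btrg \<alpha>)) (NAt (body \<alpha>) x) g"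
  shows "invertible_cell (slice CAT B) \<alpha>"
proof -
  let ?P = "bsrc \<alpha>" and ?Q = "btrg \<alpha>"
  \<comment> \<open>Inverse arrows are unique, so the choice is immaterial.\<close>
  define i where "i x = (SOME g. inverse_arrows (FDom ?Q) (NAt (body \<alpha>) x) g)" for x
  have i: "inverse_arrows (FDom ?Q) (NAt (body \<alpha>) x) (i x)" if "x \<in> Ob (FDom ?P)" for x
    unfolding i_def using someI_ex[OF inv[OF that]] .
  note iD = inverse_arrowsD[OF i]
  have ao: "?P \<in> Obj (slice CAT B)" "?Q \<in> Obj (slice CAT B)" and an: "nat_over ?P (body \<alpha>) ?Q"
    using a unfolding slice_CAT_Cell by auto
  note A = nat_overD[OF an]
  have fn: "is_functor ?P" "is_functor ?Q" "FCod ?P = B" "FCod ?Q = B" using ao by auto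
  define b where "b = \<lparr>NDom = NCod (body \<alpha>), NCod = NDom (body \<alpha>), NAt = (\<lambda>x \<in> Ob (FDom ?P). i x)\<rparr>"
  have b: "natural_transformation b"
  proof (rule natural_transformationI, goal_cases)
    case (7 f)
    let ?E = "FDom ?Q" and ?C = "FDom ?P"
    let ?x = "Dom ?C f" and ?y = "Cod ?C f"
    let ?F = "FAr (NDom (body \<alpha>)) f" and ?G = "FAr (NCod (body \<alpha>)) f"
    have f: "f \<in> Ar ?C" using 7 A by (simp add: b_def)
    then have xy: "?x \<in> Ob ?C" "?y \<in> Ob ?C" using fn by simp_all
    \<comment> \<open>A component and its inverse are inserted on the right, naturality carries the
      component across, and it cancels on the left.\<close>
    have "Cmp ?E (i ?y) ?G = Cmp ?E (i ?y) (Cmp ?E (Cmp ?E ?G (NAt (body \<alpha>) ?x)) (i ?x))"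
      by (subst inverse_arrows_cancel_r[OF _ i[OF xy(1)]]) (use A f fn xy in simp_all)
    also have "Cmp ?E ?G (NAt (body \<alpha>) ?x) = Cmp ?E (NAt (body \<alpha>) ?y) ?F"
      using NAt_natural[OF A(1) A(5,4) f] by simp
    also have "Cmp ?E (Cmp ?E (NAt (body \<alpha>) ?y) ?F) (i ?x) = Cmp ?E (NAt (body \<alpha>) ?y) (Cmp ?E ?F (i ?x))"
      by (rule Cmp_assoc_r) (use A f fn xy iD in simp_all)
    also have "Cmp ?E (i ?y) \<dots> = Cmp ?E ?F (i ?x)"
      by (rule inverse_arrows_cancel_l[OF _ i[OF xy(2)]]) (use A f fn xy iD in simp_all)
    finally show ?case using A f xy by (simp add: b_def)
  qed (use A iD in \<open>auto simp: b_def\<close>)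
  have bn: "nat_over ?P b ?Q"
    unfolding nat_over_def
  proof (intro conjI ballI)
    fix x assume x: "x \<in> Ob (FDom ?P)"
    have x': "FOb ?P x \<in> Ob B" using x fn by simp
    have "FAr ?Q (i x) = Idn B (FOb ?P x)"
      by (rule inverse_arrows_Idn[of B "FAr ?Q (NAt (body \<alpha>) x)"])
        (use inverse_arrows_FAr[OF fn(2) i[OF x]] A(6)[OF x] fn x' functor_category[OF fn(1)] in simp_all)
    then show "FAr ?Q (NAt b x) = Idn (FCod ?P) (FOb ?P x)" using x fn by (simp add: b_def)
  qed (use b A in \<open>simp_all add: b_def\<close>)
  have n: "vcomp_nat b (body \<alpha>) = id_nat (NDom (body \<alpha>))"
    by (rule nat_eqI) (use A b iD in \<open>simp_all add: b_def\<close>)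
  have n': "vcomp_nat (body \<alpha>) b = id_nat (NCod (body \<alpha>))"
    by (rule nat_eqI) (use A b iD in \<open>simp_all add: b_def\<close>)
  have "\<lparr>bsrc = ?P, body = b, btrg = ?Q\<rparr> \<in> cell (slice CAT B) (Trg2 (slice CAT B) \<alpha>) (Src2 (slice CAT B) \<alpha>)"
    unfolding slice_CAT_cell using ao bn by (auto simp: b_def)
  then show ?thesis
    unfolding invertible_cell_def using a n n' by (intro conjI bexI) (auto simp: b_def)
qed

section \<open>The comma 2-monad\<close>

text \<open>Cardinals are comparable, so one factor injects into the other. If the larger one,
  \<open>X\<close>, is infinite, then \<open>X \<times> X \<approx> X\<close> absorbs the product;
  if it is finite, the product is finite and the universe is not. The fact keeps comma categories
  locally small.\<close>

lemma small_Times: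
  fixes A B :: "'u set"
  assumes A: "small A" and B: "small B" and inf: "infinite (UNIV :: 'u set)"
  shows "A \<times> B \<prec> (UNIV :: 'u set)"
proof -
  have main: "X \<times> Y \<prec> (UNIV :: 'u set)" if XY: "Y \<lesssim> X" and X: "small X" for X Y :: "'u set"
  proof (cases "finite X")
    case True
    then have "finite Y" using XY lepoll_iff_card_le by (metis lepoll_def inj_on_finite)
    then show ?thesis using True inf by (simp add: finite_lesspoll_infinite)
  next
    case False
    obtain f where f: "inj_on f Y" "f ` Y \<subseteq> X" using XY by (auto simp: lepoll_def)
    have "inj_on (\<lambda>(x, y). (x, f y)) (X \<times> Y)" "(\<lambda>(x, y). (x, f y)) ` (X \<times> Y) \<subseteq> X \<times> X"
      using f by (auto simp: inj_on_def)
    then have "X \<times> Y \<lesssim> X \<times> X" unfolding lepoll_def by blast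
    also have "X \<times> X \<approx> X"
      using card_of_Times_same_infinite[OF False] card_of_ordIso[of "X \<times> X" X] by (auto simp: eqpoll_def)
    finally have "X \<times> Y \<lesssim> X" by (metis lepoll_trans2)
    then show ?thesis using X lesspoll_trans1 unfolding small_def by blast
  qed
  have "A \<lesssim> B \<or> B \<lesssim> A"
    using ordLeq_total[OF card_of_Well_order card_of_Well_order, of A B]
      card_of_ordLeq[of A B] card_of_ordLeq[of B A] by (auto simp: lepoll_def)
  then show ?thesis
  proof
    assume "A \<lesssim> B"
    have "inj_on prod.swap (A \<times> B)" "prod.swap ` (A \<times> B) \<subseteq> B \<times> A" by auto
    then have "A \<times> B \<lesssim> B \<times> A" unfolding lepoll_def by blast
    then show ?thesis using main[OF \<open>A \<lesssim> B\<close> B] lesspoll_trans1 by blast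
  qed (use main A in blast)
qed

section \<open>The comma category inside the universe\<close>

lemma upair_eq_iff [simp]: "upair a b = upair c d \<longleftrightarrow> a = c \<and> b = (d :: 'u::universe)"
  by (metis ufst_upair usnd_upair)

lemma comma_ar_eq_iff [simp]:
  "comma_ar X Y f v = comma_ar X' Y' f' v' \<longleftrightarrow> X = X' \<and> Y = Y' \<and> f = f' \<and> v = v'"
  by (simp add: comma_ar_def)

lemma cm_simps [simp]:
  "cm_src (comma_ar X Y f v) = X" "cm_trg (comma_ar X Y f v) = Y"
  "cm_fst (comma_ar X Y f v) = f" "cm_snd (comma_ar X Y f v) = v"
  by (simp_all add: comma_ar_def cm_src_def cm_trg_def cm_fst_def cm_snd_def)

lemma upair_comma_Ob [simp]:
  "upair x u \<in> comma_Ob P \<longleftrightarrow> x \<in> Ob (FDom P) \<and> u \<in> Ar (FCod P) \<and> Dom (FCod P) u = FOb P x"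
  by (auto simp: comma_Ob_def)

lemma comma_ar_comma_Ar [simp]:
  "comma_ar X Y f v \<in> comma_Ar P \<longleftrightarrow> X \<in> comma_Ob P \<and> Y \<in> comma_Ob P \<and>
    f \<in> Ar (FDom P) \<and> Dom (FDom P) f = ufst X \<and> Cod (FDom P) f = ufst Y \<and>
    v \<in> Ar (FCod P) \<and> Dom (FCod P) v = Cod (FCod P) (usnd X) \<and> Cod (FCod P) v = Cod (FCod P) (usnd Y) \<and>
    Cmp (FCod P) v (usnd X) = Cmp (FCod P) (usnd Y) (FAr P f)"
  by (auto simp: comma_Ar_def comma_Ob_def hom_iff)

lemma comma_Ob_sel [simp]:
  "X \<in> comma_Ob P \<Longrightarrow> ufst X \<in> Ob (FDom P)"
  "X \<in> comma_Ob P \<Longrightarrow> usnd X \<in> Ar (FCod P)"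
  "X \<in> comma_Ob P \<Longrightarrow> Dom (FCod P) (usnd X) = FOb P (ufst X)"
  by (auto simp: comma_Ob_def)

text \<open>The class \<open>universe\<close> postulates the two projection equations but not that
  every element is a pair; recomposing from projections is available exactly for encoded elements,
  here objects and below arrows.\<close>

lemma upair_sel: "X \<in> comma_Ob P \<Longrightarrow> upair (ufst X) (usnd X) = X"
  by (auto simp: comma_Ob_def)

lemma comma_Ar_sel [simp]:
  assumes "a \<in> comma_Ar P"
  shows "cm_src a \<in> comma_Ob P" "cm_trg a \<in> comma_Ob P"
    "cm_fst a \<in> Ar (FDom P)" "Dom (FDom P) (cm_fst a) = ufst (cm_src a)"
    "Cod (FDom P) (cm_fst a) = ufst (cm_trg a)"
    "cm_snd a \<in> Ar (FCod P)" "Dom (FCod P) (cm_snd a) = Cod (FCod P) (usnd (cm_src a))"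
    "Cod (FCod P) (cm_snd a) = Cod (FCod P) (usnd (cm_trg a))"
  using assms by (auto simp: comma_Ar_def hom_iff)

lemma comma_ar_sel: "a \<in> comma_Ar P \<Longrightarrow> comma_ar (cm_src a) (cm_trg a) (cm_fst a) (cm_snd a) = a"
  by (auto simp: comma_Ar_def)

lemma comma_square:
  "a \<in> comma_Ar P \<Longrightarrow>
    Cmp (FCod P) (cm_snd a) (usnd (cm_src a)) = Cmp (FCod P) (usnd (cm_trg a)) (FAr P (cm_fst a))"
  by (auto simp: comma_Ar_def)

lemma comma_Ar_eqI:
  "a \<in> comma_Ar P \<Longrightarrow> b \<in> comma_Ar Q \<Longrightarrow> cm_src a = cm_src b \<Longrightarrow> cm_trg a = cm_trg b \<Longrightarrow>
    cm_fst a = cm_fst b \<Longrightarrow> cm_snd a = cm_snd b \<Longrightarrow> a = b"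
  by (metis comma_ar_sel)

lemma comma_cat_simps [simp]:
  "Ob (comma_cat P) = comma_Ob P" "Ar (comma_cat P) = comma_Ar P"
  "a \<in> comma_Ar P \<Longrightarrow> Dom (comma_cat P) a = cm_src a"
  "a \<in> comma_Ar P \<Longrightarrow> Cod (comma_cat P) a = cm_trg a"
  "X \<in> comma_Ob P \<Longrightarrow> Idn (comma_cat P) X
    = comma_ar X X (Idn (FDom P) (ufst X)) (Idn (FCod P) (Cod (FCod P) (usnd X)))"
  by (simp_all add: comma_cat_def)

lemma comma_Cmp:
  "a \<in> comma_Ar P \<Longrightarrow> b \<in> comma_Ar P \<Longrightarrow> cm_src b = cm_trg a \<Longrightarrow> Cmp (comma_cat P) b a
    = comma_ar (cm_src a) (cm_trg b) (Cmp (FDom P) (cm_fst b) (cm_fst a)) (Cmp (FCod P) (cm_snd b) (cm_snd a))"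
  by (simp add: comma_cat_def)

lemma comma_Cmp_sel [simp]:
  assumes "a \<in> comma_Ar P" "b \<in> comma_Ar P" "cm_src b = cm_trg a"
  shows "cm_src (Cmp (comma_cat P) b a) = cm_src a" "cm_trg (Cmp (comma_cat P) b a) = cm_trg b"
    "cm_fst (Cmp (comma_cat P) b a) = Cmp (FDom P) (cm_fst b) (cm_fst a)"
    "cm_snd (Cmp (comma_cat P) b a) = Cmp (FCod P) (cm_snd b) (cm_snd a)"
  using assms by (simp_all add: comma_Cmp)

lemma comma_Cmp_Ar:
  assumes P: "is_functor P" and a: "a \<in> comma_Ar P" and b: "b \<in> comma_Ar P" and c: "cm_src b = cm_trg a"
  shows "Cmp (comma_cat P) b a \<in> comma_Ar P"
proof -
  let ?B = "FCod P"
  have "Cmp ?B (Cmp ?B (cm_snd b) (cm_snd a)) (usnd (cm_src a))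
      = Cmp ?B (cm_snd b) (Cmp ?B (usnd (cm_trg a)) (FAr P (cm_fst a)))"
    using P a b c by (simp add: Cmp_assoc_r comma_square)
  also have "\<dots> = Cmp ?B (Cmp ?B (cm_snd b) (usnd (cm_src b))) (FAr P (cm_fst a))"
    using P a b c by (simp add: Cmp_assoc_r)
  also have "\<dots> = Cmp ?B (usnd (cm_trg b)) (FAr P (Cmp (FDom P) (cm_fst b) (cm_fst a)))"
    unfolding comma_square[OF b] using P a b c by (simp add: Cmp_assoc_r)
  finally show ?thesis
    using P a b c by (simp add: comma_Cmp)
qed

lemma category_comma [simp]:
  assumes P: "is_functor P"
  shows "category (comma_cat P)"
proof (rule category.intro, goal_cases)
  case (1)
  then show ?case by (auto simp: comma_cat_def)
next
  case (2)
  then show ?case by (auto simp: comma_cat_def)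
next
  case (3)
  then show ?case by (auto simp: comma_cat_def)
next
  case (4 x)
  then show ?case using P by (simp add: hom_iff)
next
  case (5 g f)
  then show ?case by (auto simp: composable_def comma_cat_def)
next
  case (6 g f)
  then show ?case using comma_Cmp_Ar[OF P, of f g] by (auto simp: composable_def hom_iff)
next
  case (7 f)
  then show ?case
    using P by - (rule comma_Ar_eqI[of _ P _ P], simp_all add: comma_Cmp_Ar)
next
  case (8 f)
  then show ?case
    using P by - (rule comma_Ar_eqI[of _ P _ P], simp_all add: comma_Cmp_Ar)
next
  case (9 g f h)
  then show ?case
    using P by - (rule comma_Ar_eqI[of _ P _ P], auto simp: composable_def comma_Cmp_Ar Cmp_assoc_r)
qed

text \<open>Between fixed ends a comma arrow is its pair of components, so a hom-set embeds in a
  product of two small hom-sets.\<close>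

lemma locally_small_comma:
  fixes P :: "'u::universe func"
  assumes P: "is_functor P" and E: "locally_small_category (FDom P)" and B: "locally_small_category (FCod P)"
  shows "locally_small_category (comma_cat P)"
proof -
  have "small (hom (comma_cat P) X Y)" if "X \<in> comma_Ob P" "Y \<in> comma_Ob P" for X Y
  proof -
    let ?A = "hom (FDom P) (ufst X) (ufst Y)"
      and ?B = "hom (FCod P) (Cod (FCod P) (usnd X)) (Cod (FCod P) (usnd Y))"
    have s: "small ?A" "small ?B"
      using locally_small_category.small_hom[OF E] locally_small_category.small_hom[OF B] that P
      by auto
    have "inj_on (\<lambda>a. (cm_fst a, cm_snd a)) (hom (comma_cat P) X Y)"
      by (rule inj_onI) (rule comma_Ar_eqI[of _ P _ P], auto simp: hom_iff)
    moreover have "(\<lambda>a. (cm_fst a, cm_snd a)) ` hom (comma_cat P) X Y \<subseteq> ?A \<times> ?B"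
      by (auto simp: hom_iff)
    ultimately have "hom (comma_cat P) X Y \<lesssim> ?A \<times> ?B" unfolding lepoll_def by blast
    also have "?A \<times> ?B \<prec> (UNIV :: 'u set)" by (rule small_Times[OF s infinite_universe])
    finally show ?thesis by (simp add: small_def)
  qed
  then show ?thesis
    using P by (simp add: locally_small_category_def locally_small_category_axioms_def)
qed

section \<open>Action of the comma construction on objects, functors and 2-cells over the
  base\<close>

lemma comma_proj_simps [simp]:
  "FDom (comma_proj P) = comma_cat P" "FCod (comma_proj P) = FCod P"
  "X \<in> comma_Ob P \<Longrightarrow> FOb (comma_proj P) X = Cod (FCod P) (usnd X)"
  "a \<in> comma_Ar P \<Longrightarrow> FAr (comma_proj P) a = cm_snd a"
  by (simp_all add: comma_proj_def)

lemma comma_proj_ext: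
  "FOb (comma_proj P) \<in> extensional (comma_Ob P)" "FAr (comma_proj P) \<in> extensional (comma_Ar P)"
  by (simp_all add: comma_proj_def)

lemma is_functor_comma_proj [simp]: "is_functor P \<Longrightarrow> is_functor (comma_proj P)"
  by (rule is_functorI) (simp_all add: comma_proj_ext comma_Cmp_Ar)

lemma comma_func_simps [simp]:
  "FDom (comma_func P T Q) = comma_cat P" "FCod (comma_func P T Q) = comma_cat Q"
  "X \<in> comma_Ob P \<Longrightarrow> FOb (comma_func P T Q) X = upair (FOb T (ufst X)) (usnd X)"
  "a \<in> comma_Ar P \<Longrightarrow> FAr (comma_func P T Q) a = comma_ar
       (upair (FOb T (ufst (cm_src a))) (usnd (cm_src a)))
       (upair (FOb T (ufst (cm_trg a))) (usnd (cm_trg a))) (FAr T (cm_fst a)) (cm_snd a)"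
  by (simp_all add: comma_func_def)

lemma comma_func_ext:
  "FOb (comma_func P T Q) \<in> extensional (comma_Ob P)" "FAr (comma_func P T Q) \<in> extensional (comma_Ar P)"
  by (simp_all add: comma_func_def)

lemma is_functor_comma_func [simp]:
  assumes P: "is_functor P" "is_functor Q" and T: "fun_over P T Q"
  shows "is_functor (comma_func P T Q)"
proof -
  note t = fun_overD[OF T]
  show ?thesis
  proof (rule is_functorI, goal_cases)
    case (8 f g)
    then show ?case
      using P t comma_square[OF comma_Cmp_Ar[OF P(1), of g f]] comma_square[of f P] comma_square[of g P]
      by - (rule comma_Ar_eqI[of _ Q _ Q], simp_all add: comma_Cmp_Ar comma_square)
  qed (use P t in \<open>simp_all add: comma_func_ext comma_square\<close>)
qed

lemma fun_over_comma_func: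
  assumes P: "is_functor P" "is_functor Q" and T: "fun_over P T Q"
  shows "fun_over (comma_proj P) (comma_func P T Q) (comma_proj Q)"
  using assms fun_overD[OF T] by (intro fun_overI) (simp_all add: comma_square)

lemma comma_nat_simps [simp]:
  "NDom (comma_nat P \<beta> Q) = comma_func P (NDom \<beta>) Q" "NCod (comma_nat P \<beta> Q) = comma_func P (NCod \<beta>) Q"
  "X \<in> comma_Ob P \<Longrightarrow> NAt (comma_nat P \<beta> Q) X = comma_ar
       (upair (FOb (NDom \<beta>) (ufst X)) (usnd X)) (upair (FOb (NCod \<beta>) (ufst X)) (usnd X))
       (NAt \<beta> (ufst X)) (Idn (FCod P) (Cod (FCod P) (usnd X)))"
  by (simp_all add: comma_nat_def)

lemma comma_nat_ext: "NAt (comma_nat P \<beta> Q) \<in> extensional (comma_Ob P)"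
  by (simp add: comma_nat_def)

lemma nat_over_comma_nat:
  assumes P: "is_functor P" "is_functor Q" and b: "nat_over P \<beta> Q"
  shows "nat_over (comma_proj P) (comma_nat P \<beta> Q) (comma_proj Q)"
proof -
  note D = fun_overD[OF nat_overD(2)[OF b]] and C = fun_overD[OF nat_overD(3)[OF b]] and n = nat_overD[OF b]
  have "natural_transformation (comma_nat P \<beta> Q)"
  proof (rule natural_transformationI, goal_cases)
    case (7 f)
    then show ?case
      using P n D C NAt_natural[OF n(1) n(5,4), of "cm_fst f"]
      by - (rule comma_Ar_eqI[of _ Q _ Q], simp_all add: comma_Cmp_Ar comma_square)
  qed (use P n D C in \<open>simp_all add: comma_nat_ext\<close>)
  then show ?thesis
    using P n D C unfolding nat_over_def by (simp add: fun_over_comma_func)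
qed

section \<open>Unit and multiplication of the comma construction\<close>

lemma comma_unit_simps [simp]:
  "FDom (comma_unit P) = FDom P" "FCod (comma_unit P) = comma_cat P"
  "x \<in> Ob (FDom P) \<Longrightarrow> FOb (comma_unit P) x = upair x (Idn (FCod P) (FOb P x))"
  "f \<in> Ar (FDom P) \<Longrightarrow> FAr (comma_unit P) f = comma_ar
       (upair (Dom (FDom P) f) (Idn (FCod P) (FOb P (Dom (FDom P) f))))
       (upair (Cod (FDom P) f) (Idn (FCod P) (FOb P (Cod (FDom P) f)))) f (FAr P f)"
  by (simp_all add: comma_unit_def comma_unit_ob_def)

lemma comma_unit_ext:
  "FOb (comma_unit P) \<in> extensional (Ob (FDom P))" "FAr (comma_unit P) \<in> extensional (Ar (FDom P))"
  by (simp_all add: comma_unit_def)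

lemma is_functor_comma_unit [simp]:
  assumes P: "is_functor P"
  shows "is_functor (comma_unit P)"
proof (rule is_functorI, goal_cases)
  case (8 g f)
  then show ?case
    using P by - (rule comma_Ar_eqI[of _ P _ P], simp_all add: comma_Cmp_Ar)
qed (use P in \<open>simp_all add: comma_unit_ext\<close>)

lemma fun_over_comma_unit: "is_functor P \<Longrightarrow> fun_over P (comma_unit P) (comma_proj P)"
  by (rule fun_overI) simp_all

lemma comma_mult_simps [simp]:
  "FDom (comma_mult P) = comma_cat (comma_proj P)" "FCod (comma_mult P) = comma_cat P"
  "Z \<in> comma_Ob (comma_proj P) \<Longrightarrow> FOb (comma_mult P) Z
    = upair (ufst (ufst Z)) (Cmp (FCod P) (usnd Z) (usnd (ufst Z)))"
  "a \<in> comma_Ar (comma_proj P) \<Longrightarrow> FAr (comma_mult P) a = comma_ar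
     (upair (ufst (ufst (cm_src a))) (Cmp (FCod P) (usnd (cm_src a)) (usnd (ufst (cm_src a)))))
     (upair (ufst (ufst (cm_trg a))) (Cmp (FCod P) (usnd (cm_trg a)) (usnd (ufst (cm_trg a)))))
     (cm_fst (cm_fst a)) (cm_snd a)"
  by (simp_all add: comma_mult_def comma_mult_ob_def)

lemma comma_mult_ext:
  "FOb (comma_mult P) \<in> extensional (comma_Ob (comma_proj P))"
  "FAr (comma_mult P) \<in> extensional (comma_Ar (comma_proj P))"
  by (simp_all add: comma_mult_def)

text \<open>
  The simplifier turns \<^term>\<open>FCod (comma_proj P)\<close> into \<^term>\<open>FCod P\<close>, after which the selector rules
  above no longer match for the iterated comma categories.
\<close>

lemma comma_Ob2_sel [simp]:
  assumes "Z \<in> comma_Ob (comma_proj P)"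
  shows "ufst Z \<in> comma_Ob P" "usnd Z \<in> Ar (FCod P)" "Dom (FCod P) (usnd Z) = Cod (FCod P) (usnd (ufst Z))"
  using assms by (auto simp: comma_Ob_def[of "comma_proj P"])

lemma comma_Ar2_sel [simp]:
  assumes "a \<in> comma_Ar (comma_proj P)"
  shows "cm_fst a \<in> comma_Ar P" "cm_src (cm_fst a) = ufst (cm_src a)" "cm_trg (cm_fst a) = ufst (cm_trg a)"
    "cm_snd a \<in> Ar (FCod P)" "Dom (FCod P) (cm_snd a) = Cod (FCod P) (usnd (cm_src a))"
    "Cod (FCod P) (cm_snd a) = Cod (FCod P) (usnd (cm_trg a))"
  using assms by (auto simp: comma_Ar_def[of "comma_proj P"] hom_iff)

lemma comma_Ob3_sel [simp]:
  assumes "Z \<in> comma_Ob (comma_proj (comma_proj P))"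
  shows "usnd Z \<in> Ar (FCod P)" "Dom (FCod P) (usnd Z) = Cod (FCod P) (usnd (ufst Z))"
  using assms by (auto simp: comma_Ob_def[of "comma_proj (comma_proj P)"])

lemma comma_Ar3_sel [simp]:
  assumes "a \<in> comma_Ar (comma_proj (comma_proj P))"
  shows "cm_snd a \<in> Ar (FCod P)" "Dom (FCod P) (cm_snd a) = Cod (FCod P) (usnd (cm_src a))"
    "Cod (FCod P) (cm_snd a) = Cod (FCod P) (usnd (cm_trg a))"
    "cm_src (cm_fst (cm_fst a)) = ufst (ufst (cm_src a))" "cm_trg (cm_fst (cm_fst a)) = ufst (ufst (cm_trg a))"
  using assms comma_Ar2_sel(2,3)[of "cm_fst a" P]
  by (auto simp: comma_Ar_def[of "comma_proj (comma_proj P)"] hom_iff)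

text \<open>An arrow of the iterated comma category consists of an outer square over
  \<open>cm_fst a\<close>, which carries an inner square of its own. Pasting the two gives the
  square that the multiplication needs for its value to be an arrow.\<close>

lemma comma_mult_square:
  assumes P: "is_functor P" and a: "a \<in> comma_Ar (comma_proj P)"
  shows "Cmp (FCod P) (cm_snd a) (Cmp (FCod P) (usnd (cm_src a)) (usnd (ufst (cm_src a))))
    = Cmp (FCod P) (Cmp (FCod P) (usnd (cm_trg a)) (usnd (ufst (cm_trg a)))) (FAr P (cm_fst (cm_fst a)))"
proof -
  let ?B = "FCod P"
  have 1: "Cmp ?B (cm_snd a) (usnd (cm_src a)) = Cmp ?B (usnd (cm_trg a)) (cm_snd (cm_fst a))"
    using comma_square[OF a] a by simp
  have 2: "Cmp ?B (cm_snd (cm_fst a)) (usnd (ufst (cm_src a)))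
      = Cmp ?B (usnd (ufst (cm_trg a))) (FAr P (cm_fst (cm_fst a)))"
    using comma_square[of "cm_fst a" P] a by simp
  have "Cmp ?B (cm_snd a) (Cmp ?B (usnd (cm_src a)) (usnd (ufst (cm_src a))))
      = Cmp ?B (Cmp ?B (cm_snd a) (usnd (cm_src a))) (usnd (ufst (cm_src a)))"
    by (rule Cmp_assoc_r[symmetric]) (use P a in simp_all)
  also have "\<dots> = Cmp ?B (usnd (cm_trg a)) (Cmp ?B (cm_snd (cm_fst a)) (usnd (ufst (cm_src a))))"
    unfolding 1 by (rule Cmp_assoc_r) (use P a in simp_all)
  also have "\<dots> = Cmp ?B (Cmp ?B (usnd (cm_trg a)) (usnd (ufst (cm_trg a)))) (FAr P (cm_fst (cm_fst a)))"
    unfolding 2 by (rule Cmp_assoc_r[symmetric]) (use P a in simp_all)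
  finally show ?thesis .
qed

lemma is_functor_comma_mult [simp]:
  assumes P: "is_functor P"
  shows "is_functor (comma_mult P)"
proof (rule is_functorI, goal_cases)
  case (8 f g)
  then show ?case
    using P comma_mult_square[OF P comma_Cmp_Ar[of "comma_proj P" g f]]
      comma_mult_square[OF P, of f] comma_mult_square[OF P, of g]
    by - (rule comma_Ar_eqI[of _ P _ P], simp_all add: comma_Cmp_Ar)
qed (use P in \<open>simp_all add: comma_mult_ext comma_mult_square\<close>)

lemma fun_over_comma_mult: "is_functor P \<Longrightarrow> fun_over (comma_proj (comma_proj P)) (comma_mult P) (comma_proj P)"
  by (rule fun_overI) (simp_all add: comma_mult_square)

subsection \<open>The 2-monad axioms\<close>

lemma comma_func_id: "is_functor P \<Longrightarrow> comma_func P (id_func (FDom P)) P = id_func (comma_cat P)"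
  by (rule func_eqI)
    (auto simp: comma_square upair_sel[of _ P] comma_ar_sel[of _ P] fun_over_def comp_func_id_right)

lemma fun_over_comp:
  assumes "is_functor P" "is_functor Q" "is_functor R" "fun_over P T Q" "fun_over Q S R"
  shows "fun_over P (comp_func S T) R"
  using assms fun_overD[OF assms(4)] fun_overD[OF assms(5)] by (intro fun_overI) simp_all

lemma comma_func_comp:
  assumes "is_functor P" "is_functor Q" "is_functor R" "fun_over P T Q" "fun_over Q S R"
  shows "comma_func P (comp_func S T) R = comp_func (comma_func Q S R) (comma_func P T Q)"
  using assms fun_overD[OF assms(4)] fun_overD[OF assms(5)] fun_over_comp[OF assms]
  by (intro func_eqI) (simp_all add: comma_square)

lemma comma_nat_id:
  assumes "is_functor P" "is_functor Q" "fun_over P T Q"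
  shows "comma_nat P (id_nat T) Q = id_nat (comma_func P T Q)"
proof -
  have "nat_over P (id_nat T) Q"
    using assms fun_overD[OF assms(3)] unfolding nat_over_def by simp
  from nat_overD(1)[OF nat_over_comma_nat[OF assms(1,2) this]] show ?thesis
    using assms fun_overD[OF assms(3)] by (intro nat_eqI) simp_all
qed

lemma nat_over_vcomp:
  assumes "is_functor P" "is_functor Q" "nat_over P \<alpha> Q" "nat_over P \<beta> Q" "NDom \<beta> = NCod \<alpha>"
  shows "nat_over P (vcomp_nat \<beta> \<alpha>) Q"
  using assms nat_overD[OF assms(3)] nat_overD[OF assms(4)] fun_overD[OF nat_overD(2)[OF assms(3)]]
    fun_overD[OF nat_overD(2)[OF assms(4)]]
  unfolding nat_over_def by simp

lemma comma_nat_vcomp: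
  assumes P: "is_functor P" "is_functor Q" and a: "nat_over P \<alpha> Q" and b: "nat_over P \<beta> Q"
    and c: "NDom \<beta> = NCod \<alpha>"
  shows "comma_nat P (vcomp_nat \<beta> \<alpha>) Q = vcomp_nat (comma_nat P \<beta> Q) (comma_nat P \<alpha> Q)"
proof -
  note v = nat_over_vcomp[OF P a b c]
  note n = nat_overD(1)[OF nat_over_comma_nat[OF P v]] nat_overD(1)[OF nat_over_comma_nat[OF P a]]
    nat_overD(1)[OF nat_over_comma_nat[OF P b]]
  note aD = nat_overD[OF a] fun_overD[OF nat_overD(2)[OF a]] fun_overD[OF nat_overD(3)[OF a]]
  note bD = nat_overD[OF b] fun_overD[OF nat_overD(2)[OF b]] fun_overD[OF nat_overD(3)[OF b]]
  show ?thesis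
  proof (rule nat_eqI)
    fix X assume X: "X \<in> Ob (FDom (NDom (vcomp_nat (comma_nat P \<beta> Q) (comma_nat P \<alpha> Q))))"
    show "NAt (comma_nat P (vcomp_nat \<beta> \<alpha>) Q) X
      = NAt (vcomp_nat (comma_nat P \<beta> Q) (comma_nat P \<alpha> Q)) X"
      using X P aD bD c by (simp add: comma_Cmp)
  qed (use n c in simp_all)
qed

lemma nat_over_hcomp:
  assumes P: "is_functor P" "is_functor Q" "is_functor R" and a: "nat_over P \<alpha> Q" and b: "nat_over Q \<beta> R"
  shows "nat_over P (hcomp_nat \<beta> \<alpha>) R"
proof -
  note aD = nat_overD[OF a] fun_overD[OF nat_overD(2)[OF a]] fun_overD[OF nat_overD(3)[OF a]]
  note bD = nat_overD[OF b] fun_overD[OF nat_overD(2)[OF b]] fun_overD[OF nat_overD(3)[OF b]]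
  show ?thesis
    unfolding nat_over_def using P aD bD
    by (simp add: fun_over_comp[OF P nat_overD(2)[OF a] nat_overD(2)[OF b]]
        fun_over_comp[OF P nat_overD(3)[OF a] nat_overD(3)[OF b]])
qed

lemma comma_nat_hcomp:
  assumes P: "is_functor P" "is_functor Q" "is_functor R" and a: "nat_over P \<alpha> Q" and b: "nat_over Q \<beta> R"
  shows "comma_nat P (hcomp_nat \<beta> \<alpha>) R = hcomp_nat (comma_nat Q \<beta> R) (comma_nat P \<alpha> Q)"
proof -
  note v = nat_over_hcomp[OF P a b]
  note n = nat_overD(1)[OF nat_over_comma_nat[OF P(1,3) v]] nat_overD(1)[OF nat_over_comma_nat[OF P(1,2) a]]
    nat_overD(1)[OF nat_over_comma_nat[OF P(2,3) b]]
  note aD = nat_overD[OF a] fun_overD[OF nat_overD(2)[OF a]] fun_overD[OF nat_overD(3)[OF a]]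
  note bD = nat_overD[OF b] fun_overD[OF nat_overD(2)[OF b]] fun_overD[OF nat_overD(3)[OF b]]
  show ?thesis
  proof (rule nat_eqI)
    fix X assume X: "X \<in> Ob (FDom (NDom (hcomp_nat (comma_nat Q \<beta> R) (comma_nat P \<alpha> Q))))"
    show "NAt (comma_nat P (hcomp_nat \<beta> \<alpha>) R) X
      = NAt (hcomp_nat (comma_nat Q \<beta> R) (comma_nat P \<alpha> Q)) X"
      using X P aD bD by (simp add: comma_Cmp)
  qed (use P aD bD n in \<open>simp_all add: comma_func_comp[OF P nat_overD(2)[OF a] nat_overD(2)[OF b]]
      comma_func_comp[OF P nat_overD(3)[OF a] nat_overD(3)[OF b]]\<close>)
qed

lemma comma_2monad_simps [simp]:
  "T0 comma_2monad P = comma_proj P"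
  "T1 comma_2monad t = \<lparr>bsrc = comma_proj (bsrc t), body = comma_func (bsrc t) (body t) (btrg t),
         btrg = comma_proj (btrg t)\<rparr>"
  "T2 comma_2monad \<beta> = \<lparr>bsrc = comma_proj (bsrc \<beta>), body = comma_nat (bsrc \<beta>) (body \<beta>) (btrg \<beta>),
         btrg = comma_proj (btrg \<beta>)\<rparr>"
  "Unit comma_2monad P = \<lparr>bsrc = P, body = comma_unit P, btrg = comma_proj P\<rparr>"
  "Mult comma_2monad P = \<lparr>bsrc = comma_proj (comma_proj P), body = comma_mult P, btrg = comma_proj P\<rparr>"
  by (simp_all add: comma_2monad_def)

lemma comma_proj_Obj: "P \<in> Obj (slice CAT B) \<Longrightarrow> comma_proj P \<in> Obj (slice CAT B)"
  by (auto simp: locally_small_comma)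

lemma slice_ObjD:
  assumes "P \<in> Obj (slice CAT B)"
  shows "is_functor P" "FCod P = B"
  using assms by auto

lemma comma_unit_natural:
  assumes "is_functor P" "is_functor Q" and T: "fun_over P T Q"
  shows "comp_func (comma_unit Q) T = comp_func (comma_func P T Q) (comma_unit P)"
  using assms fun_overD[OF T] by (intro func_eqI) simp_all

lemma comma_mult_natural:
  assumes P: "is_functor P" "is_functor Q" and T: "fun_over P T Q"
  shows "comp_func (comma_mult Q) (comma_func (comma_proj P) (comma_func P T Q) (comma_proj Q))
    = comp_func (comma_func P T Q) (comma_mult P)"
proof -
  note t = fun_overD[OF T]
  note f = fun_over_comma_func[OF P T]
  show ?thesis
  proof (rule func_eqI, goal_cases)
    case (6 a)
    then show ?case
      using P t f comma_square[of a "comma_proj P"] comma_square[of "cm_fst a" P] comma_mult_square[OF P(1), of a]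
      by simp
  qed (use P t f is_functor_comma_func[OF P T] in simp_all)
qed

lemma comma_mult_unit: "is_functor P \<Longrightarrow> comp_func (comma_mult P) (comma_unit (comma_proj P)) = id_func (comma_cat P)"
  by (rule func_eqI) (simp_all add: upair_sel[of _ P] comma_ar_sel[of _ P])

lemma comma_mult_comma_unit:
  assumes P: "is_functor P"
  shows "comp_func (comma_mult P) (comma_func P (comma_unit P) (comma_proj P)) = id_func (comma_cat P)"
proof (rule func_eqI, goal_cases)
  case (6 a)
  then show ?case
    using P fun_over_comma_unit[OF P] comma_square[of a P]
    by (simp add: upair_sel[of _ P] comma_ar_sel[of _ P])
qed (use P fun_over_comma_unit[OF P] in \<open>simp_all add: upair_sel[of _ P]\<close>)

text \<open>On objects the two sides bracket three base arrows differently; on arrows both keep the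
  innermost arrow of the domain and the outermost arrow of the base.\<close>

lemma comma_mult_assoc:
  assumes P: "is_functor P"
  shows "comp_func (comma_mult P) (comma_mult (comma_proj P))
    = comp_func (comma_mult P) (comma_func (comma_proj (comma_proj P)) (comma_mult P) (comma_proj P))"
proof (rule func_eqI, goal_cases)
  case (5 Z)
  then show ?case
    using P fun_over_comma_mult[OF P] by (simp add: Cmp_assoc_r)
next
  case (6 a)
  then show ?case
    using P fun_over_comma_mult[OF P] comma_square[of a "comma_proj (comma_proj P)"]
      comma_mult_square[of "comma_proj P" a] comma_mult_square[of P "cm_fst a"]
    by (simp add: Cmp_assoc_r)
qed (use P fun_over_comma_mult[OF P] in simp_all)

lemma comma_strict_2monad: "strict_2monad (slice CAT B) (comma_2monad :: ('u::universe func, _, _) twomonad)"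
proof -
  let ?S = "slice CAT B :: ('u func, _, _) twocat"
  interpret S: two_category ?S by (rule two_category_slice_CAT)
  note O = slice_ObjD[of _ B] comma_proj_Obj[of _ B]
  show ?thesis
  proof (rule strict_2monad.intro)
    show "two_functor ?S ?S (Endo comma_2monad)"
    proof (rule two_functor.intro)
      show "F1 (Endo comma_2monad) f \<in> mor ?S (T0 comma_2monad X) (T0 comma_2monad Y)"
        if "f \<in> mor ?S X Y" for f X Y
        using that O unfolding slice_CAT_mor by (auto simp del: slice_simps(1) intro: fun_over_comma_func)
      show "F2 (Endo comma_2monad) \<alpha> \<in> cell ?S (T1 comma_2monad f) (T1 comma_2monad g)"
        if "\<alpha> \<in> cell ?S f g" for \<alpha> f g
        using that O unfolding slice_CAT_cell by (auto simp del: slice_simps(1) intro: nat_over_comma_nat)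
      show "F1 (Endo comma_2monad) (Id1 ?S X) = Id1 ?S (T0 comma_2monad X)" if "X \<in> Obj ?S" for X
        using O[OF that] by (simp add: comma_func_id)
      show "F1 (Endo comma_2monad) (Comp1 ?S g f) = Comp1 ?S (T1 comma_2monad g) (T1 comma_2monad f)"
        if "f \<in> mor ?S X Y" "g \<in> mor ?S Y Z" for f g X Y Z
        using that O unfolding slice_CAT_mor by (simp del: slice_simps(1) add: comma_func_comp)
      show "F2 (Endo comma_2monad) (Id2 ?S f) = Id2 ?S (T1 comma_2monad f)" if "f \<in> Mor ?S" for f
        using that O unfolding slice_CAT_Mor by (simp del: slice_simps(1) add: comma_nat_id)
      show "F2 (Endo comma_2monad) (VComp ?S \<beta> \<alpha>) = VComp ?S (T2 comma_2monad \<beta>) (T2 comma_2monad \<alpha>)"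
        if "\<alpha> \<in> cell ?S f g" "\<beta> \<in> cell ?S g h" for \<alpha> \<beta> f g h
        using that O unfolding slice_CAT_cell by (auto simp del: slice_simps(1) simp: comma_nat_vcomp)
      show "F2 (Endo comma_2monad) (HComp ?S \<beta> \<alpha>) = HComp ?S (T2 comma_2monad \<beta>) (T2 comma_2monad \<alpha>)"
        if "\<alpha> \<in> Cell ?S" "\<beta> \<in> Cell ?S" "Trg0 ?S \<alpha> = Src0 ?S \<beta>" for \<alpha> \<beta>
        using that O unfolding slice_CAT_Cell by (simp del: slice_simps(1) add: comma_nat_hcomp)
    qed (use O two_category_slice_CAT in \<open>simp_all del: slice_simps(1)\<close>)
    show "Unit comma_2monad X \<in> mor ?S X (T0 comma_2monad X)" if "X \<in> Obj ?S" for X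
      using O[OF that] that unfolding slice_CAT_mor by (simp del: slice_simps(1) add: fun_over_comma_unit)
    show "Mult comma_2monad X \<in> mor ?S (T0 comma_2monad (T0 comma_2monad X)) (T0 comma_2monad X)" if "X \<in> Obj ?S" for X
      using O[OF that] that O(3)[OF O(3)[OF that]] unfolding slice_CAT_mor
      by (simp del: slice_simps(1) add: fun_over_comma_mult)
    show "Comp1 ?S (Unit comma_2monad Y) f = Comp1 ?S (T1 comma_2monad f) (Unit comma_2monad X)"
      if "f \<in> mor ?S X Y" for f X Y
      using that O unfolding slice_CAT_mor by (simp del: slice_simps(1) add: comma_unit_natural)
    show "Comp1 ?S (Mult comma_2monad Y) (T1 comma_2monad (T1 comma_2monad f))
        = Comp1 ?S (T1 comma_2monad f) (Mult comma_2monad X)"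
      if "f \<in> mor ?S X Y" for f X Y
      using that O unfolding slice_CAT_mor by (simp del: slice_simps(1) add: comma_mult_natural)
    show "whisker_left ?S (Unit comma_2monad (Trg0 ?S \<alpha>)) \<alpha>
        = whisker_right ?S (T2 comma_2monad \<alpha>) (Unit comma_2monad (Src0 ?S \<alpha>))"
      if "\<alpha> \<in> Cell ?S" for \<alpha>
    proof -
      let ?P = "bsrc \<alpha>" and ?Q = "btrg \<alpha>" and ?a = "body \<alpha>"
      have P: "is_functor ?P" "is_functor ?Q" and a: "nat_over ?P ?a ?Q"
        using that unfolding slice_CAT_Cell by auto
      note aD = nat_overD[OF a] fun_overD[OF nat_overD(2)[OF a]] fun_overD[OF nat_overD(3)[OF a]]
      note m = nat_overD(1)[OF nat_over_comma_nat[OF P a]]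
      have "hcomp_nat (id_nat (comma_unit ?Q)) ?a = hcomp_nat (comma_nat ?P ?a ?Q) (id_nat (comma_unit ?P))"
      proof (rule nat_eqI, goal_cases)
        case (5 x)
        have "NAt (hcomp_nat (id_nat (comma_unit ?Q)) ?a) x = FAr (comma_unit ?Q) (NAt ?a x)"
          by (rule hcomp_id_left) (use 5 P aD in simp_all)
        moreover have "NAt (hcomp_nat (comma_nat ?P ?a ?Q) (id_nat (comma_unit ?P))) x
            = NAt (comma_nat ?P ?a ?Q) (FOb (comma_unit ?P) x)"
          by (rule hcomp_id_right) (use 5 P aD m in simp_all)
        ultimately show ?case using 5 P aD by simp
      qed (use P aD m comma_unit_natural[OF P nat_overD(2)[OF a]] comma_unit_natural[OF P nat_overD(3)[OF a]] in simp_all)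
      then show ?thesis by (simp add: whisker_left_def whisker_right_def)
    qed
    show "whisker_left ?S (Mult comma_2monad (Trg0 ?S \<alpha>)) (T2 comma_2monad (T2 comma_2monad \<alpha>))
        = whisker_right ?S (T2 comma_2monad \<alpha>) (Mult comma_2monad (Src0 ?S \<alpha>))"
      if "\<alpha> \<in> Cell ?S" for \<alpha>
    proof -
      let ?P = "bsrc \<alpha>" and ?Q = "btrg \<alpha>" and ?a = "body \<alpha>"
      let ?c = "comma_nat ?P ?a ?Q"
      have P: "is_functor ?P" "is_functor ?Q" and a: "nat_over ?P ?a ?Q"
        using that unfolding slice_CAT_Cell by auto
      have cP: "is_functor (comma_proj ?P)" "is_functor (comma_proj ?Q)" using P by simp_all
      note aD = nat_overD[OF a] fun_overD[OF nat_overD(2)[OF a]] fun_overD[OF nat_overD(3)[OF a]]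
      note c = nat_over_comma_nat[OF P a]
      note m = nat_overD(1)[OF c] nat_overD(1)[OF nat_over_comma_nat[OF cP c]]
      note f = fun_over_comma_func[OF P nat_overD(2)[OF a]] fun_over_comma_func[OF P nat_overD(3)[OF a]]
      have "hcomp_nat (id_nat (comma_mult ?Q)) (comma_nat (comma_proj ?P) ?c (comma_proj ?Q))
          = hcomp_nat ?c (id_nat (comma_mult ?P))"
      proof (rule nat_eqI, goal_cases)
        case (5 x)
        have "NAt (hcomp_nat (id_nat (comma_mult ?Q)) (comma_nat (comma_proj ?P) ?c (comma_proj ?Q))) x
            = FAr (comma_mult ?Q) (NAt (comma_nat (comma_proj ?P) ?c (comma_proj ?Q)) x)"
          by (rule hcomp_id_left) (use 5 P m in simp_all)
        moreover have "NAt (hcomp_nat ?c (id_nat (comma_mult ?P))) x = NAt ?c (FOb (comma_mult ?P) x)"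
          by (rule hcomp_id_right) (use 5 P m in simp_all)
        ultimately show ?case using 5 P aD f by simp
      qed (use P aD m f comma_mult_natural[OF P nat_overD(2)[OF a]] comma_mult_natural[OF P nat_overD(3)[OF a]] in simp_all)
      then show ?thesis by (simp add: whisker_left_def whisker_right_def)
    qed
    show "Comp1 ?S (Mult comma_2monad X) (Unit comma_2monad (T0 comma_2monad X)) = Id1 ?S (T0 comma_2monad X)"
      if "X \<in> Obj ?S" for X
      using O[OF that] by (simp add: comma_mult_unit)
    show "Comp1 ?S (Mult comma_2monad X) (T1 comma_2monad (Unit comma_2monad X)) = Id1 ?S (T0 comma_2monad X)"
      if "X \<in> Obj ?S" for X
      using O[OF that] by (simp add: comma_mult_comma_unit)
    show "Comp1 ?S (Mult comma_2monad X) (Mult comma_2monad (T0 comma_2monad X))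
        = Comp1 ?S (Mult comma_2monad X) (T1 comma_2monad (Mult comma_2monad X))"
      if "X \<in> Obj ?S" for X
      using O[OF that] by (simp add: comma_mult_assoc)
  qed
qed

section \<open>Components of pasted 2-cells\<close>

text \<open>Operations of the slice stay folded from here on, so that the component rules can match
  on \<open>VComp\<close> and \<open>Id2\<close>.\<close>

declare slice_simps [simp del]

lemmas slice_Src_Trg [simp] = slice_simps(2,3)

lemma slice_CellD:
  assumes "\<beta> \<in> Cell (slice CAT B)"
  shows "natural_transformation (body \<beta>)" "FDom (NDom (body \<beta>)) = FDom (bsrc \<beta>)"
    "FCod (NDom (body \<beta>)) = FDom (btrg \<beta>)"
  using assms nat_overD[of "bsrc \<beta>" "body \<beta>" "btrg \<beta>"] unfolding slice_CAT_Cell by blast+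

lemma slice_morD:
  assumes "f \<in> mor (slice CAT B) X Y"
  shows "is_functor (body f)" "FDom (body f) = FDom X" "FCod (body f) = FDom Y"
    "bsrc f = X" "btrg f = Y"
  using assms fun_overD[of X "body f" Y] unfolding slice_CAT_mor by blast+

text \<open>Whiskering is horizontal composition with an identity, and one of the two factors in the
  component of \<open>hcomp_nat\<close> collapses accordingly. Pasted cells can then be evaluated at
  one object without unfolding them.\<close>

lemma NAt_whisker_left:
  assumes "\<alpha> \<in> Cell (slice CAT B)" "g \<in> mor (slice CAT B) (btrg \<alpha>) Z" "x \<in> Ob (FDom (bsrc \<alpha>))"
  shows "NAt (body (whisker_left (slice CAT B) g \<alpha>)) x = FAr (body g) (NAt (body \<alpha>) x)"
  using hcomp_id_left[of "body \<alpha>" "body g" x] slice_CellD[OF assms(1)] slice_morD[OF assms(2)] assms(3)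
  by (simp add: slice_simps whisker_left_def)

lemma NAt_whisker_right:
  assumes "\<beta> \<in> Cell (slice CAT B)" "f \<in> mor (slice CAT B) X (bsrc \<beta>)" "x \<in> Ob (FDom X)"
  shows "NAt (body (whisker_right (slice CAT B) \<beta> f)) x = NAt (body \<beta>) (FOb (body f) x)"
  using hcomp_id_right[of "body \<beta>" "body f" x] slice_CellD[OF assms(1)] slice_morD[OF assms(2)] assms(3)
  by (simp add: slice_simps whisker_right_def)

lemma NAt_VComp:
  assumes "\<alpha> \<in> Cell (slice CAT B)" "x \<in> Ob (FDom (bsrc \<alpha>))"
  shows "NAt (body (VComp (slice CAT B) \<beta> \<alpha>)) x
    = Cmp (FDom (btrg \<alpha>)) (NAt (body \<beta>) x) (NAt (body \<alpha>) x)"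
  using slice_CellD[OF assms(1)] assms(2) by (simp add: slice_simps)

lemma NAt_Id2:
  assumes "f \<in> mor (slice CAT B) X Y" "x \<in> Ob (FDom X)"
  shows "NAt (body (Id2 (slice CAT B) f)) x = Idn (FDom Y) (FOb (body f) x)"
  using slice_morD[OF assms(1)] assms(2) by (simp add: slice_simps)

lemma slice_record:
  "bsrc (whisker_left (slice CAT B) g \<alpha>) = bsrc \<alpha>" "btrg (whisker_left (slice CAT B) g \<alpha>) = btrg g"
  "bsrc (whisker_right (slice CAT B) \<beta> f) = bsrc f" "btrg (whisker_right (slice CAT B) \<beta> f) = btrg \<beta>"
  "bsrc (VComp (slice CAT B) \<beta> \<alpha>) = bsrc \<alpha>" "btrg (VComp (slice CAT B) \<beta> \<alpha>) = btrg \<alpha>"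
  by (simp_all add: slice_simps whisker_left_def whisker_right_def)


section \<open>Typing of the pseudoalgebra axioms\<close>

text \<open>Two slice cells may be compared by components once they are known to be parallel. For
  the pseudoalgebra equations this is a computation with the 2-monad laws, and carrying it out
  abstractly keeps nested comma categories out of it.\<close>

locale monad_on_two_category =
  K: two_category K + T: strict_2monad K T
  for K :: "('o, 'm, 't) twocat" and T :: "('o, 'm, 't) twomonad"
begin

sublocale Endo: two_functor K K "Endo T"
  by (rule T.Endo_2functor)

context
  fixes X a \<iota> \<chi>
  assumes X: "X \<in> Obj K" and a: "a \<in> mor K (T0 T X) X"
    and \<iota>: "\<iota> \<in> cell K (Id1 K X) (Comp1 K a (Unit T X))"
    and \<chi>: "\<chi> \<in> cell K (Comp1 K a (T1 T a)) (Comp1 K a (Mult T X))"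
begin

lemma T0_Obj: "T0 T X \<in> Obj K" "T0 T (T0 T X) \<in> Obj K"
  using X Endo.F0_Obj by auto

lemma pasting_mors:
  "Unit T X \<in> mor K X (T0 T X)" "Unit T (T0 T X) \<in> mor K (T0 T X) (T0 T (T0 T X))"
  "T1 T (Unit T X) \<in> mor K (T0 T X) (T0 T (T0 T X))"
  "Mult T X \<in> mor K (T0 T (T0 T X)) (T0 T X)"
  "Mult T (T0 T X) \<in> mor K (T0 T (T0 T (T0 T X))) (T0 T (T0 T X))"
  "T1 T (Mult T X) \<in> mor K (T0 T (T0 T (T0 T X))) (T0 T (T0 T X))"
  "T1 T a \<in> mor K (T0 T (T0 T X)) (T0 T X)" "T1 T (T1 T a) \<in> mor K (T0 T (T0 T (T0 T X))) (T0 T (T0 T X))"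
  "Id1 K X \<in> mor K X X" "Comp1 K a (Mult T X) \<in> mor K (T0 T (T0 T X)) X"
  "Comp1 K a (T1 T a) \<in> mor K (T0 T (T0 T X)) X" "Comp1 K a (Unit T X) \<in> mor K X X"
  using X T0_Obj a T.Unit_mor T.Mult_mor Endo.F1_mor K.Id1_mor K.Comp1_mor by meson+

text \<open>The two whiskerings meet because \<open>T\<close> preserves composition, and the
  composite ends at \<open>a\<close> by the law \<open>Mult_T_Unit\<close>.\<close>

lemma unit_right_cell:
  "VComp K (whisker_right K \<chi> (T1 T (Unit T X))) (whisker_left K a (T2 T \<iota>)) \<in> cell K a a"
proof -
  have 1: "whisker_left K a (T2 T \<iota>) \<in> cell K (Comp1 K a (T1 T (Id1 K X))) (Comp1 K a (T1 T (Comp1 K a (Unit T X))))"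
    by (rule K.whisker_left_cell[OF Endo.F2_cell[OF \<iota>] Endo.F1_mor[OF pasting_mors(9)] a])
  have 2: "whisker_right K \<chi> (T1 T (Unit T X))
      \<in> cell K (Comp1 K (Comp1 K a (T1 T a)) (T1 T (Unit T X))) (Comp1 K (Comp1 K a (Mult T X)) (T1 T (Unit T X)))"
    by (rule K.whisker_right_cell[OF \<chi> pasting_mors(11) pasting_mors(3)])
  have e1: "Comp1 K a (T1 T (Id1 K X)) = a"
    using Endo.F1_Id1[OF X] K.Comp1_Id1_right[OF a] by simp
  have e2: "Comp1 K a (T1 T (Comp1 K a (Unit T X))) = Comp1 K (Comp1 K a (T1 T a)) (T1 T (Unit T X))"
    using Endo.F1_Comp1[OF pasting_mors(1) a] K.Comp1_assoc[OF pasting_mors(3) pasting_mors(7) a] by simp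
  have e3: "Comp1 K (Comp1 K a (Mult T X)) (T1 T (Unit T X)) = a"
    using K.Comp1_assoc[OF pasting_mors(3) pasting_mors(4) a] T.Mult_T_Unit[OF X] K.Comp1_Id1_right[OF a] by simp
  show ?thesis using K.VComp_cell 1 2 unfolding e1 e2 e3 by blast
qed

text \<open>The middle 1-cells agree by naturality of the unit at \<open>a\<close>; the end is
  \<open>a\<close> by the law \<open>Mult_Unit\<close>.\<close>

lemma unit_left_cell:
  "VComp K (whisker_right K \<chi> (Unit T (T0 T X))) (whisker_right K \<iota> a) \<in> cell K a a"
proof -
  have 1: "whisker_right K \<iota> a \<in> cell K (Comp1 K (Id1 K X) a) (Comp1 K (Comp1 K a (Unit T X)) a)"
    by (rule K.whisker_right_cell[OF \<iota> pasting_mors(9) a])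
  have 2: "whisker_right K \<chi> (Unit T (T0 T X))
      \<in> cell K (Comp1 K (Comp1 K a (T1 T a)) (Unit T (T0 T X))) (Comp1 K (Comp1 K a (Mult T X)) (Unit T (T0 T X)))"
    by (rule K.whisker_right_cell[OF \<chi> pasting_mors(11) pasting_mors(2)])
  have e1: "Comp1 K (Id1 K X) a = a" by (rule K.Comp1_Id1_left[OF a])
  have e2: "Comp1 K (Comp1 K a (Unit T X)) a = Comp1 K (Comp1 K a (T1 T a)) (Unit T (T0 T X))"
    using K.Comp1_assoc[OF a pasting_mors(1) a] K.Comp1_assoc[OF pasting_mors(2) pasting_mors(7) a] T.Unit_natural[OF a] by simp
  have e3: "Comp1 K (Comp1 K a (Mult T X)) (Unit T (T0 T X)) = a"
    using K.Comp1_assoc[OF pasting_mors(2) pasting_mors(4) a] T.Mult_Unit[OF X] K.Comp1_Id1_right[OF a] by simp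
  show ?thesis using K.VComp_cell 1 2 unfolding e1 e2 e3 by blast
qed

text \<open>Naturality of the multiplication at \<open>a\<close> lets the second composite be
  formed, and associativity of the multiplication gives both the same target.\<close>

lemma associativity_cells:
  "VComp K (whisker_right K \<chi> (T1 T (Mult T X))) (whisker_left K a (T2 T \<chi>))
    \<in> cell K (Comp1 K (Comp1 K a (T1 T a)) (T1 T (T1 T a))) (Comp1 K (Comp1 K a (Mult T X)) (T1 T (Mult T X)))"
  "VComp K (whisker_right K \<chi> (Mult T (T0 T X))) (whisker_right K \<chi> (T1 T (T1 T a)))
    \<in> cell K (Comp1 K (Comp1 K a (T1 T a)) (T1 T (T1 T a))) (Comp1 K (Comp1 K a (Mult T X)) (T1 T (Mult T X)))"
proof -
  have 1: "whisker_left K a (T2 T \<chi>)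
      \<in> cell K (Comp1 K a (T1 T (Comp1 K a (T1 T a)))) (Comp1 K a (T1 T (Comp1 K a (Mult T X))))"
    by (rule K.whisker_left_cell[OF Endo.F2_cell[OF \<chi>] Endo.F1_mor[OF pasting_mors(11)] a])
  have 2: "whisker_right K \<chi> (T1 T (Mult T X))
      \<in> cell K (Comp1 K (Comp1 K a (T1 T a)) (T1 T (Mult T X))) (Comp1 K (Comp1 K a (Mult T X)) (T1 T (Mult T X)))"
    by (rule K.whisker_right_cell[OF \<chi> pasting_mors(11) pasting_mors(6)])
  have e1: "Comp1 K a (T1 T (Comp1 K a (T1 T a))) = Comp1 K (Comp1 K a (T1 T a)) (T1 T (T1 T a))"
    using Endo.F1_Comp1[OF pasting_mors(7) a] K.Comp1_assoc[OF pasting_mors(8) pasting_mors(7) a] by simp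
  have e2: "Comp1 K a (T1 T (Comp1 K a (Mult T X))) = Comp1 K (Comp1 K a (T1 T a)) (T1 T (Mult T X))"
    using Endo.F1_Comp1[OF pasting_mors(4) a] K.Comp1_assoc[OF pasting_mors(6) pasting_mors(7) a] by simp
  show "VComp K (whisker_right K \<chi> (T1 T (Mult T X))) (whisker_left K a (T2 T \<chi>))
    \<in> cell K (Comp1 K (Comp1 K a (T1 T a)) (T1 T (T1 T a))) (Comp1 K (Comp1 K a (Mult T X)) (T1 T (Mult T X)))"
    using K.VComp_cell 1 2 unfolding e1 e2 by blast
  have 3: "whisker_right K \<chi> (T1 T (T1 T a))
      \<in> cell K (Comp1 K (Comp1 K a (T1 T a)) (T1 T (T1 T a))) (Comp1 K (Comp1 K a (Mult T X)) (T1 T (T1 T a)))"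
    by (rule K.whisker_right_cell[OF \<chi> pasting_mors(11) pasting_mors(8)])
  have 4: "whisker_right K \<chi> (Mult T (T0 T X))
      \<in> cell K (Comp1 K (Comp1 K a (T1 T a)) (Mult T (T0 T X))) (Comp1 K (Comp1 K a (Mult T X)) (Mult T (T0 T X)))"
    by (rule K.whisker_right_cell[OF \<chi> pasting_mors(11) pasting_mors(5)])
  have e3: "Comp1 K (Comp1 K a (Mult T X)) (T1 T (T1 T a)) = Comp1 K (Comp1 K a (T1 T a)) (Mult T (T0 T X))"
    using K.Comp1_assoc[OF pasting_mors(8) pasting_mors(4) a] K.Comp1_assoc[OF pasting_mors(5) pasting_mors(7) a] T.Mult_natural[OF a] by simp
  have e4: "Comp1 K (Comp1 K a (Mult T X)) (Mult T (T0 T X)) = Comp1 K (Comp1 K a (Mult T X)) (T1 T (Mult T X))"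
    using K.Comp1_assoc[OF pasting_mors(5) pasting_mors(4) a] K.Comp1_assoc[OF pasting_mors(6) pasting_mors(4) a] T.Mult_Mult[OF X] by simp
  show "VComp K (whisker_right K \<chi> (Mult T (T0 T X))) (whisker_right K \<chi> (T1 T (T1 T a)))
    \<in> cell K (Comp1 K (Comp1 K a (T1 T a)) (T1 T (T1 T a))) (Comp1 K (Comp1 K a (Mult T X)) (T1 T (Mult T X)))"
    using K.VComp_cell 3 4 unfolding e3 e4 by blast
qed

end

section \<open>Both sides of the equations for pseudomorphisms and algebra transformations\<close>

context
  fixes X a \<iota>a \<chi>a Y b \<iota>b \<chi>b f fbar
  assumes X: "X \<in> Obj K" and a: "a \<in> mor K (T0 T X) X"
    and \<iota>a: "\<iota>a \<in> cell K (Id1 K X) (Comp1 K a (Unit T X))"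
    and \<chi>a: "\<chi>a \<in> cell K (Comp1 K a (T1 T a)) (Comp1 K a (Mult T X))"
    and Y: "Y \<in> Obj K" and b: "b \<in> mor K (T0 T Y) Y"
    and \<iota>b: "\<iota>b \<in> cell K (Id1 K Y) (Comp1 K b (Unit T Y))"
    and \<chi>b: "\<chi>b \<in> cell K (Comp1 K b (T1 T b)) (Comp1 K b (Mult T Y))"
    and f: "f \<in> mor K X Y" and fbar: "fbar \<in> cell K (Comp1 K b (T1 T f)) (Comp1 K f a)"
begin

lemmas source_mors = pasting_mors[OF X a \<iota>a \<chi>a] and target_mors = pasting_mors[OF Y b \<iota>b \<chi>b]

lemma T1_mors:
  "T1 T f \<in> mor K (T0 T X) (T0 T Y)" "T1 T (T1 T f) \<in> mor K (T0 T (T0 T X)) (T0 T (T0 T Y))"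
  "Comp1 K b (T1 T f) \<in> mor K (T0 T X) Y" "Comp1 K f a \<in> mor K (T0 T X) Y"
  using f a b Endo.F1_mor K.Comp1_mor by meson+

lemma Str_unit_cells:
  "VComp K (whisker_right K fbar (Unit T X)) (whisker_right K \<iota>b f) \<in> cell K f (Comp1 K f (Comp1 K a (Unit T X)))"
  "whisker_left K f \<iota>a \<in> cell K f (Comp1 K f (Comp1 K a (Unit T X)))"
proof -
  have 1: "whisker_right K \<iota>b f \<in> cell K (Comp1 K (Id1 K Y) f) (Comp1 K (Comp1 K b (Unit T Y)) f)"
    by (rule K.whisker_right_cell[OF \<iota>b target_mors(9) f])
  have 2: "whisker_right K fbar (Unit T X)
      \<in> cell K (Comp1 K (Comp1 K b (T1 T f)) (Unit T X)) (Comp1 K (Comp1 K f a) (Unit T X))"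
    by (rule K.whisker_right_cell[OF fbar T1_mors(3) source_mors(1)])
  have e1: "Comp1 K (Id1 K Y) f = f" by (rule K.Comp1_Id1_left[OF f])
  have e2: "Comp1 K (Comp1 K b (Unit T Y)) f = Comp1 K (Comp1 K b (T1 T f)) (Unit T X)"
    using K.Comp1_assoc[OF f target_mors(1) b] K.Comp1_assoc[OF source_mors(1) T1_mors(1) b] T.Unit_natural[OF f] by simp
  have e3: "Comp1 K (Comp1 K f a) (Unit T X) = Comp1 K f (Comp1 K a (Unit T X))"
    using K.Comp1_assoc[OF source_mors(1) a f] by simp
  show "VComp K (whisker_right K fbar (Unit T X)) (whisker_right K \<iota>b f) \<in> cell K f (Comp1 K f (Comp1 K a (Unit T X)))"
    using K.VComp_cell 1 2 unfolding e1 e2 e3 by blast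
  show "whisker_left K f \<iota>a \<in> cell K f (Comp1 K f (Comp1 K a (Unit T X)))"
    using K.whisker_left_cell[OF \<iota>a source_mors(9) f] K.Comp1_Id1_right[OF f] by simp
qed

text \<open>Naturality of the multiplication at \<open>f\<close> joins the two cells on the
  left-hand side. The third clause types the inner composite separately, since taking components of
  the outer one requires it to be a cell.\<close>

lemma Str_mult_cells:
  "VComp K (whisker_right K fbar (Mult T X)) (whisker_right K \<chi>b (T1 T (T1 T f)))
    \<in> cell K (Comp1 K (Comp1 K b (T1 T b)) (T1 T (T1 T f))) (Comp1 K (Comp1 K f a) (Mult T X))"
  "VComp K (whisker_left K f \<chi>a) (VComp K (whisker_right K fbar (T1 T a)) (whisker_left K b (T2 T fbar)))
    \<in> cell K (Comp1 K (Comp1 K b (T1 T b)) (T1 T (T1 T f))) (Comp1 K (Comp1 K f a) (Mult T X))"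
  "VComp K (whisker_right K fbar (T1 T a)) (whisker_left K b (T2 T fbar))
    \<in> cell K (Comp1 K (Comp1 K b (T1 T b)) (T1 T (T1 T f))) (Comp1 K f (Comp1 K a (T1 T a)))"
proof -
  have 1: "whisker_right K \<chi>b (T1 T (T1 T f))
      \<in> cell K (Comp1 K (Comp1 K b (T1 T b)) (T1 T (T1 T f))) (Comp1 K (Comp1 K b (Mult T Y)) (T1 T (T1 T f)))"
    by (rule K.whisker_right_cell[OF \<chi>b target_mors(11) T1_mors(2)])
  have 2: "whisker_right K fbar (Mult T X)
      \<in> cell K (Comp1 K (Comp1 K b (T1 T f)) (Mult T X)) (Comp1 K (Comp1 K f a) (Mult T X))"
    by (rule K.whisker_right_cell[OF fbar T1_mors(3) source_mors(4)])
  have e1: "Comp1 K (Comp1 K b (Mult T Y)) (T1 T (T1 T f)) = Comp1 K (Comp1 K b (T1 T f)) (Mult T X)"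
    using K.Comp1_assoc[OF T1_mors(2) target_mors(4) b] K.Comp1_assoc[OF source_mors(4) T1_mors(1) b] T.Mult_natural[OF f]
    by simp
  show "VComp K (whisker_right K fbar (Mult T X)) (whisker_right K \<chi>b (T1 T (T1 T f)))
    \<in> cell K (Comp1 K (Comp1 K b (T1 T b)) (T1 T (T1 T f))) (Comp1 K (Comp1 K f a) (Mult T X))"
    using K.VComp_cell 1 2 unfolding e1 by blast
  have 3: "whisker_left K b (T2 T fbar)
      \<in> cell K (Comp1 K b (T1 T (Comp1 K b (T1 T f)))) (Comp1 K b (T1 T (Comp1 K f a)))"
    by (rule K.whisker_left_cell[OF Endo.F2_cell[OF fbar] Endo.F1_mor[OF T1_mors(3)] b])
  have 4: "whisker_right K fbar (T1 T a)
      \<in> cell K (Comp1 K (Comp1 K b (T1 T f)) (T1 T a)) (Comp1 K (Comp1 K f a) (T1 T a))"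
    by (rule K.whisker_right_cell[OF fbar T1_mors(3) source_mors(7)])
  have 5: "whisker_left K f \<chi>a \<in> cell K (Comp1 K f (Comp1 K a (T1 T a))) (Comp1 K f (Comp1 K a (Mult T X)))"
    by (rule K.whisker_left_cell[OF \<chi>a source_mors(11) f])
  have e2: "Comp1 K b (T1 T (Comp1 K b (T1 T f))) = Comp1 K (Comp1 K b (T1 T b)) (T1 T (T1 T f))"
    using Endo.F1_Comp1[OF T1_mors(1) b] K.Comp1_assoc[OF T1_mors(2) target_mors(7) b] by simp
  have e3: "Comp1 K b (T1 T (Comp1 K f a)) = Comp1 K (Comp1 K b (T1 T f)) (T1 T a)"
    using Endo.F1_Comp1[OF a f] K.Comp1_assoc[OF source_mors(7) T1_mors(1) b] by simp
  have e4: "Comp1 K (Comp1 K f a) (T1 T a) = Comp1 K f (Comp1 K a (T1 T a))"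
    using K.Comp1_assoc[OF source_mors(7) a f] by simp
  have e5: "Comp1 K f (Comp1 K a (Mult T X)) = Comp1 K (Comp1 K f a) (Mult T X)"
    using K.Comp1_assoc[OF source_mors(4) a f] by simp
  show 6: "VComp K (whisker_right K fbar (T1 T a)) (whisker_left K b (T2 T fbar))
    \<in> cell K (Comp1 K (Comp1 K b (T1 T b)) (T1 T (T1 T f))) (Comp1 K f (Comp1 K a (T1 T a)))"
    using K.VComp_cell 3 4 unfolding e2 e3 e4 by blast
  show "VComp K (whisker_left K f \<chi>a) (VComp K (whisker_right K fbar (T1 T a)) (whisker_left K b (T2 T fbar)))
    \<in> cell K (Comp1 K (Comp1 K b (T1 T b)) (T1 T (T1 T f))) (Comp1 K (Comp1 K f a) (Mult T X))"
    using K.VComp_cell[OF 6 5] unfolding e5 .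
qed

lemma CUnd_cells:
  assumes \<alpha>: "\<alpha> \<in> cell K f g" and gbar: "gbar \<in> cell K (Comp1 K b (T1 T g)) (Comp1 K g a)"
  shows "VComp K (whisker_right K \<alpha> a) fbar \<in> cell K (Comp1 K b (T1 T f)) (Comp1 K g a)"
    and "VComp K gbar (whisker_left K b (T2 T \<alpha>)) \<in> cell K (Comp1 K b (T1 T f)) (Comp1 K g a)"
proof -
  show "VComp K (whisker_right K \<alpha> a) fbar \<in> cell K (Comp1 K b (T1 T f)) (Comp1 K g a)"
    by (rule K.VComp_cell[OF fbar K.whisker_right_cell[OF \<alpha> f a]])
  show "VComp K gbar (whisker_left K b (T2 T \<alpha>)) \<in> cell K (Comp1 K b (T1 T f)) (Comp1 K g a)"
    by (rule K.VComp_cell[OF K.whisker_left_cell[OF Endo.F2_cell[OF \<alpha>] T1_mors(1) b] gbar])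
qed

text \<open>The composite runs from \<open>c T(g f)\<close> through \<open>g b T(f)\<close> to
  \<open>g f a\<close>; functoriality of \<open>T\<close> and associativity identify the
  stages.\<close>

lemma comp_Str_cell:
  assumes g: "g \<in> mor K Y Z" and c: "c \<in> mor K (T0 T Z) Z"
    and gbar: "gbar \<in> cell K (Comp1 K c (T1 T g)) (Comp1 K g b)"
  shows "VComp K (whisker_left K g fbar) (whisker_right K gbar (T1 T f))
    \<in> cell K (Comp1 K c (T1 T (Comp1 K g f))) (Comp1 K (Comp1 K g f) a)"
proof -
  have Tg: "T1 T g \<in> mor K (T0 T Y) (T0 T Z)" by (rule Endo.F1_mor[OF g])
  have 1: "whisker_right K gbar (T1 T f)
      \<in> cell K (Comp1 K (Comp1 K c (T1 T g)) (T1 T f)) (Comp1 K (Comp1 K g b) (T1 T f))"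
    by (rule K.whisker_right_cell[OF gbar K.Comp1_mor[OF Tg c] T1_mors(1)])
  have 2: "whisker_left K g fbar \<in> cell K (Comp1 K g (Comp1 K b (T1 T f))) (Comp1 K g (Comp1 K f a))"
    by (rule K.whisker_left_cell[OF fbar T1_mors(3) g])
  have e1: "Comp1 K (Comp1 K c (T1 T g)) (T1 T f) = Comp1 K c (T1 T (Comp1 K g f))"
    using Endo.F1_Comp1[OF f g] K.Comp1_assoc[OF T1_mors(1) Tg c] by simp
  have e2: "Comp1 K (Comp1 K g b) (T1 T f) = Comp1 K g (Comp1 K b (T1 T f))"
    using K.Comp1_assoc[OF T1_mors(1) b g] by simp
  have e3: "Comp1 K g (Comp1 K f a) = Comp1 K (Comp1 K g f) a"
    using K.Comp1_assoc[OF a f g] by simp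
  show ?thesis using K.VComp_cell 1 2 unfolding e1 e2 e3 by blast
qed

end

end

lemma comma_monad_on_slice:
  "monad_on_two_category (slice CAT B) (comma_2monad :: ('u::universe func, _, _) twomonad)"
  by (simp add: monad_on_two_category_def two_category_slice_CAT comma_strict_2monad)

subsection \<open>Componentwise form of the axioms\<close>

lemma slice_cell_eq_iff:
  assumes "\<alpha> \<in> cell (slice CAT B) s t" "\<beta> \<in> cell (slice CAT B) s t"
  shows "\<alpha> = \<beta> \<longleftrightarrow> (\<forall>x \<in> Ob (FDom (bsrc s)). NAt (body \<alpha>) x = NAt (body \<beta>) x)"
  using slice_cell_eqI[OF assms] by auto

lemma slice_cellD:
  assumes "\<alpha> \<in> cell (slice CAT B) s t"
  shows "\<alpha> \<in> Cell (slice CAT B)" "bsrc s = bsrc \<alpha>" "btrg s = btrg \<alpha>"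
  using assms by (auto simp: cell_iff slice_simps)

context
  fixes B :: "'u::universe cat" and P a \<iota> \<chi>
  assumes P: "P \<in> Obj (slice CAT B)"
    and a: "a \<in> mor (slice CAT B) (comma_proj P) P"
    and \<iota>: "\<iota> \<in> cell (slice CAT B) (Id1 (slice CAT B) P) (Comp1 (slice CAT B) a (Unit comma_2monad P))"
    and \<chi>: "\<chi> \<in> cell (slice CAT B) (Comp1 (slice CAT B) a (T1 comma_2monad a))
      (Comp1 (slice CAT B) a (Mult comma_2monad P))"
begin

interpretation M: monad_on_two_category "slice CAT B" "comma_2monad :: ('u func, _, _) twomonad"
  by (rule comma_monad_on_slice)

lemma act_mor_T0: "a \<in> mor (slice CAT B) (T0 comma_2monad P) P"
  using a by simp

lemmas action_mors = M.pasting_mors[OF P act_mor_T0 \<iota> \<chi>, simplified]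

lemma action_records:
  "bsrc a = comma_proj P" "btrg a = P" "bsrc \<iota> = P" "btrg \<iota> = P"
  "bsrc \<chi> = comma_proj (comma_proj P)" "btrg \<chi> = P" "\<iota> \<in> Cell (slice CAT B)" "\<chi> \<in> Cell (slice CAT B)"
  using a \<iota> \<chi> by (auto simp: mor_iff cell_iff slice_simps)

lemma T2_action_cells: "T2 comma_2monad \<iota> \<in> Cell (slice CAT B)" "T2 comma_2monad \<chi> \<in> Cell (slice CAT B)"
  using M.Endo.F2_cell[OF \<iota>] M.Endo.F2_cell[OF \<chi>] by (simp_all add: cell_iff)

text \<open>For \<open>X = (x, u)\<close> the cell \<chi> is evaluated at
  \<open>((x, 1), u)\<close>, after the action on the comma arrow
  \<open>(\<iota>_x, 1)\<close>.\<close>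

lemma unit_right_iff:
  "VComp (slice CAT B) (whisker_right (slice CAT B) \<chi> (T1 comma_2monad (Unit comma_2monad P)))
      (whisker_left (slice CAT B) a (T2 comma_2monad \<iota>)) = Id2 (slice CAT B) a \<longleftrightarrow>
    (\<forall>X \<in> comma_Ob P. Cmp (FDom P) (NAt (body \<chi>) (FOb (comma_func P (comma_unit P) (comma_proj P)) X))
      (FAr (body a) (NAt (comma_nat P (body \<iota>) P) X)) = Idn (FDom P) (FOb (body a) X))"
proof -
  have 1: "whisker_left (slice CAT B) a (T2 comma_2monad \<iota>) \<in> Cell (slice CAT B)"
    using slice.whisker_left_cell[OF M.Endo.F2_cell[OF \<iota>] M.Endo.F1_mor[OF M.pasting_mors(9)[OF P act_mor_T0 \<iota> \<chi>]] act_mor_T0]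
    by (simp add: cell_iff)
  have n: "Id2 (slice CAT B) a \<in> cell (slice CAT B) a a"
    using a by (intro slice.Id2_cell) (simp add: mor_iff)
  show ?thesis
    unfolding slice_cell_eq_iff[OF M.unit_right_cell[OF P act_mor_T0 \<iota> \<chi>] n]
    using NAt_VComp[OF 1] NAt_whisker_left[OF T2_action_cells(1), of a P] NAt_whisker_right[OF action_records(8), of _ "comma_proj P"]
      NAt_Id2[OF a] a action_mors
    by (simp add: action_records slice_record)
qed

text \<open>For \<open>X = (x, u)\<close> the cell \<chi> is evaluated at
  \<open>((x, u), 1)\<close>, after \<iota> at the value of the action.\<close>

lemma unit_left_iff:
  "VComp (slice CAT B) (whisker_right (slice CAT B) \<chi> (Unit comma_2monad (T0 comma_2monad P)))
      (whisker_right (slice CAT B) \<iota> a) = Id2 (slice CAT B) a \<longleftrightarrow>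
    (\<forall>X \<in> comma_Ob P. Cmp (FDom P) (NAt (body \<chi>) (FOb (comma_unit (comma_proj P)) X))
      (NAt (body \<iota>) (FOb (body a) X)) = Idn (FDom P) (FOb (body a) X))"
proof -
  have 1: "whisker_right (slice CAT B) \<iota> a \<in> Cell (slice CAT B)"
    using slice.whisker_right_cell[OF \<iota> action_mors(9) a] by (simp add: cell_iff)
  have n: "Id2 (slice CAT B) a \<in> cell (slice CAT B) a a"
    using a by (intro slice.Id2_cell) (simp add: mor_iff)
  show ?thesis
    unfolding slice_cell_eq_iff[OF M.unit_left_cell[OF P act_mor_T0 \<iota> \<chi>] n]
    using NAt_VComp[OF 1] NAt_whisker_right[OF action_records(7), of a "comma_proj P"]
      NAt_whisker_right[OF action_records(8), of _ "comma_proj P"] NAt_Id2[OF a] a action_mors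
    by (simp add: action_records slice_record)
qed

text \<open>For \<open>W = (((x, u), v), w)\<close> the left side contracts \<open>u\<close> and
  \<open>v\<close> first and ends with \<chi> at \<open>((x, v u), w)\<close>; the right side
  contracts \<open>v\<close> and \<open>w\<close> first and ends with \<chi> at
  \<open>((x, u), w v)\<close>.\<close>

lemma associativity_iff:
  "VComp (slice CAT B) (whisker_right (slice CAT B) \<chi> (T1 comma_2monad (Mult comma_2monad P)))
      (whisker_left (slice CAT B) a (T2 comma_2monad \<chi>))
    = VComp (slice CAT B) (whisker_right (slice CAT B) \<chi> (Mult comma_2monad (T0 comma_2monad P)))
      (whisker_right (slice CAT B) \<chi> (T1 comma_2monad (T1 comma_2monad a))) \<longleftrightarrow>
    (\<forall>W \<in> comma_Ob (comma_proj (comma_proj P)).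
      Cmp (FDom P) (NAt (body \<chi>) (FOb (comma_func (comma_proj (comma_proj P)) (comma_mult P) (comma_proj P)) W))
        (FAr (body a) (NAt (comma_nat (comma_proj (comma_proj P)) (body \<chi>) P) W))
      = Cmp (FDom P) (NAt (body \<chi>) (FOb (comma_mult (comma_proj P)) W))
        (NAt (body \<chi>) (FOb (comma_func (comma_proj (comma_proj P)) (comma_func (comma_proj P) (body a) P) (comma_proj P)) W)))"
proof -
  have 1: "whisker_left (slice CAT B) a (T2 comma_2monad \<chi>) \<in> Cell (slice CAT B)"
    using slice.whisker_left_cell[OF M.Endo.F2_cell[OF \<chi>] M.Endo.F1_mor[OF M.pasting_mors(11)[OF P act_mor_T0 \<iota> \<chi>]] act_mor_T0]
    by (simp add: cell_iff)
  have 2: "whisker_right (slice CAT B) \<chi> (T1 comma_2monad (T1 comma_2monad a)) \<in> Cell (slice CAT B)"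
    using slice.whisker_right_cell[OF \<chi> M.pasting_mors(11)[OF P act_mor_T0 \<iota> \<chi>] M.pasting_mors(8)[OF P act_mor_T0 \<iota> \<chi>]] by (simp add: cell_iff)
  show ?thesis
    unfolding slice_cell_eq_iff[OF M.associativity_cells[OF P act_mor_T0 \<iota> \<chi>]]
    using NAt_VComp[OF 1] NAt_VComp[OF 2] NAt_whisker_left[OF T2_action_cells(2), of a P]
      NAt_whisker_right[OF action_records(8), of _ "comma_proj (comma_proj (comma_proj P))"] a action_mors
    by (simp add: action_records slice_record slice_simps)
qed

end

section \<open>Componentwise form of the equations for morphisms and transformations\<close>

context
  fixes B :: "'u::universe cat" and P a \<iota>a \<chi>a Q b \<iota>b \<chi>b f fbar
  assumes P: "P \<in> Obj (slice CAT B)"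
    and a: "a \<in> mor (slice CAT B) (comma_proj P) P"
    and \<iota>a: "\<iota>a \<in> cell (slice CAT B) (Id1 (slice CAT B) P) (Comp1 (slice CAT B) a (Unit comma_2monad P))"
    and \<chi>a: "\<chi>a \<in> cell (slice CAT B) (Comp1 (slice CAT B) a (T1 comma_2monad a))
      (Comp1 (slice CAT B) a (Mult comma_2monad P))"
    and Q: "Q \<in> Obj (slice CAT B)"
    and b: "b \<in> mor (slice CAT B) (comma_proj Q) Q"
    and \<iota>b: "\<iota>b \<in> cell (slice CAT B) (Id1 (slice CAT B) Q) (Comp1 (slice CAT B) b (Unit comma_2monad Q))"
    and \<chi>b: "\<chi>b \<in> cell (slice CAT B) (Comp1 (slice CAT B) b (T1 comma_2monad b))
      (Comp1 (slice CAT B) b (Mult comma_2monad Q))"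
    and f: "f \<in> mor (slice CAT B) P Q"
    and fbar: "fbar \<in> cell (slice CAT B) (Comp1 (slice CAT B) b (T1 comma_2monad f)) (Comp1 (slice CAT B) f a)"
begin

interpretation M: monad_on_two_category "slice CAT B" "comma_2monad :: ('u func, _, _) twomonad"
  by (rule comma_monad_on_slice)

lemmas act_mors_T0 = act_mor_T0[OF P a \<iota>a \<chi>a] act_mor_T0[OF Q b \<iota>b \<chi>b]
lemmas lax_morphism_typing = P act_mors_T0(1) \<iota>a \<chi>a Q act_mors_T0(2) \<iota>b \<chi>b f fbar
lemmas actions_records = action_records[OF P a \<iota>a \<chi>a] action_records[OF Q b \<iota>b \<chi>b]
lemmas lax_morphism_mors = action_mors[OF P a \<iota>a \<chi>a] action_mors[OF Q b \<iota>b \<chi>b] M.T1_mors[OF lax_morphism_typing, simplified]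

lemma lax_morphism_records: "bsrc f = P" "btrg f = Q" "bsrc fbar = comma_proj P" "btrg fbar = Q" "fbar \<in> Cell (slice CAT B)"
  using a b f fbar by (auto simp: mor_iff cell_iff slice_simps)

lemma Str_unit_iff:
  "VComp (slice CAT B) (whisker_right (slice CAT B) fbar (Unit comma_2monad P)) (whisker_right (slice CAT B) \<iota>b f)
      = whisker_left (slice CAT B) f \<iota>a \<longleftrightarrow>
    (\<forall>x \<in> Ob (FDom P). Cmp (FDom Q) (NAt (body fbar) (FOb (comma_unit P) x)) (NAt (body \<iota>b) (FOb (body f) x))
      = FAr (body f) (NAt (body \<iota>a) x))"
proof -
  have 1: "whisker_right (slice CAT B) \<iota>b f \<in> Cell (slice CAT B)"
    using slice.whisker_right_cell[OF \<iota>b M.pasting_mors(9)[OF Q act_mors_T0(2) \<iota>b \<chi>b] f] by (simp add: cell_iff)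
  show ?thesis
    unfolding slice_cell_eq_iff[OF M.Str_unit_cells[OF lax_morphism_typing]]
    using NAt_VComp[OF 1] NAt_whisker_left[OF actions_records(7), of f Q] NAt_whisker_right[OF lax_morphism_records(5), of _ P]
      NAt_whisker_right[OF actions_records(15), of f P] f lax_morphism_mors
    by (simp add: actions_records lax_morphism_records slice_record)
qed

text \<open>For \<open>Z = ((x, u), v)\<close> the left side multiplies in the target and applies
  \<open>fbar\<close> once, at \<open>(x, v u)\<close>. The right side applies \<open>fbar\<close>
  at \<open>(x, u)\<close> inside the action, then at \<open>(a (x, u), v)\<close>, and multiplies
  in the source last.\<close>

lemma Str_mult_iff:
  "VComp (slice CAT B) (whisker_right (slice CAT B) fbar (Mult comma_2monad P))
      (whisker_right (slice CAT B) \<chi>b (T1 comma_2monad (T1 comma_2monad f)))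
    = VComp (slice CAT B) (whisker_left (slice CAT B) f \<chi>a)
        (VComp (slice CAT B) (whisker_right (slice CAT B) fbar (T1 comma_2monad a))
          (whisker_left (slice CAT B) b (T2 comma_2monad fbar))) \<longleftrightarrow>
    (\<forall>Z \<in> comma_Ob (comma_proj P).
      Cmp (FDom Q) (NAt (body fbar) (FOb (comma_mult P) Z))
        (NAt (body \<chi>b) (FOb (comma_func (comma_proj P) (comma_func P (body f) Q) (comma_proj Q)) Z))
      = Cmp (FDom Q) (FAr (body f) (NAt (body \<chi>a) Z))
          (Cmp (FDom Q) (NAt (body fbar) (FOb (comma_func (comma_proj P) (body a) P) Z))
            (FAr (body b) (NAt (comma_nat (comma_proj P) (body fbar) Q) Z))))"
proof -
  have 1: "whisker_right (slice CAT B) \<chi>b (T1 comma_2monad (T1 comma_2monad f)) \<in> Cell (slice CAT B)"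
    using slice.whisker_right_cell[OF \<chi>b M.pasting_mors(11)[OF Q act_mors_T0(2) \<iota>b \<chi>b] M.T1_mors(2)[OF lax_morphism_typing]] by (simp add: cell_iff)
  have 2: "VComp (slice CAT B) (whisker_right (slice CAT B) fbar (T1 comma_2monad a))
      (whisker_left (slice CAT B) b (T2 comma_2monad fbar)) \<in> Cell (slice CAT B)"
    using M.Str_mult_cells(3)[OF lax_morphism_typing] by (simp add: cell_iff)
  have 3: "whisker_left (slice CAT B) b (T2 comma_2monad fbar) \<in> Cell (slice CAT B)"
    using slice.whisker_left_cell[OF M.Endo.F2_cell[OF fbar] M.Endo.F1_mor[OF M.T1_mors(3)[OF lax_morphism_typing]] act_mors_T0(2)]
    by (simp add: cell_iff)
  have 4: "T2 comma_2monad fbar \<in> Cell (slice CAT B)"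
    using M.Endo.F2_cell[OF fbar] by (simp add: cell_iff)
  show ?thesis
    unfolding slice_cell_eq_iff[OF M.Str_mult_cells(1,2)[OF lax_morphism_typing]]
    using NAt_VComp[OF 1] NAt_VComp[OF 2] NAt_VComp[OF 3] NAt_whisker_left[OF actions_records(8), of f Q]
      NAt_whisker_left[OF 4, of b Q]
      NAt_whisker_right[OF lax_morphism_records(5), of _ "comma_proj (comma_proj P)"]
      NAt_whisker_right[OF actions_records(16), of _ "comma_proj (comma_proj P)"] f b lax_morphism_mors
    by (simp add: actions_records lax_morphism_records slice_record slice_simps)
qed

lemma CUnd_iff:
  assumes \<alpha>: "\<alpha> \<in> cell (slice CAT B) f g"
    and gbar: "gbar \<in> cell (slice CAT B) (Comp1 (slice CAT B) b (T1 comma_2monad g)) (Comp1 (slice CAT B) g a)"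
  shows "VComp (slice CAT B) (whisker_right (slice CAT B) \<alpha> a) fbar
      = VComp (slice CAT B) gbar (whisker_left (slice CAT B) b (T2 comma_2monad \<alpha>)) \<longleftrightarrow>
    (\<forall>X \<in> comma_Ob P. Cmp (FDom Q) (NAt (body \<alpha>) (FOb (body a) X)) (NAt (body fbar) X)
      = Cmp (FDom Q) (NAt (body gbar) X) (FAr (body b) (NAt (comma_nat P (body \<alpha>) Q) X)))"
proof -
  have r: "\<alpha> \<in> Cell (slice CAT B)" "bsrc \<alpha> = P" "btrg \<alpha> = Q"
    using slice_cellD[OF \<alpha>] lax_morphism_records by simp_all
  have 1: "whisker_left (slice CAT B) b (T2 comma_2monad \<alpha>) \<in> Cell (slice CAT B)"
    using slice.whisker_left_cell[OF M.Endo.F2_cell[OF \<alpha>] M.T1_mors(1)[OF lax_morphism_typing] act_mors_T0(2)] by (simp add: cell_iff)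
  have 2: "T2 comma_2monad \<alpha> \<in> Cell (slice CAT B)"
    using M.Endo.F2_cell[OF \<alpha>] by (simp add: cell_iff)
  show ?thesis
    unfolding slice_cell_eq_iff[OF M.CUnd_cells[OF lax_morphism_typing \<alpha> gbar]]
    using NAt_VComp[OF 1] NAt_VComp[OF lax_morphism_records(5)] NAt_whisker_left[OF 2, of b Q]
      NAt_whisker_right[OF r(1), of a "comma_proj P"] a b
    by (simp add: actions_records lax_morphism_records r slice_record slice_simps)
qed

lemma NAt_comp_Str:
  assumes g: "g \<in> mor (slice CAT B) Q R" and c: "c \<in> mor (slice CAT B) (comma_proj R) R"
    and gbar: "gbar \<in> cell (slice CAT B) (Comp1 (slice CAT B) c (T1 comma_2monad g)) (Comp1 (slice CAT B) g b)"
    and X: "X \<in> comma_Ob P"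
  shows "NAt (body (VComp (slice CAT B) (whisker_left (slice CAT B) g fbar)
      (whisker_right (slice CAT B) gbar (T1 comma_2monad f)))) X
    = Cmp (FDom R) (FAr (body g) (NAt (body fbar) X)) (NAt (body gbar) (FOb (comma_func P (body f) Q) X))"
proof -
  have r: "gbar \<in> Cell (slice CAT B)" "bsrc gbar = comma_proj Q" "btrg gbar = R"
    using slice_cellD[OF gbar] g c by (simp_all add: slice_simps mor_iff)
  have gc: "Comp1 (slice CAT B) c (T1 comma_2monad g) \<in> mor (slice CAT B) (comma_proj Q) R"
    using slice.Comp1_mor[OF M.Endo.F1_mor[OF g], of c R] c by simp
  have 1: "whisker_right (slice CAT B) gbar (T1 comma_2monad f) \<in> Cell (slice CAT B)"
    using slice.whisker_right_cell[OF gbar gc, of "T1 comma_2monad f"] lax_morphism_mors by (simp add: cell_iff)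
  show ?thesis
    using NAt_VComp[OF 1] NAt_whisker_left[OF lax_morphism_records(5), of g R]
      NAt_whisker_right[OF r(1), of "T1 comma_2monad f" "comma_proj P"] g lax_morphism_mors X
    by (simp add: lax_morphism_records r slice_record)
qed

end

section \<open>Cocartesian arrows\<close>

text \<open>The mediating arrow out of \<open>e\<close>. The description is meaningful for
  cocartesian \<open>e\<close> and \<open>g\<close> over \<open>v\<close> after the image of
  \<open>e\<close>; the codomain is read off from \<open>g\<close>.\<close>

definition fill :: "'u func \<Rightarrow> 'u \<Rightarrow> 'u \<Rightarrow> 'u \<Rightarrow> 'u" where
  "fill P e g v = (THE h. h \<in> hom (FDom P) (Cod (FDom P) e) (Cod (FDom P) g) \<and>
    Cmp (FDom P) h e = g \<and> FAr P h = v)"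

lemma cocartesian_Ar: "cocartesian P e \<Longrightarrow> e \<in> Ar (FDom P)"
  by (simp add: cocartesian_def)

lemma fill:
  assumes "cocartesian P e" "g \<in> Ar (FDom P)" "Dom (FDom P) g = Dom (FDom P) e" "v \<in> Ar (FCod P)"
    "Dom (FCod P) v = FOb P (Cod (FDom P) e)" "Cod (FCod P) v = FOb P (Cod (FDom P) g)"
    "FAr P g = Cmp (FCod P) v (FAr P e)"
  shows "fill P e g v \<in> Ar (FDom P)" "Dom (FDom P) (fill P e g v) = Cod (FDom P) e"
    "Cod (FDom P) (fill P e g v) = Cod (FDom P) g" "Cmp (FDom P) (fill P e g v) e = g"
    "FAr P (fill P e g v) = v"
proof -
  have "\<exists>!h. h \<in> hom (FDom P) (Cod (FDom P) e) (Cod (FDom P) g) \<and> Cmp (FDom P) h e = g \<and> FAr P h = v"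
    using assms unfolding cocartesian_def hom_iff by blast
  from theI'[OF this] show "fill P e g v \<in> Ar (FDom P)" "Dom (FDom P) (fill P e g v) = Cod (FDom P) e"
    "Cod (FDom P) (fill P e g v) = Cod (FDom P) g" "Cmp (FDom P) (fill P e g v) e = g"
    "FAr P (fill P e g v) = v"
    unfolding fill_def hom_iff by auto
qed

lemma cocartesian_cancel:
  assumes "is_functor P" "cocartesian P e" "h \<in> Ar (FDom P)" "k \<in> Ar (FDom P)"
    "Dom (FDom P) h = Cod (FDom P) e" "Dom (FDom P) k = Cod (FDom P) e" "Cod (FDom P) h = Cod (FDom P) k"
    "FAr P h = FAr P k" "Cmp (FDom P) h e = Cmp (FDom P) k e"
  shows "h = k"
proof -
  let ?g = "Cmp (FDom P) k e"
  have e: "e \<in> Ar (FDom P)" by (rule cocartesian_Ar[OF assms(2)])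
  have g: "?g \<in> Ar (FDom P)" "Dom (FDom P) ?g = Dom (FDom P) e" "Cod (FDom P) ?g = Cod (FDom P) k"
    "FAr P ?g = Cmp (FCod P) (FAr P k) (FAr P e)"
    "FAr P k \<in> hom (FCod P) (FOb P (Cod (FDom P) e)) (FOb P (Cod (FDom P) ?g))"
    using assms e by (simp_all add: hom_iff)
  have "\<exists>!h. h \<in> hom (FDom P) (Cod (FDom P) e) (Cod (FDom P) ?g) \<and> Cmp (FDom P) h e = ?g \<and> FAr P h = FAr P k"
    using assms(2) g unfolding cocartesian_def by blast
  moreover have "h \<in> hom (FDom P) (Cod (FDom P) e) (Cod (FDom P) ?g)" "k \<in> hom (FDom P) (Cod (FDom P) e) (Cod (FDom P) ?g)"
    using assms g by (simp_all add: hom_iff)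
  ultimately show ?thesis using assms by blast
qed

text \<open>Uniqueness is phrased as cancellation between two arrows with the same image, the form
  in which it can be verified without naming \<open>g\<close>.\<close>

lemma cocartesianI:
  assumes "e \<in> Ar (FDom P)"
    and ex: "\<And>g v. \<lbrakk>g \<in> Ar (FDom P); Dom (FDom P) g = Dom (FDom P) e; v \<in> Ar (FCod P);
      Dom (FCod P) v = FOb P (Cod (FDom P) e); Cod (FCod P) v = FOb P (Cod (FDom P) g);
      FAr P g = Cmp (FCod P) v (FAr P e)\<rbrakk> \<Longrightarrow>
      \<exists>h. h \<in> Ar (FDom P) \<and> Dom (FDom P) h = Cod (FDom P) e \<and> Cod (FDom P) h = Cod (FDom P) g \<and>
        Cmp (FDom P) h e = g \<and> FAr P h = v"
    and uniq: "\<And>h k. \<lbrakk>h \<in> Ar (FDom P); k \<in> Ar (FDom P); Dom (FDom P) h = Cod (FDom P) e;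
      Dom (FDom P) k = Cod (FDom P) e; Cod (FDom P) h = Cod (FDom P) k; FAr P h = FAr P k;
      Cmp (FDom P) h e = Cmp (FDom P) k e\<rbrakk> \<Longrightarrow> h = k"
  shows "cocartesian P e"
  unfolding cocartesian_def
proof (intro conjI allI impI)
  fix g v
  assume "g \<in> Ar (FDom P) \<and> Dom (FDom P) g = Dom (FDom P) e \<and>
    v \<in> hom (FCod P) (FOb P (Cod (FDom P) e)) (FOb P (Cod (FDom P) g)) \<and>
    FAr P g = Cmp (FCod P) v (FAr P e)"
  then have "\<exists>h. h \<in> Ar (FDom P) \<and> Dom (FDom P) h = Cod (FDom P) e \<and> Cod (FDom P) h = Cod (FDom P) g \<and>
        Cmp (FDom P) h e = g \<and> FAr P h = v"
    by (intro ex) (auto simp: hom_iff)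
  then show "\<exists>!h. h \<in> hom (FDom P) (Cod (FDom P) e) (Cod (FDom P) g) \<and> Cmp (FDom P) h e = g \<and> FAr P h = v"
    using uniq unfolding hom_iff by (metis (no_types, lifting))
qed (fact assms(1))

text \<open>A filler is found through \<open>e\<close> first, over \<open>v\<close> after the image
  of \<open>d\<close>, and then through \<open>d\<close> over \<open>v\<close>; uniqueness cancels
  \<open>e\<close> and then \<open>d\<close>.\<close>

lemma cocartesian_Cmp:
  assumes P: "is_functor P" and e: "cocartesian P e" and d: "cocartesian P d" and c: "Dom (FDom P) d = Cod (FDom P) e"
  shows "cocartesian P (Cmp (FDom P) d e)"
proof (rule cocartesianI)
  note ar = cocartesian_Ar[OF e] cocartesian_Ar[OF d]
  show "Cmp (FDom P) d e \<in> Ar (FDom P)" using P ar c by simp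
  fix g v
  assume g: "g \<in> Ar (FDom P)" "Dom (FDom P) g = Dom (FDom P) (Cmp (FDom P) d e)" "v \<in> Ar (FCod P)"
    "Dom (FCod P) v = FOb P (Cod (FDom P) (Cmp (FDom P) d e))" "Cod (FCod P) v = FOb P (Cod (FDom P) g)"
    "FAr P g = Cmp (FCod P) v (FAr P (Cmp (FDom P) d e))"
  obtain h where h: "h \<in> Ar (FDom P)" "Dom (FDom P) h = Cod (FDom P) e" "Cod (FDom P) h = Cod (FDom P) g"
    "Cmp (FDom P) h e = g" "FAr P h = Cmp (FCod P) v (FAr P d)"
    using g P ar c fill[OF e, of g "Cmp (FCod P) v (FAr P d)"] by (simp add: Cmp_assoc_r)
  obtain k where k: "k \<in> Ar (FDom P)" "Dom (FDom P) k = Cod (FDom P) d" "Cod (FDom P) k = Cod (FDom P) h"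
    "Cmp (FDom P) k d = h" "FAr P k = v"
    using g P ar c h fill[OF d, of h v] by simp
  have "Cmp (FDom P) k (Cmp (FDom P) d e) = g"
    using Cmp_assoc_r[of "FDom P" e d k] h k P ar c by simp
  then show "\<exists>h. h \<in> Ar (FDom P) \<and> Dom (FDom P) h = Cod (FDom P) (Cmp (FDom P) d e) \<and>
      Cod (FDom P) h = Cod (FDom P) g \<and> Cmp (FDom P) h (Cmp (FDom P) d e) = g \<and> FAr P h = v"
    using h k P ar c by (intro exI[of _ k]) simp
next
  note ar = cocartesian_Ar[OF e] cocartesian_Ar[OF d]
  fix h k
  assume h: "h \<in> Ar (FDom P)" "k \<in> Ar (FDom P)" "Dom (FDom P) h = Cod (FDom P) (Cmp (FDom P) d e)"
      "Dom (FDom P) k = Cod (FDom P) (Cmp (FDom P) d e)" "Cod (FDom P) h = Cod (FDom P) k" "FAr P h = FAr P k"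
      "Cmp (FDom P) h (Cmp (FDom P) d e) = Cmp (FDom P) k (Cmp (FDom P) d e)"
  have "Cmp (FDom P) h d = Cmp (FDom P) k d"
    by (rule cocartesian_cancel[OF P e]) (use h P ar c in \<open>simp_all add: Cmp_assoc_r\<close>)
  with h P ar c show "h = k"
    by - (rule cocartesian_cancel[OF P d], simp_all)
qed

lemma cocartesian_iso:
  assumes P: "is_functor P" and i: "inverse_arrows (FDom P) e d"
  shows "cocartesian P e"
proof (rule cocartesianI)
  note iD = inverse_arrowsD[OF i]
  show "e \<in> Ar (FDom P)" by (rule iD)
  fix g v
  assume g: "g \<in> Ar (FDom P)" "Dom (FDom P) g = Dom (FDom P) e" "v \<in> Ar (FCod P)"
    "Dom (FCod P) v = FOb P (Cod (FDom P) e)" "FAr P g = Cmp (FCod P) v (FAr P e)"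
  have "Cmp (FCod P) (Cmp (FCod P) v (FAr P e)) (FAr P d) = v"
    by (rule inverse_arrows_cancel_r[OF _ inverse_arrows_FAr[OF P i]]) (use P g iD in simp_all)
  moreover have "Cmp (FDom P) (Cmp (FDom P) g d) e = g"
    by (rule inverse_arrows_cancel_r[OF _ inverse_arrows_sym[OF i]]) (use P g iD in simp_all)
  ultimately show "\<exists>h. h \<in> Ar (FDom P) \<and> Dom (FDom P) h = Cod (FDom P) e \<and> Cod (FDom P) h = Cod (FDom P) g \<and>
      Cmp (FDom P) h e = g \<and> FAr P h = v"
    using P g iD by (intro exI[of _ "Cmp (FDom P) g d"]) simp
next
  fix h k
  note iD = inverse_arrowsD[OF i]
  assume h: "h \<in> Ar (FDom P)" "k \<in> Ar (FDom P)" "Dom (FDom P) h = Cod (FDom P) e"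
      "Dom (FDom P) k = Cod (FDom P) e" "Cmp (FDom P) h e = Cmp (FDom P) k e"
  show "h = k"
    using inverse_arrows_cancel_r[OF functor_category(1)[OF P] i h(1,3)]
      inverse_arrows_cancel_r[OF functor_category(1)[OF P] i h(2,4)] h(5) by metis
qed

text \<open>Each round trip of the two fillers lies over an identity and fixes a cocartesian arrow,
  so cancellation makes it an identity.\<close>

lemma cocartesian_comparison:
  assumes P: "is_functor P" and e: "cocartesian P e" and d: "cocartesian P d"
    and eq: "Dom (FDom P) e = Dom (FDom P) d" "FAr P e = FAr P d"
  shows "inverse_arrows (FDom P) (fill P e d (Idn (FCod P) (FOb P (Cod (FDom P) e))))
    (fill P d e (Idn (FCod P) (FOb P (Cod (FDom P) d))))"
proof -
  let ?E = "FDom P" and ?B = "FCod P"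
  let ?b = "FOb P (Cod ?E e)"
  note ar = cocartesian_Ar[OF e] cocartesian_Ar[OF d]
  have b: "FOb P (Cod ?E d) = ?b" using Cod_FAr[OF P refl ar(1)] Cod_FAr[OF P refl ar(2)] eq by simp
  let ?h = "fill P e d (Idn ?B ?b)" and ?k = "fill P d e (Idn ?B ?b)"
  have ib: "Cmp ?B (Idn ?B ?b) (FAr P e) = FAr P e" "Cmp ?B (Idn ?B ?b) (FAr P d) = FAr P d"
    using P ar b eq by simp_all
  have h: "?h \<in> Ar ?E" "Dom ?E ?h = Cod ?E e" "Cod ?E ?h = Cod ?E d" "Cmp ?E ?h e = d" "FAr P ?h = Idn ?B ?b"
    using P ar b eq ib by (auto intro!: fill[OF e])
  have k: "?k \<in> Ar ?E" "Dom ?E ?k = Cod ?E d" "Cod ?E ?k = Cod ?E e" "Cmp ?E ?k d = e" "FAr P ?k = Idn ?B ?b"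
    using P ar b eq ib by (auto intro!: fill[OF d])
  have "Cmp ?E ?k ?h = Idn ?E (Cod ?E e)"
    by (rule cocartesian_cancel[OF P e]) (use P ar h k b in \<open>simp_all add: Cmp_assoc_r\<close>)
  moreover have "Cmp ?E ?h ?k = Idn ?E (Cod ?E d)"
    by (rule cocartesian_cancel[OF P d]) (use P ar h k b in \<open>simp_all add: Cmp_assoc_r\<close>)
  ultimately show ?thesis
    using h k b by (simp add: inverse_arrows_def)
qed

lemma cocartesian_factor:
  assumes P: "is_functor P" and e: "cocartesian P e" and d: "cocartesian P d"
    and eq: "Dom (FDom P) e = Dom (FDom P) d" "FAr P e = FAr P d"
  obtains i j where "inverse_arrows (FDom P) i j" "Dom (FDom P) i = Cod (FDom P) e" "Cmp (FDom P) i e = d"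
proof -
  let ?E = "FDom P" and ?B = "FCod P"
  let ?b = "FOb P (Cod ?E e)"
  note ar = cocartesian_Ar[OF e] cocartesian_Ar[OF d]
  have b: "FOb P (Cod ?E d) = ?b" using Cod_FAr[OF P refl ar(1)] Cod_FAr[OF P refl ar(2)] eq by simp
  have "FAr P d = Cmp ?B (Idn ?B ?b) (FAr P e)" using P ar b eq by simp
  then have "Dom ?E (fill P e d (Idn ?B ?b)) = Cod ?E e" "Cmp ?E (fill P e d (Idn ?B ?b)) e = d"
    using P ar b eq by (auto intro!: fill[OF e])
  then show thesis using that cocartesian_comparison[OF assms] by blast
qed


section \<open>The pseudoalgebra of a cloven cofibration\<close>

definition act_func :: "'u::universe func \<Rightarrow> ('u \<Rightarrow> 'u \<Rightarrow> 'u) \<Rightarrow> 'u func" where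
  "act_func P \<delta> = \<lparr>FDom = comma_cat P, FCod = FDom P,
    FOb = (\<lambda>X \<in> comma_Ob P. Cod (FDom P) (\<delta> (ufst X) (usnd X))),
    FAr = (\<lambda>a \<in> comma_Ar P. fill P (\<delta> (ufst (cm_src a)) (usnd (cm_src a)))
      (Cmp (FDom P) (\<delta> (ufst (cm_trg a)) (usnd (cm_trg a))) (cm_fst a)) (cm_snd a))\<rparr>"

definition lift_unit :: "'u::universe func \<Rightarrow> ('u \<Rightarrow> 'u \<Rightarrow> 'u) \<Rightarrow> 'u nattr" where
  "lift_unit P \<delta> = \<lparr>NDom = id_func (FDom P), NCod = comp_func (act_func P \<delta>) (comma_unit P),
    NAt = (\<lambda>x \<in> Ob (FDom P). \<delta> x (Idn (FCod P) (FOb P x)))\<rparr>"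

definition lift_mult :: "'u::universe func \<Rightarrow> ('u \<Rightarrow> 'u \<Rightarrow> 'u) \<Rightarrow> 'u nattr" where
  "lift_mult P \<delta> = \<lparr>NDom = comp_func (act_func P \<delta>) (comma_func (comma_proj P) (act_func P \<delta>) P),
    NCod = comp_func (act_func P \<delta>) (comma_mult P),
    NAt = (\<lambda>Z \<in> comma_Ob (comma_proj P).
      let X = ufst Z; d = \<delta> (ufst X) (usnd X)
      in fill P (Cmp (FDom P) (\<delta> (Cod (FDom P) d) (usnd Z)) d) (\<delta> (ufst X) (Cmp (FCod P) (usnd Z) (usnd X)))
        (Idn (FCod P) (Cod (FCod P) (usnd Z))))\<rparr>"

definition lift_psalg :: "'u::universe clcofib
    \<Rightarrow> ('u func, ('u func, 'u func) between, ('u func, 'u nattr) between) psalg" where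
  "lift_psalg C = (let P = Proj C; \<delta> = Lift C in
    \<lparr>Carrier = P,
     Act = \<lparr>bsrc = comma_proj P, body = act_func P \<delta>, btrg = P\<rparr>,
     UnitC = \<lparr>bsrc = P, body = lift_unit P \<delta>, btrg = P\<rparr>,
     MultC = \<lparr>bsrc = comma_proj (comma_proj P), body = lift_mult P \<delta>, btrg = P\<rparr>\<rparr>)"

locale cloven =
  fixes P :: "'u::universe func" and \<delta> :: "'u \<Rightarrow> 'u \<Rightarrow> 'u"
  assumes P: "is_functor P" and cleavage: "cleavage P \<delta>"
begin

abbreviation "E \<equiv> FDom P"
abbreviation "B \<equiv> FCod P"
abbreviation "L \<equiv> act_func P \<delta>"
abbreviation "C \<equiv> comma_proj P"
abbreviation comp (infixr "\<cdot>" 70) where "g \<cdot> f \<equiv> Cmp E g f"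

lemma lift [simp]:
  assumes "x \<in> Ob E" "u \<in> Ar B" "Dom B u = FOb P x"
  shows "\<delta> x u \<in> Ar E" "Dom E (\<delta> x u) = x" "FAr P (\<delta> x u) = u" "cocartesian P (\<delta> x u)"
    "FOb P (Cod E (\<delta> x u)) = Cod B u"
proof -
  show *: "cocartesian P (\<delta> x u)" "Dom E (\<delta> x u) = x" "FAr P (\<delta> x u) = u"
    using cleavage assms unfolding cleavage_def liftable_def by blast+
  from *(1) show "\<delta> x u \<in> Ar E" by (rule cocartesian_Ar)
  from Cod_FAr[OF P refl this] *(3) show "FOb P (Cod E (\<delta> x u)) = Cod B u" by simp
qed

lemma L_simps [simp]:
  "FDom L = comma_cat P" "FCod L = E"
  "X \<in> comma_Ob P \<Longrightarrow> FOb L X = Cod E (\<delta> (ufst X) (usnd X))"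
  by (simp_all add: act_func_def)

lemma L_ext: "FOb L \<in> extensional (comma_Ob P)" "FAr L \<in> extensional (comma_Ar P)"
  by (simp_all add: act_func_def)

lemma
  assumes a: "a \<in> comma_Ar P"
  shows L_Ar [simp]: "FAr L a \<in> Ar E" "Dom E (FAr L a) = Cod E (\<delta> (ufst (cm_src a)) (usnd (cm_src a)))"
    "Cod E (FAr L a) = Cod E (\<delta> (ufst (cm_trg a)) (usnd (cm_trg a)))" "FAr P (FAr L a) = cm_snd a"
  and L_lift: "FAr L a \<cdot> \<delta> (ufst (cm_src a)) (usnd (cm_src a)) = \<delta> (ufst (cm_trg a)) (usnd (cm_trg a)) \<cdot> cm_fst a"
  using a P comma_square[OF a]
    fill[OF lift(4), of "ufst (cm_src a)" "usnd (cm_src a)" "\<delta> (ufst (cm_trg a)) (usnd (cm_trg a)) \<cdot> cm_fst a" "cm_snd a"]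
  by (simp_all add: act_func_def)

text \<open>Cancelling the lift at the source makes the defining equation of the action
  characteristic. Functoriality and the uniqueness of the induced action both come down to this
  test.\<close>

lemma L_eqI:
  assumes a: "a \<in> comma_Ar P" and h: "h \<in> Ar E" "Dom E h = Cod E (\<delta> (ufst (cm_src a)) (usnd (cm_src a)))"
    "Cod E h = Cod E (\<delta> (ufst (cm_trg a)) (usnd (cm_trg a)))" "FAr P h = cm_snd a"
    "h \<cdot> \<delta> (ufst (cm_src a)) (usnd (cm_src a)) = \<delta> (ufst (cm_trg a)) (usnd (cm_trg a)) \<cdot> cm_fst a"
  shows "FAr L a = h"
  by (rule cocartesian_cancel[OF P lift(4), of "ufst (cm_src a)" "usnd (cm_src a)"])
    (use a h in \<open>simp_all add: L_lift\<close>)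

lemma is_functor_L [simp]: "is_functor L"
proof (rule is_functorI, goal_cases)
  case (7 X)
  then show ?case using P by - (rule L_eqI, simp_all)
next
  case (8 a b)
  then have ab: "a \<in> comma_Ar P" "b \<in> comma_Ar P" "cm_src a = cm_trg b" by auto
  let ?ds = "\<delta> (ufst (cm_src b)) (usnd (cm_src b))"
    and ?dm = "\<delta> (ufst (cm_trg b)) (usnd (cm_trg b))"
    and ?dt = "\<delta> (ufst (cm_trg a)) (usnd (cm_trg a))"
  have 1: "FAr L b \<cdot> ?ds = ?dm \<cdot> cm_fst b" "FAr L a \<cdot> ?dm = ?dt \<cdot> cm_fst a"
    using L_lift[OF ab(2)] L_lift[OF ab(1)] ab by simp_all
  have "(FAr L a \<cdot> FAr L b) \<cdot> ?ds = FAr L a \<cdot> ?dm \<cdot> cm_fst b"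
    using P ab by (simp add: Cmp_assoc_r 1)
  also have "\<dots> = (FAr L a \<cdot> ?dm) \<cdot> cm_fst b"
    using P ab by (simp add: Cmp_assoc_r)
  also have "\<dots> = ?dt \<cdot> cm_fst a \<cdot> cm_fst b"
    unfolding 1 using P ab by (simp add: Cmp_assoc_r)
  finally show ?case
    using P ab comma_Cmp_Ar[OF P ab(2,1)] by (simp add: L_eqI)
qed (use P in \<open>simp_all add: L_ext\<close>)

lemma fun_over_L: "fun_over C L P"
  using P by (intro fun_overI) simp_all

abbreviation "\<iota> \<equiv> NAt (lift_unit P \<delta>)"
abbreviation "\<chi> \<equiv> NAt (lift_mult P \<delta>)"

lemma unit_simps [simp]:
  "NDom (lift_unit P \<delta>) = id_func E" "NCod (lift_unit P \<delta>) = comp_func L (comma_unit P)"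
  "x \<in> Ob E \<Longrightarrow> \<iota> x = \<delta> x (Idn B (FOb P x))"
  by (simp_all add: lift_unit_def)

lemma fun_over_id: "fun_over P (id_func E) P"
  using P by (intro fun_overI) simp_all

text \<open>Naturality at \<open>f\<close> is the defining equation of the action at the comma arrow
  \<open>(f, P f)\<close> between the lifts of identities.\<close>

lemma nat_over_unit: "nat_over P (lift_unit P \<delta>) P"
proof -
  have *: "natural_transformation (lift_unit P \<delta>)"
  proof (rule natural_transformationI, goal_cases)
    case (7 f)
    then show ?case
      using P L_lift[of "FAr (comma_unit P) f"] by simp
  qed (use P in \<open>simp_all add: lift_unit_def\<close>)
  show ?thesis
    unfolding nat_over_def
    using P * fun_over_id fun_over_comp[OF P _ P fun_over_comma_unit[OF P] fun_over_L] by simp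
qed

lemma mult_simps [simp]:
  "NDom (lift_mult P \<delta>) = comp_func L (comma_func C L P)" "NCod (lift_mult P \<delta>) = comp_func L (comma_mult P)"
  by (simp_all add: lift_mult_def)

lemma mult_ext: "\<chi> \<in> extensional (comma_Ob C)"
  by (simp add: lift_mult_def)

abbreviation lift2 where
  "lift2 Z \<equiv> \<delta> (Cod E (\<delta> (ufst (ufst Z)) (usnd (ufst Z)))) (usnd Z) \<cdot> \<delta> (ufst (ufst Z)) (usnd (ufst Z))"

abbreviation lift_comp where
  "lift_comp Z \<equiv> \<delta> (ufst (ufst Z)) (Cmp B (usnd Z) (usnd (ufst Z)))"

text \<open>The two-step lift is the arrow against which equations about \<chi> are tested.\<close>

lemma lift2:
  assumes "Z \<in> comma_Ob C"
  shows "cocartesian P (lift2 Z)" "FAr P (lift2 Z) = Cmp B (usnd Z) (usnd (ufst Z))"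
  using assms P by (auto intro!: cocartesian_Cmp)

lemma
  assumes Z: "Z \<in> comma_Ob C"
  shows mult [simp]: "\<chi> Z \<in> Ar E"
    "Dom E (\<chi> Z) = Cod E (\<delta> (Cod E (\<delta> (ufst (ufst Z)) (usnd (ufst Z)))) (usnd Z))"
    "Cod E (\<chi> Z) = Cod E (lift_comp Z)" "FAr P (\<chi> Z) = Idn B (Cod B (usnd Z))"
  and mult_lift: "\<chi> Z \<cdot> lift2 Z = lift_comp Z"
proof -
  have *: "\<chi> Z = fill P (lift2 Z) (lift_comp Z) (Idn B (Cod B (usnd Z)))"
    using Z by (simp add: lift_mult_def Let_def)
  show "\<chi> Z \<in> Ar E"
    "Dom E (\<chi> Z) = Cod E (\<delta> (Cod E (\<delta> (ufst (ufst Z)) (usnd (ufst Z)))) (usnd Z))"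
    "Cod E (\<chi> Z) = Cod E (lift_comp Z)" "FAr P (\<chi> Z) = Idn B (Cod B (usnd Z))" "\<chi> Z \<cdot> lift2 Z = lift_comp Z"
    unfolding * using Z P fill[OF lift2(1)[OF Z], of "lift_comp Z" "Idn B (Cod B (usnd Z))"] by simp_all
qed

text \<open>The two-step lift and the one-step lift are cocartesian over the same composite, and
  \<chi> is their comparison.\<close>

lemma mult_iso: "Z \<in> comma_Ob C \<Longrightarrow> \<exists>k. inverse_arrows E (\<chi> Z) k"
  using cocartesian_comparison[OF P lift2(1) lift(4), of Z "ufst (ufst Z)" "Cmp B (usnd Z) (usnd (ufst Z))"] P
  by (auto simp: lift_mult_def Let_def)

text \<open>An identity arrow is cocartesian over an identity, so the chosen lift of that identity
  differs from it by an isomorphism, which is \<iota> itself.\<close>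

lemma unit_iso:
  assumes x: "x \<in> Ob E"
  shows "\<exists>k. inverse_arrows E (\<iota> x) k"
proof -
  have e: "cocartesian P (Idn E x)"
    by (rule cocartesian_iso[OF P, of _ "Idn E x"]) (use x P in \<open>simp add: inverse_arrows_def\<close>)
  obtain i j where ij: "inverse_arrows E i j" "Dom E i = x" "i \<cdot> Idn E x = \<iota> x"
    using cocartesian_factor[OF P e lift(4)[of x "Idn B (FOb P x)"]] x P by auto
  then show ?thesis using x P inverse_arrowsD[OF ij(1)] by auto
qed

text \<open>Against the two-step lift, both sides of the square become the one-step lift at the
  target after the innermost arrow: \<open>k1\<close> and \<open>k2\<close> move the action past one
  lift each, and \<open>k3\<close> does the same for the composite lift.\<close>

lemma nat_over_mult: "nat_over (comma_proj C) (lift_mult P \<delta>) P"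
proof -
  have CP: "is_functor C" "is_functor (comma_proj C)" using P by simp_all
  note cf = fun_over_comma_func[OF CP(1) P fun_over_L]
  note d = fun_over_comp[OF CP(2,1) P cf fun_over_L]
    and c = fun_over_comp[OF CP(2,1) P fun_over_comma_mult[OF P] fun_over_L]
  have *: "natural_transformation (lift_mult P \<delta>)"
  proof (rule natural_transformationI, goal_cases)
    case (7 a)
    then have a: "a \<in> comma_Ar C" by simp
    let ?Z = "cm_src a" and ?W = "cm_trg a"
    let ?du = "\<delta> (ufst (ufst ?Z)) (usnd (ufst ?Z))" and ?dw = "\<delta> (ufst (ufst ?W)) (usnd (ufst ?W))"
    let ?dv = "\<delta> (Cod E ?du) (usnd ?Z)" and ?dt = "\<delta> (Cod E ?dw) (usnd ?W)"
    define a1 a2 where "a1 = FAr L (FAr (comma_func C L P) a)" and "a2 = FAr L (FAr (comma_mult P) a)"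
    have m1: "FAr (comma_func C L P) a \<in> comma_Ar P" and m2: "FAr (comma_mult P) a \<in> comma_Ar P"
      using FAr_Ar[OF fun_overD(1)[OF cf], of "comma_cat P" a] FAr_Ar[OF is_functor_comma_mult[OF P], of "comma_cat P" a] a
      by simp_all
    have k1: "a1 \<cdot> ?dv = ?dt \<cdot> FAr L (cm_fst a)" using L_lift[OF m1, folded a1_def] a by simp
    have k2: "FAr L (cm_fst a) \<cdot> ?du = ?dw \<cdot> cm_fst (cm_fst a)" using L_lift[of "cm_fst a"] a by simp
    have k3: "a2 \<cdot> lift_comp ?Z = lift_comp ?W \<cdot> cm_fst (cm_fst a)" using L_lift[OF m2, folded a2_def] a by simp
    have t: "a1 \<in> Ar E" "Dom E a1 = Cod E ?dv" "Cod E a1 = Cod E ?dt" "FAr P a1 = cm_snd a"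
      "a2 \<in> Ar E" "Dom E a2 = Cod E (lift_comp ?Z)" "Cod E a2 = Cod E (lift_comp ?W)" "FAr P a2 = cm_snd a"
      using L_Ar[OF m1, folded a1_def] L_Ar[OF m2, folded a2_def] a by simp_all
    have "\<chi> ?W \<cdot> a1 = a2 \<cdot> \<chi> ?Z"
    proof (rule cocartesian_cancel[OF P lift2(1)[of ?Z]])
      have "(\<chi> ?W \<cdot> a1) \<cdot> ?dv \<cdot> ?du = \<chi> ?W \<cdot> (a1 \<cdot> ?dv) \<cdot> ?du"
        using P a t by (simp add: Cmp_assoc_r)
      also have "\<dots> = \<chi> ?W \<cdot> ?dt \<cdot> FAr L (cm_fst a) \<cdot> ?du"
        unfolding k1 using P a by (simp add: Cmp_assoc_r)
      also have "\<dots> = (\<chi> ?W \<cdot> lift2 ?W) \<cdot> cm_fst (cm_fst a)"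
        unfolding k2 using P a by (simp add: Cmp_assoc_r)
      also have "\<dots> = a2 \<cdot> \<chi> ?Z \<cdot> lift2 ?Z"
        using a by (simp add: mult_lift k3)
      also have "\<dots> = (a2 \<cdot> \<chi> ?Z) \<cdot> lift2 ?Z"
        using P a t by (simp add: Cmp_assoc_r)
      finally show "(\<chi> ?W \<cdot> a1) \<cdot> lift2 ?Z = (a2 \<cdot> \<chi> ?Z) \<cdot> lift2 ?Z" .
    qed (use P a t in simp_all)
    then show ?case using a P fun_overD(1)[OF cf] by (simp add: a1_def a2_def)
  qed (use P d c fun_overD(1)[OF d] fun_overD(1)[OF c] in \<open>simp_all add: mult_ext\<close>)
  show ?thesis
    unfolding nat_over_def using * d c P by simp
qed

text \<open>Against \<open>\<delta> x u\<close>, the action on \<open>(\<iota>_x, 1)\<close>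
  produces the two-step lift along \<open>1\<close> and \<open>u\<close>, which \<chi> contracts to
  the lift of \<open>u\<close> after \<open>1\<close>.\<close>

lemma unit_right_component:
  assumes X: "X \<in> comma_Ob P"
  shows "\<chi> (FOb (comma_func P (comma_unit P) C) X) \<cdot> FAr L (NAt (comma_nat P (lift_unit P \<delta>) P) X) = Idn E (FOb L X)"
proof -
  let ?x = "ufst X" and ?u = "usnd X"
  let ?d1 = "\<delta> ?x (Idn B (FOb P ?x))"
  let ?Z = "FOb (comma_func P (comma_unit P) C) X"
  define a where "a = NAt (comma_nat P (lift_unit P \<delta>) P) X"
  have nc: "nat_over C (comma_nat P (lift_unit P \<delta>) P) C" by (rule nat_over_comma_nat[OF P P nat_over_unit])
  have a: "a \<in> comma_Ar P" "cm_src a = X" "cm_trg a = upair (Cod E ?d1) ?u" "cm_fst a = ?d1"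
    "cm_snd a = Idn B (Cod B ?u)"
    unfolding a_def using X P nat_overD[OF nc] NAt_Ar[of "comma_nat P (lift_unit P \<delta>) P" "comma_cat P" X]
    by (simp_all add: upair_sel[of _ P])
  have Z: "?Z \<in> comma_Ob C" "ufst ?Z = upair ?x (Idn B (FOb P ?x))" "usnd ?Z = ?u" using X P by simp_all
  have 1: "FAr L a \<cdot> \<delta> ?x ?u = \<delta> (Cod E ?d1) ?u \<cdot> ?d1" using L_lift[OF a(1)] a by simp
  have 2: "\<chi> ?Z \<cdot> \<delta> (Cod E ?d1) ?u \<cdot> ?d1 = \<delta> ?x ?u" using mult_lift[OF Z(1)] Z(2,3) X P by simp
  have "(\<chi> ?Z \<cdot> FAr L a) \<cdot> \<delta> ?x ?u = \<chi> ?Z \<cdot> FAr L a \<cdot> \<delta> ?x ?u"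
    by (rule Cmp_assoc_r) (use P a X Z mult(1-3)[OF Z(1)] in simp_all)
  also have "\<dots> = Idn E (FOb L X) \<cdot> \<delta> ?x ?u" unfolding 1 2 using X P by simp
  finally have 3: "(\<chi> ?Z \<cdot> FAr L a) \<cdot> \<delta> ?x ?u = Idn E (FOb L X) \<cdot> \<delta> ?x ?u" .
  show ?thesis
    unfolding a_def[symmetric]
    by (rule cocartesian_cancel[OF P lift(4) _ _ _ _ _ _ 3]) (use X P a Z mult[OF Z(1)] in simp_all)
qed

text \<open>Here \<iota> is itself the chosen lift of an identity, so \<open>\<delta> x u\<close> is
  extended to the two-step lift along \<open>u\<close> and \<open>1\<close>, which \<chi>
  contracts.\<close>

lemma unit_left_component:
  assumes X: "X \<in> comma_Ob P"
  shows "\<chi> (FOb (comma_unit C) X) \<cdot> \<iota> (FOb L X) = Idn E (FOb L X)"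
proof -
  let ?x = "ufst X" and ?u = "usnd X"
  let ?Z = "FOb (comma_unit C) X"
  have Z: "?Z \<in> comma_Ob C" "ufst ?Z = X" "usnd ?Z = Idn B (Cod B ?u)" using X P by simp_all
  have i: "\<iota> (FOb L X) = \<delta> (Cod E (\<delta> ?x ?u)) (Idn B (Cod B ?u))" using X P by simp
  have 2: "\<chi> ?Z \<cdot> \<iota> (FOb L X) \<cdot> \<delta> ?x ?u = \<delta> ?x ?u" using mult_lift[OF Z(1)] Z(2,3) X P i by simp
  have "(\<chi> ?Z \<cdot> \<iota> (FOb L X)) \<cdot> \<delta> ?x ?u = \<chi> ?Z \<cdot> \<iota> (FOb L X) \<cdot> \<delta> ?x ?u"
    by (rule Cmp_assoc_r) (use P X Z i mult(1-3)[OF Z(1)] in simp_all)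
  also have "\<dots> = Idn E (FOb L X) \<cdot> \<delta> ?x ?u" unfolding 2 using X P by simp
  finally have 3: "(\<chi> ?Z \<cdot> \<iota> (FOb L X)) \<cdot> \<delta> ?x ?u = Idn E (FOb L X) \<cdot> \<delta> ?x ?u" .
  show ?thesis
    by (rule cocartesian_cancel[OF P lift(4) _ _ _ _ _ _ 3]) (use X P i Z mult[OF Z(1)] in simp_all)
qed

text \<open>The test arrow is the three-step lift along \<open>u\<close>, \<open>v\<close>,
  \<open>w\<close>. One side contracts it to the lift of \<open>w (v u)\<close>, the other to the
  lift of \<open>(w v) u\<close>, and these agree by associativity in the base.\<close>

lemma associativity_component:
  assumes W: "W \<in> comma_Ob (comma_proj C)"
  shows "\<chi> (FOb (comma_func (comma_proj C) (comma_mult P) C) W) \<cdot> FAr L (NAt (comma_nat (comma_proj C) (lift_mult P \<delta>) P) W)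
    = \<chi> (FOb (comma_mult C) W) \<cdot> \<chi> (FOb (comma_func (comma_proj C) (comma_func C L P) C) W)"
proof -
  let ?x = "ufst (ufst (ufst W))" and ?u = "usnd (ufst (ufst W))" and ?v = "usnd (ufst W)" and ?w = "usnd W"
  let ?du = "\<delta> ?x ?u" let ?dv = "\<delta> (Cod E ?du) ?v" let ?dw = "\<delta> (Cod E ?dv) ?w"
  let ?Z1 = "FOb (comma_func (comma_proj C) (comma_mult P) C) W"
  let ?Z2 = "FOb (comma_mult C) W" and ?Z3 = "FOb (comma_func (comma_proj C) (comma_func C L P) C) W"
  have CP: "is_functor C" "is_functor (comma_proj C)" using P by simp_all
  note cf = fun_over_comma_func[OF CP(1) P fun_over_L]
  have WZ: "ufst W \<in> comma_Ob C" using W comma_Ob2_sel(1)[of W C] by simp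
  have ty: "?x \<in> Ob E" "?u \<in> Ar B" "?v \<in> Ar B" "?w \<in> Ar B" "Dom B ?u = FOb P ?x" "Dom B ?v = Cod B ?u" "Dom B ?w = Cod B ?v"
    using W WZ by simp_all
  define a where "a = NAt (comma_nat (comma_proj C) (lift_mult P \<delta>) P) W"
  have a: "a \<in> comma_Ar P" "cm_src a = upair (Cod E ?dv) ?w" "cm_trg a = upair (Cod E (\<delta> ?x (Cmp B ?v ?u))) ?w"
    "cm_fst a = \<chi> (ufst W)" "cm_snd a = Idn B (Cod B ?w)"
    unfolding a_def using W WZ ty P mult[OF WZ] fun_overD(1)[OF cf] by simp_all
  have Z1: "?Z1 \<in> comma_Ob C" "ufst ?Z1 = upair ?x (Cmp B ?v ?u)" "usnd ?Z1 = ?w"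
    and Z2: "?Z2 \<in> comma_Ob C" "ufst ?Z2 = upair ?x ?u" "usnd ?Z2 = Cmp B ?w ?v"
    and Z3: "?Z3 \<in> comma_Ob C" "ufst ?Z3 = upair (Cod E ?du) ?v" "usnd ?Z3 = ?w"
    using W WZ ty P by (simp_all add: upair_sel[of _ P])
  note m0 = mult[OF WZ] and m1 = mult[OF Z1(1), unfolded Z1 ufst_upair usnd_upair]
    and m2 = mult[OF Z2(1), unfolded Z2 ufst_upair usnd_upair] and m3 = mult[OF Z3(1), unfolded Z3 ufst_upair usnd_upair]
  note k0 = mult_lift[OF WZ] and k1 = mult_lift[OF Z1(1), unfolded Z1 ufst_upair usnd_upair]
    and k2 = mult_lift[OF Z2(1), unfolded Z2 ufst_upair usnd_upair]
    and k3 = mult_lift[OF Z3(1), unfolded Z3 ufst_upair usnd_upair]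
  let ?dvu = "\<delta> ?x (Cmp B ?v ?u)"
  have ka: "FAr L a \<cdot> ?dw = \<delta> (Cod E ?dvu) ?w \<cdot> \<chi> (ufst W)" using L_lift[OF a(1)] a by simp
  have aT: "FAr L a \<in> Ar E" "Dom E (FAr L a) = Cod E ?dw" "Cod E (FAr L a) = Cod E (\<delta> (Cod E ?dvu) ?w)"
    "FAr P (FAr L a) = Idn B (Cod B ?w)"
    using L_Ar[OF a(1)] a by simp_all
  let ?e = "?dw \<cdot> ?dv \<cdot> ?du"
  have e: "cocartesian P ?e" using ty P by (intro cocartesian_Cmp) simp_all
  have "(\<chi> ?Z1 \<cdot> FAr L a) \<cdot> ?e = \<chi> ?Z1 \<cdot> (FAr L a \<cdot> ?dw) \<cdot> ?dv \<cdot> ?du"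
    using ty P aT m1 by (simp add: Cmp_assoc_r)
  also have "\<dots> = \<chi> ?Z1 \<cdot> \<delta> (Cod E ?dvu) ?w \<cdot> \<chi> (ufst W) \<cdot> ?dv \<cdot> ?du"
    unfolding ka using ty P m1 m0 by (simp add: Cmp_assoc_r)
  also have "\<dots> = \<delta> ?x (Cmp B ?w (Cmp B ?v ?u))"
    unfolding k0 k1 ..
  finally have l: "(\<chi> ?Z1 \<cdot> FAr L a) \<cdot> ?e = \<delta> ?x (Cmp B ?w (Cmp B ?v ?u))" .
  have "(\<chi> ?Z2 \<cdot> \<chi> ?Z3) \<cdot> ?e = \<chi> ?Z2 \<cdot> (\<chi> ?Z3 \<cdot> ?dw \<cdot> ?dv) \<cdot> ?du"
    using ty P m2 m3 by (simp add: Cmp_assoc_r)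
  also have "\<dots> = \<delta> ?x (Cmp B (Cmp B ?w ?v) ?u)"
    unfolding k3 k2 ..
  finally have r: "(\<chi> ?Z1 \<cdot> FAr L a) \<cdot> ?e = (\<chi> ?Z2 \<cdot> \<chi> ?Z3) \<cdot> ?e"
    unfolding l using ty P by (simp add: Cmp_assoc_r)
  show ?thesis
    unfolding a_def[symmetric]
    by (rule cocartesian_cancel[OF P e _ _ _ _ _ _ r]) (use ty P aT m1 m2 m3 in \<open>simp_all add: Cmp_assoc_r\<close>)
qed

end

locale cloven_slice = cloven +
  assumes P_Obj: "P \<in> Obj (slice CAT B)"
begin

abbreviation "A \<equiv> lift_psalg \<lparr>Proj = P, Lift = \<delta>\<rparr>"

lemma A_simps [simp]:
  "Carrier A = P" "Act A = \<lparr>bsrc = C, body = L, btrg = P\<rparr>"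
  "UnitC A = \<lparr>bsrc = P, body = lift_unit P \<delta>, btrg = P\<rparr>"
  "MultC A = \<lparr>bsrc = comma_proj C, body = lift_mult P \<delta>, btrg = P\<rparr>"
  by (simp_all add: lift_psalg_def)

lemma A_typing:
  "Act A \<in> mor (slice CAT B) C P"
  "UnitC A \<in> cell (slice CAT B) (Id1 (slice CAT B) P) (Comp1 (slice CAT B) (Act A) (Unit comma_2monad P))"
  "MultC A \<in> cell (slice CAT B) (Comp1 (slice CAT B) (Act A) (T1 comma_2monad (Act A)))
      (Comp1 (slice CAT B) (Act A) (Mult comma_2monad P))"
  using P_Obj comma_proj_Obj[OF P_Obj] comma_proj_Obj[OF comma_proj_Obj[OF P_Obj]]
    fun_over_L nat_over_unit nat_over_mult
  unfolding slice_CAT_mor slice_CAT_cell by (simp_all add: slice_simps)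

lemma pseudoalgebra_A: "pseudoalgebra (slice CAT B) comma_2monad A"
proof (rule pseudoalgebra.intro)
  show "Carrier A \<in> Obj (slice CAT B)" using P_Obj by simp
  show "Act A \<in> mor (slice CAT B) (T0 comma_2monad (Carrier A)) (Carrier A)"
    using A_typing by simp
  show "UnitC A \<in> cell (slice CAT B) (Id1 (slice CAT B) (Carrier A)) (Comp1 (slice CAT B) (Act A) (Unit comma_2monad (Carrier A)))"
    using A_typing by simp
  show "MultC A \<in> cell (slice CAT B) (Comp1 (slice CAT B) (Act A) (T1 comma_2monad (Act A)))
      (Comp1 (slice CAT B) (Act A) (Mult comma_2monad (Carrier A)))"
    using A_typing by simp
  show "invertible_cell (slice CAT B) (UnitC A)"
    using A_typing(2) unit_iso by (intro invertible_cell_sliceI) (auto simp: cell_iff)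
  show "invertible_cell (slice CAT B) (MultC A)"
    using A_typing(3) mult_iso by (intro invertible_cell_sliceI) (auto simp: cell_iff)
  show "VComp (slice CAT B) (whisker_right (slice CAT B) (MultC A) (T1 comma_2monad (Unit comma_2monad (Carrier A))))
     (whisker_left (slice CAT B) (Act A) (T2 comma_2monad (UnitC A))) = Id2 (slice CAT B) (Act A)"
    using unit_right_iff[OF P_Obj A_typing] unit_right_component by simp
  show "VComp (slice CAT B) (whisker_right (slice CAT B) (MultC A) (Unit comma_2monad (T0 comma_2monad (Carrier A))))
     (whisker_right (slice CAT B) (UnitC A) (Act A)) = Id2 (slice CAT B) (Act A)"
    using unit_left_iff[OF P_Obj A_typing] unit_left_component by simp
  show "VComp (slice CAT B) (whisker_right (slice CAT B) (MultC A) (T1 comma_2monad (Mult comma_2monad (Carrier A))))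
     (whisker_left (slice CAT B) (Act A) (T2 comma_2monad (MultC A))) =
    VComp (slice CAT B) (whisker_right (slice CAT B) (MultC A) (Mult comma_2monad (T0 comma_2monad (Carrier A))))
     (whisker_right (slice CAT B) (MultC A) (T1 comma_2monad (T1 comma_2monad (Act A))))"
    using associativity_iff[OF P_Obj A_typing] associativity_component by simp
qed

lemma induced_by_lifts_A: "induced_by_lifts \<lparr>Proj = P, Lift = \<delta>\<rparr> A"
proof -
  have "FAr L (comma_ar (upair x u) (upair y w) f v) \<cdot> \<delta> x u = \<delta> y w \<cdot> f"
    if "comma_ar (upair x u) (upair y w) f v \<in> comma_Ar P" for x u y w f v
    using L_lift[OF that] by simp
  moreover have "\<chi> (upair (upair x u) v) \<cdot> \<delta> (Cod E (\<delta> x u)) v \<cdot> \<delta> x u = \<delta> x (Cmp B v u)"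
    if "upair (upair x u) v \<in> comma_Ob C" for x u v
    using mult_lift[OF that] by simp
  ultimately show ?thesis
    unfolding induced_by_lifts_def Let_def by simp
qed

end

lemma psalgD:
  assumes "pseudoalgebra K T A"
  shows "Carrier A \<in> Obj K" "Act A \<in> mor K (T0 T (Carrier A)) (Carrier A)"
    "UnitC A \<in> cell K (Id1 K (Carrier A)) (Comp1 K (Act A) (Unit T (Carrier A)))"
    "invertible_cell K (UnitC A)"
    "MultC A \<in> cell K (Comp1 K (Act A) (T1 T (Act A))) (Comp1 K (Act A) (Mult T (Carrier A)))"
    "invertible_cell K (MultC A)"
    "VComp K (whisker_right K (MultC A) (T1 T (Unit T (Carrier A)))) (whisker_left K (Act A) (T2 T (UnitC A)))
      = Id2 K (Act A)"
    "VComp K (whisker_right K (MultC A) (Unit T (T0 T (Carrier A)))) (whisker_right K (UnitC A) (Act A))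
      = Id2 K (Act A)"
  using assms unfolding pseudoalgebra_def by blast+

text \<open>The action is pinned down by \<open>L_eqI\<close>, the unit cell componentwise, and the
  multiplication cell by cancelling the two-step lift. This gives one of the two round trips on
  objects.\<close>

lemma (in cloven_slice) psalg_unique:
  assumes psalg: "pseudoalgebra (slice CAT B) comma_2monad A'" and ind: "induced_by_lifts \<lparr>Proj = P, Lift = \<delta>\<rparr> A'"
  shows "A' = A"
proof -
  let ?L = "body (Act A')"
  have C: "Carrier A' = P"
    and I0: "\<And>x u. upair x u \<in> comma_Ob P \<Longrightarrow> FOb ?L (upair x u) = Cod E (\<delta> x u)"
    and I1: "\<And>x u y w f v. comma_ar (upair x u) (upair y w) f v \<in> comma_Ar P \<Longrightarrow>
      FAr ?L (comma_ar (upair x u) (upair y w) f v) \<cdot> \<delta> x u = \<delta> y w \<cdot> f"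
    and I2: "\<And>x. x \<in> Ob E \<Longrightarrow> NAt (body (UnitC A')) x = \<delta> x (Idn B (FOb P x))"
    and I3: "\<And>x u v. upair (upair x u) v \<in> comma_Ob C \<Longrightarrow>
      NAt (body (MultC A')) (upair (upair x u) v) \<cdot> \<delta> (Cod E (\<delta> x u)) v \<cdot> \<delta> x u = \<delta> x (Cmp B v u)"
    using ind unfolding induced_by_lifts_def Let_def by simp_all
  have a: "Act A' \<in> mor (slice CAT B) C P" using psalgD(2)[OF psalg] C by simp
  have L: "fun_over C ?L P" using a unfolding slice_CAT_mor by simp
  note LD = fun_overD(1-3,6,7)[OF L]
  have "?L = L"
  proof (rule func_eqI)
    fix X assume "X \<in> Ob (FDom L)"
    then have X: "X \<in> comma_Ob P" by simp
    show "FOb ?L X = FOb L X" using I0[of "ufst X" "usnd X"] X by (simp add: upair_sel[OF X])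
  next
    fix b assume "b \<in> Ar (FDom L)"
    then have b: "b \<in> comma_Ar P" by simp
    have s: "cm_src b \<in> comma_Ob P" "cm_trg b \<in> comma_Ob P" using b by simp_all
    have eq: "comma_ar (upair (ufst (cm_src b)) (usnd (cm_src b))) (upair (ufst (cm_trg b)) (usnd (cm_trg b)))
        (cm_fst b) (cm_snd b) = b"
      by (simp only: upair_sel[OF s(1)] upair_sel[OF s(2)] comma_ar_sel[OF b])
    have "FAr ?L b \<cdot> \<delta> (ufst (cm_src b)) (usnd (cm_src b)) = \<delta> (ufst (cm_trg b)) (usnd (cm_trg b)) \<cdot> cm_fst b"
      using I1[of "ufst (cm_src b)" "usnd (cm_src b)" "ufst (cm_trg b)" "usnd (cm_trg b)" "cm_fst b" "cm_snd b"] b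
      unfolding eq by simp
    moreover have "FOb ?L (cm_src b) = Cod E (\<delta> (ufst (cm_src b)) (usnd (cm_src b)))"
      "FOb ?L (cm_trg b) = Cod E (\<delta> (ufst (cm_trg b)) (usnd (cm_trg b)))"
      using I0[of "ufst (cm_src b)" "usnd (cm_src b)"] I0[of "ufst (cm_trg b)" "usnd (cm_trg b)"] s
      by (simp_all add: upair_sel[OF s(1)] upair_sel[OF s(2)])
    ultimately show "FAr ?L b = FAr L b"
      using b LD P by - (rule L_eqI[symmetric], simp_all)
  qed (use LD in simp_all)
  then have act: "Act A' = Act A"
    using slice_morD(4,5)[OF a] by (cases "Act A'") simp
  have u: "UnitC A' = UnitC A"
  proof (rule slice_cell_eqI)
    show "UnitC A' \<in> cell (slice CAT B) (Id1 (slice CAT B) P) (Comp1 (slice CAT B) (Act A) (Unit comma_2monad P))"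
      using psalgD(3)[OF psalg] C act by simp
    show "UnitC A \<in> cell (slice CAT B) (Id1 (slice CAT B) P) (Comp1 (slice CAT B) (Act A) (Unit comma_2monad P))"
      by (rule A_typing(2))
    show "NAt (body (UnitC A')) x = NAt (body (UnitC A)) x" if "x \<in> Ob (FDom (bsrc (Id1 (slice CAT B) P)))" for x
      using that I2 by (simp add: slice_simps)
  qed
  have m: "MultC A' = MultC A"
  proof (rule slice_cell_eqI)
    show c: "MultC A' \<in> cell (slice CAT B) (Comp1 (slice CAT B) (Act A) (T1 comma_2monad (Act A)))
      (Comp1 (slice CAT B) (Act A) (Mult comma_2monad P))"
      using psalgD(5)[OF psalg] C act by simp
    show "MultC A \<in> cell (slice CAT B) (Comp1 (slice CAT B) (Act A) (T1 comma_2monad (Act A)))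
      (Comp1 (slice CAT B) (Act A) (Mult comma_2monad P))"
      by (rule A_typing(3))
    fix Z assume "Z \<in> Ob (FDom (bsrc (Comp1 (slice CAT B) (Act A) (T1 comma_2monad (Act A)))))"
    then have Z: "Z \<in> comma_Ob C" by (simp add: slice_simps)
    have Z': "upair (upair (ufst (ufst Z)) (usnd (ufst Z))) (usnd Z) = Z"
      using Z upair_sel[of "ufst Z" P] upair_sel[of Z C] by simp
    have "bsrc (MultC A') = comma_proj C" "btrg (MultC A') = P"
      using c by (auto simp: cell_iff slice_simps)
    then have n: "nat_over (comma_proj C) (body (MultC A')) P"
      using c unfolding slice_CAT_cell by metis
    have nd: "NDom (body (MultC A')) = comp_func L (comma_func C L P)"
      "NCod (body (MultC A')) = comp_func L (comma_mult P)"
      using c by (auto simp: cell_iff slice_simps)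
    note nD = nat_overD[OF n]
    have t: "NAt (body (MultC A')) Z \<in> Ar E" "Dom E (NAt (body (MultC A')) Z) = Dom E (\<chi> Z)"
      "Cod E (NAt (body (MultC A')) Z) = Cod E (\<chi> Z)" "FAr P (NAt (body (MultC A')) Z) = FAr P (\<chi> Z)"
      using nD nd Z P NAt_Ar[OF nD(1,5), of Z] Dom_NAt[OF nD(1,5), of Z] Cod_NAt[OF nD(1,5), of Z] by simp_all
    have e: "NAt (body (MultC A')) Z \<cdot> lift2 Z = \<chi> Z \<cdot> lift2 Z"
      using I3[of "ufst (ufst Z)" "usnd (ufst Z)" "usnd Z"] mult_lift[OF Z] Z unfolding Z' by simp
    have "NAt (body (MultC A')) Z = \<chi> Z"
      by (rule cocartesian_cancel[OF P lift2(1)[OF Z] _ _ _ _ _ _ e]) (use t Z P in simp_all)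
    then show "NAt (body (MultC A')) Z = NAt (body (MultC A)) Z" by simp
  qed
  show ?thesis by (rule psalg.equality) (use C act u m in simp_all)
qed


section \<open>The cleavage of a pseudoalgebra\<close>

text \<open>Off the liftable pairs the value is \<open>undefined\<close>, as \<open>cleavage\<close>
  demands, so that the recovered cleavage can equal a given one as a function.\<close>

definition psalg_lift :: "('u::universe func, ('u func, 'u func) between, ('u func, 'u nattr) between) psalg
    \<Rightarrow> 'u \<Rightarrow> 'u \<Rightarrow> 'u" where
  "psalg_lift A x u = (let P = Carrier A in if liftable P x u
    then Cmp (FDom P) (FAr (body (Act A))
      (comma_ar (upair x (Idn (FCod P) (FOb P x))) (upair x u) (Idn (FDom P) x) u)) (NAt (body (UnitC A)) x)
    else undefined)"

definition psalg_clcofib :: "('u::universe func, ('u func, 'u func) between, ('u func, 'u nattr) between) psalg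
    \<Rightarrow> 'u clcofib" where
  "psalg_clcofib A = \<lparr>Proj = Carrier A, Lift = psalg_lift A\<rparr>"

section \<open>Lifts in a pseudoalgebra of the comma 2-monad\<close>

locale comma_psalg =
  fixes B\<^sub>0 :: "'u::universe cat" and A
  assumes psalg: "pseudoalgebra (slice CAT B\<^sub>0) comma_2monad A"
begin

lemmas Carrier_Obj = psalgD(1)[OF psalg]
  and UnitC_cell = psalgD(3)[OF psalg]
  and MultC_cell = psalgD(5)[OF psalg]

abbreviation "P \<equiv> Carrier A"
abbreviation "E \<equiv> FDom P"
abbreviation "B \<equiv> FCod P"
abbreviation "L \<equiv> body (Act A)"
abbreviation "C \<equiv> comma_proj P"
abbreviation "\<iota> \<equiv> NAt (body (UnitC A))"
abbreviation "\<chi> \<equiv> NAt (body (MultC A))"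
abbreviation comp (infixr "\<cdot>" 70) where "g \<cdot> f \<equiv> Cmp E g f"
abbreviation "un x \<equiv> upair x (Idn B (FOb P x))"

lemma P [simp]: "is_functor P" and B: "B = B\<^sub>0"
  using slice_ObjD[OF Carrier_Obj] by auto

lemma Act_mor: "Act A \<in> mor (slice CAT B\<^sub>0) C P"
  using psalgD(2)[OF psalg] by simp

lemma L_over: "fun_over C L P"
  using Act_mor unfolding slice_CAT_mor by blast

lemma L [simp]:
  "is_functor L" "FDom L = comma_cat P" "FCod L = E"
  "X \<in> comma_Ob P \<Longrightarrow> FOb P (FOb L X) = Cod B (usnd X)"
  "a \<in> comma_Ar P \<Longrightarrow> FAr P (FAr L a) = cm_snd a"
  using fun_overD(1-3)[OF L_over] fun_overD(6)[OF L_over, of X] fun_overD(7)[OF L_over, of a] by simp_all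

lemma unit_cell:
  "nat_over P (body (UnitC A)) P" "NDom (body (UnitC A)) = id_func E"
  "NCod (body (UnitC A)) = comp_func L (comma_unit P)"
  "bsrc (UnitC A) = P" "btrg (UnitC A) = P"
proof -
  have "bsrc (UnitC A) = P" "btrg (UnitC A) = P"
    using UnitC_cell by (auto simp: cell_iff slice_simps)
  then show "nat_over P (body (UnitC A)) P" "NDom (body (UnitC A)) = id_func E"
    "NCod (body (UnitC A)) = comp_func L (comma_unit P)" "bsrc (UnitC A) = P" "btrg (UnitC A) = P"
    using UnitC_cell unfolding slice_CAT_cell by (simp_all add: slice_simps)
qed

lemma mult_cell:
  "nat_over (comma_proj C) (body (MultC A)) P" "NDom (body (MultC A)) = comp_func L (comma_func C L P)"
  "NCod (body (MultC A)) = comp_func L (comma_mult P)"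
  "bsrc (MultC A) = comma_proj C" "btrg (MultC A) = P"
proof -
  have "bsrc (MultC A) = comma_proj C" "btrg (MultC A) = P"
    using MultC_cell Act_mor by (auto simp: cell_iff slice_simps mor_iff)
  then show "nat_over (comma_proj C) (body (MultC A)) P" "NDom (body (MultC A)) = comp_func L (comma_func C L P)"
    "NCod (body (MultC A)) = comp_func L (comma_mult P)" "bsrc (MultC A) = comma_proj C" "btrg (MultC A) = P"
    using MultC_cell slice_morD(4,5)[OF Act_mor] unfolding slice_CAT_cell by (simp_all add: slice_simps)
qed

lemma unit [simp]:
  assumes "x \<in> Ob E"
  shows "\<iota> x \<in> Ar E" "Dom E (\<iota> x) = x" "Cod E (\<iota> x) = FOb L (un x)" "FAr P (\<iota> x) = Idn B (FOb P x)"
proof -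
  note n = nat_overD[OF unit_cell(1)]
  show "\<iota> x \<in> Ar E" "Dom E (\<iota> x) = x" "Cod E (\<iota> x) = FOb L (un x)" "FAr P (\<iota> x) = Idn B (FOb P x)"
    using n(4,6) assms NAt_Ar[OF n(1,5)] Dom_NAt[OF n(1,5)] Cod_NAt[OF n(1,5)] unit_cell(2,3) by simp_all
qed

lemma unit_natural:
  assumes "f \<in> Ar E"
  shows "\<iota> (Cod E f) \<cdot> f = FAr L (comma_ar (un (Dom E f)) (un (Cod E f)) f (FAr P f)) \<cdot> \<iota> (Dom E f)"
  using NAt_natural[OF nat_overD(1,5,4)[OF unit_cell(1)] assms] unit_cell(2,3) assms by simp

lemma mult [simp]:
  assumes Z: "Z \<in> comma_Ob C"
  shows "\<chi> Z \<in> Ar E" "Dom E (\<chi> Z) = FOb L (upair (FOb L (ufst Z)) (usnd Z))"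
    "Cod E (\<chi> Z) = FOb L (upair (ufst (ufst Z)) (Cmp B (usnd Z) (usnd (ufst Z))))"
proof -
  note n = nat_overD[OF mult_cell(1)]
  show "\<chi> Z \<in> Ar E" "Dom E (\<chi> Z) = FOb L (upair (FOb L (ufst Z)) (usnd Z))"
    "Cod E (\<chi> Z) = FOb L (upair (ufst (ufst Z)) (Cmp B (usnd Z) (usnd (ufst Z))))"
    using n(4,6) Z NAt_Ar[OF n(1,5)] Dom_NAt[OF n(1,5)] Cod_NAt[OF n(1,5)] mult_cell(2,3) by simp_all
qed

lemma mult_natural:
  assumes "q \<in> comma_Ar C"
  shows "\<chi> (cm_trg q) \<cdot> FAr L (FAr (comma_func C L P) q) = FAr L (FAr (comma_mult P) q) \<cdot> \<chi> (cm_src q)"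
  using NAt_natural[OF nat_overD(1,5,4)[OF mult_cell(1)], of q] mult_cell(2,3) assms by simp

lemma unit_inverse:
  assumes x: "x \<in> Ob E"
  obtains j where "inverse_arrows E (\<iota> x) j" "FAr P j = Idn B (FOb P x)"
  using invertible_cell_sliceD[OF psalgD(4)[OF psalg], of x] x B unit_cell(4,5) by auto

lemma mult_inverse:
  assumes "Z \<in> comma_Ob C"
  obtains j where "inverse_arrows E (\<chi> Z) j"
  using invertible_cell_sliceD[OF psalgD(6)[OF psalg], of Z] assms mult_cell(4,5) by auto

lemma L_comp:
  assumes "comma_ar X Y f v \<in> comma_Ar P" "comma_ar Y Z g w \<in> comma_Ar P"
  shows "FAr L (comma_ar Y Z g w) \<cdot> FAr L (comma_ar X Y f v) = FAr L (comma_ar X Z (g \<cdot> f) (Cmp B w v))"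
  using FAr_Cmp_eq[of L "comma_cat P" "comma_ar X Y f v" "comma_ar Y Z g w"] comma_Cmp[OF assms] assms
  by (simp del: comma_ar_comma_Ar)

abbreviation "to_lift x u \<equiv> comma_ar (un x) (upair x u) (Idn E x) u"

lemma to_lift: "upair x u \<in> comma_Ob P \<Longrightarrow> to_lift x u \<in> comma_Ar P"
  by simp

abbreviation "\<delta> \<equiv> psalg_lift A"

lemma psalg_lift: "upair x u \<in> comma_Ob P \<Longrightarrow> \<delta> x u = FAr L (to_lift x u) \<cdot> \<iota> x"
  by (simp add: psalg_lift_def liftable_def Let_def)

lemma lift [simp]:
  assumes X: "x \<in> Ob E" "u \<in> Ar B" "Dom B u = FOb P x"
  shows "\<delta> x u \<in> Ar E" "Dom E (\<delta> x u) = x" "Cod E (\<delta> x u) = FOb L (upair x u)" "FAr P (\<delta> x u) = u"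
  using X by (simp_all add: psalg_lift)

text \<open>
  Naturality of \<open>\<chi>\<close> along \<open>((1, u), 1) : ((x, 1), u) \<rightarrow> ((x, u), 1)\<close> compares the two unit axioms at
  \<open>(x, u)\<close>; cancelling the invertible component \<open>\<chi> ((x, u), 1)\<close> leaves this formula.
\<close>

lemma unit_at_action:
  assumes X: "upair x u \<in> comma_Ob P"
  defines "l \<equiv> FOb L (upair x u)"
  shows "\<iota> l = FAr L (comma_ar (upair x u) (un l) (\<delta> x u) (Idn B (Cod B u)))"
proof -
  let ?X = "upair x u" and ?b = "Cod B u"
  let ?Z0 = "upair (un x) u" and ?Z1 = "upair ?X (Idn B ?b)"
  let ?q = "comma_ar ?Z0 ?Z1 (to_lift x u) (Idn B ?b)"
  let ?n = "comma_ar ?X (upair (FOb L (un x)) u) (\<iota> x) (Idn B ?b)"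
  let ?t = "comma_ar (upair (FOb L (un x)) u) (un l) (FAr L (to_lift x u)) (Idn B ?b)"
  have X': "x \<in> Ob E" "u \<in> Ar B" "Dom B u = FOb P x" using X by simp_all
  have l: "l \<in> Ob E" "FOb P l = ?b" using X' unfolding l_def by simp_all
  have Z: "?Z0 \<in> comma_Ob C" "?Z1 \<in> comma_Ob C" using X' by simp_all
  have q: "?q \<in> comma_Ar C" using X' by simp
  have n: "?n \<in> comma_Ar P" using X' by simp
  have t: "?t \<in> comma_Ar P" using X' l by (simp add: l_def)
  have LI: "FAr L (comma_ar ?X ?X (Idn E x) (Idn B ?b)) = Idn E l"
    using FAr_Idn_eq[of L "comma_cat P" ?X] X by (simp add: l_def)
  have "\<chi> ?Z1 \<cdot> FAr L ?t = Idn E l \<cdot> \<chi> ?Z0"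
    using mult_natural[OF q] q X' l LI by (simp add: l_def)
  also have "\<dots> = \<chi> ?Z0" using X' mult[OF Z(1)] by (simp add: l_def)
  finally have nat: "\<chi> ?Z1 \<cdot> FAr L ?t = \<chi> ?Z0" .
  have ur: "\<chi> ?Z0 \<cdot> FAr L ?n = Idn E l"
    using bspec[OF iffD1[OF unit_right_iff[OF Carrier_Obj Act_mor UnitC_cell MultC_cell] psalgD(7)[OF psalg]] X]
      X' unit_cell(2,3)
    by (simp add: l_def)
  have ul: "\<chi> ?Z1 \<cdot> \<iota> l = Idn E l"
    using bspec[OF iffD1[OF unit_left_iff[OF Carrier_Obj Act_mor UnitC_cell MultC_cell] psalgD(8)[OF psalg]] X] X'
    by (simp add: l_def)
  obtain j where j: "inverse_arrows E (\<chi> ?Z1) j" by (rule mult_inverse[OF Z(2)])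
  have cE: "category E" by simp
  have ty: "FAr L ?t \<in> Ar E" "FAr L ?n \<in> Ar E" "Dom E (FAr L ?t) = Cod E (FAr L ?n)"
    "Cod E (FAr L ?t) = Dom E (\<chi> ?Z1)" "Dom E (FAr L ?n) = l"
    "\<iota> l \<in> Ar E" "Cod E (\<iota> l) = Dom E (\<chi> ?Z1)"
    using n t l X' Z mult[OF Z(2)] by (simp_all add: l_def)
  have "\<chi> ?Z1 \<cdot> FAr L ?t \<cdot> FAr L ?n = (\<chi> ?Z1 \<cdot> FAr L ?t) \<cdot> FAr L ?n"
    by (rule Cmp_assoc_r[symmetric]) (use ty mult[OF Z(2)] in simp_all)
  then have e: "\<chi> ?Z1 \<cdot> FAr L ?t \<cdot> FAr L ?n = \<chi> ?Z1 \<cdot> \<iota> l" unfolding nat ur ul by simp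
  have "FAr L ?t \<cdot> FAr L ?n = j \<cdot> \<chi> ?Z1 \<cdot> FAr L ?t \<cdot> FAr L ?n"
    by (rule inverse_arrows_cancel_l[OF cE j, symmetric]) (use ty in simp_all)
  also have "\<dots> = \<iota> l" unfolding e
    by (rule inverse_arrows_cancel_l[OF cE j]) (use ty in simp_all)
  finally have "\<iota> l = FAr L ?t \<cdot> FAr L ?n" by simp
  also have "\<dots> = FAr L (comma_ar ?X (un l) (FAr L (to_lift x u) \<cdot> \<iota> x) (Cmp B (Idn B ?b) (Idn B ?b)))"
    by (rule L_comp[OF n t])
  also have "\<dots> = FAr L (comma_ar ?X (un l) (\<delta> x u) (Idn B ?b))"
    using X' by (simp add: psalg_lift)
  finally show ?thesis .
qed

text \<open>The comma arrow \<open>(1, u)\<close> is absorbed by functoriality, leaving a single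
  action on an arrow out of \<open>(x, 1)\<close> after \<iota>. Composites with lifts are compared
  in this normal form.\<close>

lemma L_lift:
  assumes a: "comma_ar (upair x u) (upair y w) f v \<in> comma_Ar P"
  shows "FAr L (comma_ar (upair x u) (upair y w) f v) \<cdot> \<delta> x u
    = FAr L (comma_ar (un x) (upair y w) f (Cmp B v u)) \<cdot> \<iota> x"
proof -
  have X: "upair x u \<in> comma_Ob P" using a by simp
  have "FAr L (comma_ar (upair x u) (upair y w) f v) \<cdot> FAr L (to_lift x u) \<cdot> \<iota> x
      = (FAr L (comma_ar (upair x u) (upair y w) f v) \<cdot> FAr L (to_lift x u)) \<cdot> \<iota> x"
    by (rule Cmp_assoc_r[symmetric]) (use a in simp_all)
  then show ?thesis
    unfolding psalg_lift[OF X] L_comp[OF to_lift[OF X] a] using a by simp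
qed

text \<open>Naturality of \<iota> moves \<open>f\<close> past it, which brings the other side of the
  action equation to the same normal form as in \<open>L_lift\<close>.\<close>

lemma lift_after:
  assumes f: "f \<in> Ar E" "Cod E f = y" and Y: "upair y w \<in> comma_Ob P"
  shows "\<delta> y w \<cdot> f = FAr L (comma_ar (un (Dom E f)) (upair y w) f (Cmp B w (FAr P f))) \<cdot> \<iota> (Dom E f)"
proof -
  let ?h = "comma_ar (un (Dom E f)) (un y) f (FAr P f)"
  have h: "?h \<in> comma_Ar P" using f by auto
  have t: "to_lift y w \<in> comma_Ar P" by (rule to_lift[OF Y])
  have "\<delta> y w \<cdot> f = FAr L (to_lift y w) \<cdot> \<iota> y \<cdot> f"
    unfolding psalg_lift[OF Y] by (rule Cmp_assoc_r) (use f Y t in simp_all)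
  also have "\<dots> = FAr L (to_lift y w) \<cdot> FAr L ?h \<cdot> \<iota> (Dom E f)"
    using unit_natural[OF f(1)] f by simp
  also have "\<dots> = (FAr L (to_lift y w) \<cdot> FAr L ?h) \<cdot> \<iota> (Dom E f)"
    by (rule Cmp_assoc_r[symmetric]) (use f Y t h in auto)
  finally show ?thesis
    unfolding L_comp[OF h t] using f by simp
qed

text \<open>Both halves rest on the invertibility of \<iota>: in the existence part its inverse
  returns from \<open>L (z, 1)\<close> to \<open>z\<close>, in the uniqueness part it is
  cancelled.\<close>

lemma cocartesian_lift:
  assumes X: "upair x u \<in> comma_Ob P"
  shows "cocartesian P (\<delta> x u)"
proof (rule cocartesianI)
  let ?X = "upair x u"
  have X': "x \<in> Ob E" "u \<in> Ar B" "Dom B u = FOb P x" using X by simp_all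
  show "\<delta> x u \<in> Ar E" using X' by simp
  fix g v
  assume "g \<in> Ar E" "Dom E g = Dom E (\<delta> x u)" "v \<in> Ar B" "Dom B v = FOb P (Cod E (\<delta> x u))"
    "Cod B v = FOb P (Cod E g)" "FAr P g = Cmp B v (FAr P (\<delta> x u))"
  then have g: "g \<in> Ar E" "Dom E g = x" "v \<in> Ar B" "Dom B v = Cod B u" "Cod B v = FOb P (Cod E g)"
    "FAr P g = Cmp B v u"
    using X' by simp_all
  let ?z = "Cod E g"
  have z: "?z \<in> Ob E" using g by simp
  have a: "comma_ar ?X (un ?z) g v \<in> comma_Ar P" using X' g z by simp
  obtain j where j: "inverse_arrows E (\<iota> ?z) j" and Pj: "FAr P j = Idn B (FOb P ?z)"
    by (rule unit_inverse[OF z])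
  note jD = inverse_arrowsD[OF j]
  \<comment> \<open>The witness is dictated by the uniqueness part: there \<iota> after any filler
    is the action on \<open>(g, v)\<close>, so the filler is that action followed by the inverse of
    \<iota>.\<close>
  let ?h = "j \<cdot> FAr L (comma_ar ?X (un ?z) g v)"
  have "?h \<cdot> \<delta> x u = j \<cdot> FAr L (comma_ar ?X (un ?z) g v) \<cdot> \<delta> x u"
    by (rule Cmp_assoc_r) (use a jD X' z in simp_all)
  also have "\<dots> = j \<cdot> \<iota> ?z \<cdot> g"
    unfolding L_lift[OF a] using unit_natural[OF g(1)] g by simp
  also have "\<dots> = g"
    by (rule inverse_arrows_cancel_l[OF _ j]) (use g z in simp_all)
  finally have "?h \<cdot> \<delta> x u = g" .
  moreover have "?h \<in> Ar E" "Dom E ?h = Cod E (\<delta> x u)" "Cod E ?h = ?z" "FAr P ?h = v"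
    using a jD X' z g Pj by simp_all
  ultimately show "\<exists>h. h \<in> Ar E \<and> Dom E h = Cod E (\<delta> x u) \<and> Cod E h = ?z \<and> h \<cdot> \<delta> x u = g \<and> FAr P h = v"
    by blast
next
  let ?X = "upair x u" and ?l = "FOb L (upair x u)"
  have X': "x \<in> Ob E" "u \<in> Ar B" "Dom B u = FOb P x" using X by simp_all
  have l: "?l \<in> Ob E" "FOb P ?l = Cod B u" using X' by simp_all
  \<comment> \<open>Naturality turns \<iota> after \<open>h\<close> into an action after \<iota> at
    \<open>?l\<close>, and \<open>unit_at_action\<close> turns the latter into an action too;
    functoriality merges the two.\<close>
  have key: "\<iota> (Cod E h) \<cdot> h = FAr L (comma_ar ?X (un (Cod E h)) (h \<cdot> \<delta> x u) (FAr P h))"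
    if h: "h \<in> Ar E" "Dom E h = ?l" for h
  proof -
    let ?h = "comma_ar (un ?l) (un (Cod E h)) h (FAr P h)"
    let ?d = "comma_ar ?X (un ?l) (\<delta> x u) (Idn B (Cod B u))"
    have m: "?h \<in> comma_Ar P" "?d \<in> comma_Ar P" using h X' l by simp_all
    have "\<iota> (Cod E h) \<cdot> h = FAr L ?h \<cdot> FAr L ?d"
      using unit_natural[OF h(1)] unit_at_action[OF X] h by simp
    then show ?thesis unfolding L_comp[OF m(2,1)] using h X' l by simp
  qed
  fix h k
  assume h: "h \<in> Ar E" "k \<in> Ar E" "Dom E h = Cod E (\<delta> x u)" "Dom E k = Cod E (\<delta> x u)"
    "Cod E h = Cod E k" "FAr P h = FAr P k" "h \<cdot> \<delta> x u = k \<cdot> \<delta> x u"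
  have z: "Cod E k \<in> Ob E" using h by simp
  have d: "Dom E h = ?l" "Dom E k = ?l" using h X' by simp_all
  have e: "\<iota> (Cod E k) \<cdot> h = \<iota> (Cod E k) \<cdot> k"
    using key[OF h(1) d(1)] key[OF h(2) d(2)] h(5-7) by simp
  obtain j where j: "inverse_arrows E (\<iota> (Cod E k)) j" by (rule unit_inverse[OF z])
  have "j \<cdot> \<iota> (Cod E k) \<cdot> h = h" "j \<cdot> \<iota> (Cod E k) \<cdot> k = k"
    by (rule inverse_arrows_cancel_l[OF _ j]; use h z in simp)+
  then show "h = k" using e by simp
qed

lemma cleavage_lift: "cleavage P \<delta>"
  unfolding cleavage_def
  using cocartesian_lift by (auto simp: liftable_def) (simp add: psalg_lift_def liftable_def)+

text \<open>Naturality of \<chi> along \<open>((1, 1), v)\<close> from \<open>((x, u), 1)\<close> to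
  \<open>((x, u), v)\<close> moves \<chi> to the place where the left unit axiom cancels it against
  \<iota>. Thus \<chi> after the lift of \<open>v\<close> is the action on \<open>(1, v)\<close>,
  and this carries \<open>\<delta> x u\<close> to the lift of the composite.\<close>

lemma mult_lift:
  assumes "upair (upair x u) v \<in> comma_Ob C"
  shows "\<chi> (upair (upair x u) v) \<cdot> \<delta> (FOb L (upair x u)) v \<cdot> \<delta> x u = \<delta> x (Cmp B v u)"
proof -
  let ?X = "upair x u" and ?b = "Cod B u" and ?l = "FOb L (upair x u)"
  let ?Z = "upair ?X v" and ?Z1 = "upair ?X (Idn B ?b)"
  let ?q = "comma_ar ?Z1 ?Z (Idn (comma_cat P) ?X) v"
  have X': "x \<in> Ob E" "u \<in> Ar B" "Dom B u = FOb P x" "v \<in> Ar B" "Dom B v = Cod B u"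
    using assms by simp_all
  have X: "?X \<in> comma_Ob P" using X' by simp
  have l: "?l \<in> Ob E" "FOb P ?l = ?b" using X' by simp_all
  have Z: "?Z \<in> comma_Ob C" "?Z1 \<in> comma_Ob C" using X' by simp_all
  have q: "?q \<in> comma_Ar C" using X' by simp
  let ?m = "comma_ar ?X (upair x (Cmp B v u)) (Idn E x) v"
  have m: "?m \<in> comma_Ar P" using X' by simp
  have t: "to_lift ?l v \<in> comma_Ar P" using X' l by simp
  have LI: "FAr L (comma_ar ?X ?X (Idn E x) (Idn B ?b)) = Idn E ?l"
    using FAr_Idn_eq[of L "comma_cat P" ?X] X by simp
  have nat: "\<chi> ?Z \<cdot> FAr L (to_lift ?l v) = FAr L ?m \<cdot> \<chi> ?Z1"
    using mult_natural[OF q] q X' l LI by simp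
  have ul: "\<chi> ?Z1 \<cdot> \<iota> ?l = Idn E ?l"
    using bspec[OF iffD1[OF unit_left_iff[OF Carrier_Obj Act_mor UnitC_cell MultC_cell] psalgD(8)[OF psalg]] X] X'
    by simp
  note mz = mult[OF Z(1)] mult[OF Z(2)]
  have "\<chi> ?Z \<cdot> \<delta> ?l v = \<chi> ?Z \<cdot> FAr L (to_lift ?l v) \<cdot> \<iota> ?l"
    using psalg_lift[of ?l v] X' l by simp
  also have "\<dots> = (\<chi> ?Z \<cdot> FAr L (to_lift ?l v)) \<cdot> \<iota> ?l"
    by (rule Cmp_assoc_r[symmetric]) (use X' l t mz in simp_all)
  also have "\<dots> = FAr L ?m \<cdot> \<chi> ?Z1 \<cdot> \<iota> ?l"
    unfolding nat by (rule Cmp_assoc_r) (use X' l m mz in simp_all)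
  also have "\<dots> = FAr L ?m"
    unfolding ul using X' by simp
  finally have e: "\<chi> ?Z \<cdot> \<delta> ?l v = FAr L ?m" .
  have "\<chi> ?Z \<cdot> \<delta> ?l v \<cdot> \<delta> x u = (\<chi> ?Z \<cdot> \<delta> ?l v) \<cdot> \<delta> x u"
    by (rule Cmp_assoc_r[symmetric]) (use X' l mz in simp_all)
  also have "\<dots> = \<delta> x (Cmp B v u)"
    unfolding e L_lift[OF m] using X' by (simp add: psalg_lift)
  finally show ?thesis .
qed

text \<open>The two normal forms of the action equation agree by the comma square. For the unit
  equation, \<open>(1, 1)\<close> is an identity of the comma category, so the action on it
  disappears.\<close>

lemma induced_by_psalg_lift: "induced_by_lifts (psalg_clcofib A) A"
proof -
  have "FAr L (comma_ar (upair x u) (upair y w) f v) \<cdot> \<delta> x u = \<delta> y w \<cdot> f"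
    if a: "comma_ar (upair x u) (upair y w) f v \<in> comma_Ar P" for x u y w f v
    using lift_after[of f y w] L_lift[OF a] a by auto
  moreover have "\<delta> x (Idn B (FOb P x)) = \<iota> x" if "x \<in> Ob E" for x
    using that FAr_Idn_eq[of L "comma_cat P" "un x"] by (simp add: psalg_lift)
  ultimately show ?thesis
    unfolding induced_by_lifts_def Let_def psalg_clcofib_def using mult_lift by simp
qed

sublocale lift: cloven_slice P \<delta>
proof (intro cloven_slice.intro cloven.intro cloven_slice_axioms.intro)
  show "P \<in> Obj (slice CAT B)" using Carrier_Obj B by simp
qed (use cleavage_lift in simp_all)

lemma cloven_cofibration_psalg: "cloven_cofibration B\<^sub>0 (psalg_clcofib A)"
  using Carrier_Obj cleavage_lift by (simp add: cloven_cofibration_def psalg_clcofib_def)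

text \<open>Being induced by its own lifts, the pseudoalgebra is the unique one so induced.\<close>

lemma psalg_eq: "lift_psalg (psalg_clcofib A) = A"
  using lift.psalg_unique[of A] psalg induced_by_psalg_lift B by (simp add: psalg_clcofib_def)

end

lemma cloven_slice_clcofib: "cloven_cofibration B C \<Longrightarrow> cloven_slice (Proj C) (Lift C)"
  using slice_ObjD[of "Proj C" B]
  by (auto simp: cloven_cofibration_def cloven_slice_def cloven_def cloven_slice_axioms_def)

text \<open>On liftable pairs this is the defining equation of the action at \<open>(1, u)\<close>,
  where the lift of an identity is the unit component; elsewhere both sides are
  \<open>undefined\<close>.\<close>

lemma clcofib_eq:
  assumes "cloven_cofibration B C"
  shows "psalg_clcofib (lift_psalg C) = C"
proof -
  interpret C: cloven_slice "Proj C" "Lift C" by (rule cloven_slice_clcofib[OF assms])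
  have A: "lift_psalg C = C.A" by (cases C) simp
  have "psalg_lift (lift_psalg C) x u = Lift C x u" for x u
  proof (cases "liftable (Proj C) x u")
    case True
    then have X: "x \<in> Ob C.E" "u \<in> Ar C.B" "Dom C.B u = FOb (Proj C) x" by (auto simp: liftable_def)
    then show ?thesis
      using True C.P C.L_lift[of "comma_ar (upair x (Idn C.B (FOb (Proj C) x))) (upair x u) (Idn C.E x) u"]
      unfolding A psalg_lift_def by simp
  next
    case False
    then show ?thesis
      using assms unfolding A psalg_lift_def cloven_cofibration_def cleavage_def by simp
  qed
  then show ?thesis unfolding psalg_clcofib_def by (cases C) (simp add: lift_psalg_def fun_eq_iff)
qed

section \<open>Pseudomorphisms\<close>

lemma psmorD:
  assumes "pseudomorphism K T m"
  shows "pseudoalgebra K T (MSrc m)" "pseudoalgebra K T (MTrg m)"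
    "Und m \<in> mor K (Carrier (MSrc m)) (Carrier (MTrg m))"
    "Str m \<in> cell K (Comp1 K (Act (MTrg m)) (T1 T (Und m))) (Comp1 K (Und m) (Act (MSrc m)))"
    "invertible_cell K (Str m)"
    "VComp K (whisker_right K (Str m) (Unit T (Carrier (MSrc m)))) (whisker_right K (UnitC (MTrg m)) (Und m))
      = whisker_left K (Und m) (UnitC (MSrc m))"
  using assms unfolding pseudomorphism_def by blast+

definition lift_str :: "'u::universe func \<Rightarrow> ('u \<Rightarrow> 'u \<Rightarrow> 'u) \<Rightarrow> 'u func \<Rightarrow> 'u func \<Rightarrow> ('u \<Rightarrow> 'u \<Rightarrow> 'u) \<Rightarrow> 'u nattr" where
  "lift_str P \<delta> T Q \<epsilon> = \<lparr>NDom = comp_func (act_func Q \<epsilon>) (comma_func P T Q),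
    NCod = comp_func T (act_func P \<delta>),
    NAt = (\<lambda>X \<in> comma_Ob P. fill Q (\<epsilon> (FOb T (ufst X)) (usnd X)) (FAr T (\<delta> (ufst X) (usnd X)))
      (Idn (FCod P) (Cod (FCod P) (usnd X))))\<rparr>"

definition lift_mor :: "('u::universe clcofib, 'u func) between
    \<Rightarrow> ('u func, ('u func, 'u func) between, ('u func, 'u nattr) between) psmor" where
  "lift_mor t = (let P = Proj (bsrc t); Q = Proj (btrg t) in
    \<lparr>MSrc = lift_psalg (bsrc t), Und = over t,
     Str = \<lparr>bsrc = comma_proj P, body = lift_str P (Lift (bsrc t)) (body t) Q (Lift (btrg t)), btrg = Q\<rparr>,
     MTrg = lift_psalg (btrg t)\<rparr>)"

section \<open>Functors over the base between two cloven cofibrations\<close>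

locale cloven_pair =
  S: cloven_slice P \<delta> + R: cloven_slice Q \<epsilon>
  for P :: "'u::universe func" and \<delta> and Q :: "'u func" and \<epsilon> +
  assumes same_base: "FCod Q = FCod P"
begin

abbreviation "B \<equiv> FCod P"
abbreviation "E \<equiv> FDom P"
abbreviation "E' \<equiv> FDom Q"
abbreviation comp (infixr "\<bullet>" 70) where "g \<bullet> f \<equiv> Cmp E' g f"

lemmas bases = S.P R.P same_base

lemma Q_Obj: "Q \<in> Obj (slice CAT B)"
  using R.P_Obj same_base by simp

text \<open>The rules for lifts in \<open>Q\<close> are restated over \<open>FCod P\<close>, so that
  facts about both cofibrations speak of the base by one name.\<close>

lemma R_lift [simp]:
  assumes "x \<in> Ob E'" "u \<in> Ar B" "Dom B u = FOb Q x"
  shows "\<epsilon> x u \<in> Ar E'" "Dom E' (\<epsilon> x u) = x" "FAr Q (\<epsilon> x u) = u" "cocartesian Q (\<epsilon> x u)"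
    "FOb Q (Cod E' (\<epsilon> x u)) = Cod B u"
  using R.lift[of x u] assms same_base by simp_all

text \<open>Every cocartesian arrow is a chosen lift followed by an isomorphism, and functors
  preserve isomorphisms; chosen lifts therefore suffice as test arrows.\<close>

lemma preserves_cocartesian_iff:
  assumes T: "fun_over P T Q"
  shows "preserves_cocartesian P T Q \<longleftrightarrow> (\<forall>X \<in> comma_Ob P. cocartesian Q (FAr T (\<delta> (ufst X) (usnd X))))"
proof
  note TD = fun_overD[OF T]
  assume *: "\<forall>X \<in> comma_Ob P. cocartesian Q (FAr T (\<delta> (ufst X) (usnd X)))"
  show "preserves_cocartesian P T Q"
    unfolding preserves_cocartesian_def
  proof (intro allI impI)
    fix e assume e: "cocartesian P e"
    note ar = cocartesian_Ar[OF e]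
    let ?X = "upair (Dom E e) (FAr P e)"
    have X: "?X \<in> comma_Ob P" using ar S.P by simp
    let ?d = "\<delta> (Dom E e) (FAr P e)"
    obtain i j where i: "inverse_arrows E i j" "Dom E i = Cod E ?d" "Cmp E i ?d = e"
      using cocartesian_factor[OF S.P S.lift(4) e, of "Dom E e" "FAr P e"] X by auto
    note iD = inverse_arrowsD[OF i(1)]
    have ci: "cocartesian Q (FAr T i)"
      using cocartesian_iso[OF R.P, of "FAr T i" "FAr T j"] inverse_arrows_FAr[OF TD(1), of i j] i(1) TD(2,3) by simp
    have cd: "cocartesian Q (FAr T ?d)" using bspec[OF * X] by simp
    have "cocartesian Q (FAr T i \<bullet> FAr T ?d)"
      by (rule cocartesian_Cmp[OF R.P cd ci]) (use TD(1-3) iD i X in simp)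
    moreover have "FAr T e = FAr T i \<bullet> FAr T ?d"
      using FAr_Cmp_eq[OF TD(1,2), of ?d i] iD i X TD(3) by simp
    ultimately show "cocartesian Q (FAr T e)" by simp
  qed
qed (auto simp: preserves_cocartesian_def)

context
  fixes T
  assumes T: "fun_over P T Q"
begin

lemmas TD = fun_overD(1-3,6,7)[OF T]

abbreviation "\<sigma> \<equiv> NAt (lift_str P \<delta> T Q \<epsilon>)"

lemma str_simps:
  "NDom (lift_str P \<delta> T Q \<epsilon>) = comp_func R.L (comma_func P T Q)"
  "NCod (lift_str P \<delta> T Q \<epsilon>) = comp_func T S.L"
  "\<sigma> \<in> extensional (comma_Ob P)"
  by (simp_all add: lift_str_def)

lemma str:
  assumes X: "X \<in> comma_Ob P"
  shows "\<sigma> X \<in> Ar E'" "Dom E' (\<sigma> X) = Cod E' (\<epsilon> (FOb T (ufst X)) (usnd X))"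
    "Cod E' (\<sigma> X) = FOb T (Cod E (\<delta> (ufst X) (usnd X)))" "FAr Q (\<sigma> X) = Idn B (Cod B (usnd X))"
    "\<sigma> X \<bullet> \<epsilon> (FOb T (ufst X)) (usnd X) = FAr T (\<delta> (ufst X) (usnd X))"
proof -
  have e: "cocartesian Q (\<epsilon> (FOb T (ufst X)) (usnd X))"
    using X TD bases by (intro R_lift(4)) simp_all
  have *: "\<sigma> X = fill Q (\<epsilon> (FOb T (ufst X)) (usnd X)) (FAr T (\<delta> (ufst X) (usnd X))) (Idn B (Cod B (usnd X)))"
    using X by (simp add: lift_str_def)
  show "\<sigma> X \<in> Ar E'" "Dom E' (\<sigma> X) = Cod E' (\<epsilon> (FOb T (ufst X)) (usnd X))"
    "Cod E' (\<sigma> X) = FOb T (Cod E (\<delta> (ufst X) (usnd X)))" "FAr Q (\<sigma> X) = Idn B (Cod B (usnd X))"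
    "\<sigma> X \<bullet> \<epsilon> (FOb T (ufst X)) (usnd X) = FAr T (\<delta> (ufst X) (usnd X))"
    unfolding * using X TD bases
      fill[OF e, of "FAr T (\<delta> (ufst X) (usnd X))" "Idn B (Cod B (usnd X))"] by simp_all
qed

text \<open>The test by which an arrow is recognized as the canonical comparison: for identities,
  composites, strictness, and the structure cell of a given pseudomorphism.\<close>

lemma str_unique:
  assumes X: "X \<in> comma_Ob P" and h: "h \<in> Ar E'" "Dom E' h = Cod E' (\<epsilon> (FOb T (ufst X)) (usnd X))"
    "Cod E' h = FOb T (Cod E (\<delta> (ufst X) (usnd X)))" "FAr Q h = Idn B (Cod B (usnd X))"
    "h \<bullet> \<epsilon> (FOb T (ufst X)) (usnd X) = FAr T (\<delta> (ufst X) (usnd X))"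
  shows "h = \<sigma> X"
  by (rule cocartesian_cancel[OF R.P R_lift(4), of "FOb T (ufst X)" "usnd X"])
    (use X h TD bases str[OF X] in simp_all)

lemma comma_T: "fun_over S.C (comma_func P T Q) R.C" "is_functor (comma_func P T Q)"
  using fun_over_comma_func[OF S.P R.P T] is_functor_comma_func[OF S.P R.P T] by simp_all

lemma comma_T_Ar:
  assumes a: "a \<in> comma_Ar P"
  shows "FAr (comma_func P T Q) a \<in> comma_Ar Q"
  using FAr_Ar[OF comma_T(2), of "comma_cat Q" a] a by simp

text \<open>Against the lift at the source, both sides of the square become the image under
  \<open>T\<close> of \<open>S.L_lift\<close>.\<close>

lemma nat_over_str: "nat_over S.C (lift_str P \<delta> T Q \<epsilon>) Q"
proof -
  have d: "fun_over S.C (comp_func R.L (comma_func P T Q)) Q"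
    by (rule fun_over_comp[OF _ _ R.P comma_T(1) R.fun_over_L]) (use S.P R.P in simp_all)
  have c: "fun_over S.C (comp_func T S.L) Q"
    by (rule fun_over_comp[OF _ S.P R.P S.fun_over_L T]) (use S.P in simp_all)
  have *: "natural_transformation (lift_str P \<delta> T Q \<epsilon>)"
  proof (rule natural_transformationI, goal_cases)
    case (7 a)
    then have a: "a \<in> comma_Ar P" by (simp add: str_simps)
    let ?X = "cm_src a" and ?Y = "cm_trg a"
    have XY: "?X \<in> comma_Ob P" "?Y \<in> comma_Ob P" using a by simp_all
    let ?dX = "\<delta> (ufst ?X) (usnd ?X)" and ?dY = "\<delta> (ufst ?Y) (usnd ?Y)"
    let ?eX = "\<epsilon> (FOb T (ufst ?X)) (usnd ?X)" and ?eY = "\<epsilon> (FOb T (ufst ?Y)) (usnd ?Y)"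
    define b where "b = FAr R.L (FAr (comma_func P T Q) a)"
    have b: "b \<in> Ar E'" "Dom E' b = Cod E' ?eX" "Cod E' b = Cod E' ?eY" "FAr Q b = cm_snd a"
      and bk: "b \<bullet> ?eX = ?eY \<bullet> FAr T (cm_fst a)"
      using R.L_Ar[OF comma_T_Ar[OF a], folded b_def] R.L_lift[OF comma_T_Ar[OF a], folded b_def] a by simp_all
    note sX = str[OF XY(1)] and sY = str[OF XY(2)]
    have e: "\<sigma> ?Y \<bullet> b = FAr T (FAr S.L a) \<bullet> \<sigma> ?X"
    proof (rule cocartesian_cancel[OF R.P R_lift(4), of "FOb T (ufst ?X)" "usnd ?X"])
      have "(\<sigma> ?Y \<bullet> b) \<bullet> ?eX = \<sigma> ?Y \<bullet> b \<bullet> ?eX"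
        by (rule Cmp_assoc_r) (use a XY TD bases b sY in simp_all)
      also have "\<dots> = (\<sigma> ?Y \<bullet> ?eY) \<bullet> FAr T (cm_fst a)"
        unfolding bk by (rule Cmp_assoc_r[symmetric]) (use a XY TD bases sY in simp_all)
      also have "\<dots> = FAr T (Cmp E ?dY (cm_fst a))"
        unfolding sY(5) using a XY TD S.P FAr_Cmp_eq[OF TD(1,2), of "cm_fst a" ?dY] by simp
      also have "\<dots> = FAr T (FAr S.L a) \<bullet> FAr T ?dX"
        unfolding S.L_lift[OF a, symmetric]
        using a XY TD S.P FAr_Cmp_eq[OF TD(1,2), of ?dX "FAr S.L a"] by simp
      also have "\<dots> = (FAr T (FAr S.L a) \<bullet> \<sigma> ?X) \<bullet> ?eX"
        unfolding sX(5)[symmetric] by (rule Cmp_assoc_r[symmetric]) (use a XY TD bases sX in simp_all)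
      finally show "(\<sigma> ?Y \<bullet> b) \<bullet> ?eX = (FAr T (FAr S.L a) \<bullet> \<sigma> ?X) \<bullet> ?eX" .
    qed (use a XY TD bases b sX sY in simp_all)
    then show ?case using a TD by (simp add: str_simps b_def)
  qed (use str TD bases comma_T(2) in \<open>simp_all add: str_simps\<close>)
  show ?thesis
    unfolding nat_over_def str_simps using * d c str(4) by simp
qed

abbreviation "tT \<equiv> \<lparr>bsrc = P, body = T, btrg = Q\<rparr>"
abbreviation "tS \<equiv> \<lparr>bsrc = S.C, body = lift_str P \<delta> T Q \<epsilon>, btrg = Q\<rparr>"

lemma T_typing:
  "tT \<in> mor (slice CAT B) P Q"
  "tS \<in> cell (slice CAT B) (Comp1 (slice CAT B) (Act R.A) (T1 comma_2monad tT)) (Comp1 (slice CAT B) tT (Act S.A))"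
  using S.P_Obj Q_Obj comma_proj_Obj[OF S.P_Obj] T nat_over_str
  unfolding slice_CAT_mor slice_CAT_cell by (simp_all add: slice_simps str_simps)

lemmas R_typing = R.A_typing[unfolded same_base]

lemma Str_unit_component:
  assumes x: "x \<in> Ob E"
  shows "\<sigma> (FOb (comma_unit P) x) \<bullet> R.\<iota> (FOb T x) = FAr T (S.\<iota> x)"
  using str(5)[of "FOb (comma_unit P) x"] x TD bases by simp

text \<open>Against the two-step lift in \<open>Q\<close>, both sides become \<open>T\<close> of the
  lift of the composite. On the right, \<sigma> is used once per lift, and then the defining
  equation of \<chi> is applied inside \<open>T\<close>.\<close>

lemma Str_mult_component:
  assumes Z: "Z \<in> comma_Ob S.C"
  shows "\<sigma> (FOb (comma_mult P) Z) \<bullet> R.\<chi> (FOb (comma_func S.C (comma_func P T Q) R.C) Z)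
    = FAr T (S.\<chi> Z) \<bullet> \<sigma> (FOb (comma_func S.C S.L P) Z)
      \<bullet> FAr R.L (NAt (comma_nat S.C (lift_str P \<delta> T Q \<epsilon>) Q) Z)"
proof -
  let ?x = "ufst (ufst Z)" and ?u = "usnd (ufst Z)" and ?v = "usnd Z"
  let ?X = "ufst Z"
  let ?Z' = "FOb (comma_func S.C (comma_func P T Q) R.C) Z"
  let ?eu = "\<epsilon> (FOb T ?x) ?u" and ?du = "\<delta> ?x ?u"
  let ?ev = "\<epsilon> (Cod E' ?eu) ?v" and ?dv = "\<delta> (Cod E ?du) ?v"
  let ?ew = "\<epsilon> (FOb T (Cod E ?du)) ?v"
  let ?M = "FOb (comma_mult P) Z" and ?N = "FOb (comma_func S.C S.L P) Z"
  have X: "?X \<in> comma_Ob P" using Z by simp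
  have ty: "?x \<in> Ob E" "?u \<in> Ar B" "?v \<in> Ar B" "Dom B ?u = FOb P ?x" "Dom B ?v = Cod B ?u"
    using Z X by simp_all
  have Tx: "FOb T ?x \<in> Ob E'" "FOb Q (FOb T ?x) = FOb P ?x" using ty TD by simp_all
  have M: "?M \<in> comma_Ob P" "ufst ?M = ?x" "usnd ?M = Cmp B ?v ?u" using Z ty S.P by simp_all
  have N: "?N \<in> comma_Ob P" "ufst ?N = Cod E ?du" "usnd ?N = ?v" using Z ty S.P by simp_all
  have Z': "?Z' \<in> comma_Ob R.C" "ufst ?Z' = upair (FOb T ?x) ?u" "usnd ?Z' = ?v"
    using Z ty Tx bases by simp_all
  define a where "a = NAt (comma_nat S.C (lift_str P \<delta> T Q \<epsilon>) Q) Z"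
  note sX = str[OF X] and sM = str[OF M(1), unfolded M(2,3)] and sN = str[OF N(1), unfolded N(2,3)]
  have a: "a \<in> comma_Ar Q" "cm_src a = upair (Cod E' ?eu) ?v" "cm_trg a = upair (FOb T (Cod E ?du)) ?v"
    "cm_fst a = \<sigma> ?X" "cm_snd a = Idn B (Cod B ?v)"
    unfolding a_def using Z X ty Tx TD bases sX by (simp_all add: str_simps)
  define b where "b = FAr R.L a"
  have bT: "b \<in> Ar E'" "Dom E' b = Cod E' ?ev" "Cod E' b = Cod E' ?ew" "FAr Q b = Idn B (Cod B ?v)"
    and bk: "b \<bullet> ?ev = ?ew \<bullet> \<sigma> ?X"
    using R.L_Ar[OF a(1)] R.L_lift[OF a(1)] unfolding b_def a by simp_all
  note m = R.mult[OF Z'(1), unfolded Z' ufst_upair usnd_upair same_base]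
    and mk = R.mult_lift[OF Z'(1), unfolded Z' ufst_upair usnd_upair same_base]
  note n = S.mult[OF Z] and nk = S.mult_lift[OF Z]
  let ?e = "?ev \<bullet> ?eu"
  have e: "cocartesian Q ?e" using ty Tx R.P by (intro cocartesian_Cmp) simp_all
  have "(\<sigma> ?M \<bullet> R.\<chi> ?Z') \<bullet> ?e = \<sigma> ?M \<bullet> R.\<chi> ?Z' \<bullet> ?e"
    by (rule Cmp_assoc_r) (use ty Tx bases m sM in simp_all)
  also have "\<dots> = FAr T (\<delta> ?x (Cmp B ?v ?u))"
    unfolding mk sM(5) ..
  finally have l: "(\<sigma> ?M \<bullet> R.\<chi> ?Z') \<bullet> ?e = FAr T (\<delta> ?x (Cmp B ?v ?u))" .
  have "(FAr T (S.\<chi> Z) \<bullet> \<sigma> ?N \<bullet> b) \<bullet> ?e = FAr T (S.\<chi> Z) \<bullet> \<sigma> ?N \<bullet> (b \<bullet> ?ev) \<bullet> ?eu"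
    using ty Tx TD bases bT sN(1-4) n by (simp add: Cmp_assoc_r)
  also have "\<dots> = FAr T (S.\<chi> Z) \<bullet> (\<sigma> ?N \<bullet> ?ew) \<bullet> \<sigma> ?X \<bullet> ?eu"
    unfolding bk using ty Tx TD bases sN(1-4) sX(1-4) n by (simp add: Cmp_assoc_r)
  also have "\<dots> = FAr T (S.\<chi> Z) \<bullet> FAr T ?dv \<bullet> FAr T ?du"
    unfolding sN(5) sX(5) ..
  also have "\<dots> = FAr T (Cmp E (S.\<chi> Z) (Cmp E ?dv ?du))"
    using ty TD S.P n by simp
  also have "\<dots> = (\<sigma> ?M \<bullet> R.\<chi> ?Z') \<bullet> ?e"
    unfolding nk l ..
  finally have r: "(\<sigma> ?M \<bullet> R.\<chi> ?Z') \<bullet> ?e = (FAr T (S.\<chi> Z) \<bullet> \<sigma> ?N \<bullet> b) \<bullet> ?e" by simp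
  have "\<sigma> ?M \<bullet> R.\<chi> ?Z' = FAr T (S.\<chi> Z) \<bullet> \<sigma> ?N \<bullet> b"
    by (rule cocartesian_cancel[OF R.P e _ _ _ _ _ _ r]) (use ty Tx TD bases bT sN sM m n in simp_all)
  then show ?thesis unfolding b_def a_def .
qed

abbreviation "tM \<equiv> lift_mor \<lparr>bsrc = \<lparr>Proj = P, Lift = \<delta>\<rparr>, body = T, btrg = \<lparr>Proj = Q, Lift = \<epsilon>\<rparr>\<rparr>"

lemma tM_simps: "MSrc tM = S.A" "Und tM = tT" "Str tM = tS" "MTrg tM = R.A"
  by (simp_all add: lift_mor_def over_def)

text \<open>When \<open>T\<close> preserves cocartesian arrows, \<sigma> compares two cocartesian
  arrows over the same base arrow.\<close>

lemma str_iso: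
  assumes "preserves_cocartesian P T Q" and X: "X \<in> comma_Ob P"
  shows "\<exists>k. inverse_arrows E' (\<sigma> X) k"
proof -
  let ?e = "\<epsilon> (FOb T (ufst X)) (usnd X)" and ?d = "FAr T (\<delta> (ufst X) (usnd X))"
  have e: "cocartesian Q ?e" "FOb Q (Cod E' ?e) = Cod B (usnd X)"
    using X TD bases by (simp_all add: R_lift)
  have d: "cocartesian Q ?d" using assms preserves_cocartesian_iff[OF T] by blast
  show ?thesis
    using cocartesian_comparison[OF R.P e(1) d] X TD bases e(2) by (auto simp: lift_str_def)
qed

lemma pseudomorphism_tM:
  assumes pc: "preserves_cocartesian P T Q"
  shows "pseudomorphism (slice CAT B) comma_2monad tM"
proof (rule pseudomorphism.intro, unfold tM_simps)
  note ty = S.P_Obj S.A_typing Q_Obj R_typing T_typing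
  show "pseudoalgebra (slice CAT B) comma_2monad S.A" by (rule S.pseudoalgebra_A)
  show "pseudoalgebra (slice CAT B) comma_2monad R.A" using R.pseudoalgebra_A same_base by simp
  show "tT \<in> mor (slice CAT B) (Carrier S.A) (Carrier R.A)" using T_typing by simp
  show "tS \<in> cell (slice CAT B) (Comp1 (slice CAT B) (Act R.A) (T1 comma_2monad tT)) (Comp1 (slice CAT B) tT (Act S.A))"
    by (rule T_typing)
  show "invertible_cell (slice CAT B) tS"
    using T_typing(2) str_iso[OF pc] by (intro invertible_cell_sliceI) (auto simp: cell_iff)
  show "VComp (slice CAT B) (whisker_right (slice CAT B) tS (Unit comma_2monad (Carrier S.A)))
      (whisker_right (slice CAT B) (UnitC R.A) tT) = whisker_left (slice CAT B) tT (UnitC S.A)"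
    using Str_unit_iff[OF ty] Str_unit_component by simp
  show "VComp (slice CAT B) (whisker_right (slice CAT B) tS (Mult comma_2monad (Carrier S.A)))
      (whisker_right (slice CAT B) (MultC R.A) (T1 comma_2monad (T1 comma_2monad tT)))
    = VComp (slice CAT B) (whisker_left (slice CAT B) tT (MultC S.A))
        (VComp (slice CAT B) (whisker_right (slice CAT B) tS (T1 comma_2monad (Act S.A)))
          (whisker_left (slice CAT B) (Act R.A) (T2 comma_2monad tS)))"
    using Str_mult_iff[OF ty] Str_mult_component by simp
qed

text \<open>The structure cell of a pseudomorphism is forced by its unit axiom and naturality.\<close>

lemma pseudomorphism_unique:
  assumes m: "pseudomorphism (slice CAT B) comma_2monad m"
    and m_simps: "MSrc m = S.A" "MTrg m = R.A" "Und m = tT"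
  shows "m = tM" and "preserves_cocartesian P T Q"
proof -
  note D = psmorD[OF m, unfolded m_simps]
  have c: "Str m \<in> cell (slice CAT B) (Comp1 (slice CAT B) (Act R.A) (T1 comma_2monad tT)) (Comp1 (slice CAT B) tT (Act S.A))"
    by (rule D(4))
  have b: "bsrc (Str m) = S.C" "btrg (Str m) = Q"
    using c by (auto simp: cell_iff slice_simps)
  have n: "nat_over S.C (body (Str m)) Q"
    using c b unfolding slice_CAT_cell by metis
  have nd: "NDom (body (Str m)) = comp_func R.L (comma_func P T Q)" "NCod (body (Str m)) = comp_func T S.L"
    using c by (auto simp: cell_iff slice_simps)
  note nD = nat_overD(1,4,5,6)[OF n]
  let ?s = "NAt (body (Str m))"
  have sX: "?s X \<in> Ar E'" "Dom E' (?s X) = Cod E' (\<epsilon> (FOb T (ufst X)) (usnd X))"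
    "Cod E' (?s X) = FOb T (Cod E (\<delta> (ufst X) (usnd X)))" "FAr Q (?s X) = Idn B (Cod B (usnd X))"
    if X: "X \<in> comma_Ob P" for X
    using nD(2,4) X NAt_Ar[OF nD(1,3), of X] Dom_NAt[OF nD(1,3), of X] Cod_NAt[OF nD(1,3), of X] TD bases
    by (simp_all add: nd)
  have un: "?s (FOb (comma_unit P) x) \<bullet> R.\<iota> (FOb T x) = FAr T (S.\<iota> x)" if "x \<in> Ob E" for x
    using Str_unit_iff[OF S.P_Obj S.A_typing Q_Obj R_typing T_typing(1) c] D(6) that by simp
  have eq: "?s X = \<sigma> X" if X: "X \<in> comma_Ob P" for X
  proof (rule str_unique[OF X sX[OF X]])
    let ?x = "ufst X" and ?u = "usnd X"
    let ?U = "FOb (comma_unit P) ?x"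
    let ?e1 = "\<epsilon> (FOb T ?x) (Idn B (FOb P ?x))" and ?d1 = "\<delta> ?x (Idn B (FOb P ?x))"
    let ?e = "\<epsilon> (FOb T ?x) ?u" and ?d = "\<delta> ?x ?u"
    \<comment> \<open>The comma arrow \<open>(1, u)\<close> transports the unit axiom from
      \<open>(x, 1)\<close> to \<open>X\<close>: in \<open>Q\<close> its action takes the lift of
      the identity to the lift of \<open>u\<close>, and likewise in \<open>P\<close>.\<close>
    let ?a = "comma_ar ?U X (Idn E ?x) ?u"
    have x: "?x \<in> Ob E" "?u \<in> Ar B" "Dom B ?u = FOb P ?x" using X by simp_all
    have Tx: "FOb T ?x \<in> Ob E'" "FOb Q (FOb T ?x) = FOb P ?x" using x TD by simp_all
    have U: "?U \<in> comma_Ob P" "ufst ?U = ?x" "usnd ?U = Idn B (FOb P ?x)" using x S.P by simp_all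
    have a: "?a \<in> comma_Ar P" using X x U S.P by simp
    define b where "b = FAr R.L (FAr (comma_func P T Q) ?a)"
    have bT: "b \<in> Ar E'" "Dom E' b = Cod E' ?e1" "Cod E' b = Cod E' ?e" "b \<bullet> ?e1 = ?e"
      using R.L_Ar[OF comma_T_Ar[OF a], folded b_def] R.L_lift[OF comma_T_Ar[OF a], folded b_def] a x Tx U TD bases
      by simp_all
    have dk: "Cmp E (FAr S.L ?a) ?d1 = ?d" using S.L_lift[OF a] a x U S.P by simp
    have La: "FAr S.L ?a \<in> Ar E" "Dom E (FAr S.L ?a) = Cod E ?d1" using S.L_Ar[OF a] U by simp_all
    have nat: "?s X \<bullet> b = FAr T (FAr S.L ?a) \<bullet> ?s ?U"
      using NAt_natural[OF nD(1,3,2), of ?a] X x S.P nd TD by (simp add: b_def)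
    have u1: "?s ?U \<bullet> ?e1 = FAr T ?d1" using un[OF x(1)] x Tx same_base by simp
    have "?s X \<bullet> ?e = (?s X \<bullet> b) \<bullet> ?e1"
      unfolding bT(4)[symmetric] by (rule Cmp_assoc_r[symmetric]) (use x Tx bases bT sX[OF X] in simp_all)
    also have "\<dots> = FAr T (FAr S.L ?a) \<bullet> ?s ?U \<bullet> ?e1"
      unfolding nat by (rule Cmp_assoc_r) (use x Tx bases TD La sX[OF U(1)] U in simp_all)
    also have "\<dots> = FAr T (Cmp E (FAr S.L ?a) ?d1)"
      unfolding u1 using FAr_Cmp_eq[OF TD(1,2), of ?d1 "FAr S.L ?a"] x La TD(3) S.P by simp
    finally show "?s X \<bullet> ?e = FAr T ?d" unfolding dk .
  qed
  have Str: "Str m = tS"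
    by (rule slice_cell_eqI[OF c T_typing(2)]) (simp add: slice_simps eq)
  show "m = tM"
    by (rule psmor.equality) (use m_simps Str tM_simps in simp_all)
  show "preserves_cocartesian P T Q"
    unfolding preserves_cocartesian_iff[OF T]
  proof
    fix X assume X: "X \<in> comma_Ob P"
    obtain j where "inverse_arrows E' (?s X) j"
      using invertible_cell_sliceD[OF D(5), of X] b X by auto
    \<comment> \<open>As an isomorphism \<sigma> is cocartesian, and composing it after the lift in
      \<open>Q\<close> gives the image of the lift in \<open>P\<close>.\<close>
    then have "cocartesian Q (\<sigma> X)" using cocartesian_iso[OF R.P] eq[OF X] by simp
    then have "cocartesian Q (\<sigma> X \<bullet> \<epsilon> (FOb T (ufst X)) (usnd X))"
      by (intro cocartesian_Cmp[OF R.P]) (use X TD bases str[OF X] in simp_all)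
    then show "cocartesian Q (FAr T (\<delta> (ufst X) (usnd X)))" unfolding str(5)[OF X] .
  qed
qed

text \<open>If \<sigma> is an identity, \<open>\<sigma> \<cdot> \<epsilon> = T \<delta>\<close>
  becomes preservation of lifts. Conversely equal lifts have equal codomains and the identity
  satisfies that equation; \<open>nat_componentwise_id\<close> then supplies the equality of the two
  functors.\<close>

lemma strict_iff:
  "strict_psmor (slice CAT B) tM \<longleftrightarrow> (\<forall>X \<in> comma_Ob P. FAr T (\<delta> (ufst X) (usnd X)) = \<epsilon> (FOb T (ufst X)) (usnd X))"
proof -
  have 1: "strict_psmor (slice CAT B) tM \<longleftrightarrow> lift_str P \<delta> T Q \<epsilon> = id_nat (comp_func T S.L)"
    unfolding strict_psmor_def tM_simps by (simp add: slice_simps)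
  show ?thesis
    unfolding 1
  proof
    assume *: "lift_str P \<delta> T Q \<epsilon> = id_nat (comp_func T S.L)"
    show "\<forall>X \<in> comma_Ob P. FAr T (\<delta> (ufst X) (usnd X)) = \<epsilon> (FOb T (ufst X)) (usnd X)"
    proof
      fix X assume X: "X \<in> comma_Ob P"
      let ?y = "FOb T (Cod E (\<delta> (ufst X) (usnd X)))"
      have y: "?y \<in> Ob E'" using X TD S.P by simp
      have s: "\<sigma> X = Idn E' ?y" using * X TD by simp
      have "Cod E' (\<epsilon> (FOb T (ufst X)) (usnd X)) = ?y" using str(2)[OF X] s y bases by simp
      then show "FAr T (\<delta> (ufst X) (usnd X)) = \<epsilon> (FOb T (ufst X)) (usnd X)"
        using str(5)[OF X] s X TD bases by simp
    qed
  next
    assume *: "\<forall>X \<in> comma_Ob P. FAr T (\<delta> (ufst X) (usnd X)) = \<epsilon> (FOb T (ufst X)) (usnd X)"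
    have "lift_str P \<delta> T Q \<epsilon> = id_nat (NCod (lift_str P \<delta> T Q \<epsilon>))"
    proof (rule nat_componentwise_id)
      show "natural_transformation (lift_str P \<delta> T Q \<epsilon>)" using nat_overD(1)[OF nat_over_str] .
      fix X assume "X \<in> Ob (FDom (NDom (lift_str P \<delta> T Q \<epsilon>)))"
      then have X: "X \<in> comma_Ob P" by (simp add: str_simps)
      let ?d = "\<delta> (ufst X) (usnd X)" and ?e = "\<epsilon> (FOb T (ufst X)) (usnd X)"
      have de: "FAr T ?d = ?e" using * X by blast
      have c: "Cod E' ?e = FOb T (Cod E ?d)" unfolding de[symmetric] using X TD S.P by simp
      have e: "?e \<in> Ar E'" "Dom E' ?e = FOb T (ufst X)" "FOb Q (Cod E' ?e) = Cod B (usnd X)"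
        using X TD bases by simp_all
      have y: "Cod E' ?e \<in> Ob E'" using e bases by simp
      have "\<sigma> X = Idn E' (Cod E' ?e)"
        by (rule str_unique[OF X, symmetric]) (use e y c de bases in simp_all)
      then show "FOb (NDom (lift_str P \<delta> T Q \<epsilon>)) X = FOb (NCod (lift_str P \<delta> T Q \<epsilon>)) X \<and>
          \<sigma> X = Idn (FCod (NDom (lift_str P \<delta> T Q \<epsilon>))) (FOb (NCod (lift_str P \<delta> T Q \<epsilon>)) X)"
        using X c TD bases by (simp add: str_simps)
    qed
    then show "lift_str P \<delta> T Q \<epsilon> = id_nat (comp_func T S.L)" by (simp add: str_simps)
  qed
qed

end

text \<open>After cancelling the lift in \<open>Q\<close>, what remains is naturality of \<alpha> at
  the chosen lift in \<open>P\<close>; the action on \<open>(\<alpha>_x, 1)\<close> only moves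
  \<alpha> past the lift.\<close>

lemma CUnd_component:
  assumes T: "fun_over P T Q" and T': "fun_over P T' Q" and \<alpha>: "nat_over P \<alpha> Q" "NDom \<alpha> = T" "NCod \<alpha> = T'"
    and X: "X \<in> comma_Ob P"
  shows "NAt \<alpha> (FOb S.L X) \<bullet> \<sigma> T X = \<sigma> T' X \<bullet> FAr R.L (NAt (comma_nat P \<alpha> Q) X)"
proof -
  let ?x = "ufst X" and ?u = "usnd X"
  let ?d = "\<delta> ?x ?u" and ?e = "\<epsilon> (FOb T ?x) ?u" and ?e' = "\<epsilon> (FOb T' ?x) ?u"
  note TD = fun_overD(1-3,6,7)[OF T] and TD' = fun_overD(1-3,6,7)[OF T']
  note n = nat_overD(1,4,5,6)[OF \<alpha>(1)]
  have x: "?x \<in> Ob E" "?u \<in> Ar B" "Dom B ?u = FOb P ?x" using X by simp_all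
  have Tx: "FOb T ?x \<in> Ob E'" "FOb Q (FOb T ?x) = FOb P ?x" "FOb T' ?x \<in> Ob E'" "FOb Q (FOb T' ?x) = FOb P ?x"
    using x TD TD' by simp_all
  have at: "NAt \<alpha> y \<in> Ar E'" "Dom E' (NAt \<alpha> y) = FOb T y" "Cod E' (NAt \<alpha> y) = FOb T' y"
    "FAr Q (NAt \<alpha> y) = Idn B (FOb P y)" if "y \<in> Ob E" for y
    using n(2,4) that NAt_Ar[OF n(1,3), of y] Dom_NAt[OF n(1,3), of y] Cod_NAt[OF n(1,3), of y] \<alpha>(2,3)
    by simp_all
  define a where "a = NAt (comma_nat P \<alpha> Q) X"
  have a: "a \<in> comma_Ar Q" "cm_src a = upair (FOb T ?x) ?u" "cm_trg a = upair (FOb T' ?x) ?u"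
    "cm_fst a = NAt \<alpha> ?x" "cm_snd a = Idn B (Cod B ?u)"
    unfolding a_def using X x Tx at[OF x(1)] bases \<alpha>(2,3) by simp_all
  define b where "b = FAr R.L a"
  have b: "b \<in> Ar E'" "Dom E' b = Cod E' ?e" "Cod E' b = Cod E' ?e'" "FAr Q b = Idn B (Cod B ?u)"
    and bk: "b \<bullet> ?e = ?e' \<bullet> NAt \<alpha> ?x"
    using R.L_Ar[OF a(1)] R.L_lift[OF a(1)] unfolding b_def a by simp_all
  have d: "?d \<in> Ar E" "Cod E ?d \<in> Ob E" "FOb P (Cod E ?d) = Cod B ?u" using x S.P by simp_all
  note s = str[OF T X] and s' = str[OF T' X]
  have nat: "NAt \<alpha> (Cod E ?d) \<bullet> FAr T ?d = FAr T' ?d \<bullet> NAt \<alpha> ?x"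
    using NAt_natural[OF n(1,3,2) d(1)] x \<alpha>(2,3) by simp
  have "NAt \<alpha> (Cod E ?d) \<bullet> \<sigma> T X = \<sigma> T' X \<bullet> b"
  proof (rule cocartesian_cancel[OF R.P R_lift(4), of "FOb T ?x" ?u])
    have "(NAt \<alpha> (Cod E ?d) \<bullet> \<sigma> T X) \<bullet> ?e = NAt \<alpha> (Cod E ?d) \<bullet> \<sigma> T X \<bullet> ?e"
      by (rule Cmp_assoc_r) (use x Tx bases s at d in simp_all)
    also have "\<dots> = (\<sigma> T' X \<bullet> ?e') \<bullet> NAt \<alpha> ?x"
      unfolding s(5) s'(5) by (rule nat)
    also have "\<dots> = \<sigma> T' X \<bullet> b \<bullet> ?e"
      unfolding bk by (rule Cmp_assoc_r) (use x Tx bases s' at d in simp_all)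
    also have "\<dots> = (\<sigma> T' X \<bullet> b) \<bullet> ?e"
      by (rule Cmp_assoc_r[symmetric]) (use x Tx bases s' b in simp_all)
    finally show "(NAt \<alpha> (Cod E ?d) \<bullet> \<sigma> T X) \<bullet> ?e = (\<sigma> T' X \<bullet> b) \<bullet> ?e" .
  qed (use x Tx bases s s' at b d in simp_all)
  then show ?thesis using X unfolding b_def a_def by simp
qed

end

section \<open>The isomorphism\<close>

lemma ClCoFib_simps:
  "C \<in> Obj (ClCoFib B) \<longleftrightarrow> cloven_cofibration B C"
  "t \<in> Mor (ClCoFib B) \<longleftrightarrow> functor_over B t \<and> preserves_cocartesian (Proj (bsrc t)) (body t) (Proj (btrg t))"
  "\<beta> \<in> Cell (ClCoFib B) \<longleftrightarrow> cloven_cofibration B (bsrc \<beta>) \<and> cloven_cofibration B (btrg \<beta>)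
       \<and> over \<beta> \<in> Cell (slice CAT B)
       \<and> preserves_cocartesian (Proj (bsrc \<beta>)) (NDom (body \<beta>)) (Proj (btrg \<beta>))
       \<and> preserves_cocartesian (Proj (bsrc \<beta>)) (NCod (body \<beta>)) (Proj (btrg \<beta>))"
  "Src (ClCoFib B) = bsrc" "Trg (ClCoFib B) = btrg"
  "Id1 (ClCoFib B) C = \<lparr>bsrc = C, body = id_func (FDom (Proj C)), btrg = C\<rparr>"
  "Comp1 (ClCoFib B) t s = \<lparr>bsrc = bsrc s, body = comp_func (body t) (body s), btrg = btrg t\<rparr>"
  "Src2 (ClCoFib B) \<beta> = \<lparr>bsrc = bsrc \<beta>, body = NDom (body \<beta>), btrg = btrg \<beta>\<rparr>"
  "Trg2 (ClCoFib B) \<beta> = \<lparr>bsrc = bsrc \<beta>, body = NCod (body \<beta>), btrg = btrg \<beta>\<rparr>"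
  "Id2 (ClCoFib B) t = \<lparr>bsrc = bsrc t, body = id_nat (body t), btrg = btrg t\<rparr>"
  "VComp (ClCoFib B) \<beta> \<alpha> = \<lparr>bsrc = bsrc \<alpha>, body = vcomp_nat (body \<beta>) (body \<alpha>), btrg = btrg \<alpha>\<rparr>"
  "HComp (ClCoFib B) \<beta> \<alpha> = \<lparr>bsrc = bsrc \<alpha>, body = hcomp_nat (body \<beta>) (body \<alpha>), btrg = btrg \<beta>\<rparr>"
  "Src0 (ClCoFib B) \<beta> = bsrc \<beta>" "Trg0 (ClCoFib B) \<beta> = btrg \<beta>"
  by (simp_all add: ClCoFib_def Src0_def Trg0_def)

lemma over_simps [simp]:
  "bsrc (over t) = Proj (bsrc t)" "body (over t) = body t" "btrg (over t) = Proj (btrg t)"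
  by (simp_all add: over_def)

lemma over_ops:
  "over (Id1 (ClCoFib B) C) = Id1 (slice CAT B) (Proj C)"
  "over (Comp1 (ClCoFib B) t s) = Comp1 (slice CAT B) (over t) (over s)"
  "over (Src2 (ClCoFib B) \<beta>) = Src2 (slice CAT B) (over \<beta>)"
  "over (Trg2 (ClCoFib B) \<beta>) = Trg2 (slice CAT B) (over \<beta>)"
  "over (Id2 (ClCoFib B) t) = Id2 (slice CAT B) (over t)"
  "over (VComp (ClCoFib B) \<beta> \<alpha>) = VComp (slice CAT B) (over \<beta>) (over \<alpha>)"
  "over (HComp (ClCoFib B) \<beta> \<alpha>) = HComp (slice CAT B) (over \<beta>) (over \<alpha>)"
  by (simp_all add: over_def ClCoFib_simps slice_simps)

lemma preserves_cocartesian_comp: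
  assumes "fun_over P T Q" "preserves_cocartesian P T Q" "preserves_cocartesian Q S R"
  shows "preserves_cocartesian P (comp_func S T) R"
  using assms fun_overD(2)[OF assms(1)] cocartesian_Ar
  unfolding preserves_cocartesian_def by fastforce

lemma preserves_cocartesian_id: "preserves_cocartesian P (id_func (FDom P)) P"
  using cocartesian_Ar unfolding preserves_cocartesian_def by fastforce

lemma over_mor: "t \<in> mor (ClCoFib B) C D \<Longrightarrow> over t \<in> mor (slice CAT B) (Proj C) (Proj D)"
  by (auto simp: mor_iff ClCoFib_simps functor_over_def)

lemma over_cell: "\<beta> \<in> cell (ClCoFib B) s t \<Longrightarrow> over \<beta> \<in> cell (slice CAT B) (over s) (over t)"
  by (auto simp: cell_iff ClCoFib_simps over_def slice_simps)

lemma ClCoFib_mor_iff: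
  "t \<in> mor (ClCoFib B) C D \<longleftrightarrow> cloven_cofibration B C \<and> cloven_cofibration B D \<and> bsrc t = C \<and> btrg t = D \<and>
    fun_over (Proj C) (body t) (Proj D) \<and> preserves_cocartesian (Proj C) (body t) (Proj D)"
  by (auto simp: mor_iff ClCoFib_simps functor_over_def slice_CAT_Mor cloven_cofibration_def)

lemma ClCoFib_cell_iff:
  "\<beta> \<in> cell (ClCoFib B) s t \<longleftrightarrow> s \<in> mor (ClCoFib B) (bsrc \<beta>) (btrg \<beta>) \<and> t \<in> mor (ClCoFib B) (bsrc \<beta>) (btrg \<beta>) \<and>
    body s = NDom (body \<beta>) \<and> body t = NCod (body \<beta>) \<and> nat_over (Proj (bsrc \<beta>)) (body \<beta>) (Proj (btrg \<beta>))"
  by (cases s; cases t)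
    (auto simp: ClCoFib_mor_iff cell_iff ClCoFib_simps slice_CAT_Cell cloven_cofibration_def nat_over_def)

text \<open>\<open>over\<close> commutes with all operations, so their typing comes from the slice
  except for one clause: identities and composites must preserve cocartesian arrows.\<close>

lemma ClCoFib_faithful: "faithful_structure (slice CAT B) (ClCoFib B) ClCoFib_forget"
proof (rule faithful_structure.intro[OF two_category_slice_CAT], unfold_locales, goal_cases)
  case (3 C)
  then show ?case
    using slice_ObjD[of "Proj C" B]
    by (auto simp: ClCoFib_mor_iff ClCoFib_simps cloven_cofibration_def preserves_cocartesian_id
        intro!: fun_overI)
next
  case (4 f X Y g Z)
  then show ?case
    using fun_over_comp[of "Proj X" "Proj Y" "Proj Z" "body f" "body g"]
      preserves_cocartesian_comp[of "Proj X" "body f" "Proj Y" "body g" "Proj Z"]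
      slice_ObjD(1)[of "Proj X" B] slice_ObjD(1)[of "Proj Y" B] slice_ObjD(1)[of "Proj Z" B]
    by (simp add: ClCoFib_mor_iff ClCoFib_simps cloven_cofibration_def)
next
  case (6 \<alpha>)
  then have "\<alpha> \<in> cell (ClCoFib B) (Src2 (ClCoFib B) \<alpha>) (Trg2 (ClCoFib B) \<alpha>)" by (simp add: cell_iff)
  then show ?case by (simp add: ClCoFib_cell_iff ClCoFib_simps)
next
  case (5 \<alpha>)
  then have "\<alpha> \<in> cell (ClCoFib B) (Src2 (ClCoFib B) \<alpha>) (Trg2 (ClCoFib B) \<alpha>)" by (simp add: cell_iff)
  then show ?case by (simp add: ClCoFib_cell_iff mor_iff)
next
  case (7 f)
  then have f: "f \<in> mor (ClCoFib B) (bsrc f) (btrg f)" by (simp add: mor_iff ClCoFib_simps)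
  then have "Id2 (slice CAT B) (over f) \<in> cell (slice CAT B) (over f) (over f)"
    using over_mor[OF f] by (intro slice.Id2_cell) (simp add: mor_iff)
  then show ?case
    using f by (simp add: ClCoFib_cell_iff ClCoFib_simps slice_CAT_cell slice_simps)
next
  case (8 \<alpha> f g \<beta> h)
  then have "VComp (slice CAT B) (over \<beta>) (over \<alpha>) \<in> cell (slice CAT B) (over f) (over h)"
    using slice.VComp_cell over_cell by blast
  moreover have "bsrc \<beta> = bsrc \<alpha>" "btrg \<beta> = btrg \<alpha>"
    using 8 by (auto simp: ClCoFib_cell_iff ClCoFib_mor_iff)
  ultimately show ?case
    using 8 by (auto simp: ClCoFib_cell_iff ClCoFib_simps slice_CAT_cell slice_simps)
next
  case (9 \<alpha> f f' \<beta> g g')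
  have m: "f \<in> mor (ClCoFib B) (bsrc f) (btrg f)" "g \<in> mor (ClCoFib B) (btrg f) (btrg g)"
    "f' \<in> mor (ClCoFib B) (bsrc f) (btrg f)" "g' \<in> mor (ClCoFib B) (btrg f) (btrg g)"
    and b: "bsrc \<alpha> = bsrc f" "btrg \<alpha> = btrg f" "bsrc \<beta> = btrg f" "btrg \<beta> = btrg g"
    using 9 by (auto simp: ClCoFib_cell_iff ClCoFib_mor_iff ClCoFib_simps)
  have comp: "Comp1 (ClCoFib B) v u \<in> mor (ClCoFib B) X Z"
    if "u \<in> mor (ClCoFib B) X Y" "v \<in> mor (ClCoFib B) Y Z" for u v X Y Z
    using that fun_over_comp[of "Proj X" "Proj Y" "Proj Z" "body u" "body v"]
      preserves_cocartesian_comp[of "Proj X" "body u" "Proj Y" "body v" "Proj Z"]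
      slice_ObjD(1)[of "Proj X" B] slice_ObjD(1)[of "Proj Y" B] slice_ObjD(1)[of "Proj Z" B]
    by (simp add: ClCoFib_mor_iff ClCoFib_simps cloven_cofibration_def)
  have "HComp (slice CAT B) (over \<beta>) (over \<alpha>)
      \<in> cell (slice CAT B) (Comp1 (slice CAT B) (over g) (over f)) (Comp1 (slice CAT B) (over g') (over f'))"
    by (rule slice.HComp_cell) (use 9 over_cell in \<open>auto simp: ClCoFib_simps\<close>)
  then show ?case
    using 9 b comp[OF m(1,2)] comp[OF m(3,4)]
    by (simp add: ClCoFib_cell_iff ClCoFib_simps slice_CAT_cell slice_simps)
next
  case (11 f X Y)
  then show ?case using over_mor by (simp add: ClCoFib_forget_def)
next
  case (12 \<alpha> f g)
  then show ?case using over_cell by (simp add: ClCoFib_forget_def)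
next
  case (18 f X Y g)
  then show ?case by (auto simp: ClCoFib_forget_def ClCoFib_mor_iff over_def)
next
  case (19 \<alpha> f g \<beta>)
  then show ?case by (auto simp: ClCoFib_forget_def ClCoFib_cell_iff ClCoFib_mor_iff over_def)
qed (auto simp: ClCoFib_forget_def over_ops ClCoFib_simps(1-5,13,14) functor_over_def cloven_cofibration_def)

section \<open>From functors and 2-cells over the base to pseudomorphisms and
  transformations\<close>

definition lift_cell :: "('u::universe clcofib, 'u nattr) between
    \<Rightarrow> ('u func, ('u func, 'u func) between, ('u func, 'u nattr) between) pscell" where
  "lift_cell \<beta> = \<lparr>CSrc = lift_mor \<lparr>bsrc = bsrc \<beta>, body = NDom (body \<beta>), btrg = btrg \<beta>\<rparr>,
    CUnd = over \<beta>,
    CTrg = lift_mor \<lparr>bsrc = bsrc \<beta>, body = NCod (body \<beta>), btrg = btrg \<beta>\<rparr>\<rparr>"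

lemma lift_mor_simps [simp]:
  "MSrc (lift_mor t) = lift_psalg (bsrc t)" "MTrg (lift_mor t) = lift_psalg (btrg t)" "Und (lift_mor t) = over t"
  by (simp_all add: lift_mor_def Let_def)

lemma FCod_Proj: "cloven_cofibration B C \<Longrightarrow> FCod (Proj C) = B"
  using slice_ObjD(2) by (auto simp: cloven_cofibration_def)

lemma cloven_pair_clcofib:
  assumes "cloven_cofibration B C" "cloven_cofibration B D"
  shows "cloven_pair (Proj C) (Lift C) (Proj D) (Lift D)"
  using cloven_slice_clcofib[OF assms(1)] cloven_slice_clcofib[OF assms(2)] FCod_Proj[OF assms(1)] FCod_Proj[OF assms(2)]
  by (simp add: cloven_pair_def cloven_pair_axioms_def)

lemma pseudoalgebra_lift_psalg:
  assumes "cloven_cofibration B C"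
  shows "pseudoalgebra (slice CAT B) comma_2monad (lift_psalg C)"
  using cloven_slice.pseudoalgebra_A[OF cloven_slice_clcofib[OF assms]] FCod_Proj[OF assms]
  by (cases C) simp

lemma pseudomorphism_lift_mor:
  assumes t: "t \<in> mor (ClCoFib B) C D"
  shows "pseudomorphism (slice CAT B) comma_2monad (lift_mor t)"
proof -
  have c: "cloven_cofibration B C" "cloven_cofibration B D" using t by (auto simp: ClCoFib_mor_iff)
  interpret cloven_pair "Proj C" "Lift C" "Proj D" "Lift D" by (rule cloven_pair_clcofib[OF c])
  have "t = \<lparr>bsrc = \<lparr>Proj = Proj C, Lift = Lift C\<rparr>, body = body t, btrg = \<lparr>Proj = Proj D, Lift = Lift D\<rparr>\<rparr>"
    using t by (cases t; cases C; cases D) (auto simp: ClCoFib_mor_iff)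
  then show ?thesis
    using pseudomorphism_tM[of "body t"] t FCod_Proj[OF c(1)] by (simp add: ClCoFib_mor_iff)
qed

text \<open>Surjectivity on morphisms: a pseudomorphism between two induced pseudoalgebras comes
  from its underlying functor.\<close>

lemma lift_mor_unique:
  assumes c: "cloven_cofibration B C" "cloven_cofibration B D"
    and m: "pseudomorphism (slice CAT B) comma_2monad m" "MSrc m = lift_psalg C" "MTrg m = lift_psalg D"
  defines "t \<equiv> \<lparr>bsrc = C, body = body (Und m), btrg = D\<rparr>"
  shows "t \<in> mor (ClCoFib B) C D" "lift_mor t = m"
proof -
  interpret cloven_pair "Proj C" "Lift C" "Proj D" "Lift D" by (rule cloven_pair_clcofib[OF c])
  have CD: "\<lparr>Proj = Proj C, Lift = Lift C\<rparr> = C" "\<lparr>Proj = Proj D, Lift = Lift D\<rparr> = D" by simp_all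
  have U: "Und m \<in> mor (slice CAT B) (Proj C) (Proj D)"
    using psmorD(3)[OF m(1)] m(2,3) by (simp add: lift_psalg_def Let_def)
  have T: "fun_over (Proj C) (body (Und m)) (Proj D)" using U unfolding slice_CAT_mor by blast
  have und: "Und m = \<lparr>bsrc = Proj C, body = body (Und m), btrg = Proj D\<rparr>"
    using U by (cases "Und m") (simp add: mor_iff)
  note u = pseudomorphism_unique[OF T, of m, unfolded CD FCod_Proj[OF c(1)], OF m und]
  show "t \<in> mor (ClCoFib B) C D" using c T u(2) by (simp add: t_def ClCoFib_mor_iff)
  show "lift_mor t = m" using u(1) by (simp add: t_def)
qed

lemma Str_lift_mor_cell:
  assumes "t \<in> mor (ClCoFib B) C D"
  shows "Str (lift_mor t) \<in> cell (slice CAT B)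
    (Comp1 (slice CAT B) (Act (lift_psalg D)) (T1 comma_2monad (over t))) (Comp1 (slice CAT B) (over t) (Act (lift_psalg C)))"
  using psmorD(4)[OF pseudomorphism_lift_mor[OF assms]] assms by (simp add: mor_iff ClCoFib_simps)

lemma carrier_lift_psalg: "Carrier (lift_psalg C) = Proj C"
  by (simp add: lift_psalg_def Let_def)

lemma lift_psalg_typing:
  assumes "cloven_cofibration B C"
  shows "Proj C \<in> Obj (slice CAT B)" "Act (lift_psalg C) \<in> mor (slice CAT B) (comma_proj (Proj C)) (Proj C)"
    "UnitC (lift_psalg C) \<in> cell (slice CAT B) (Id1 (slice CAT B) (Proj C))
      (Comp1 (slice CAT B) (Act (lift_psalg C)) (Unit comma_2monad (Proj C)))"
    "MultC (lift_psalg C) \<in> cell (slice CAT B) (Comp1 (slice CAT B) (Act (lift_psalg C)) (T1 comma_2monad (Act (lift_psalg C))))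
      (Comp1 (slice CAT B) (Act (lift_psalg C)) (Mult comma_2monad (Proj C)))"
  using psalgD(1,2,3,5)[OF pseudoalgebra_lift_psalg[OF assms]]
  by (simp_all add: carrier_lift_psalg)

text \<open>The ten facts stand in the order of the typing premises of the componentwise lemmas on
  morphisms and are passed to them as one block.\<close>

lemma lift_typing:
  assumes t: "t \<in> mor (ClCoFib B) C D"
  shows "Proj C \<in> Obj (slice CAT B)" "Act (lift_psalg C) \<in> mor (slice CAT B) (comma_proj (Proj C)) (Proj C)"
    "UnitC (lift_psalg C) \<in> cell (slice CAT B) (Id1 (slice CAT B) (Proj C))
      (Comp1 (slice CAT B) (Act (lift_psalg C)) (Unit comma_2monad (Proj C)))"
    "MultC (lift_psalg C) \<in> cell (slice CAT B) (Comp1 (slice CAT B) (Act (lift_psalg C)) (T1 comma_2monad (Act (lift_psalg C))))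
      (Comp1 (slice CAT B) (Act (lift_psalg C)) (Mult comma_2monad (Proj C)))"
    "Proj D \<in> Obj (slice CAT B)" "Act (lift_psalg D) \<in> mor (slice CAT B) (comma_proj (Proj D)) (Proj D)"
    "UnitC (lift_psalg D) \<in> cell (slice CAT B) (Id1 (slice CAT B) (Proj D))
      (Comp1 (slice CAT B) (Act (lift_psalg D)) (Unit comma_2monad (Proj D)))"
    "MultC (lift_psalg D) \<in> cell (slice CAT B) (Comp1 (slice CAT B) (Act (lift_psalg D)) (T1 comma_2monad (Act (lift_psalg D))))
      (Comp1 (slice CAT B) (Act (lift_psalg D)) (Mult comma_2monad (Proj D)))"
    "over t \<in> mor (slice CAT B) (Proj C) (Proj D)"
    "Str (lift_mor t) \<in> cell (slice CAT B)
    (Comp1 (slice CAT B) (Act (lift_psalg D)) (T1 comma_2monad (over t))) (Comp1 (slice CAT B) (over t) (Act (lift_psalg C)))"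
  using lift_psalg_typing[of B C] lift_psalg_typing[of B D] over_mor[OF t] Str_lift_mor_cell[OF t] t
  by (simp_all add: ClCoFib_mor_iff)

lemma NAt_Str_lift_mor:
  assumes t: "t \<in> mor (ClCoFib B) C D" and X: "X \<in> comma_Ob (Proj C)"
  shows "NAt (body (Str (lift_mor t))) X = NAt (lift_str (Proj C) (Lift C) (body t) (Proj D) (Lift D)) X"
  using t by (simp add: ClCoFib_mor_iff lift_mor_def Let_def)

text \<open>An identity satisfies the equation that characterizes \<sigma> for the identity
  functor.\<close>

lemma lift_mor_Id1:
  assumes C: "cloven_cofibration B C"
  shows "lift_mor (Id1 (ClCoFib B) C) = id_psmor (slice CAT B) (lift_psalg C)"
proof -
  let ?K = "slice CAT B" and ?P = "Proj C" and ?t = "Id1 (ClCoFib B) C"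
  interpret cloven_pair ?P "Lift C" ?P "Lift C" by (rule cloven_pair_clcofib[OF C C])
  interpret M: monad_on_two_category ?K "comma_2monad :: ('a func, _, _) twomonad" by (rule comma_monad_on_slice)
  note base = FCod_Proj[OF C]
  have t: "?t \<in> mor (ClCoFib B) C C"
    using faithful_structure.Id1_mor[OF ClCoFib_faithful, of C B] C by (simp add: ClCoFib_simps(1))
  note ty = lift_typing[OF t]
  have T: "fun_over ?P (id_func (FDom ?P)) ?P" by (rule S.fun_over_id)
  have a: "Act (lift_psalg C) \<in> mor ?K (T0 comma_2monad ?P) ?P" using ty(2) by simp
  have o: "over ?t = Id1 ?K ?P" by (rule over_ops)
  have s: "Str (lift_mor ?t) \<in> cell ?K (Act (lift_psalg C)) (Act (lift_psalg C))"
    using ty(10) unfolding o M.Endo.F1_Id1[OF ty(1)] slice.Comp1_Id1_right[OF a] slice.Comp1_Id1_left[OF a] .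
  have i: "Id2 ?K (Act (lift_psalg C)) \<in> cell ?K (Act (lift_psalg C)) (Act (lift_psalg C))"
    using ty(2) by (intro slice.Id2_cell) (simp add: mor_iff)
  have "Str (lift_mor ?t) = Id2 ?K (Act (lift_psalg C))"
  proof (rule slice_cell_eqI[OF s i])
    fix X assume "X \<in> Ob (FDom (bsrc (Act (lift_psalg C))))"
    then have X: "X \<in> comma_Ob ?P" by (simp add: lift_psalg_def Let_def)
    let ?d = "Lift C (ufst X) (usnd X)"
    have "Idn E (Cod E ?d) = NAt (lift_str ?P (Lift C) (id_func E) ?P (Lift C)) X"
      by (rule str_unique[OF T X]) (use X S.P in simp_all)
    then show "NAt (body (Str (lift_mor ?t))) X = NAt (body (Id2 ?K (Act (lift_psalg C)))) X"
      using NAt_Str_lift_mor[OF t X] NAt_Id2[OF ty(2), of X] X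
      by (simp add: ClCoFib_simps) (simp add: lift_psalg_def Let_def)
  qed
  then show ?thesis
    unfolding id_psmor_def
    by (intro psmor.equality) (simp_all add: o, simp_all add: ClCoFib_simps lift_psalg_def Let_def)
qed

text \<open>Pasting the two structure cells gives an arrow over an identity which sends the lift in
  the last cofibration to the image of the first one. \<open>str_unique\<close> recognizes it as
  \<sigma> of the composite functor.\<close>

lemma lift_mor_Comp1:
  assumes s: "s \<in> mor (ClCoFib B) C D" and t: "t \<in> mor (ClCoFib B) D F"
  shows "lift_mor (Comp1 (ClCoFib B) t s) = comp_psmor (slice CAT B) comma_2monad (lift_mor t) (lift_mor s)"
proof -
  let ?K = "slice CAT B" and ?P = "Proj C" and ?Q = "Proj D" and ?R = "Proj F"
  let ?u = "Comp1 (ClCoFib B) t s"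
  have c: "cloven_cofibration B C" "cloven_cofibration B D" "cloven_cofibration B F"
    and recs: "bsrc s = C" "btrg s = D" "bsrc t = D" "btrg t = F"
    and over: "fun_over ?P (body s) ?Q" "fun_over ?Q (body t) ?R"
    using s t by (auto simp: ClCoFib_mor_iff)
  interpret CD: cloven_pair ?P "Lift C" ?Q "Lift D" by (rule cloven_pair_clcofib[OF c(1,2)])
  interpret DF: cloven_pair ?Q "Lift D" ?R "Lift F" by (rule cloven_pair_clcofib[OF c(2,3)])
  interpret CF: cloven_pair ?P "Lift C" ?R "Lift F" by (rule cloven_pair_clcofib[OF c(1,3)])
  interpret M: monad_on_two_category ?K "comma_2monad :: ('a func, _, _) twomonad" by (rule comma_monad_on_slice)
  note base = FCod_Proj[OF c(1)] FCod_Proj[OF c(2)] FCod_Proj[OF c(3)]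
  note sD = fun_overD(1-3,6,7)[OF over(1)] and tD = fun_overD(1-3,6,7)[OF over(2)]
  have u: "?u \<in> mor (ClCoFib B) C F"
    by (rule faithful_structure.Comp1_mor[OF ClCoFib_faithful s t])
  have o: "over ?u = Comp1 ?K (over t) (over s)" by (rule over_ops)
  have U: "fun_over ?P (comp_func (body t) (body s)) ?R"
    by (rule fun_over_comp[OF CD.S.P CD.R.P DF.R.P over])
  note ty = lift_typing[OF s] and ty' = lift_typing[OF t]
  have a: "Act (lift_psalg C) \<in> mor ?K (T0 comma_2monad ?P) ?P" "Act (lift_psalg D) \<in> mor ?K (T0 comma_2monad ?Q) ?Q"
    "Act (lift_psalg F) \<in> mor ?K (T0 comma_2monad ?R) ?R"
    using ty(2) ty'(2,6) by simp_all
  let ?S = "VComp ?K (whisker_left ?K (over t) (Str (lift_mor s))) (whisker_right ?K (Str (lift_mor t)) (T1 comma_2monad (over s)))"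
  have 1: "Str (lift_mor ?u) \<in> cell ?K (Comp1 ?K (Act (lift_psalg F)) (T1 comma_2monad (Comp1 ?K (over t) (over s))))
      (Comp1 ?K (Comp1 ?K (over t) (over s)) (Act (lift_psalg C)))"
    using lift_typing(10)[OF u] unfolding o .
  have 2: "?S \<in> cell ?K (Comp1 ?K (Act (lift_psalg F)) (T1 comma_2monad (Comp1 ?K (over t) (over s))))
      (Comp1 ?K (Comp1 ?K (over t) (over s)) (Act (lift_psalg C)))"
    by (rule M.comp_Str_cell[OF ty(1) a(1) ty(3,4,5) a(2) ty(7,8,9,10) ty'(9) a(3) ty'(10)])
  have "Str (lift_mor ?u) = ?S"
  proof (rule slice_cell_eqI[OF 1 2])
    fix X
    assume "X \<in> Ob (FDom (bsrc (Comp1 ?K (Act (lift_psalg F)) (T1 comma_2monad (Comp1 ?K (over t) (over s))))))"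
    then have X: "X \<in> comma_Ob ?P" using recs by (simp add: slice_simps)
    let ?x = "ufst X" and ?v = "usnd X"
    have x: "?x \<in> Ob (FDom ?P)" "?v \<in> Ar (FCod ?P)" "Dom (FCod ?P) ?v = FOb ?P ?x" using X by simp_all
    let ?Y = "FOb (comma_func ?P (body s) ?Q) X"
    have Y: "?Y \<in> comma_Ob ?Q" "ufst ?Y = FOb (body s) ?x" "usnd ?Y = ?v" using X x sD CD.same_base by simp_all
    note p = CD.str[OF over(1) X] and q = DF.str[OF over(2) Y(1), unfolded Y(2,3)]
    let ?p = "NAt (lift_str ?P (Lift C) (body s) ?Q (Lift D)) X"
      and ?q = "NAt (lift_str ?Q (Lift D) (body t) ?R (Lift F)) ?Y"
    let ?e = "Lift F (FOb (body t) (FOb (body s) ?x)) ?v"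
    have e: "?e \<in> Ar (FDom ?R)" "Dom (FDom ?R) ?e = FOb (body t) (FOb (body s) ?x)"
      using x sD tD base by (simp_all add: DF.R_lift)
    \<comment> \<open>The defining equation of \<open>?q\<close> is used first; the one for
      \<open>?p\<close> is then available inside \<open>body t\<close>.\<close>
    have "Cmp (FDom ?R) (Cmp (FDom ?R) (FAr (body t) ?p) ?q) ?e = Cmp (FDom ?R) (FAr (body t) ?p) (Cmp (FDom ?R) ?q ?e)"
      by (rule Cmp_assoc_r) (use DF.R.P tD p q e in simp_all)
    also have "\<dots> = FAr (body t) (Cmp (FDom ?Q) ?p (Lift D (FOb (body s) ?x) ?v))"
      unfolding q(5) using x p(1,2) sD tD base CD.R.P by (simp add: CD.R_lift)
    also have "\<dots> = FAr (body t) (FAr (body s) (Lift C ?x ?v))" unfolding p(5) ..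
    finally have k: "Cmp (FDom ?R) (Cmp (FDom ?R) (FAr (body t) ?p) ?q) ?e = FAr (body t) (FAr (body s) (Lift C ?x ?v))" .
    have "Cmp (FDom ?R) (FAr (body t) ?p) ?q = NAt (lift_str ?P (Lift C) (comp_func (body t) (body s)) ?R (Lift F)) X"
    proof (rule CF.str_unique[OF U X])
      have P2: "FAr ?R (Cmp (FDom ?R) (FAr (body t) ?p) ?q)
          = Cmp (FCod ?R) (FAr ?R (FAr (body t) ?p)) (FAr ?R ?q)"
        using DF.R.P tD p(1-3) q(1-3) by simp
      show "FAr ?R (Cmp (FDom ?R) (FAr (body t) ?p) ?q) = Idn (FCod ?P) (Cod (FCod ?P) ?v)"
        unfolding P2 using x tD p(1,4) q(4) base functor_category(2)[OF CD.S.P] by simp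
    qed (use k x sD tD p(1-3) q(1-3) DF.R.P CD.S.P in simp_all)
    then show "NAt (body (Str (lift_mor ?u))) X = NAt (body ?S) X"
      using NAt_Str_lift_mor[OF u X] NAt_Str_lift_mor[OF s X] NAt_Str_lift_mor[OF t Y(1)]
        NAt_comp_Str[OF ty ty'(9) ty'(6) ty'(10) X]
      by (simp add: ClCoFib_simps)
  qed
  then show ?thesis
    unfolding comp_psmor_def
    by (intro psmor.equality) (simp_all add: o, simp_all add: ClCoFib_simps)
qed

lemma algebra_transformation_lift_cell:
  assumes \<beta>: "\<beta> \<in> cell (ClCoFib B) s t"
  shows "algebra_transformation (slice CAT B) comma_2monad (lift_cell \<beta>)"
proof -
  let ?K = "slice CAT B" and ?C = "bsrc \<beta>" and ?D = "btrg \<beta>"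
  have st: "s \<in> mor (ClCoFib B) ?C ?D" "t \<in> mor (ClCoFib B) ?C ?D"
    and body: "body s = NDom (body \<beta>)" "body t = NCod (body \<beta>)" and n: "nat_over (Proj ?C) (body \<beta>) (Proj ?D)"
    using \<beta> by (auto simp: ClCoFib_cell_iff)
  have c: "cloven_cofibration B ?C" "cloven_cofibration B ?D"
    and T: "fun_over (Proj ?C) (body s) (Proj ?D)" "fun_over (Proj ?C) (body t) (Proj ?D)"
    using st by (auto simp: ClCoFib_mor_iff)
  interpret cloven_pair "Proj ?C" "Lift ?C" "Proj ?D" "Lift ?D" by (rule cloven_pair_clcofib[OF c])
  have seq: "s = \<lparr>bsrc = ?C, body = NDom (body \<beta>), btrg = ?D\<rparr>" "t = \<lparr>bsrc = ?C, body = NCod (body \<beta>), btrg = ?D\<rparr>"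
    using st body by (cases s; cases t; simp add: ClCoFib_mor_iff)+
  have CS: "CSrc (lift_cell \<beta>) = lift_mor s" "CTrg (lift_cell \<beta>) = lift_mor t" "CUnd (lift_cell \<beta>) = over \<beta>"
    by (simp_all add: lift_cell_def seq)
  have r: "bsrc s = ?C" "btrg s = ?D" "bsrc t = ?C" "btrg t = ?D" using st by (auto simp: ClCoFib_mor_iff)
  show ?thesis
  proof (rule algebra_transformation.intro, unfold CS lift_mor_simps r)
    show "pseudomorphism ?K comma_2monad (lift_mor s)" "pseudomorphism ?K comma_2monad (lift_mor t)"
      using st pseudomorphism_lift_mor by blast+
    show "over \<beta> \<in> cell ?K (over s) (over t)" by (rule over_cell[OF \<beta>])
    show "VComp ?K (whisker_right ?K (over \<beta>) (Act (lift_psalg ?C))) (Str (lift_mor s))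
      = VComp ?K (Str (lift_mor t)) (whisker_left ?K (Act (lift_psalg ?D)) (T2 comma_2monad (over \<beta>)))"
      unfolding CUnd_iff[OF lift_typing[OF st(1)] over_cell[OF \<beta>] lift_typing(10)[OF st(2)]]
    proof
      fix X assume X: "X \<in> comma_Ob (Proj ?C)"
      have act: "body (Act (lift_psalg ?C)) = S.L" "body (Act (lift_psalg ?D)) = R.L"
        by (simp_all add: lift_psalg_def Let_def)
      show "Cmp E' (NAt (body (over \<beta>)) (FOb (body (Act (lift_psalg ?C))) X)) (NAt (body (Str (lift_mor s))) X)
        = Cmp E' (NAt (body (Str (lift_mor t))) X)
            (FAr (body (Act (lift_psalg ?D))) (NAt (comma_nat (Proj ?C) (body (over \<beta>)) (Proj ?D)) X))"
        using CUnd_component[OF T n _ _ X] NAt_Str_lift_mor[OF st(1) X] NAt_Str_lift_mor[OF st(2) X]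
        by (simp only: over_simps body act)
    qed
  qed simp_all
qed

section \<open>The bijection on cells and the transport of structure\<close>

definition psalg_iso :: "('u::universe clcofib, ('u clcofib, 'u func) between, ('u clcofib, 'u nattr) between,
    ('u func, ('u func, 'u func) between, ('u func, 'u nattr) between) psalg,
    ('u func, ('u func, 'u func) between, ('u func, 'u nattr) between) psmor,
    ('u func, ('u func, 'u func) between, ('u func, 'u nattr) between) pscell) twofun" where
  "psalg_iso = \<lparr>F0 = lift_psalg, F1 = lift_mor, F2 = lift_cell\<rparr>"

text \<open>The end objects of a transformation are read off from its source pseudomorphism; its
  target pseudomorphism has the same ends by \<open>same_MSrc\<close> and
  \<open>same_MTrg\<close>.\<close>

definition psalg_iso_inv :: "(('u::universe func, ('u func, 'u func) between, ('u func, 'u nattr) between) psalg,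
    ('u func, ('u func, 'u func) between, ('u func, 'u nattr) between) psmor,
    ('u func, ('u func, 'u func) between, ('u func, 'u nattr) between) pscell,
    'u clcofib, ('u clcofib, 'u func) between, ('u clcofib, 'u nattr) between) twofun" where
  "psalg_iso_inv = \<lparr>F0 = psalg_clcofib,
    F1 = (\<lambda>m. \<lparr>bsrc = psalg_clcofib (MSrc m), body = body (Und m), btrg = psalg_clcofib (MTrg m)\<rparr>),
    F2 = (\<lambda>c. \<lparr>bsrc = psalg_clcofib (MSrc (CSrc c)), body = body (CUnd c), btrg = psalg_clcofib (MTrg (CSrc c))\<rparr>)\<rparr>"

lemma PsAlg_simps:
  "A \<in> Obj (PsAlg K T) \<longleftrightarrow> pseudoalgebra K T A" "m \<in> Mor (PsAlg K T) \<longleftrightarrow> pseudomorphism K T m"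
  "c \<in> Cell (PsAlg K T) \<longleftrightarrow> algebra_transformation K T c"
  "Src (PsAlg K T) = MSrc" "Trg (PsAlg K T) = MTrg" "Id1 (PsAlg K T) = id_psmor K"
  "Comp1 (PsAlg K T) = comp_psmor K T" "Src2 (PsAlg K T) = CSrc" "Trg2 (PsAlg K T) = CTrg"
  "Id2 (PsAlg K T) m = \<lparr>CSrc = m, CUnd = Id2 K (Und m), CTrg = m\<rparr>"
  "VComp (PsAlg K T) d c = \<lparr>CSrc = CSrc c, CUnd = VComp K (CUnd d) (CUnd c), CTrg = CTrg d\<rparr>"
  "HComp (PsAlg K T) d c = \<lparr>CSrc = comp_psmor K T (CSrc d) (CSrc c), CUnd = HComp K (CUnd d) (CUnd c),
       CTrg = comp_psmor K T (CTrg d) (CTrg c)\<rparr>"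
  by (simp_all add: PsAlg_def)

lemma comma_psalg_eqs:
  assumes "pseudoalgebra (slice CAT B) comma_2monad A"
  shows "cloven_cofibration B (psalg_clcofib A)" "lift_psalg (psalg_clcofib A) = A"
  using assms by (auto intro!: comma_psalg.cloven_cofibration_psalg comma_psalg.psalg_eq simp: comma_psalg_def)

lemma pseudomorphism_inv:
  assumes m: "pseudomorphism (slice CAT B) comma_2monad m"
  shows "F1 psalg_iso_inv m \<in> mor (ClCoFib B) (psalg_clcofib (MSrc m)) (psalg_clcofib (MTrg m))"
    "lift_mor (F1 psalg_iso_inv m) = m"
  using lift_mor_unique[of B "psalg_clcofib (MSrc m)" "psalg_clcofib (MTrg m)" m] m
    comma_psalg_eqs[OF psmorD(1)[OF m]] comma_psalg_eqs[OF psmorD(2)[OF m]]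
  by (simp_all add: psalg_iso_inv_def)

text \<open>A transformation is determined by its two pseudomorphisms and its underlying slice cell.
  The former are recovered by \<open>pseudomorphism_inv\<close>, and the latter is kept up to
  renaming of its ends.\<close>

lemma transformation_inv:
  assumes c: "algebra_transformation (slice CAT B) comma_2monad c"
  shows "F2 psalg_iso_inv c \<in> cell (ClCoFib B) (F1 psalg_iso_inv (CSrc c)) (F1 psalg_iso_inv (CTrg c))"
    "lift_cell (F2 psalg_iso_inv c) = c"
proof -
  interpret c: algebra_transformation "slice CAT B" comma_2monad c by fact
  note s = pseudomorphism_inv[OF c.CSrc_psmor] and t = pseudomorphism_inv[OF c.CTrg_psmor]
  have U: "CUnd c \<in> cell (slice CAT B) (Und (CSrc c)) (Und (CTrg c))" by (rule c.CUnd_cell)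
  have m: "Und (CSrc c) \<in> mor (slice CAT B) (Carrier (MSrc (CSrc c))) (Carrier (MTrg (CSrc c)))"
    by (rule psmorD(3)[OF c.CSrc_psmor])
  have b: "bsrc (CUnd c) = Carrier (MSrc (CSrc c))" "btrg (CUnd c) = Carrier (MTrg (CSrc c))"
    using slice_cellD[OF U] m by (simp_all add: mor_iff)
  have p: "Proj (psalg_clcofib A) = Carrier A" for A by (simp add: psalg_clcofib_def)
  have n: "nat_over (Carrier (MSrc (CSrc c))) (body (CUnd c)) (Carrier (MTrg (CSrc c)))"
    "body (Und (CSrc c)) = NDom (body (CUnd c))" "body (Und (CTrg c)) = NCod (body (CUnd c))"
    using U b unfolding slice_CAT_cell by (metis between.select_convs(2))+
  show 1: "F2 psalg_iso_inv c \<in> cell (ClCoFib B) (F1 psalg_iso_inv (CSrc c)) (F1 psalg_iso_inv (CTrg c))"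
    using s(1) t(1) n unfolding ClCoFib_cell_iff
    by (simp add: psalg_iso_inv_def c.same_MSrc c.same_MTrg p)
  show "lift_cell (F2 psalg_iso_inv c) = c"
  proof (rule pscell.equality)
    have "\<lparr>bsrc = bsrc (F2 psalg_iso_inv c), body = NDom (body (F2 psalg_iso_inv c)), btrg = btrg (F2 psalg_iso_inv c)\<rparr>
        = F1 psalg_iso_inv (CSrc c)"
      using n by (simp add: psalg_iso_inv_def)
    then show "CSrc (lift_cell (F2 psalg_iso_inv c)) = CSrc c" using s(2) by (simp add: lift_cell_def)
    have "\<lparr>bsrc = bsrc (F2 psalg_iso_inv c), body = NCod (body (F2 psalg_iso_inv c)), btrg = btrg (F2 psalg_iso_inv c)\<rparr>
        = F1 psalg_iso_inv (CTrg c)"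
      using n by (simp add: psalg_iso_inv_def c.same_MSrc c.same_MTrg)
    then show "CTrg (lift_cell (F2 psalg_iso_inv c)) = CTrg c" using t(2) by (simp add: lift_cell_def)
    show "CUnd (lift_cell (F2 psalg_iso_inv c)) = CUnd c"
      by (rule between.equality) (simp_all add: lift_cell_def psalg_iso_inv_def p b)
  qed simp
qed

lemma lift_cell_sel:
  assumes "\<beta> \<in> cell (ClCoFib B) s t"
  shows "CSrc (lift_cell \<beta>) = lift_mor s" "CTrg (lift_cell \<beta>) = lift_mor t" "CUnd (lift_cell \<beta>) = over \<beta>"
  using assms by (auto simp: lift_cell_def cell_iff ClCoFib_simps)

text \<open>Compatibility with composition is checked on the side of cloven cofibrations, where the
  cells of a composite are known; the corresponding facts for pseudoalgebras are then
  consequences.\<close>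

lemma transported: "transported_structure (ClCoFib B) (PsAlg (slice CAT B) comma_2monad) psalg_iso psalg_iso_inv"
proof -
  interpret K: two_category "ClCoFib B" by (rule faithful_structure.two_category[OF ClCoFib_faithful])
  let ?L = "PsAlg (slice CAT B) comma_2monad"
  have cellI: "\<alpha> \<in> cell (ClCoFib B) (Src2 (ClCoFib B) \<alpha>) (Trg2 (ClCoFib B) \<alpha>)" if "\<alpha> \<in> Cell (ClCoFib B)" for \<alpha>
    using that by (simp add: cell_iff)
  have morI: "f \<in> mor (ClCoFib B) (bsrc f) (btrg f)" if "f \<in> Mor (ClCoFib B)" for f
    using that by (simp add: mor_iff ClCoFib_simps)
  have iso: "F0 psalg_iso = lift_psalg" "F1 psalg_iso = lift_mor" "F2 psalg_iso = lift_cell"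
    by (simp_all add: psalg_iso_def)
  have inv0: "F0 psalg_iso_inv = psalg_clcofib" by (simp add: psalg_iso_inv_def)
  show ?thesis
  proof (unfold_locales, unfold iso inv0 PsAlg_simps)
    show "pseudoalgebra (slice CAT B) comma_2monad (lift_psalg X)" if "X \<in> Obj (ClCoFib B)" for X
      using that pseudoalgebra_lift_psalg by (simp add: ClCoFib_simps)
    show "pseudomorphism (slice CAT B) comma_2monad (lift_mor f)" if "f \<in> Mor (ClCoFib B)" for f
      by (rule pseudomorphism_lift_mor[OF morI[OF that]])
    show "algebra_transformation (slice CAT B) comma_2monad (lift_cell \<alpha>)" if "\<alpha> \<in> Cell (ClCoFib B)" for \<alpha>
      by (rule algebra_transformation_lift_cell[OF cellI[OF that]])
    show "psalg_clcofib X \<in> Obj (ClCoFib B)" if "pseudoalgebra (slice CAT B) comma_2monad X" for X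
      using comma_psalg_eqs[OF that] by (simp add: ClCoFib_simps)
    show "F1 psalg_iso_inv m \<in> Mor (ClCoFib B)" if "pseudomorphism (slice CAT B) comma_2monad m" for m
      using pseudomorphism_inv(1)[OF that] by (simp add: mor_iff)
    show "F2 psalg_iso_inv c \<in> Cell (ClCoFib B)" if "algebra_transformation (slice CAT B) comma_2monad c" for c
      using transformation_inv(1)[OF that] by (simp add: cell_iff)
    show "inverse_on (ClCoFib B) psalg_iso psalg_iso_inv"
    proof -
      have p0: "psalg_clcofib (lift_psalg X) = X" if "cloven_cofibration B X" for X by (rule clcofib_eq[OF that])
      have "F1 psalg_iso_inv (lift_mor f) = f" if "f \<in> Mor (ClCoFib B)" for f
        by (rule between.equality)
          (use morI[OF that] p0 in \<open>simp_all add: psalg_iso_inv_def ClCoFib_mor_iff\<close>)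
      moreover have "F2 psalg_iso_inv (lift_cell \<alpha>) = \<alpha>" if "\<alpha> \<in> Cell (ClCoFib B)" for \<alpha>
        by (rule between.equality)
          (use that p0 in \<open>simp_all add: psalg_iso_inv_def lift_cell_def ClCoFib_simps\<close>)
      ultimately show ?thesis
        unfolding inverse_on_def iso inv0 using p0 by (simp add: ClCoFib_simps(1))
    qed
    show "inverse_on ?L psalg_iso_inv psalg_iso"
      unfolding inverse_on_def iso inv0 PsAlg_simps
      using comma_psalg_eqs(2)[of B] pseudomorphism_inv(2)[of B] transformation_inv(2)[of B] by (auto simp: PsAlg_simps)
    show "MSrc (lift_mor f) = lift_psalg (Src (ClCoFib B) f)" "MTrg (lift_mor f) = lift_psalg (Trg (ClCoFib B) f)" for f
      by (simp_all add: ClCoFib_simps)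
    show "CSrc (lift_cell \<alpha>) = lift_mor (Src2 (ClCoFib B) \<alpha>)" "CTrg (lift_cell \<alpha>) = lift_mor (Trg2 (ClCoFib B) \<alpha>)" for \<alpha>
      by (simp_all add: ClCoFib_simps lift_cell_def)
    show "lift_mor (Id1 (ClCoFib B) X) = id_psmor (slice CAT B) (lift_psalg X)" if "X \<in> Obj (ClCoFib B)" for X
      using that lift_mor_Id1 by (simp add: ClCoFib_simps(1))
    show "lift_mor (Comp1 (ClCoFib B) g f) = comp_psmor (slice CAT B) comma_2monad (lift_mor g) (lift_mor f)"
      if "f \<in> mor (ClCoFib B) X Y" "g \<in> mor (ClCoFib B) Y Z" for f g X Y Z
      by (rule lift_mor_Comp1[OF that])
    show "lift_cell (Id2 (ClCoFib B) f) = \<lparr>CSrc = lift_mor f, CUnd = Id2 (slice CAT B) (Und (lift_mor f)), CTrg = lift_mor f\<rparr>"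
      if "f \<in> Mor (ClCoFib B)" for f
      using lift_cell_sel[OF K.Id2_cell[OF that]] by (intro pscell.equality) (simp_all add: over_ops)
    show "lift_cell (VComp (ClCoFib B) \<beta> \<alpha>) = \<lparr>CSrc = CSrc (lift_cell \<alpha>),
        CUnd = VComp (slice CAT B) (CUnd (lift_cell \<beta>)) (CUnd (lift_cell \<alpha>)), CTrg = CTrg (lift_cell \<beta>)\<rparr>"
      if "\<alpha> \<in> cell (ClCoFib B) f g" "\<beta> \<in> cell (ClCoFib B) g h" for \<alpha> \<beta> f g h
      using lift_cell_sel[OF K.VComp_cell[OF that]] lift_cell_sel[OF that(1)] lift_cell_sel[OF that(2)]
      by (intro pscell.equality) (simp_all add: over_ops)
    show "lift_cell (HComp (ClCoFib B) \<beta> \<alpha>)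
        = \<lparr>CSrc = comp_psmor (slice CAT B) comma_2monad (CSrc (lift_cell \<beta>)) (CSrc (lift_cell \<alpha>)),
          CUnd = HComp (slice CAT B) (CUnd (lift_cell \<beta>)) (CUnd (lift_cell \<alpha>)),
          CTrg = comp_psmor (slice CAT B) comma_2monad (CTrg (lift_cell \<beta>)) (CTrg (lift_cell \<alpha>))\<rparr>"
      if "\<alpha> \<in> Cell (ClCoFib B)" "\<beta> \<in> Cell (ClCoFib B)" "Trg0 (ClCoFib B) \<alpha> = Src0 (ClCoFib B) \<beta>" for \<alpha> \<beta>
    proof -
      let ?f = "Src2 (ClCoFib B) \<alpha>" and ?f' = "Trg2 (ClCoFib B) \<alpha>" and ?g = "Src2 (ClCoFib B) \<beta>" and ?g' = "Trg2 (ClCoFib B) \<beta>"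
      note a = cellI[OF that(1)] and b = cellI[OF that(2)]
      have ab: "btrg \<alpha> = bsrc \<beta>" using that(3) by (simp add: ClCoFib_simps)
      have m: "?f \<in> mor (ClCoFib B) (bsrc \<alpha>) (bsrc \<beta>)" "?f' \<in> mor (ClCoFib B) (bsrc \<alpha>) (bsrc \<beta>)"
        "?g \<in> mor (ClCoFib B) (bsrc \<beta>) (btrg \<beta>)" "?g' \<in> mor (ClCoFib B) (bsrc \<beta>) (btrg \<beta>)"
        using a b unfolding ClCoFib_cell_iff ab by blast+
      have h: "HComp (ClCoFib B) \<beta> \<alpha> \<in> cell (ClCoFib B) (Comp1 (ClCoFib B) ?g ?f) (Comp1 (ClCoFib B) ?g' ?f')"
        by (rule K.HComp_cell[OF a b]) (use m in \<open>simp add: mor_iff\<close>)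
      show ?thesis
        using lift_cell_sel[OF h] lift_cell_sel[OF a] lift_cell_sel[OF b]
          lift_mor_Comp1[OF m(1,3)] lift_mor_Comp1[OF m(2,4)]
        by (intro pscell.equality) (simp_all add: over_ops)
    qed
  qed
qed

text \<open>Equality of \<iota> with an identity 2-cell includes that the action after the unit is
  the identity functor. For a normal cleavage this functor equality is obtained from the components
  by \<open>nat_componentwise_id\<close>.\<close>

lemma normal_iff:
  assumes C: "cloven_cofibration B C"
  shows "normal_psalg (slice CAT B) (lift_psalg C) \<longleftrightarrow> normally_cloven C"
proof -
  interpret cloven_slice "Proj C" "Lift C" by (rule cloven_slice_clcofib[OF C])
  have 1: "normal_psalg (slice CAT B) (lift_psalg C) \<longleftrightarrow> lift_unit (Proj C) (Lift C) = id_nat (id_func E)"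
    by (simp add: normal_psalg_def lift_psalg_def Let_def slice_simps)
  show ?thesis
    unfolding 1
  proof
    assume *: "lift_unit (Proj C) (Lift C) = id_nat (id_func E)"
    have "Lift C x (Idn (FCod (Proj C)) (FOb (Proj C) x)) = Idn E x" if "x \<in> Ob E" for x
      using unit_simps(3)[OF that] that unfolding * by simp
    then show "normally_cloven C" by (simp add: normally_cloven_def)
  next
    assume *: "normally_cloven C"
    have "lift_unit (Proj C) (Lift C) = id_nat (NCod (lift_unit (Proj C) (Lift C)))"
    proof (rule nat_componentwise_id)
      show "natural_transformation (lift_unit (Proj C) (Lift C))" by (rule nat_overD(1)[OF nat_over_unit])
      fix x assume "x \<in> Ob (FDom (NDom (lift_unit (Proj C) (Lift C))))"
      then have x: "x \<in> Ob E" by simp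
      have n: "Lift C x (Idn (FCod (Proj C)) (FOb (Proj C) x)) = Idn E x"
        using * x by (simp add: normally_cloven_def)
      show "FOb (NDom (lift_unit (Proj C) (Lift C))) x = FOb (NCod (lift_unit (Proj C) (Lift C))) x \<and>
          \<iota> x = Idn (FCod (NDom (lift_unit (Proj C) (Lift C)))) (FOb (NCod (lift_unit (Proj C) (Lift C))) x)"
        using x n P by simp
    qed
    then show "lift_unit (Proj C) (Lift C) = id_nat (id_func E)"
      by (metis id_nat_simps(1) unit_simps(1))
  qed
qed

text \<open>Preservation of chosen lifts forces preservation of all cocartesian arrows, because the
  images of the lifts are again lifts. Such functors are therefore morphisms already, and
  \<open>strict_iff\<close> applies.\<close>

lemma strict_lift_mor_iff:
  "functor_over B t \<and> preserves_lifts (bsrc t) (body t) (btrg t) \<longleftrightarrow>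
    t \<in> Mor (ClCoFib B) \<and> strict_psmor (slice CAT B) (lift_mor t)"
proof (cases "functor_over B t")
  case True
  let ?C = "bsrc t" and ?D = "btrg t"
  have c: "cloven_cofibration B ?C" "cloven_cofibration B ?D" and T: "fun_over (Proj ?C) (body t) (Proj ?D)"
    using True by (auto simp: functor_over_def slice_CAT_Mor)
  interpret cloven_pair "Proj ?C" "Lift ?C" "Proj ?D" "Lift ?D" by (rule cloven_pair_clcofib[OF c])
  have t: "\<lparr>bsrc = \<lparr>Proj = Proj ?C, Lift = Lift ?C\<rparr>, body = body t, btrg = \<lparr>Proj = Proj ?D, Lift = Lift ?D\<rparr>\<rparr> = t"
    by simp
  \<comment> \<open>Liftable pairs and encoded objects of the comma category are matched, as
    \<open>preserves_lifts\<close> quantifies over the former and \<open>strict_iff\<close> over the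
    latter.\<close>
  have X: "X \<in> comma_Ob (Proj ?C) \<longleftrightarrow> X = upair (ufst X) (usnd X) \<and> liftable (Proj ?C) (ufst X) (usnd X)" for X
    by (auto simp: liftable_def upair_sel[of X "Proj ?C"]) (metis upair_comma_Ob)
  have l: "preserves_lifts ?C (body t) ?D \<longleftrightarrow>
      (\<forall>X \<in> comma_Ob (Proj ?C). FAr (body t) (Lift ?C (ufst X) (usnd X)) = Lift ?D (FOb (body t) (ufst X)) (usnd X))"
    unfolding preserves_lifts_def Ball_def X
    by (metis ufst_upair usnd_upair)
  have s: "strict_psmor (slice CAT B) (lift_mor t) \<longleftrightarrow> preserves_lifts ?C (body t) ?D"
    using strict_iff[OF T] unfolding l t FCod_Proj[OF c(1)] .
  have "preserves_cocartesian (Proj ?C) (body t) (Proj ?D)" if "preserves_lifts ?C (body t) ?D"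
    unfolding preserves_cocartesian_iff[OF T]
  proof
    fix X assume x: "X \<in> comma_Ob (Proj ?C)"
    have "cocartesian (Proj ?D) (Lift ?D (FOb (body t) (ufst X)) (usnd X))"
      using x fun_overD(1-3,6)[OF T] bases by (intro R_lift(4)) simp_all
    then show "cocartesian (Proj ?D) (FAr (body t) (Lift ?C (ufst X) (usnd X)))"
      using that x unfolding l by simp
  qed
  then show ?thesis using True s by (auto simp: ClCoFib_simps(2))
qed (auto simp: ClCoFib_simps(2))

theorem theorem5p6:
  fixes B :: "'u::universe cat"
  assumes "locally_small_category B"
  shows "strict_2monad (slice CAT B) comma_2monad \<and> (\<exists>\<Phi>.
      two_isomorphism_over (slice CAT B)
        (ClCoFib B) ClCoFib_forget
        (PsAlg (slice CAT B) comma_2monad) PsAlg_forget \<Phi>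
      \<and> (\<forall>C \<in> Obj (ClCoFib B). induced_by_lifts C (F0 \<Phi> C))
      \<and> two_isomorphism_over (slice CAT B)
        (full_sub (ClCoFib B) normally_cloven) ClCoFib_forget
        (full_sub (PsAlg (slice CAT B) comma_2monad) (normal_psalg (slice CAT B))) PsAlg_forget \<Phi>
      \<and> (\<forall>t. functor_over B t \<and> preserves_lifts (bsrc t) (body t) (btrg t) \<longleftrightarrow>
            t \<in> Mor (ClCoFib B) \<and> strict_psmor (slice CAT B) (F1 \<Phi> t)))"
proof (intro conjI exI[of _ psalg_iso] ballI allI)
  show "strict_2monad (slice CAT B) comma_2monad" by (rule comma_strict_2monad)
  have iso: "F0 psalg_iso = lift_psalg" "F1 psalg_iso = lift_mor" "F2 psalg_iso = lift_cell"
    by (simp_all add: psalg_iso_def)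
  show *: "two_isomorphism_over (slice CAT B) (ClCoFib B) ClCoFib_forget
      (PsAlg (slice CAT B) comma_2monad) PsAlg_forget psalg_iso"
    \<comment> \<open>The forgetful 2-functors agree by construction: each lifted structure keeps
      the functor or 2-cell it was built from as its underlying cell.\<close>
    by (rule transported_structure.isomorphism_over[OF transported
          faithful_structure.two_functor[OF ClCoFib_faithful]])
      (simp_all add: iso PsAlg_forget_def ClCoFib_forget_def lift_cell_def lift_psalg_def Let_def)
  show "induced_by_lifts C (F0 psalg_iso C)" if "C \<in> Obj (ClCoFib B)" for C
    using cloven_slice.induced_by_lifts_A[OF cloven_slice_clcofib[of B C]] that
    by (cases C) (simp add: iso ClCoFib_simps(1))
  show "two_isomorphism_over (slice CAT B)
        (full_sub (ClCoFib B) normally_cloven) ClCoFib_forget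
        (full_sub (PsAlg (slice CAT B) comma_2monad) (normal_psalg (slice CAT B))) PsAlg_forget psalg_iso"
    by (rule isomorphism_over_full_sub[OF *]) (simp add: iso ClCoFib_simps(1) normal_iff)
  show "functor_over B t \<and> preserves_lifts (bsrc t) (body t) (btrg t) \<longleftrightarrow>
      t \<in> Mor (ClCoFib B) \<and> strict_psmor (slice CAT B) (F1 psalg_iso t)" for t
    unfolding iso by (rule strict_lift_mor_iff)
qed

end
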